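(* Let $w$ be a strictly positive weight on $\mathbb{D}$ that is nearly constant on $\rho$-tops, i.e. there exist $0<\rho<1$ and a constant $C_\rho$ such that for every interval $I\subset\mathbb{T}$ $$C_{\rho}^{-1}w(\xi)\leq w(z)\leq C_{\rho}w(\xi)\quad\text{for all } z,\xi\in T_{I,\rho}.$$ Then the following are equivalent: (a) $w\in B_\infty$. (b) There exist $p>1$ and $\eta>-1$ such that $\frac{w}{(1-|z|^2)^\eta}\in B_p(\eta)$. (c) There exists $\gamma>0$ such that $$\int_{\mathbb{D}}\frac{w(\xi)}{|1-\bar{\xi}z|^{\gamma+2}}\,dA(\xi)\lesssim\frac{w(z)}{(1-|z|^2)^\gamma},\quad z\in\mathbb{D}.$$ (d) For all $q>0$, all positive integers $n$ and all analytic functions $f$ in $\mathbb{D}$, $$\|f\|_{L^q(w)}\approx\sum_{j=0}^{n-1}|f^{(j)}(0)|+\left(\int_{\mathbb{D}}|f^{(n)}|^q(1-|z|)^{qn}\,w\,dA\right)^{1/q}.$$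
   Context: $\mathbb{D}$ is the unit disk, $\mathbb{T}$ its boundary circle, $dA$ is area measure on $\mathbb{D}$ and $|E|$ is the area of a set $E\subset\mathbb{D}$; for an interval (arc) $I\subset\mathbb{T}$, $|I|$ is its length. A weight is a positive measurable function on $\mathbb{D}$. For a set $E\subset\mathbb{D}$ and an integrable function $f$, $f(E):=\int_E f\,dA$. $\|f\|_{L^q(w)}=\left(\int_{\mathbb{D}}|f|^q w\,dA\right)^{1/q}$. For an interval $I\subset\mathbb{T}$ with center $e^{i\theta}$, the Carleson box is $$Q_I:=\{re^{i\alpha}:\ 1-|I|<r<1,\ |\theta-\alpha|<|I|/2\},$$ and for $0<\rho<1$ the $\rho$-top of $Q_I$ is $$T_{I,\rho}:=\{re^{i\alpha}:\ 1-|I|<r<1-(1-\rho)|I|,\ |\theta-\alpha|<|I|/2\}.$$ $M$ is the Hardy–Littlewood maximal function over Carleson boxes: $Mf(z)=\sup_{I:\ z\in Q_I}\frac{1}{|Q_I|}\int_{Q_I}|f|\,dA$. $w\in B_\infty$ means $$B_\infty(w):=\sup_{I\subset\mathbb{T}\text{ interval}}\frac{1}{w(Q_I)}\int_{Q_I}M(w1_{Q_I})\,dA<\infty.$$ For $\eta>-1$ put $dA_\eta=(1-|z|^2)^\eta dA$ and $A_\eta(E)=\int_E dA_\eta$. For $1<p<\infty$, $p'=p/(p-1)$, a positive measurable function $v$ belongs to $B_p(\eta)$ if $$\sup_{I\subset\mathbb{T}\text{ interval}}\left(\frac{1}{A_\eta(Q_I)}\int_{Q_I}v\,dA_\eta\right)\left(\frac{1}{A_\eta(Q_I)}\int_{Q_I}v^{1-p'}dA_\eta\right)^{p-1}<\infty.$$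 The notation $X\lesssim Y$ means $X\le CY$ and $X\approx Y$ means $C^{-1}Y\le X\le CY$, with a finite constant $C>0$ independent of $z$ in (c), and independent of $f$ (but allowed to depend on $q$, $n$, $w$) in (d). *)

theory Defs
  imports "HOL-Analysis.Analysis"
begin

abbreviation unit_disk :: "complex set" where
  "unit_disk \<equiv> ball 0 1"

text \<open>Area measure on the disk is \<^term>\<open>lebesgue\<close> restricted to \<^term>\<open>unit_disk\<close>. Integrals of
  nonnegative functions are taken in \<^typ>\<open>ennreal\<close>, so that they may be infinite.\<close>

definition weight :: "(complex \<Rightarrow> real) \<Rightarrow> bool" where
  "weight w \<longleftrightarrow> w \<in> borel_measurable (lebesgue_on unit_disk) \<and> (\<forall>z\<in>unit_disk. 0 < w z)"

text \<open>Power of an extended nonnegative real with exponent \<open>a > 0\<close>; in particular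
  \<open>0 powr a = 0\<close> and \<open>\<infinity> powr a = \<infinity>\<close>.\<close>

definition ennpowr :: "ennreal \<Rightarrow> real \<Rightarrow> ennreal" where
  "ennpowr x a = (if x = \<infinity> then \<infinity> else ennreal (enn2real x powr a))"

text \<open>An interval of the unit circle is encoded by the argument \<open>\<theta>\<close> of its center and its (not
  normalized) arc length \<open>L\<close>. Whether it is open or closed is immaterial for what follows.\<close>

definition intervals :: "(real \<times> real) set" where
  "intervals = UNIV \<times> {0<..2 * pi}"

text \<open>The requirement \<open>0 \<le> r\<close> only matters for intervals longer than 1: the radius in polar
  coordinates is nonnegative. The argument \<open>\<alpha>\<close> ranges over all reals, so the angular distance is
  understood modulo \<open>2 * pi\<close>.\<close>

definition carleson_box :: "real \<times> real \<Rightarrow> complex set" where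
  "carleson_box = (\<lambda>(\<theta>, L). {rcis r \<alpha> | r \<alpha>.
     0 \<le> r \<and> 1 - L < r \<and> r < 1 \<and> \<bar>\<theta> - \<alpha>\<bar> < L / 2})"

definition box_top :: "real \<Rightarrow> real \<times> real \<Rightarrow> complex set" where
  "box_top \<rho> = (\<lambda>(\<theta>, L). {rcis r \<alpha> | r \<alpha>.
     0 \<le> r \<and> 1 - L < r \<and> r < 1 - (1 - \<rho>) * L \<and> \<bar>\<theta> - \<alpha>\<bar> < L / 2})"

definition nearly_constant_on_tops :: "(complex \<Rightarrow> real) \<Rightarrow> bool" where
  "nearly_constant_on_tops w \<longleftrightarrow>
     (\<exists>\<rho> C. 0 < \<rho> \<and> \<rho> < 1 \<and> 0 < C \<and>
        (\<forall>I\<in>intervals. \<forall>z\<in>box_top \<rho> I. \<forall>\<xi>\<in>box_top \<rho> I.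
            inverse C * w \<xi> \<le> w z \<and> w z \<le> C * w \<xi>))"

definition carleson_maximal :: "(complex \<Rightarrow> real) \<Rightarrow> complex \<Rightarrow> ennreal" where
  "carleson_maximal f z = (SUP I\<in>{I\<in>intervals. z \<in> carleson_box I}.
     (\<integral>\<^sup>+\<xi>\<in>carleson_box I. ennreal \<bar>f \<xi>\<bar> \<partial>lebesgue) / emeasure lebesgue (carleson_box I))"

definition B_infty_const :: "(complex \<Rightarrow> real) \<Rightarrow> ennreal" where
  "B_infty_const w = (SUP I\<in>intervals.
     (\<integral>\<^sup>+z\<in>carleson_box I. carleson_maximal (\<lambda>\<xi>. w \<xi> * indicator (carleson_box I) \<xi>) z \<partial>lebesgue)
       / (\<integral>\<^sup>+z\<in>carleson_box I. ennreal (w z) \<partial>lebesgue))"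

text \<open>The finiteness of \<open>w(Q\<^sub>I)\<close> is implicit in the quotient defining the constant. It has to be
  stated here because \<open>\<infinity> / \<infinity> = 0\<close> in \<^typ>\<open>ennreal\<close>.\<close>

definition B_infty :: "(complex \<Rightarrow> real) \<Rightarrow> bool" where
  "B_infty w \<longleftrightarrow>
     (\<forall>I\<in>intervals. (\<integral>\<^sup>+z\<in>carleson_box I. ennreal (w z) \<partial>lebesgue) < \<infinity>) \<and> B_infty_const w < \<infinity>"

definition weighted_area :: "real \<Rightarrow> complex measure" where
  "weighted_area \<eta> = density (lebesgue_on unit_disk) (\<lambda>z. ennreal ((1 - (cmod z)\<^sup>2) powr \<eta>))"

definition area_average :: "real \<Rightarrow> complex set \<Rightarrow> (complex \<Rightarrow> real) \<Rightarrow> ennreal" where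
  "area_average \<eta> E v =
     (\<integral>\<^sup>+z\<in>E. ennreal (v z) \<partial>weighted_area \<eta>) / emeasure (weighted_area \<eta>) E"

text \<open>The exponent in the second factor is \<open>1 - p'\<close> with \<open>p' = p / (p - 1)\<close>.\<close>

definition B_p :: "real \<Rightarrow> real \<Rightarrow> (complex \<Rightarrow> real) \<Rightarrow> bool" where
  "B_p p \<eta> v \<longleftrightarrow> weight v \<and>
     (SUP I\<in>intervals. area_average \<eta> (carleson_box I) v *
        ennpowr (area_average \<eta> (carleson_box I) (\<lambda>z. v z powr (1 - p / (p - 1)))) (p - 1)) < \<infinity>"

definition Lq_norm :: "real \<Rightarrow> (complex \<Rightarrow> real) \<Rightarrow> (complex \<Rightarrow> complex) \<Rightarrow> ennreal" where
  "Lq_norm q w f =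
     ennpowr (\<integral>\<^sup>+z\<in>unit_disk. ennreal (cmod (f z) powr q * w z) \<partial>lebesgue) (1 / q)"

end

theory Submission
  imports Defs "HOL-Complex_Analysis.Cauchy_Integral_Formula"
begin

text \<open>
  Write \<open>\<delta> z = 1 - \<bar>z\<bar>\<close>. A weight that is nearly constant on the \<open>\<rho>\<close>-tops of Carleson boxes varies
  by a bounded factor on every disk of radius \<open>\<delta> z / 2\<close> about \<open>z\<close> (such a weight is called slow
  below), and for slow weights each of the four conditions is equivalent to disk control:
  there is \<open>C\<close> such that for all \<open>z\<close> in the unit disk \<open>\<D>\<close> the mass of \<open>w\<close> on the part in \<open>\<D>\<close> of the disk of
  radius \<open>3 \<delta> z\<close> about \<open>z\<close> is at most \<open>C (\<delta> z)\<^sup>2 w z\<close>. Up to constants this says that the mass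
  of a Carleson box is at most its area times the value of \<open>w\<close> at its center, a form that is used
  for the conditions stated with boxes. Measure-theoretic trouble is avoided by replacing \<open>w\<close> by a
  comparable slow weight \<open>v\<close> that is lower semicontinuous on the disk, extended by 0 to the plane
  (\<open>slow_regularize\<close>).

  Two facts about slow weights are used throughout. Chaining disks along radii gives a polynomial
  comparison of \<open>v z\<close> and \<open>v \<xi>\<close> in the depths of the two points (\<open>slow_growth\<close>). Tonelli's theorem
  for the cone \<open>\<bar>z - \<xi>\<bar> < K \<delta> \<xi>\<close> turns an integral over \<open>z\<close> of integrals over \<open>\<xi>\<close> into
  an integral of masses of disks (\<open>tonelli_cone\<close>).

  Condition (c): on the disk of radius \<open>3 \<delta> z\<close> the kernel is at least a constant times
  \<open>(\<delta> z) powr (- (\<gamma> + 2))\<close>, so (c) gives disk control; conversely \<open>slow_growth\<close> and disk control bound the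
  mass on disks of every larger radius polynomially, and the dyadic sum of these bounds against
  the kernel converges for large \<open>\<gamma>\<close>.

  Condition (d): the bounds for the \<open>n\<close>-th derivative and for the coefficients hold for every slow weight, by the
  sub-mean-value property of \<open>\<bar>f\<bar> powr q\<close>. The bound for \<open>f\<close> needs disk control, which improves
  itself: the mass at depth below \<open>s\<close> is at most a constant times that of the shell just above, so
  it decays geometrically and disk control persists for \<open>\<delta> powr (- \<epsilon>) * v\<close> with some \<open>\<epsilon> > 0\<close>
  (\<open>ball_carleson_improve\<close>). As \<open>\<bar>f z - f 0\<bar>\<close> is at most \<open>(\<delta> z) powr (- s) / s\<close>
  times the maximum of \<open>\<bar>f'\<bar> \<delta> powr (1 + s)\<close> along the radius, and the \<open>q\<close>-th power of this maximum is bounded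
  by an average over the cone of \<open>z\<close>, Tonelli and the case \<open>s = \<epsilon> / q\<close> give the bound with one derivative,
  and induction over the weights \<open>\<delta> powr p * v\<close> gives all orders. Conversely, (d) with \<open>q = n = 1\<close>
  is tested on \<open>f z = (1 - cnj a * z) powi (- N)\<close> for large \<open>N\<close>: where \<open>\<delta> z\<close> is small in
  comparison with \<open>\<bar>1 - cnj a * z\<bar>\<close> the integrand on the right is absorbed on the left, and
  elsewhere \<open>slow_growth\<close> applies.

  Condition (a): under disk control the maximal function of \<open>w\<close> restricted to a box is at most a
  constant times the sum of a cone integral and the average over the box, and Tonelli bounds its integral. Conversely, on each
  of many disjoint shells near the circle the integral of the maximal function over the part of
  the shell in the box \<open>Q\<close> is at least a constant times the mass of \<open>Q\<close> below the shell. If there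
  are sufficiently many shells, the mass below the last one is at most half of the mass of \<open>Q\<close>; the rest is
  controlled by \<open>slow_growth\<close>.

  Condition (b): given \<open>B_p\<close>, the second average is bounded below by its contribution from
  a disk about the center of the box, which leaves a bound for the mass of the box. Conversely, if \<open>\<kappa>\<close> is
  the exponent in \<open>slow_growth\<close>, then \<open>p = 2\<close> and \<open>\<eta> = \<kappa>\<close> bound the integrand of the second average
  by a constant times its value at the center of the box.
\<close>

section \<open>Slowly varying weights\<close>

text \<open>The distance of a point of the unit disk to the unit circle, also called its depth; negative
  outside of the closed disk.\<close>

abbreviation bdist :: "complex \<Rightarrow> real" where
  "bdist z \<equiv> 1 - cmod z"

text \<open>The mass of a set with respect to the density \<open>v\<close>.\<close>

abbreviation mass :: "(complex \<Rightarrow> real) \<Rightarrow> complex set \<Rightarrow> ennreal" where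
  "mass v S \<equiv> \<integral>\<^sup>+\<xi>\<in>S. ennreal (v \<xi>) \<partial>lborel"

text \<open>A slow weight varies at most by the factor \<open>A\<close> on the disk about \<open>z\<close> whose radius is half the
  distance of \<open>z\<close> to the circle. Nothing is said about measurability.\<close>

definition slow :: "real \<Rightarrow> (complex \<Rightarrow> real) \<Rightarrow> bool" where
  "slow A v \<longleftrightarrow> 1 \<le> A \<and> (\<forall>z\<in>unit_disk. 0 < v z) \<and>
     (\<forall>z\<in>unit_disk. \<forall>\<xi>. dist z \<xi> \<le> bdist z / 2 \<longrightarrow> v \<xi> \<le> A * v z \<and> v z \<le> A * v \<xi>)"

lemma slowD:
  assumes "slow A v"
  shows "1 \<le> A" "z \<in> unit_disk \<Longrightarrow> 0 < v z"
    "z \<in> unit_disk \<Longrightarrow> dist z \<xi> \<le> bdist z / 2 \<Longrightarrow> v \<xi> \<le> A * v z"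
    "z \<in> unit_disk \<Longrightarrow> dist z \<xi> \<le> bdist z / 2 \<Longrightarrow> v z \<le> A * v \<xi>"
  using assms unfolding slow_def by blast+

lemma bdist_diff: "\<bar>bdist z - bdist \<xi>\<bar> \<le> dist z \<xi>"
  using norm_triangle_ineq3[of z \<xi>] by (simp add: dist_norm)

lemma bdist_ge: "bdist z \<le> bdist \<xi> + dist z \<xi>"
  using bdist_diff[of z \<xi>] by linarith

text \<open>A local comparison at scale \<open>c\<close> propagates along a segment between two points of depth at least
  \<open>s\<close>: by convexity the whole segment has depth at least \<open>s\<close>, so each step may have length \<open>c * s\<close>.\<close>

lemma local_chain:
  fixes v :: "complex \<Rightarrow> real" and A :: real
  assumes A: "1 \<le> A" and c: "0 < c" "c \<le> 1"
    and step: "\<And>z \<xi>. z \<in> unit_disk \<Longrightarrow> dist z \<xi> \<le> c * bdist z \<Longrightarrow> v \<xi> \<le> A * v z"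
    and s: "0 < s" "s \<le> bdist z" "s \<le> bdist \<xi>" "dist z \<xi> \<le> real n * (c * s)"
  shows "v \<xi> \<le> A ^ n * v z"
  using s(3,4)
proof (induction n arbitrary: \<xi>)
  case 0
  then show ?case by simp
next
  case (Suc n)
  \<comment> \<open>the last but one of the equidistant points on the segment\<close>
  define \<eta> where "\<eta> = z + (real n / real (Suc n)) *\<^sub>R (\<xi> - z)"
  have conv: "\<eta> = (1 - real n / real (Suc n)) *\<^sub>R z + (real n / real (Suc n)) *\<^sub>R \<xi>"
    by (simp add: \<eta>_def algebra_simps)
  have t: "0 \<le> real n / real (Suc n)" "real n / real (Suc n) \<le> 1"
    by simp_all
  have "\<eta> \<in> cball 0 (1 - s)"
    unfolding conv using Suc.prems(1) s(2) t
    by (intro convexD_alt[OF convex_cball]) auto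
  then have \<eta>: "s \<le> bdist \<eta>" by simp
  have d1: "dist z \<eta> = (real n / real (Suc n)) * dist z \<xi>"
    unfolding \<eta>_def dist_norm by (simp add: norm_minus_commute)
  have "\<xi> - \<eta> = (1 - real n / real (Suc n)) *\<^sub>R (\<xi> - z)"
    by (simp add: \<eta>_def algebra_simps)
  then have "dist \<eta> \<xi> = (1 - real n / real (Suc n)) * dist z \<xi>"
    using t unfolding dist_norm by (metis abs_of_nonneg diff_ge_0_iff_ge norm_minus_commute norm_scaleR)
  also have "\<dots> = dist z \<xi> / real (Suc n)" by (simp add: field_simps)
  finally have d2: "dist \<eta> \<xi> = dist z \<xi> / real (Suc n)" .
  have "dist z \<eta> \<le> (real n / real (Suc n)) * (real (Suc n) * (c * s))"
    unfolding d1 using Suc.prems(2) t by (intro mult_left_mono) auto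
  then have "dist z \<eta> \<le> real n * (c * s)" by simp
  then have IH: "v \<eta> \<le> A ^ n * v z" using Suc.IH \<eta> by blast
  have "dist \<eta> \<xi> \<le> c * s"
    unfolding d2 using Suc.prems(2) by (simp add: pos_divide_le_eq mult.commute)
  also have "\<dots> \<le> c * bdist \<eta>" using \<eta> c by (intro mult_left_mono) auto
  finally have "v \<xi> \<le> A * v \<eta>" using \<eta> s(1) by (intro step) auto
  also have "\<dots> \<le> A * (A ^ n * v z)"
    using IH A by (intro mult_left_mono) auto
  finally show ?case by simp
qed

lemma slow_chain:
  assumes "slow A v" "0 < s" "s \<le> bdist z" "s \<le> bdist \<xi>" "dist z \<xi> \<le> real n * (s / 2)"
  shows "v \<xi> \<le> A ^ n * v z"
proof (rule local_chain[where c = "1 / 2" and s = s])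
  show "v \<xi>' \<le> A * v z'" if "z' \<in> unit_disk" "dist z' \<xi>' \<le> 1 / 2 * bdist z'" for z' \<xi>'
    using slowD(3)[OF assms(1), of z' \<xi>'] that by simp
qed (use assms slowD(1)[OF assms(1)] in auto)

text \<open>The point of depth \<open>s\<close> on the radius through \<open>z\<close>. As \<open>sgn 0 = 0\<close>, the value for \<open>z = 0\<close> is 0;
  the lemmas below concern points at least as far from the circle as \<open>z\<close>, where \<open>z = 0\<close> forces \<open>s = 1\<close>.\<close>

definition radial :: "real \<Rightarrow> complex \<Rightarrow> complex" where
  "radial s z = (1 - s) *\<^sub>R sgn z"

lemma norm_scaleR_sgn: "norm z *\<^sub>R sgn z = z"
  by (cases "z = 0") (simp_all add: sgn_div_norm)

lemma radial:
  assumes "z \<in> unit_disk" "bdist z \<le> s" "s \<le> 1"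
  shows "bdist (radial s z) = s" "dist z (radial s z) = s - bdist z" "sgn (radial s z) = (if s < 1 then sgn z else 0)"
proof -
  show "bdist (radial s z) = s"
    using assms by (cases "z = 0") (auto simp: radial_def norm_sgn)
  have "z - radial s z = (cmod z - (1 - s)) *\<^sub>R sgn z"
    using norm_scaleR_sgn[of z] by (simp add: radial_def scaleR_left_diff_distrib)
  then show "dist z (radial s z) = s - bdist z"
    unfolding dist_norm using assms by (cases "z = 0") (auto simp: norm_sgn)
  show "sgn (radial s z) = (if s < 1 then sgn z else 0)"
    using assms by (simp add: radial_def sgn_scaleR)
qed

lemma radial_bdist: "z \<in> unit_disk \<Longrightarrow> radial (bdist z) z = z"
  by (simp add: radial_def norm_scaleR_sgn)

lemma radial_radial:
  assumes "z \<in> unit_disk" "bdist z \<le> s" "s \<le> t" "t \<le> 1"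
  shows "radial t (radial s z) = radial t z"
  using radial(3)[of z s] assms by (auto simp: radial_def)

text \<open>Each doubling of the depth costs two steps of the comparison.\<close>

lemma slow_along_radius:
  assumes "slow A v" "z \<in> unit_disk" "bdist z \<le> s" "s \<le> 2 ^ k * bdist z" "s \<le> 1"
  shows "v (radial s z) \<le> A ^ (2 * k) * v z \<and> v z \<le> A ^ (2 * k) * v (radial s z)"
  using assms(3-5)
proof (induction k arbitrary: s)
  case 0
  then show ?case using radial_bdist[OF assms(2)] by simp
next
  case (Suc k)
  \<comment> \<open>the maximum keeps the intermediate depth at least that of \<open>z\<close>\<close>
  define t where "t = max (bdist z) (s / 2)"
  have zpos: "0 < bdist z" using assms(2) by simp
  have t: "bdist z \<le> t" "t \<le> 2 ^ k * bdist z" "t \<le> 1" "t \<le> s" "s / 2 \<le> t" "0 < t"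
  proof -
    have "bdist z \<le> 2 ^ k * bdist z" using zpos by simp
    then show "t \<le> 2 ^ k * bdist z" using Suc.prems(2) by (simp add: t_def)
  qed (use Suc.prems zpos in \<open>auto simp: t_def\<close>)
  have IH: "v (radial t z) \<le> A ^ (2 * k) * v z \<and> v z \<le> A ^ (2 * k) * v (radial t z)"
    using Suc.IH t by blast
  have rt: "bdist (radial t z) = t" using radial(1)[OF assms(2)] t by blast
  have rs: "bdist (radial s z) = s" using radial(1)[OF assms(2)] Suc.prems by blast
  have "radial t z \<in> unit_disk" using rt t by simp
  then have "dist (radial t z) (radial s (radial t z)) = s - t"
    using radial(2)[of "radial t z" s] rt t Suc.prems by auto
  then have d: "dist (radial t z) (radial s z) \<le> real 2 * (t / 2)"
    using radial_radial[OF assms(2), of t s] t Suc.prems by auto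
  have 1: "v (radial s z) \<le> A ^ 2 * v (radial t z)"
    using slow_chain[OF assms(1) \<open>0 < t\<close> _ _ d] rs rt t by simp
  have 2: "v (radial t z) \<le> A ^ 2 * v (radial s z)"
    using slow_chain[OF assms(1) \<open>0 < t\<close>, of "radial s z" "radial t z" 2] d rs rt t
    by (simp add: dist_commute)
  have A: "0 \<le> A" using slowD(1)[OF assms(1)] by simp
  have "v (radial s z) \<le> A ^ 2 * (A ^ (2 * k) * v z)"
    using 1 IH mult_left_mono[of _ _ "A ^ 2"] A by (meson order_trans zero_le_power)
  moreover have "v z \<le> A ^ (2 * k) * (A ^ 2 * v (radial s z))"
    using 2 IH mult_left_mono[of _ _ "A ^ (2 * k)"] A by (meson order_trans zero_le_power)
  ultimately show ?case by (simp add: power_add power2_eq_square mult_ac)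
qed

text \<open>A slow weight grows at most polynomially in the depths. The comparison goes from \<open>z\<close> inwards to
  depth \<open>min 1 R\<close>, across in six steps, and back outwards to \<open>\<xi>\<close>. The number of steps on the radii is
  logarithmic in the ratio of the depths, whence a power.\<close>

lemma slow_growth:
  assumes "slow A v"
  obtains \<kappa> C where "0 \<le> \<kappa>" "1 \<le> C"
    "\<And>z \<xi> R. z \<in> unit_disk \<Longrightarrow> \<xi> \<in> unit_disk \<Longrightarrow> dist z \<xi> \<le> R \<Longrightarrow> bdist z \<le> R \<Longrightarrow> bdist \<xi> \<le> R \<Longrightarrow>
      v \<xi> \<le> C * (R / bdist z) powr \<kappa> * (R / bdist \<xi>) powr \<kappa> * v z"
proof
  \<comment> \<open>two factors \<open>A\<close> for each doubling\<close>
  define \<kappa> where "\<kappa> = 2 * log 2 A"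
  have A: "1 \<le> A" using slowD(1)[OF assms] .
  show \<kappa>0: "0 \<le> \<kappa>" using A by (simp add: \<kappa>_def)
  define B where "B = 2 powr \<kappa>"
  have B: "1 \<le> B" using \<kappa>0 by (simp add: B_def ge_one_powr_ge_zero)
  show "1 \<le> B * B * A ^ 6"
    using A B by (metis mult_ge1_I one_le_power)
  have radial_growth: "v (radial s z) \<le> B * (R / bdist z) powr \<kappa> * v z \<and> v z \<le> B * (R / bdist z) powr \<kappa> * v (radial s z)"
    if z: "z \<in> unit_disk" and s: "bdist z \<le> s" "s \<le> 1" "s \<le> R" for z s R
  proof -
    have zpos: "0 < bdist z" using z by simp
    define k where "k = nat \<lceil>log 2 (s / bdist z)\<rceil>"
    have q1: "1 \<le> s / bdist z" using zpos s by simp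
    then have l0: "0 \<le> log 2 (s / bdist z)" by simp
    have k1: "log 2 (s / bdist z) \<le> real k" unfolding k_def by linarith
    have k2: "real k \<le> log 2 (s / bdist z) + 1" unfolding k_def using l0 by linarith
    have "s / bdist z \<le> 2 ^ k"
      using k1 q1 by (subst (asm) log_le_iff) (auto simp: powr_realpow)
    then have sk: "s \<le> 2 ^ k * bdist z" using zpos by (simp add: field_simps)
    have "A ^ (2 * k) = A powr (2 * real k)"
      using A by (simp flip: powr_realpow)
    also have "\<dots> = (2 powr log 2 A) powr (2 * real k)" using A by simp
    also have "\<dots> = 2 powr (\<kappa> * real k)" unfolding \<kappa>_def by (simp add: powr_powr mult_ac)
    also have "\<dots> \<le> 2 powr (\<kappa> * (log 2 (s / bdist z) + 1))"
      using k2 \<kappa>0 by (intro powr_mono mult_left_mono) auto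
    also have "\<dots> = B * (s / bdist z) powr \<kappa>"
    proof -
      have "2 powr (\<kappa> * log 2 (s / bdist z)) = (s / bdist z) powr \<kappa>"
        using q1 by (simp add: mult.commute[of \<kappa>] flip: powr_powr)
      then show ?thesis by (simp add: distrib_left powr_add B_def mult.commute)
    qed
    also have "\<dots> \<le> B * (R / bdist z) powr \<kappa>"
      using B s zpos \<kappa>0 q1 by (intro mult_left_mono powr_mono2 divide_right_mono) auto
    finally have Ak: "A ^ (2 * k) \<le> B * (R / bdist z) powr \<kappa>" .
    have rs: "radial s z \<in> unit_disk" using radial(1)[OF z s(1,2)] s zpos by simp
    show ?thesis
      using slow_along_radius[OF assms z s(1) sk s(2)] Ak slowD(2)[OF assms z] slowD(2)[OF assms rs]
      by (meson less_imp_le mult_right_mono order_trans)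
  qed
  fix z \<xi> R
  assume z: "z \<in> unit_disk" and \<xi>: "\<xi> \<in> unit_disk" and R: "dist z \<xi> \<le> R" "bdist z \<le> R" "bdist \<xi> \<le> R"
  define s where "s = min 1 R"
  have s: "bdist z \<le> s" "bdist \<xi> \<le> s" "s \<le> 1" "s \<le> R" using R by (auto simp: s_def)
  have spos: "0 < s" using s z by auto
  have rz: "bdist (radial s z) = s" "dist z (radial s z) \<le> s"
    using radial[OF z] s z by auto
  have r\<xi>: "bdist (radial s \<xi>) = s" "dist \<xi> (radial s \<xi>) \<le> s"
    using radial[OF \<xi>] s \<xi> by auto
  have "dist (radial s z) (radial s \<xi>) \<le> real 6 * (s / 2)"
  proof (cases "R \<le> 1")
    case True
    then have "s = R" by (simp add: s_def)
    then show ?thesis using rz r\<xi> R(1)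
      dist_triangle[of "radial s z" "radial s \<xi>" z] dist_triangle[of z "radial s \<xi>" \<xi>]
      by (simp add: dist_commute)
  next
    case False
    then have "s = 1" by (simp add: s_def)
    then show ?thesis by (simp add: radial_def)
  qed
  then have mid: "v (radial s \<xi>) \<le> A ^ 6 * v (radial s z)"
    using slow_chain[OF assms spos] rz r\<xi> by simp
  have "v \<xi> \<le> B * (R / bdist \<xi>) powr \<kappa> * v (radial s \<xi>)"
    using radial_growth[OF \<xi> s(2-4)] by blast
  also have "\<dots> \<le> B * (R / bdist \<xi>) powr \<kappa> * (A ^ 6 * (B * (R / bdist z) powr \<kappa> * v z))"
  proof (intro mult_left_mono)
    have "A ^ 6 * v (radial s z) \<le> A ^ 6 * (B * (R / bdist z) powr \<kappa> * v z)"
      using radial_growth[OF z s(1,3,4)] A by (intro mult_left_mono) auto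
    then show "v (radial s \<xi>) \<le> A ^ 6 * (B * (R / bdist z) powr \<kappa> * v z)"
      using mid by simp
  qed (use B in auto)
  finally show "v \<xi> \<le> B * B * A ^ 6 * (R / bdist z) powr \<kappa> * (R / bdist \<xi>) powr \<kappa> * v z"
    by (simp add: mult_ac)
qed

section \<open>Mass of boundary disks\<close>

text \<open>Slow weights that are Borel measurable and are extended by 0 to the plane, so that integrals over
  arbitrary disks only see the part in the unit disk.\<close>

definition regular :: "real \<Rightarrow> (complex \<Rightarrow> real) \<Rightarrow> bool" where
  "regular A v \<longleftrightarrow> slow A v \<and> v \<in> borel_measurable borel \<and> (\<forall>z. z \<notin> unit_disk \<longrightarrow> v z = 0)"

lemma regularD:
  assumes "regular A v"
  shows "slow A v" "v \<in> borel_measurable borel" "z \<notin> unit_disk \<Longrightarrow> v z = 0" "0 \<le> v z"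
    "1 \<le> A" "z \<in> unit_disk \<Longrightarrow> 0 < v z"
  using assms slowD[of A v] unfolding regular_def
  by (blast, blast, blast, metis less_eq_real_def, blast, blast)

text \<open>Disk control, the condition through which all equivalences pass. The disk is not required to lie
  in the unit disk; the factor 3 makes it large enough to contain the Carleson box whose center is \<open>z\<close>.\<close>

definition ball_carleson :: "(complex \<Rightarrow> real) \<Rightarrow> bool" where
  "ball_carleson v \<longleftrightarrow> (\<exists>C\<ge>0. \<forall>z\<in>unit_disk.
     mass v (ball z (3 * bdist z)) \<le> ennreal (C * (bdist z)\<^sup>2 * v z))"

lemma emeasure_ball_complex:
  "0 \<le> r \<Longrightarrow> emeasure lborel (ball (z::complex) r) = ennreal (pi * r\<^sup>2)"
  using emeasure_ball[of r z] by (simp add: unit_ball_vol_2)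

lemma measurable_ball [measurable]: "ball (z::complex) r \<in> sets borel"
  by simp

lemma measurable_cone [measurable]:
  "{p. dist (fst p) (snd p) < K * bdist (snd p)} \<in> sets (borel \<Otimes>\<^sub>M borel)"
  unfolding borel_prod by (intro borel_open open_Collect_less continuous_intros)

lemma measurable_cone_integral:
  fixes g :: "complex \<Rightarrow> ennreal"
  assumes [measurable]: "g \<in> borel_measurable borel"
  shows "(\<lambda>z. \<integral>\<^sup>+\<xi>\<in>{\<xi>. dist z \<xi> < K * bdist \<xi>}. g \<xi> \<partial>lborel) \<in> borel_measurable borel"
proof -
  define S where "S = {p::complex \<times> complex. dist (fst p) (snd p) < K * bdist (snd p)}"
  have [measurable]: "S \<in> sets (borel \<Otimes>\<^sub>M borel)" unfolding S_def by measurable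
  have "(\<lambda>z. \<integral>\<^sup>+\<xi>. g \<xi> * indicator S (z, \<xi>) \<partial>lborel) \<in> borel_measurable borel"
    by (intro sigma_finite_measure.borel_measurable_nn_integral sigma_finite_lborel) simp
  then show ?thesis by (simp add: S_def indicator_def)
qed

lemma measurable_ball_integral:
  fixes u :: "complex \<Rightarrow> ennreal"
  assumes [measurable]: "u \<in> borel_measurable borel" "Z \<in> sets borel"
  shows "(\<lambda>\<xi>. \<integral>\<^sup>+z\<in>Z \<inter> ball \<xi> (3 * bdist \<xi>). u z \<partial>lborel) \<in> borel_measurable borel"
proof -
  have [measurable]: "{p \<in> space (borel \<Otimes>\<^sub>M borel). snd p \<in> Z \<inter> ball (fst p) (3 * bdist (fst p))} \<in> sets (borel \<Otimes>\<^sub>M borel)"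
  proof -
    have "{p \<in> space (borel \<Otimes>\<^sub>M borel). snd p \<in> Z \<inter> ball (fst p) (3 * bdist (fst p))}
      = (UNIV \<times> Z) \<inter> {p. dist (fst p) (snd p) < 3 * bdist (fst p)}" by (auto simp: space_pair_measure)
    moreover have "{p::complex\<times>complex. dist (fst p) (snd p) < 3 * bdist (fst p)} \<in> sets (borel \<Otimes>\<^sub>M borel)"
      unfolding borel_prod by (intro borel_open open_Collect_less continuous_intros)
    ultimately show ?thesis by auto
  qed
  have "(\<lambda>\<xi>. \<integral>\<^sup>+z. u z * indicator {p. snd p \<in> Z \<inter> ball (fst p) (3 * bdist (fst p))} (\<xi>, z) \<partial>lborel) \<in> borel_measurable borel"
    by (intro sigma_finite_measure.borel_measurable_nn_integral sigma_finite_lborel) (simp add: split_beta')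
  then show ?thesis by (simp add: indicator_def cong: if_cong)
qed

text \<open>The set of pairs with \<open>dist z \<xi> < K * bdist \<xi>\<close> is a cone with vertex \<open>z\<close> when seen from \<open>z\<close>, and a
  disk about \<open>\<xi>\<close> when seen from \<open>\<xi>\<close>.\<close>

lemma tonelli_cone:
  fixes g u :: "complex \<Rightarrow> ennreal"
  assumes [measurable]: "g \<in> borel_measurable borel" "u \<in> borel_measurable borel"
  shows "(\<integral>\<^sup>+z. u z * (\<integral>\<^sup>+\<xi>\<in>{\<xi>. dist z \<xi> < K * bdist \<xi>}. g \<xi> \<partial>lborel) \<partial>lborel) =
    (\<integral>\<^sup>+\<xi>. g \<xi> * (\<integral>\<^sup>+z\<in>ball \<xi> (K * bdist \<xi>). u z \<partial>lborel) \<partial>lborel)"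
proof -
  define S where "S = {p::complex \<times> complex. dist (fst p) (snd p) < K * bdist (snd p)}"
  have [measurable]: "S \<in> sets (borel \<Otimes>\<^sub>M borel)" unfolding S_def by measurable
  have "(\<integral>\<^sup>+z. u z * (\<integral>\<^sup>+\<xi>\<in>{\<xi>. dist z \<xi> < K * bdist \<xi>}. g \<xi> \<partial>lborel) \<partial>lborel)
     = (\<integral>\<^sup>+z. (\<integral>\<^sup>+\<xi>. u z * g \<xi> * indicator S (z, \<xi>) \<partial>lborel) \<partial>lborel)"
  proof (intro nn_integral_cong)
    fix z
    have ind: "indicator {\<xi>. dist z \<xi> < K * bdist \<xi>} \<xi> = (indicator S (z, \<xi>) :: ennreal)" for \<xi>
      by (simp add: S_def indicator_def)
    show "u z * (\<integral>\<^sup>+\<xi>\<in>{\<xi>. dist z \<xi> < K * bdist \<xi>}. g \<xi> \<partial>lborel)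
      = (\<integral>\<^sup>+\<xi>. u z * g \<xi> * indicator S (z, \<xi>) \<partial>lborel)"
      unfolding ind mult.assoc by (subst nn_integral_cmult) auto
  qed
  also have "\<dots> = (\<integral>\<^sup>+\<xi>. (\<integral>\<^sup>+z. u z * g \<xi> * indicator S (z, \<xi>) \<partial>lborel) \<partial>lborel)"
    by (rule lborel_pair.Fubini') measurable
  also have "\<dots> = (\<integral>\<^sup>+\<xi>. g \<xi> * (\<integral>\<^sup>+z\<in>ball \<xi> (K * bdist \<xi>). u z \<partial>lborel) \<partial>lborel)"
  proof (intro nn_integral_cong)
    fix \<xi>
    have "u z * g \<xi> * indicator S (z, \<xi>) = g \<xi> * (u z * indicator (ball \<xi> (K * bdist \<xi>)) z)" for z
      by (auto simp: S_def indicator_def dist_commute mult.commute)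
    then show "(\<integral>\<^sup>+z. u z * g \<xi> * indicator S (z, \<xi>) \<partial>lborel) =
      g \<xi> * (\<integral>\<^sup>+z\<in>ball \<xi> (K * bdist \<xi>). u z \<partial>lborel)"
      by (simp only:, intro nn_integral_cmult) measurable
  qed
  finally show ?thesis .
qed

lemma nn_integral_const_ball:
  "0 \<le> r \<Longrightarrow> 0 \<le> c \<Longrightarrow> (\<integral>\<^sup>+\<xi>\<in>ball (z::complex) r. ennreal c \<partial>lborel) = ennreal (c * (pi * r\<^sup>2))"
  by (simp add: nn_integral_cmult_indicator emeasure_ball_complex ennreal_mult)

lemma ball_integral_ge:
  assumes "0 \<le> r" "0 \<le> c" "\<And>\<xi>. \<xi> \<in> ball (z::complex) r \<Longrightarrow> \<xi> \<in> S \<and> ennreal c \<le> g \<xi>"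
  shows "ennreal (c * (pi * r\<^sup>2)) \<le> (\<integral>\<^sup>+\<xi>\<in>S. g \<xi> \<partial>lborel)"
  unfolding nn_integral_const_ball[OF assms(1,2), of z, symmetric]
  using assms(3) by (intro nn_integral_mono) (auto simp: indicator_def)

lemma ball_integral_le:
  assumes "0 \<le> r" "0 \<le> c" "\<And>\<xi>. \<xi> \<in> S \<Longrightarrow> \<xi> \<in> ball (z::complex) r \<and> g \<xi> \<le> ennreal c"
  shows "(\<integral>\<^sup>+\<xi>\<in>S. g \<xi> \<partial>lborel) \<le> ennreal (c * (pi * r\<^sup>2))"
  unfolding nn_integral_const_ball[OF assms(1,2), of z, symmetric]
  using assms(3) by (intro nn_integral_mono) (auto simp: indicator_def)

text \<open>Disk control at the point of depth \<open>min 1 R\<close> on the radius of \<open>z\<close>, together with the growth of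
  the weight along that radius, controls the mass of larger disks.\<close>

lemma ball_carleson_growth:
  assumes "regular A v" "ball_carleson v"
  obtains \<kappa> C where "0 \<le> \<kappa>" "1 \<le> C"
    "\<And>z R. z \<in> unit_disk \<Longrightarrow> bdist z \<le> R \<Longrightarrow>
      mass v (ball z R) \<le> ennreal (C * (R / bdist z) powr \<kappa> * R\<^sup>2 * v z)"
proof -
  obtain \<kappa> C where \<kappa>: "0 \<le> \<kappa>" and C: "1 \<le> C" and gr: "\<And>z \<xi> R. z \<in> unit_disk \<Longrightarrow> \<xi> \<in> unit_disk \<Longrightarrow> dist z \<xi> \<le> R \<Longrightarrow> bdist z \<le> R \<Longrightarrow> bdist \<xi> \<le> R \<Longrightarrow>
      v \<xi> \<le> C * (R / bdist z) powr \<kappa> * (R / bdist \<xi>) powr \<kappa> * v z"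
    using slow_growth[OF regularD(1)[OF assms(1)]] by metis
  obtain C' where C': "0 \<le> C'" "\<And>z. z \<in> unit_disk \<Longrightarrow>
     mass v (ball z (3 * bdist z)) \<le> ennreal (C' * (bdist z)\<^sup>2 * v z)"
    using assms(2) unfolding ball_carleson_def by blast
  show ?thesis
  proof (rule that[of \<kappa> "1 + C' * C"])
    fix z R assume z: "z \<in> unit_disk" and R: "bdist z \<le> R"
    define s where "s = min 1 R"
    have s: "bdist z \<le> s" "s \<le> 1" "s \<le> R" using R by (auto simp: s_def)
    have z0: "0 < bdist z" using z by simp
    then have spos: "0 < s" using s by linarith
    note rz = radial[OF z s(1,2)]
    have rzD: "radial s z \<in> unit_disk" using rz spos by simp
    have sub: "\<xi> \<in> ball (radial s z) (3 * s)" if "\<xi> \<in> ball z R" "\<xi> \<in> unit_disk" for \<xi>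
    proof (cases "R \<le> 1")
      case True
      then have "dist \<xi> (radial s z) < R + s" using that rz(2) z0 dist_triangle[of \<xi> "radial s z" z]
        by (simp add: dist_commute)
      with True show ?thesis using spos by (simp add: s_def dist_commute)
    next
      case False
      then have "s = 1" by (simp add: s_def)
      then show ?thesis using that by (simp add: radial_def)
    qed
    have "mass v (ball z R) \<le> mass v (ball (radial s z) (3 * s))"
    proof (intro nn_integral_mono)
      fix \<xi> show "ennreal (v \<xi>) * indicator (ball z R) \<xi> \<le> ennreal (v \<xi>) * indicator (ball (radial s z) (3 * s)) \<xi>"
        using sub[of \<xi>] regularD(3)[OF assms(1), of \<xi>] by (cases "\<xi> \<in> unit_disk") (auto simp: indicator_def)
    qed
    also have "\<dots> \<le> ennreal (C' * s\<^sup>2 * v (radial s z))"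
      using C'(2)[OF rzD] rz(1) by simp
    also have "\<dots> \<le> ennreal (C' * R\<^sup>2 * (C * (R / bdist z) powr \<kappa> * v z))"
    proof (intro ennreal_leI mult_mono)
      have "v (radial s z) \<le> C * (s / bdist z) powr \<kappa> * (s / s) powr \<kappa> * v z"
        using gr[OF z rzD, of s] rz s z0 by simp
      also have "\<dots> \<le> C * (R / bdist z) powr \<kappa> * 1 * v z"
        using C \<kappa> s z0 spos regularD(4)[OF assms(1), of z]
        by (intro mult_mono powr_mono2 divide_right_mono) auto
      finally show "v (radial s z) \<le> C * (R / bdist z) powr \<kappa> * v z" by simp
      show "s\<^sup>2 \<le> R\<^sup>2" using s spos by (intro power_mono) auto
    qed (use C' C regularD(4)[OF assms(1)] in auto)
    also have "\<dots> \<le> ennreal ((1 + C' * C) * (R / bdist z) powr \<kappa> * R\<^sup>2 * v z)"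
    proof (intro ennreal_leI)
      have "C' * R\<^sup>2 * (C * (R / bdist z) powr \<kappa> * v z) = (C' * C) * ((R / bdist z) powr \<kappa> * R\<^sup>2 * v z)" by simp
      also have "\<dots> \<le> (1 + C' * C) * ((R / bdist z) powr \<kappa> * R\<^sup>2 * v z)"
        using regularD(4)[OF assms(1)] by (intro mult_right_mono) auto
      finally show "C' * R\<^sup>2 * (C * (R / bdist z) powr \<kappa> * v z) \<le> (1 + C' * C) * (R / bdist z) powr \<kappa> * R\<^sup>2 * v z"
        by simp
    qed
    finally show "mass v (ball z R) \<le> ennreal ((1 + C' * C) * (R / bdist z) powr \<kappa> * R\<^sup>2 * v z)" .
  qed (use \<kappa> C C' in auto)
qed

text \<open>The modulus of \<open>1 - cnj \<xi> * z\<close> is comparable to \<open>bdist z + dist z \<xi>\<close>.\<close>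

lemma kernel_bounds:
  assumes "z \<in> unit_disk" "\<xi> \<in> unit_disk"
  shows "bdist z \<le> cmod (1 - cnj \<xi> * z)" "dist z \<xi> \<le> cmod (1 - cnj \<xi> * z)"
    "cmod (1 - cnj \<xi> * z) \<le> 2 * bdist z + dist z \<xi>" "bdist \<xi> \<le> cmod (1 - cnj \<xi> * z)"
proof -
  have n: "cmod z < 1" "cmod \<xi> < 1" using assms by auto
  have "1 - cmod \<xi> * cmod z \<le> cmod (1 - cnj \<xi> * z)"
    by (metis complex_mod_cnj norm_mult norm_one norm_triangle_ineq2)
  moreover have "cmod \<xi> * cmod z \<le> cmod z" "cmod \<xi> * cmod z \<le> cmod \<xi>"
    using n by (simp_all add: mult_left_le_one_le mult_left_le)
  ultimately show "bdist z \<le> cmod (1 - cnj \<xi> * z)" "bdist \<xi> \<le> cmod (1 - cnj \<xi> * z)" by linarith+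
  have "(cmod (1 - cnj \<xi> * z))\<^sup>2 - (dist z \<xi>)\<^sup>2 = (1 - (cmod z)\<^sup>2) * (1 - (cmod \<xi>)\<^sup>2)"
    unfolding dist_norm cmod_power2 by (simp add: algebra_simps power2_eq_square)
  moreover have "0 \<le> (1 - (cmod z)\<^sup>2) * (1 - (cmod \<xi>)\<^sup>2)"
    using n by (intro mult_nonneg_nonneg) (auto simp: power_le_one)
  ultimately show "dist z \<xi> \<le> cmod (1 - cnj \<xi> * z)"
    by (smt (verit) norm_ge_zero power2_le_imp_le)
  have "1 - cnj \<xi> * z = (1 - cnj z * z) + cnj (z - \<xi>) * z" by (simp add: algebra_simps)
  then have "cmod (1 - cnj \<xi> * z) \<le> cmod (1 - cnj z * z) + cmod (cnj (z - \<xi>) * z)"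
    by (metis norm_triangle_ineq)
  moreover have "cnj z * z = complex_of_real ((cmod z)\<^sup>2)"
    by (metis complex_norm_square mult.commute)
  then have "1 - cnj z * z = complex_of_real (1 - (cmod z)\<^sup>2)" by simp
  then have "cmod (1 - cnj z * z) = 1 - (cmod z)\<^sup>2"
    using n by (metis abs_of_nonneg diff_ge_0_iff_ge less_imp_le norm_ge_zero norm_of_real power_le_one)
  moreover have "1 - (cmod z)\<^sup>2 \<le> 2 * bdist z"
    using zero_le_power2[of "cmod z - 1"] by (simp add: power2_eq_square algebra_simps)
  moreover have "cmod (cnj (z - \<xi>) * z) \<le> dist z \<xi>"
    using n by (simp add: norm_mult dist_norm mult_left_le del: complex_cnj_diff)
  ultimately show "cmod (1 - cnj \<xi> * z) \<le> 2 * bdist z + dist z \<xi>" by linarith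
qed

lemma term_le_suminf: "f k \<le> (\<Sum>k. f k)" for f :: "nat \<Rightarrow> ennreal"
  using sum_le_suminf[of f "{k}"] by simp

text \<open>If the mass of disks of radius \<open>R\<close> about \<open>z\<close> grows at most like \<open>R powr m\<close>, then the kernel with exponent
  \<open>m + 1\<close> is integrable: the dyadic annuli contribute a geometric series of ratio 1/2.\<close>

lemma kernel_integral_le:
  fixes g :: "complex \<Rightarrow> ennreal"
  assumes [measurable]: "g \<in> borel_measurable borel" and z: "z \<in> unit_disk"
    and m: "0 \<le> m" and B: "0 \<le> B"
    and bd: "\<And>R. bdist z \<le> R \<Longrightarrow> (\<integral>\<^sup>+\<xi>\<in>unit_disk \<inter> ball z R. g \<xi> \<partial>lborel) \<le> ennreal (B * (R / bdist z) powr m)"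
  shows "(\<integral>\<^sup>+\<xi>\<in>unit_disk. g \<xi> * ennreal (inverse (cmod (1 - cnj \<xi> * z) powr (m + 1))) \<partial>lborel)
     \<le> ennreal (2 powr (m + 2) * B / bdist z powr (m + 1))"
proof -
  define h where "h = bdist z"
  have h: "0 < h" using z by (simp add: h_def)
  define c where "c k = inverse ((2 ^ k * h / 2) powr (m + 1))" for k :: nat
  have c0: "0 \<le> c k" for k using h by (simp add: c_def)
  have pw: "ennreal (inverse (cmod (1 - cnj \<xi> * z) powr (m + 1))) * indicator unit_disk \<xi>
      \<le> (\<Sum>k. ennreal (c k) * indicator (unit_disk \<inter> ball z (2 ^ k * h)) \<xi>)" (is "?L \<le> suminf ?f") for \<xi>
  proof (cases "\<xi> \<in> unit_disk")
    case \<xi>: True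
    note K = kernel_bounds[OF z \<xi>]
    define N where "N = cmod (1 - cnj \<xi> * z)"
    have ex: "\<exists>k::nat. dist z \<xi> < 2 ^ k * h"
    proof -
      obtain k :: nat where "dist z \<xi> / h < 2 ^ k" using real_arch_pow[of 2] by auto
      then show ?thesis using h by (auto simp: pos_divide_less_eq)
    qed
    \<comment> \<open>the first dyadic disk that contains \<open>\<xi>\<close>\<close>
    define k where "k = (LEAST k::nat. dist z \<xi> < 2 ^ k * h)"
    have k: "dist z \<xi> < 2 ^ k * h" unfolding k_def using ex by (rule LeastI_ex)
    have "2 ^ k * h / 2 \<le> N"
    proof (cases k)
      case 0
      then show ?thesis using K(1) h by (simp add: N_def h_def)
    next
      case (Suc j)
      then have "\<not> dist z \<xi> < 2 ^ j * h" unfolding k_def using not_less_Least by (metis lessI)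
      then show ?thesis using K(2) Suc by (simp add: N_def)
    qed
    then have "inverse (N powr (m + 1)) \<le> c k"
      unfolding c_def using h m by (intro le_imp_inverse_le powr_mono2) auto
    then have "?L \<le> ?f k" using \<xi> k by (simp add: N_def indicator_def ennreal_leI)
    also have "\<dots> \<le> suminf ?f"
      by (rule term_le_suminf)
    finally show ?thesis .
  qed simp
  have "(\<integral>\<^sup>+\<xi>\<in>unit_disk. g \<xi> * ennreal (inverse (cmod (1 - cnj \<xi> * z) powr (m + 1))) \<partial>lborel)
     \<le> (\<integral>\<^sup>+\<xi>. (\<Sum>k. ennreal (c k) * (g \<xi> * indicator (unit_disk \<inter> ball z (2 ^ k * h)) \<xi>)) \<partial>lborel)"
  proof (intro nn_integral_mono)
    fix \<xi>
    have "g \<xi> * ennreal (inverse (cmod (1 - cnj \<xi> * z) powr (m + 1))) * indicator unit_disk \<xi>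
      \<le> g \<xi> * (\<Sum>k. ennreal (c k) * indicator (unit_disk \<inter> ball z (2 ^ k * h)) \<xi>)"
      unfolding mult.assoc by (intro mult_left_mono pw) simp
    then show "g \<xi> * ennreal (inverse (cmod (1 - cnj \<xi> * z) powr (m + 1))) * indicator unit_disk \<xi>
      \<le> (\<Sum>k. ennreal (c k) * (g \<xi> * indicator (unit_disk \<inter> ball z (2 ^ k * h)) \<xi>))"
      by (simp add: mult.left_commute[of _ "g \<xi>"])
  qed
  also have "\<dots> = (\<Sum>k. ennreal (c k) * (\<integral>\<^sup>+\<xi>\<in>unit_disk \<inter> ball z (2 ^ k * h). g \<xi> \<partial>lborel))"
    by (subst nn_integral_suminf) (measurable, simp add: nn_integral_cmult)
  also have "\<dots> \<le> (\<Sum>k. ennreal (2 powr (m + 1) * B / h powr (m + 1) * (1 / 2) ^ k))"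
  proof (intro suminf_le summableI)
    fix k :: nat
    have "h \<le> 2 ^ k * h" using h by simp
    then have "(\<integral>\<^sup>+\<xi>\<in>unit_disk \<inter> ball z (2 ^ k * h). g \<xi> \<partial>lborel) \<le> ennreal (B * (2 ^ k) powr m)"
      using bd[of "2 ^ k * h"] h by (simp add: h_def)
    then have "ennreal (c k) * (\<integral>\<^sup>+\<xi>\<in>unit_disk \<inter> ball z (2 ^ k * h). g \<xi> \<partial>lborel) \<le> ennreal (c k) * ennreal (B * (2 ^ k) powr m)"
      by (intro mult_left_mono) auto
    also have "\<dots> = ennreal (c k * (B * (2 ^ k) powr m))"
      using c0 B by (intro ennreal_mult[symmetric]) auto
    also have "c k * (B * (2 ^ k) powr m) = 2 powr (m + 1) * B / h powr (m + 1) * (1 / 2) ^ k"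
      unfolding c_def using h by (simp add: powr_mult powr_divide powr_add field_simps power_one_over)
    finally show "ennreal (c k) * (\<integral>\<^sup>+\<xi>\<in>unit_disk \<inter> ball z (2 ^ k * h). g \<xi> \<partial>lborel)
      \<le> ennreal (2 powr (m + 1) * B / h powr (m + 1) * (1 / 2) ^ k)" .
  qed
  also have "\<dots> = ennreal (2 powr (m + 1) * B / h powr (m + 1) * 2)"
  proof (rule suminf_ennreal_eq)
    show "(\<lambda>k. 2 powr (m + 1) * B / h powr (m + 1) * (1 / 2) ^ k) sums (2 powr (m + 1) * B / h powr (m + 1) * 2)"
      using geometric_sums[of "1 / 2 :: real"] by (intro sums_mult) simp
  qed (use B in auto)
  also have "2 powr (m + 1) * B / h powr (m + 1) * 2 = 2 powr (m + 2) * B / bdist z powr (m + 1)"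
    by (simp add: h_def powr_add)
  finally show ?thesis .
qed

section \<open>Regularization of a weight, and transfer of mass between shells\<close>

text \<open>The supremum over the disks of radius \<open>bdist z / 2\<close> is lower semicontinuous in \<open>z\<close> whatever the
  measurability of \<open>w\<close>, because its superlevel sets are unions of open sets.\<close>

lemma slow_regularize:
  assumes "slow A w"
  obtains v where "regular (A\<^sup>2) v" "\<And>z. z \<in> unit_disk \<Longrightarrow> w z \<le> v z" "\<And>z. z \<in> unit_disk \<Longrightarrow> v z \<le> A * w z"
proof -
  define v where "v z = (if z \<in> unit_disk then SUP \<xi>\<in>ball z (bdist z / 2). w \<xi> else 0)" for z
  have A: "1 \<le> A" using slowD(1)[OF assms] .
  have near: "\<xi> \<in> unit_disk" if "z \<in> unit_disk" "dist z \<xi> \<le> bdist z / 2" for z \<xi>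
  proof -
    have "0 < bdist z" using that by simp
    then show ?thesis using bdist_ge[of z \<xi>] that by simp
  qed
  have ne: "z \<in> ball z (bdist z / 2)" if "z \<in> unit_disk" for z using that by simp
  have bdd: "bdd_above (w ` ball z (bdist z / 2))" if "z \<in> unit_disk" for z
    using slowD(3)[OF assms that] by (intro bdd_aboveI[of _ "A * w z"]) auto
  have le: "w z \<le> v z" if "z \<in> unit_disk" for z
    using that ne bdd by (auto simp: v_def intro!: cSUP_upper)
  have ge: "v z \<le> A * w z" if "z \<in> unit_disk" for z
  proof -
    have "(SUP \<xi>\<in>ball z (bdist z / 2). w \<xi>) \<le> A * w z"
      using ne[OF that] slowD(3)[OF assms that] by (intro cSUP_least) auto
    then show ?thesis using that by (simp add: v_def)
  qed
  have meas: "v \<in> borel_measurable borel"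
  proof (rule borel_measurable_iff_greater[THEN iffD2], intro allI)
    fix t :: real
    show "{z \<in> space borel. t < v z} \<in> sets borel"
    proof (cases "t < 0")
      case True
      have "t < v z" for z
        using True le[of z] slowD(2)[OF assms, of z] by (cases "z \<in> unit_disk") (force simp: v_def)+
      then show ?thesis by simp
    next
      case False
      have "{z. t < v z} = (\<Union>\<xi>\<in>{\<xi>. t < w \<xi>}. unit_disk \<inter> {z. dist z \<xi> < bdist z / 2})" (is "_ = ?U")
      proof (intro set_eqI)
        fix z
        show "z \<in> {z. t < v z} \<longleftrightarrow> z \<in> ?U"
        proof (cases "z \<in> unit_disk")
          case True
          have "t < v z \<longleftrightarrow> (\<exists>\<xi>\<in>ball z (bdist z / 2). t < w \<xi>)"
            using True ne[OF True] bdd[OF True] less_cSUP_iff[of "ball z (bdist z / 2)" w t]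
            by (auto simp: v_def)
          then show ?thesis using True by auto
        qed (use False in \<open>auto simp: v_def\<close>)
      qed
      moreover have "open ?U"
        by (intro open_UN ballI open_Int open_ball open_Collect_less continuous_intros) simp
      ultimately show ?thesis by simp
    qed
  qed
  have "slow (A\<^sup>2) v"
    unfolding slow_def
  proof (intro conjI ballI allI impI)
    show "1 \<le> A\<^sup>2" using A by simp
    fix z :: complex assume z: "z \<in> unit_disk"
    show "0 < v z" using le[OF z] slowD(2)[OF assms z] by simp
    fix \<xi> assume d: "dist z \<xi> \<le> bdist z / 2"
    note \<xi> = near[OF z d]
    have "v \<xi> \<le> A * (A * w z)"
      using ge[OF \<xi>] slowD(3)[OF assms z d] A by (meson mult_left_mono order_trans zero_le_one)
    also have "\<dots> \<le> A * (A * v z)" using le[OF z] A by (intro mult_left_mono) auto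
    finally show "v \<xi> \<le> A\<^sup>2 * v z" by (simp add: power2_eq_square)
    have "v z \<le> A * (A * w \<xi>)"
      using ge[OF z] slowD(4)[OF assms z d] A by (meson mult_left_mono order_trans zero_le_one)
    also have "\<dots> \<le> A * (A * v \<xi>)" using le[OF \<xi>] A by (intro mult_left_mono) auto
    finally show "v z \<le> A\<^sup>2 * v \<xi>" by (simp add: power2_eq_square)
  qed
  then have "regular (A\<^sup>2) v" unfolding regular_def using meas by (auto simp: v_def)
  then show ?thesis using that le ge by blast
qed

text \<open>If each point of \<open>Z\<close> that matters sees, within its cone, a disk of radius \<open>s / 8\<close> contained in \<open>S\<close>, then the
  mass of \<open>Z\<close> is recovered by integrating over \<open>\<xi>\<close> in \<open>S\<close> the masses of the parts of \<open>Z\<close> in the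
  disks \<open>ball \<xi> (3 * bdist \<xi>)\<close>. It is used with \<open>S\<close> the shell of depths between \<open>s\<close> and \<open>2 * s\<close>.\<close>

lemma shell_transfer:
  fixes u :: "complex \<Rightarrow> ennreal"
  assumes [measurable]: "u \<in> borel_measurable borel" "S \<in> sets borel" "Z \<in> sets borel" and s: "0 < s"
    and top: "\<And>z. z \<in> Z \<Longrightarrow> u z \<noteq> 0 \<Longrightarrow> \<exists>b. ball b (s / 8) \<subseteq> S \<inter> {\<xi>. dist z \<xi> < 3 * bdist \<xi>}"
  shows "(\<integral>\<^sup>+z\<in>Z. u z \<partial>lborel) \<le>
    ennreal (64 / (pi * s\<^sup>2)) * (\<integral>\<^sup>+\<xi>\<in>S. (\<integral>\<^sup>+z\<in>Z \<inter> ball \<xi> (3 * bdist \<xi>). u z \<partial>lborel) \<partial>lborel)"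
proof -
  \<comment> \<open>the inverse of the area of a disk of radius \<open>s / 8\<close>\<close>
  define c where "c = 64 / (pi * s\<^sup>2)"
  have c: "0 < c" "c * (pi * (s / 8)\<^sup>2) = 1" using s by (auto simp: c_def power2_eq_square)
  have "(\<integral>\<^sup>+z\<in>Z. u z \<partial>lborel) \<le>
    (\<integral>\<^sup>+z. u z * indicator Z z * (\<integral>\<^sup>+\<xi>\<in>{\<xi>. dist z \<xi> < 3 * bdist \<xi>}. ennreal c * indicator S \<xi> \<partial>lborel) \<partial>lborel)"
  proof (intro nn_integral_mono)
    fix z
    show "u z * indicator Z z \<le> u z * indicator Z z *
      (\<integral>\<^sup>+\<xi>\<in>{\<xi>. dist z \<xi> < 3 * bdist \<xi>}. ennreal c * indicator S \<xi> \<partial>lborel)" (is "_ \<le> _ * ?I")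
    proof (cases "z \<in> Z \<and> u z \<noteq> 0")
      case True
      then obtain b where "ball b (s / 8) \<subseteq> S \<inter> {\<xi>. dist z \<xi> < 3 * bdist \<xi>}" using top by blast
      then have "ennreal (c * (pi * (s / 8)\<^sup>2)) \<le> ?I"
        using s c by (intro ball_integral_ge[of _ _ b]) auto
      then have "1 \<le> ?I" unfolding c(2) by simp
      then show ?thesis using mult_left_mono[of 1 ?I "u z * indicator Z z"] by simp
    qed auto
  qed
  also have "\<dots> = (\<integral>\<^sup>+\<xi>. ennreal c * indicator S \<xi> * (\<integral>\<^sup>+z\<in>ball \<xi> (3 * bdist \<xi>). u z * indicator Z z \<partial>lborel) \<partial>lborel)"
    by (rule tonelli_cone) measurable
  also have "\<dots> = (\<integral>\<^sup>+\<xi>. ennreal c * ((\<integral>\<^sup>+z\<in>Z \<inter> ball \<xi> (3 * bdist \<xi>). u z \<partial>lborel) * indicator S \<xi>) \<partial>lborel)"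
    by (simp add: mult_ac indicator_inter_arith)
  also have "\<dots> = ennreal c * (\<integral>\<^sup>+\<xi>\<in>S. (\<integral>\<^sup>+z\<in>Z \<inter> ball \<xi> (3 * bdist \<xi>). u z \<partial>lborel) \<partial>lborel)"
  proof (rule nn_integral_cmult)
    have [measurable]: "(\<lambda>\<xi>. \<integral>\<^sup>+z\<in>Z \<inter> ball \<xi> (3 * bdist \<xi>). u z \<partial>lborel) \<in> borel_measurable borel"
      by (rule measurable_ball_integral[OF assms(1,3)])
    show "(\<lambda>\<xi>. (\<integral>\<^sup>+z\<in>Z \<inter> ball \<xi> (3 * bdist \<xi>). u z \<partial>lborel) * indicator S \<xi>) \<in> borel_measurable lborel"
      by measurable
  qed
  finally show ?thesis unfolding c_def .
qed

lemma ennreal_mult_assoc: "0 \<le> a \<Longrightarrow> ennreal a * (ennreal b * x) = ennreal (a * b) * x"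
  by (simp add: ennreal_mult' mult.assoc)

text \<open>Under disk control the mass at depth below \<open>s\<close> is dominated by that of the shell of depths from \<open>s\<close> to
  \<open>2 * s\<close>; the localization to disks loses only \<open>2 * s\<close> in the radius.\<close>

lemma ball_carleson_shell:
  assumes v: "regular A v" "ball_carleson v"
  obtains C where "1 \<le> C" "\<And>a r s. 0 < s \<Longrightarrow> s \<le> 1 / 2 \<Longrightarrow>
    (\<integral>\<^sup>+z\<in>ball a r \<inter> {z. bdist z < s}. ennreal (v z) \<partial>lborel)
      \<le> ennreal C * (\<integral>\<^sup>+z\<in>ball a (r + 2 * s) \<inter> {z. s \<le> bdist z \<and> bdist z < 2 * s}. ennreal (v z) \<partial>lborel)"
proof -
  obtain C where C: "0 \<le> C" "\<And>z. z \<in> unit_disk \<Longrightarrow>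
     mass v (ball z (3 * bdist z)) \<le> ennreal (C * (bdist z)\<^sup>2 * v z)"
    using v(2) unfolding ball_carleson_def by blast
  have [measurable]: "v \<in> borel_measurable borel" using regularD(2)[OF v(1)] .
  show ?thesis
  proof (rule that[of "1 + 256 * C / pi"])
    fix a :: complex and r s :: real assume s: "0 < s" "s \<le> 1 / 2"
    define S where "S = ball a (r + 2 * s) \<inter> {z. s \<le> bdist z \<and> bdist z < 2 * s}"
    define Z where "Z = ball a r \<inter> {z. bdist z < s}"
    have [measurable]: "S \<in> sets borel" "Z \<in> sets borel" unfolding S_def Z_def by measurable
    have "mass v Z \<le>
      ennreal (64 / (pi * s\<^sup>2)) * (\<integral>\<^sup>+\<xi>\<in>S. mass v (Z \<inter> ball \<xi> (3 * bdist \<xi>)) \<partial>lborel)"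
    proof (rule shell_transfer)
      fix z assume "z \<in> Z" "ennreal (v z) \<noteq> 0"
      then have z: "z \<in> unit_disk" "bdist z < s" "dist a z < r"
        using regularD(3)[OF v(1), of z] by (cases "z \<in> unit_disk"; auto simp: Z_def)+
      note b = radial[OF z(1), of "3 * s / 2"]
      have b': "bdist (radial (3 * s / 2) z) = 3 * s / 2" "dist z (radial (3 * s / 2) z) < 3 * s / 2"
        using b z s by auto
      have "\<xi> \<in> S \<inter> {\<xi>. dist z \<xi> < 3 * bdist \<xi>}" if "\<xi> \<in> ball (radial (3 * s / 2) z) (s / 8)" for \<xi>
      proof -
        have d: "dist (radial (3 * s / 2) z) \<xi> < s / 8" using that by simp
        then have "dist z \<xi> < 13 * s / 8" using b'(2) dist_triangle[of z \<xi> "radial (3 * s / 2) z"] by simp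
        moreover have "11 * s / 8 < bdist \<xi>" "bdist \<xi> < 13 * s / 8"
          using d bdist_diff[of "radial (3 * s / 2) z" \<xi>] b'(1) by linarith+
        moreover have "dist a \<xi> < r + 13 * s / 8" using z(3) calculation(1) dist_triangle[of a \<xi> z] by simp
        ultimately show ?thesis using s by (auto simp: S_def)
      qed
      then show "\<exists>b. ball b (s / 8) \<subseteq> S \<inter> {\<xi>. dist z \<xi> < 3 * bdist \<xi>}" by blast
    qed (use s in auto)
    also have "\<dots> \<le> ennreal (64 / (pi * s\<^sup>2)) * (\<integral>\<^sup>+\<xi>\<in>S. ennreal (C * (2 * s)\<^sup>2) * ennreal (v \<xi>) \<partial>lborel)"
    proof (intro mult_left_mono nn_integral_mono)
      fix \<xi>
      show "mass v (Z \<inter> ball \<xi> (3 * bdist \<xi>)) * indicator S \<xi>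
        \<le> ennreal (C * (2 * s)\<^sup>2) * ennreal (v \<xi>) * indicator S \<xi>"
      proof (cases "\<xi> \<in> S")
        case True
        then have \<xi>: "\<xi> \<in> unit_disk" "bdist \<xi> \<le> 2 * s" "0 \<le> bdist \<xi>" using s by (auto simp: S_def)
        have "mass v (Z \<inter> ball \<xi> (3 * bdist \<xi>)) \<le> mass v (ball \<xi> (3 * bdist \<xi>))"
          by (intro nn_set_integral_set_mono) auto
        also have "\<dots> \<le> ennreal (C * (bdist \<xi>)\<^sup>2 * v \<xi>)" by (rule C(2)[OF \<xi>(1)])
        also have "\<dots> \<le> ennreal (C * (2 * s)\<^sup>2 * v \<xi>)"
          using C(1) \<xi> regularD(4)[OF v(1)] by (intro ennreal_leI mult_right_mono mult_left_mono power_mono) auto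
        also have "\<dots> = ennreal (C * (2 * s)\<^sup>2) * ennreal (v \<xi>)"
          using C(1) regularD(4)[OF v(1)] by (intro ennreal_mult) auto
        finally show ?thesis using True by simp
      qed simp
    qed simp
    also have "\<dots> = ennreal (64 / (pi * s\<^sup>2)) * (ennreal (C * (2 * s)\<^sup>2) * mass v S)"
      by (simp add: nn_integral_cmult mult.assoc)
    also have "\<dots> = ennreal (64 / (pi * s\<^sup>2) * (C * (2 * s)\<^sup>2)) * mass v S"
      by (rule ennreal_mult_assoc) simp
    also have "64 / (pi * s\<^sup>2) * (C * (2 * s)\<^sup>2) = 256 * C / pi" using s by (simp add: field_simps power2_eq_square)
    also have "ennreal (256 * C / pi) * mass v S \<le> ennreal (1 + 256 * C / pi) * mass v S"
      by (intro mult_right_mono ennreal_leI) auto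
    finally show "(\<integral>\<^sup>+z\<in>ball a r \<inter> {z. bdist z < s}. ennreal (v z) \<partial>lborel)
      \<le> ennreal (1 + 256 * C / pi) * (\<integral>\<^sup>+z\<in>ball a (r + 2 * s) \<inter> {z. s \<le> bdist z \<and> bdist z < 2 * s}. ennreal (v z) \<partial>lborel)"
      unfolding S_def Z_def .
  qed (use C(1) in simp)
qed

section \<open>Self-improvement, and the kernel condition\<close>

lemma cnj_borel [measurable]: "cnj \<in> borel_measurable borel"
  by (intro borel_measurable_continuous_onI continuous_intros)

text \<open>Disk control holds with a singular factor \<open>bdist z powr (- \<epsilon>)\<close> for some \<open>\<epsilon> > 0\<close>. If \<open>m k\<close> is the mass
  at depth below \<open>h / 2 ^ k\<close> near \<open>a\<close>, the preceding lemma gives \<open>m (Suc k) \<le> Cs * (m k - m (Suc k))\<close>,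
  hence geometric decay with ratio \<open>\<theta> = Cs / (1 + Cs)\<close>, which beats \<open>2 powr \<epsilon>\<close> for small \<open>\<epsilon>\<close>.\<close>

lemma ball_carleson_improve:
  assumes v: "regular A v" "ball_carleson v"
  obtains \<epsilon> C where "0 < \<epsilon>" "0 \<le> C" "\<And>a. a \<in> unit_disk \<Longrightarrow>
    (\<integral>\<^sup>+z\<in>ball a (3 * bdist a). ennreal (bdist z powr (- \<epsilon>) * v z) \<partial>lborel) \<le> ennreal (C * bdist a powr (2 - \<epsilon>) * v a)"
proof -
  have [measurable]: "v \<in> borel_measurable borel" using regularD(2)[OF v(1)] .
  obtain Cs where Cs: "1 \<le> Cs" and shell: "\<And>a r s. 0 < s \<Longrightarrow> s \<le> 1 / 2 \<Longrightarrow>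
    (\<integral>\<^sup>+z\<in>ball a r \<inter> {z. bdist z < s}. ennreal (v z) \<partial>lborel)
      \<le> ennreal Cs * (\<integral>\<^sup>+z\<in>ball a (r + 2 * s) \<inter> {z. s \<le> bdist z \<and> bdist z < 2 * s}. ennreal (v z) \<partial>lborel)"
    by (rule ball_carleson_shell[OF v]) (rule that; blast)
  obtain \<kappa> Cg where \<kappa>: "0 \<le> \<kappa>" and Cg: "1 \<le> Cg" and growth: "\<And>z R. z \<in> unit_disk \<Longrightarrow> bdist z \<le> R \<Longrightarrow>
      mass v (ball z R) \<le> ennreal (Cg * (R / bdist z) powr \<kappa> * R\<^sup>2 * v z)"
    using ball_carleson_growth[OF v] by metis
  define \<theta> where "\<theta> = Cs / (1 + Cs)"
  have \<theta>: "0 < \<theta>" "\<theta> < 1" using Cs by (auto simp: \<theta>_def)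
  \<comment> \<open>so that \<open>2 powr \<epsilon> * \<theta> = sqrt \<theta> < 1\<close>\<close>
  define \<epsilon> where "\<epsilon> = - log 2 \<theta> / 2"
  have \<epsilon>: "0 < \<epsilon>" using \<theta> by (simp add: \<epsilon>_def)
  have \<epsilon>\<theta>: "2 powr \<epsilon> * \<theta> = sqrt \<theta>"
  proof -
    have "\<theta> = 2 powr (log 2 \<theta>)" using \<theta> by simp
    then have "2 powr \<epsilon> * \<theta> = 2 powr \<epsilon> * 2 powr (log 2 \<theta>)" by simp
    also have "\<dots> = 2 powr (log 2 \<theta> * (1 / 2))" unfolding powr_add[symmetric] \<epsilon>_def by simp
    also have "\<dots> = \<theta> powr (1 / 2)" using \<theta> by (subst powr_powr[symmetric]) simp
    finally show ?thesis using \<theta> by (simp add: powr_half_sqrt)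
  qed
  define D where "D = Cg * 7 powr \<kappa> * 49"
  have D: "0 \<le> D" using Cg by (simp add: D_def)
  define E where "E = D * (1 + 2 powr \<epsilon> / (1 - sqrt \<theta>))"
  have sq: "sqrt \<theta> < 1" "0 < sqrt \<theta>" using \<theta> by auto
  have E: "0 \<le> E" using D sq by (simp add: E_def)
  show ?thesis
  proof (rule that[OF \<epsilon> E])
    fix a :: complex assume a: "a \<in> unit_disk"
    define h where "h = bdist a"
    have h: "0 < h" "h \<le> 1" using a by (auto simp: h_def)
    define t where "t k = h / 2 ^ k" for k :: nat
    have t: "0 < t k" "t (Suc k) = t k / 2" "t k \<le> h" for k
      using h by (auto simp: t_def field_simps)
    \<comment> \<open>the radii shrink with \<open>k\<close> to make up for the loss of radius in \<open>ball_carleson_shell\<close>\<close>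
    define F where "F k = ball a (3 * h + 4 * t k) \<inter> {z. bdist z < t k}" for k
    define m where "m k = mass v (F k)" for k
    have [measurable]: "F k \<in> sets borel" for k unfolding F_def by measurable
    have va: "0 \<le> v a" using regularD(4)[OF v(1)] .
    have m0: "mass v (ball a (7 * h)) \<le> ennreal (D * h\<^sup>2 * v a)"
    proof -
      have "mass v (ball a (7 * h)) \<le> ennreal (Cg * (7 * h / h) powr \<kappa> * (7 * h)\<^sup>2 * v a)"
        using growth[OF a, of "7 * h", folded h_def] h by simp
      also have "Cg * (7 * h / h) powr \<kappa> * (7 * h)\<^sup>2 * v a = D * h\<^sup>2 * v a"
        using h by (simp add: D_def power_mult_distrib)
      finally show ?thesis .
    qed
    have step: "m (Suc k) \<le> ennreal \<theta> * m k" for k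
    proof -
      define S where "S = ball a (3 * h + 4 * t (Suc k) + 2 * t (Suc k)) \<inter> {z. t (Suc k) \<le> bdist z \<and> bdist z < 2 * t (Suc k)}"
      have [measurable]: "S \<in> sets borel" unfolding S_def by measurable
      define mS where "mS = mass v S"
      have 1: "m (Suc k) \<le> ennreal Cs * mS"
        unfolding m_def mS_def S_def F_def using h t[of k] t(1)[of "Suc k"] by (intro shell) auto
      have "mS + m (Suc k) = (\<integral>\<^sup>+z. ennreal (v z) * indicator S z + ennreal (v z) * indicator (F (Suc k)) z \<partial>lborel)"
        unfolding m_def mS_def by (intro nn_integral_add[symmetric]) measurable
      also have "\<dots> \<le> m k"
        unfolding m_def
      proof (intro nn_integral_mono)
        fix z
        show "ennreal (v z) * indicator S z + ennreal (v z) * indicator (F (Suc k)) z \<le> ennreal (v z) * indicator (F k) z"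
          using t[of k] by (auto simp: S_def F_def indicator_def)
      qed
      finally have 2: "mS + m (Suc k) \<le> m k" .
      have "ennreal (1 + Cs) * m (Suc k) = m (Suc k) + ennreal Cs * m (Suc k)"
        using Cs by (simp add: ennreal_plus distrib_right)
      also have "\<dots> \<le> ennreal Cs * mS + ennreal Cs * m (Suc k)" using 1 by (intro add_mono) auto
      also have "\<dots> \<le> ennreal Cs * m k" unfolding distrib_left[symmetric] using 2 by (intro mult_left_mono) auto
      finally have "ennreal (1 / (1 + Cs)) * (ennreal (1 + Cs) * m (Suc k)) \<le> ennreal (1 / (1 + Cs)) * (ennreal Cs * m k)"
        by (intro mult_left_mono) auto
      then show ?thesis using Cs by (simp add: ennreal_mult_assoc \<theta>_def del: ennreal_plus)
    qed
    have mk: "m k \<le> ennreal (\<theta> ^ k * (D * h\<^sup>2 * v a))" for k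
    proof (induction k)
      case 0
      have "m 0 \<le> mass v (ball a (7 * h))"
        unfolding m_def by (intro nn_set_integral_set_mono) (auto simp: F_def t_def)
      then show ?case using m0 by simp
    next
      case (Suc k)
      have "m (Suc k) \<le> ennreal \<theta> * ennreal (\<theta> ^ k * (D * h\<^sup>2 * v a))"
        using step[of k] Suc by (meson mult_left_mono order_trans zero_le)
      then show ?case using \<theta> by (simp add: ennreal_mult'[symmetric] mult.assoc)
    qed
    have pw: "ennreal (bdist z powr (- \<epsilon>) * v z) * indicator (ball a (3 * bdist a)) z
      \<le> ennreal (h powr (- \<epsilon>)) * (ennreal (v z) * indicator (ball a (7 * h)) z)
        + (\<Sum>k. ennreal (t (Suc k) powr (- \<epsilon>)) * (ennreal (v z) * indicator (F k) z))" (is "?L \<le> ?R1 + suminf ?f") for z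
    proof (cases "z \<in> unit_disk \<and> z \<in> ball a (3 * h)")
      case True
      then have z: "0 < bdist z" "z \<in> ball a (3 * h)" by auto
      have vz: "0 \<le> v z" using regularD(4)[OF v(1)] .
      show ?thesis
      proof (cases "h \<le> bdist z")
        case True
        then have "bdist z powr (- \<epsilon>) \<le> h powr (- \<epsilon>)"
          using h \<epsilon> by (intro powr_mono2') auto
        then have "?L \<le> ?R1"
          using z vz h by (auto simp: h_def[symmetric] indicator_def ennreal_mult'[symmetric] intro!: ennreal_leI mult_right_mono)
        then show ?thesis by (rule add_increasing2[OF zero_le])
      next
        case False
        have ex: "\<exists>k. t (Suc k) \<le> bdist z"
        proof -
          obtain k :: nat where "h / bdist z < 2 ^ k" using real_arch_pow[of 2] by auto
          then have "t k < bdist z" using z by (simp add: t_def field_simps)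
          then have "t (Suc k) \<le> bdist z" using t[of k] by linarith
          then show ?thesis ..
        qed
        define k where "k = (LEAST k. t (Suc k) \<le> bdist z)"
        have k: "t (Suc k) \<le> bdist z" unfolding k_def using ex by (rule LeastI_ex)
        have "bdist z < t k"
        proof (cases k)
          case 0
          then show ?thesis using False by (simp add: t_def)
        next
          case (Suc j)
          then have "\<not> t (Suc j) \<le> bdist z" unfolding k_def using not_less_Least by (metis lessI)
          then show ?thesis using Suc by simp
        qed
        then have "z \<in> F k" using z t(1)[of k] by (auto simp: F_def)
        moreover have "bdist z powr (- \<epsilon>) \<le> t (Suc k) powr (- \<epsilon>)"
          using k \<epsilon> t(1) by (intro powr_mono2') auto
        ultimately have "?L \<le> ?f k"
          using vz z by (auto simp: h_def[symmetric] indicator_def ennreal_mult'[symmetric] intro!: ennreal_leI mult_right_mono)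
        also have "\<dots> \<le> suminf ?f" by (rule term_le_suminf)
        finally show ?thesis by (rule add_increasing[OF zero_le])
      qed
    next
      case False
      then have "?L = 0" using regularD(3)[OF v(1), of z] by (cases "z \<in> unit_disk") (auto simp: h_def)
      then show ?thesis by (simp only: zero_le)
    qed
    have "(\<integral>\<^sup>+z\<in>ball a (3 * bdist a). ennreal (bdist z powr (- \<epsilon>) * v z) \<partial>lborel)
      \<le> (\<integral>\<^sup>+z. ennreal (h powr (- \<epsilon>)) * (ennreal (v z) * indicator (ball a (7 * h)) z)
        + (\<Sum>k. ennreal (t (Suc k) powr (- \<epsilon>)) * (ennreal (v z) * indicator (F k) z)) \<partial>lborel)"
      by (intro nn_integral_mono pw)
    also have "\<dots> = ennreal (h powr (- \<epsilon>)) * mass v (ball a (7 * h))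
        + (\<Sum>k. ennreal (t (Suc k) powr (- \<epsilon>)) * m k)"
      by (subst nn_integral_add, measurable, subst nn_integral_suminf, measurable)
         (simp add: nn_integral_cmult m_def)
    also have "\<dots> \<le> ennreal (h powr (- \<epsilon>)) * ennreal (D * h\<^sup>2 * v a)
        + (\<Sum>k. ennreal (2 powr \<epsilon> * h powr (- \<epsilon>) * (D * h\<^sup>2 * v a) * sqrt \<theta> ^ k))"
    proof (intro add_mono mult_left_mono m0 suminf_le summableI)
      fix k
      have "ennreal (t (Suc k) powr (- \<epsilon>)) * m k \<le> ennreal (t (Suc k) powr (- \<epsilon>)) * ennreal (\<theta> ^ k * (D * h\<^sup>2 * v a))"
        by (intro mult_left_mono mk) auto
      also have "\<dots> = ennreal (t (Suc k) powr (- \<epsilon>) * (\<theta> ^ k * (D * h\<^sup>2 * v a)))"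
        by (simp add: ennreal_mult'[symmetric])
      also have "t (Suc k) powr (- \<epsilon>) * (\<theta> ^ k * (D * h\<^sup>2 * v a))
         = 2 powr \<epsilon> * h powr (- \<epsilon>) * (D * h\<^sup>2 * v a) * (2 powr \<epsilon> * \<theta>) ^ k"
      proof -
        have "2 powr (- real (Suc k)) = inverse (2 ^ Suc k)"
          unfolding powr_minus by (subst powr_realpow) auto
        then have "t (Suc k) = h * 2 powr (- real (Suc k))" unfolding t_def by (simp only: divide_inverse)
        then have "t (Suc k) powr (- \<epsilon>) = h powr (- \<epsilon>) * (2 powr (- real (Suc k))) powr (- \<epsilon>)"
          by (simp only: powr_mult)
        also have "(2 powr (- real (Suc k))) powr (- \<epsilon>) = (2 powr \<epsilon>) powr real (Suc k)"
          unfolding powr_powr by (simp add: mult.commute del: of_nat_Suc)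
        also have "\<dots> = (2 powr \<epsilon>) ^ Suc k"
          by (rule powr_realpow) simp
        finally show ?thesis by (simp add: power_mult_distrib)
      qed
      finally show "ennreal (t (Suc k) powr (- \<epsilon>)) * m k \<le> ennreal (2 powr \<epsilon> * h powr (- \<epsilon>) * (D * h\<^sup>2 * v a) * sqrt \<theta> ^ k)"
        unfolding \<epsilon>\<theta> .
    qed auto
    also have "(\<Sum>k. ennreal (2 powr \<epsilon> * h powr (- \<epsilon>) * (D * h\<^sup>2 * v a) * sqrt \<theta> ^ k))
       = ennreal (2 powr \<epsilon> * h powr (- \<epsilon>) * (D * h\<^sup>2 * v a) * (1 / (1 - sqrt \<theta>)))"
    proof (rule suminf_ennreal_eq)
      show "(\<lambda>k. 2 powr \<epsilon> * h powr (- \<epsilon>) * (D * h\<^sup>2 * v a) * sqrt \<theta> ^ k) sums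
        (2 powr \<epsilon> * h powr (- \<epsilon>) * (D * h\<^sup>2 * v a) * (1 / (1 - sqrt \<theta>)))"
        using sq by (intro sums_mult geometric_sums) auto
    qed (use D va \<theta> in auto)
    also have "ennreal (h powr (- \<epsilon>)) * ennreal (D * h\<^sup>2 * v a) + \<dots>
      = ennreal (h powr (- \<epsilon>) * (D * h\<^sup>2 * v a) + 2 powr \<epsilon> * h powr (- \<epsilon>) * (D * h\<^sup>2 * v a) * (1 / (1 - sqrt \<theta>)))"
      using D va sq by (simp add: ennreal_mult'[symmetric] ennreal_plus[symmetric] del: ennreal_plus)
    also have "h powr (- \<epsilon>) * (D * h\<^sup>2 * v a) + 2 powr \<epsilon> * h powr (- \<epsilon>) * (D * h\<^sup>2 * v a) * (1 / (1 - sqrt \<theta>))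
      = E * (h powr (- \<epsilon>) * h powr 2) * v a" using h by (simp add: E_def algebra_simps)
    also have "h powr (- \<epsilon>) * h powr 2 = h powr (2 - \<epsilon>)" by (simp add: powr_add[symmetric])
    finally show "(\<integral>\<^sup>+z\<in>ball a (3 * bdist a). ennreal (bdist z powr (- \<epsilon>) * v z) \<partial>lborel) \<le> ennreal (E * bdist a powr (2 - \<epsilon>) * v a)"
      unfolding h_def .
  qed
qed

lemma one_minus_sq_bounds:
  assumes "z \<in> unit_disk"
  shows "bdist z \<le> 1 - (cmod z)\<^sup>2" "1 - (cmod z)\<^sup>2 \<le> 2 * bdist z" "0 < bdist z"
proof -
  have n: "0 \<le> cmod z" "cmod z < 1" using assms by auto
  have eq: "1 - (cmod z)\<^sup>2 = bdist z * (1 + cmod z)" by (simp add: power2_eq_square algebra_simps)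
  show "0 < bdist z" using n by simp
  show "bdist z \<le> 1 - (cmod z)\<^sup>2" unfolding eq using n by (simp add: mult_le_cancel_left1)
  show "1 - (cmod z)\<^sup>2 \<le> 2 * bdist z" unfolding eq using n by (subst mult.commute) (intro mult_right_mono; simp)
qed

text \<open>With \<open>\<kappa>\<close> the growth exponent, the mass on the disk of radius \<open>R\<close> is at most of order \<open>R powr (\<kappa> + 2)\<close>, so
  \<open>\<gamma> = \<kappa> + 1\<close> makes the kernel integrable.\<close>

lemma ball_carleson_imp_kernel:
  assumes v: "regular A v" "ball_carleson v"
  shows "\<exists>\<gamma>>0. \<exists>C>0. \<forall>z\<in>unit_disk.
    (\<integral>\<^sup>+\<xi>\<in>unit_disk. ennreal (v \<xi> / cmod (1 - cnj \<xi> * z) powr (\<gamma> + 2)) \<partial>lborel)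
      \<le> ennreal (C * (v z / (1 - (cmod z)\<^sup>2) powr \<gamma>))"
proof -
  obtain \<kappa> Cg where \<kappa>: "0 \<le> \<kappa>" and Cg: "1 \<le> Cg" and growth: "\<And>z R. z \<in> unit_disk \<Longrightarrow> bdist z \<le> R \<Longrightarrow>
      mass v (ball z R) \<le> ennreal (Cg * (R / bdist z) powr \<kappa> * R\<^sup>2 * v z)"
    using ball_carleson_growth[OF v] by metis
  have [measurable]: "v \<in> borel_measurable borel" using regularD(2)[OF v(1)] .
  define \<gamma> where "\<gamma> = \<kappa> + 1"
  define C where "C = 2 powr (\<kappa> + 4) * Cg * 2 powr \<gamma>"
  have "(\<integral>\<^sup>+\<xi>\<in>unit_disk. ennreal (v \<xi> / cmod (1 - cnj \<xi> * z) powr (\<gamma> + 2)) \<partial>lborel)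
      \<le> ennreal (C * (v z / (1 - (cmod z)\<^sup>2) powr \<gamma>))" if z: "z \<in> unit_disk" for z
  proof -
    define h where "h = bdist z"
    have h: "0 < h" using z by (simp add: h_def)
    have vz: "0 \<le> v z" using regularD(4)[OF v(1)] .
    have "(\<integral>\<^sup>+\<xi>\<in>unit_disk. ennreal (v \<xi> / cmod (1 - cnj \<xi> * z) powr (\<gamma> + 2)) \<partial>lborel)
      = (\<integral>\<^sup>+\<xi>\<in>unit_disk. ennreal (v \<xi>) * ennreal (inverse (cmod (1 - cnj \<xi> * z) powr ((\<kappa> + 2) + 1))) \<partial>lborel)"
      by (simp add: \<gamma>_def ennreal_mult''[symmetric] divide_inverse add_ac)
    also have "\<dots> \<le> ennreal (2 powr ((\<kappa> + 2) + 2) * (Cg * h\<^sup>2 * v z) / bdist z powr ((\<kappa> + 2) + 1))"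
    proof (rule kernel_integral_le[OF _ z])
      fix R assume R: "bdist z \<le> R"
      have "mass v (unit_disk \<inter> ball z R) \<le> mass v (ball z R)"
        by (intro nn_set_integral_set_mono) auto
      also have "\<dots> \<le> ennreal (Cg * (R / bdist z) powr \<kappa> * R\<^sup>2 * v z)" by (rule growth[OF z R])
      also have "Cg * (R / bdist z) powr \<kappa> * R\<^sup>2 * v z = Cg * h\<^sup>2 * v z * (R / bdist z) powr (\<kappa> + 2)"
        using h R by (simp add: powr_add h_def[symmetric] power_divide)
      finally show "mass v (unit_disk \<inter> ball z R) \<le> ennreal (Cg * h\<^sup>2 * v z * (R / bdist z) powr (\<kappa> + 2))" .
    qed (use \<kappa> Cg vz in auto)
    also have "2 powr ((\<kappa> + 2) + 2) * (Cg * h\<^sup>2 * v z) / bdist z powr ((\<kappa> + 2) + 1) = 2 powr (\<kappa> + 4) * Cg * v z * (1 / h powr \<gamma>)"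
      using h by (simp add: h_def[symmetric] \<gamma>_def powr_add field_simps power2_eq_square power3_eq_cube)
    also have "\<dots> \<le> 2 powr (\<kappa> + 4) * Cg * v z * (2 powr \<gamma> / (1 - (cmod z)\<^sup>2) powr \<gamma>)"
    proof (intro mult_left_mono)
      have p: "0 < 1 - (cmod z)\<^sup>2" using one_minus_sq_bounds[OF z] by linarith
      have "(1 - (cmod z)\<^sup>2) powr \<gamma> \<le> (2 * h) powr \<gamma>"
        using one_minus_sq_bounds[OF z] \<kappa> by (intro powr_mono2) (auto simp: h_def \<gamma>_def)
      also have "\<dots> = 2 powr \<gamma> * h powr \<gamma>" using h by (simp add: powr_mult)
      finally show "1 / h powr \<gamma> \<le> 2 powr \<gamma> / (1 - (cmod z)\<^sup>2) powr \<gamma>"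
        using h p by (simp add: divide_simps mult.commute)
    qed (use Cg vz in auto)
    also have "\<dots> = C * (v z / (1 - (cmod z)\<^sup>2) powr \<gamma>)" by (simp add: C_def)
    finally show ?thesis by (simp add: ennreal_leI)
  qed
  moreover have "0 < \<gamma>" "0 < C" using \<kappa> Cg by (auto simp: \<gamma>_def C_def)
  ultimately show ?thesis by blast
qed

lemma kernel_imp_ball_carleson:
  assumes v: "regular A v" and \<gamma>: "0 < \<gamma>" and C: "0 < C"
    and K: "\<And>z. z \<in> unit_disk \<Longrightarrow> (\<integral>\<^sup>+\<xi>\<in>unit_disk. ennreal (v \<xi> / cmod (1 - cnj \<xi> * z) powr (\<gamma> + 2)) \<partial>lborel)
      \<le> ennreal (C * (v z / (1 - (cmod z)\<^sup>2) powr \<gamma>))"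
  shows "ball_carleson v"
  unfolding ball_carleson_def
proof (intro exI conjI ballI)
  have [measurable]: "v \<in> borel_measurable borel" using regularD(2)[OF v(1)] .
  show "0 \<le> 5 powr (\<gamma> + 2) * C" using C by simp
  fix z :: complex assume z: "z \<in> unit_disk"
  define h where "h = bdist z"
  have h: "0 < h" using z by (simp add: h_def)
  have v0: "0 \<le> v \<xi>" for \<xi> using regularD(4)[OF v(1)] .
  have "mass v (ball z (3 * bdist z)) \<le>
    (\<integral>\<^sup>+\<xi>. ennreal ((5 * h) powr (\<gamma> + 2)) * (ennreal (v \<xi> / cmod (1 - cnj \<xi> * z) powr (\<gamma> + 2)) * indicator unit_disk \<xi>) \<partial>lborel)"
  proof (intro nn_integral_mono)
    fix \<xi>
    show "ennreal (v \<xi>) * indicator (ball z (3 * bdist z)) \<xi> \<le>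
      ennreal ((5 * h) powr (\<gamma> + 2)) * (ennreal (v \<xi> / cmod (1 - cnj \<xi> * z) powr (\<gamma> + 2)) * indicator unit_disk \<xi>)"
    proof (cases "\<xi> \<in> unit_disk \<and> \<xi> \<in> ball z (3 * h)")
      case True
      then have \<xi>: "\<xi> \<in> unit_disk" "\<xi> \<in> ball z (3 * h)" by auto
      note k = kernel_bounds[OF z \<xi>(1)]
      define N where "N = cmod (1 - cnj \<xi> * z)"
      have N: "0 < N" "N \<le> 5 * h" using k h \<xi> by (auto simp: N_def h_def[symmetric])
      have "N powr (\<gamma> + 2) \<le> (5 * h) powr (\<gamma> + 2)" using N \<gamma> by (intro powr_mono2) auto
      then have "v \<xi> * N powr (\<gamma> + 2) \<le> v \<xi> * (5 * h) powr (\<gamma> + 2)" using v0 by (intro mult_left_mono)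
      then have "v \<xi> \<le> (5 * h) powr (\<gamma> + 2) * (v \<xi> / N powr (\<gamma> + 2))"
        using N by (simp add: field_simps)
      then show ?thesis using \<xi> by (simp add: ennreal_mult'[symmetric] N_def[symmetric] ennreal_leI h_def[symmetric])
    next
      case False
      then show ?thesis using regularD(3)[OF v(1), of \<xi>] by (cases "\<xi> \<in> unit_disk") (auto simp: h_def)
    qed
  qed
  also have "\<dots> = ennreal ((5 * h) powr (\<gamma> + 2)) * (\<integral>\<^sup>+\<xi>\<in>unit_disk. ennreal (v \<xi> / cmod (1 - cnj \<xi> * z) powr (\<gamma> + 2)) \<partial>lborel)"
    by (rule nn_integral_cmult) measurable
  also have "\<dots> \<le> ennreal ((5 * h) powr (\<gamma> + 2)) * ennreal (C * (v z / (1 - (cmod z)\<^sup>2) powr \<gamma>))"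
    by (intro mult_left_mono K z) auto
  also have "\<dots> \<le> ennreal ((5 * h) powr (\<gamma> + 2)) * ennreal (C * (v z / h powr \<gamma>))"
    using one_minus_sq_bounds[OF z] \<gamma> C v0 h
    by (intro mult_left_mono ennreal_leI divide_left_mono powr_mono2) (auto simp: h_def)
  also have "\<dots> = ennreal ((5 * h) powr (\<gamma> + 2) * (C * (v z / h powr \<gamma>)))"
    by (subst ennreal_mult') auto
  also have "(5 * h) powr (\<gamma> + 2) * (C * (v z / h powr \<gamma>)) = 5 powr (\<gamma> + 2) * C * (bdist z)\<^sup>2 * v z"
    using h by (simp add: powr_mult powr_add h_def[symmetric])
  finally show "mass v (ball z (3 * bdist z)) \<le> ennreal (5 powr (\<gamma> + 2) * C * (bdist z)\<^sup>2 * v z)" .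
qed

section \<open>Mean value inequalities for holomorphic functions\<close>

lemma nn_integral_translate:
  fixes f :: "complex \<Rightarrow> ennreal"
  assumes [measurable]: "f \<in> borel_measurable borel"
  shows "(\<integral>\<^sup>+x. f (c + x) \<partial>lborel) = (\<integral>\<^sup>+x. f x \<partial>lborel)"
  by (subst (2) lborel_distr_plus[of c, symmetric]) (simp add: nn_integral_distr)

lemma nn_integral_reflect:
  fixes f :: "complex \<Rightarrow> ennreal"
  assumes [measurable]: "f \<in> borel_measurable borel"
  shows "(\<integral>\<^sup>+x. f (- x) \<partial>lborel) = (\<integral>\<^sup>+x. f x \<partial>lborel)"
proof -
  have "(lborel :: complex measure) = distr lborel borel uminus"
    using lborel_affine[of "-1" "0::complex"] by (simp add: density_1 fun_eq_iff cong: distr_cong)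
  then have "(\<integral>\<^sup>+x. f x \<partial>lborel) = (\<integral>\<^sup>+x. f x \<partial>distr lborel borel uminus)" by simp
  also have "\<dots> = (\<integral>\<^sup>+x. f (- x) \<partial>lborel)" by (rule nn_integral_distr) auto
  finally show ?thesis by simp
qed

text \<open>Lebesgue measure on the plane is invariant under rotations. The image measure \<open>M\<close> is translation
  invariant and agrees with Lebesgue measure on the unit disk \<open>B\<close>; the usual uniqueness argument for Haar
  measures, applied to the double integral of \<open>indicator A x * indicator B (x + y)\<close>, shows that the two
  measures are equal.\<close>

lemma lborel_distr_rotation:
  fixes u :: complex
  assumes u: "cmod u = 1"
  shows "distr lborel borel (\<lambda>z. u * z) = lborel"
proof -
  define M where "M = distr lborel borel (\<lambda>z. u * z)"
  have [simp]: "sets M = sets borel" "space M = UNIV" by (simp_all add: M_def)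
  have [measurable_cong]: "sets M = sets borel" by simp
  have u0: "u \<noteq> 0" using u by auto
  have Mint: "(\<integral>\<^sup>+x. f x \<partial>M) = (\<integral>\<^sup>+x. f (u * x) \<partial>lborel)" if [measurable]: "f \<in> borel_measurable borel" for f :: "complex \<Rightarrow> ennreal"
    unfolding M_def by (rule nn_integral_distr) measurable
  have Mtrans: "(\<integral>\<^sup>+x. f (c + x) \<partial>M) = (\<integral>\<^sup>+x. f x \<partial>M)" if [measurable]: "f \<in> borel_measurable borel" for f :: "complex \<Rightarrow> ennreal" and c
  proof -
    have "(\<integral>\<^sup>+x. f (c + x) \<partial>M) = (\<integral>\<^sup>+x. f (c + u * x) \<partial>lborel)" by (rule Mint) measurable
    also have "\<dots> = (\<integral>\<^sup>+x. f (u * (c / u + x)) \<partial>lborel)" using u0 by (simp add: distrib_left)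
    also have "\<dots> = (\<integral>\<^sup>+x. f (u * x) \<partial>lborel)" by (rule nn_integral_translate[of "\<lambda>x. f (u * x)"]) measurable
    also have "\<dots> = (\<integral>\<^sup>+x. f x \<partial>M)" by (rule Mint[symmetric]) measurable
    finally show ?thesis .
  qed
  have Mball: "emeasure M (ball 0 r) = emeasure lborel (ball (0::complex) r)" for r
  proof -
    have "(\<lambda>z. u * z) -` ball 0 r = ball 0 r" using u by (auto simp: norm_mult)
    then show ?thesis unfolding M_def by (subst emeasure_distr) auto
  qed
  interpret M: sigma_finite_measure M
  proof
    show "\<exists>A. countable A \<and> A \<subseteq> sets M \<and> \<Union>A = space M \<and> (\<forall>a\<in>A. emeasure M a \<noteq> \<infinity>)"
    proof (intro exI[of _ "range (\<lambda>n::nat. ball 0 (real n))"] conjI)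
      show "\<Union>(range (\<lambda>n::nat. ball 0 (real n))) = space M" by (auto intro: reals_Archimedean2)
      show "\<forall>a\<in>range (\<lambda>n::nat. ball 0 (real n)). emeasure M a \<noteq> \<infinity>" unfolding Mball by (auto simp: Mball emeasure_ball_complex)
    qed auto
  qed
  interpret P: pair_sigma_finite M lborel ..
  define B where "B = ball (0::complex) 1"
  have [measurable]: "B \<in> sets borel" by (simp add: B_def)
  have Bval: "emeasure M B = ennreal pi" "emeasure lborel B = ennreal pi"
    unfolding B_def Mball using emeasure_ball_complex[of 1 0] by simp_all
  show ?thesis
    unfolding M_def[symmetric]
  proof (rule measure_eqI)
    fix A assume "A \<in> sets M"
    then have [measurable]: "A \<in> sets borel" by simp
    have trans: "(\<integral>\<^sup>+y. indicator B (x + y) \<partial>lborel) = emeasure lborel B" for x :: complex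
      using nn_integral_translate[of "indicator B" x] by simp
    have "emeasure M A * emeasure lborel B = (\<integral>\<^sup>+x. indicator A x * (\<integral>\<^sup>+y. indicator B (x + y) \<partial>lborel) \<partial>M)"
      unfolding trans by (simp add: nn_integral_multc)
    also have "\<dots> = (\<integral>\<^sup>+x. (\<integral>\<^sup>+y. indicator A x * indicator B (x + y) \<partial>lborel) \<partial>M)"
      by (intro nn_integral_cong nn_integral_cmult[symmetric]) measurable
    also have "\<dots> = (\<integral>\<^sup>+y. (\<integral>\<^sup>+x. indicator A x * indicator B (x + y) \<partial>M) \<partial>lborel)"
      by (rule P.Fubini'[symmetric]) measurable
    also have "\<dots> = (\<integral>\<^sup>+y. (\<integral>\<^sup>+x. indicator A (- y + x) * indicator B x \<partial>M) \<partial>lborel)"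
    proof (rule nn_integral_cong)
      fix y :: complex
      show "(\<integral>\<^sup>+x. indicator A x * indicator B (x + y) \<partial>M) = (\<integral>\<^sup>+x. indicator A (- y + x) * indicator B x \<partial>M)"
        using Mtrans[of "\<lambda>x. indicator A x * indicator B (x + y)" "- y"] by simp
    qed
    also have "\<dots> = (\<integral>\<^sup>+x. (\<integral>\<^sup>+y. indicator A (- y + x) * indicator B x \<partial>lborel) \<partial>M)"
      by (rule P.Fubini') measurable
    also have "\<dots> = (\<integral>\<^sup>+x. emeasure lborel A * indicator B x \<partial>M)"
    proof (intro nn_integral_cong)
      fix x :: complex
      have "(\<integral>\<^sup>+y. indicator A (- y + x) * indicator B x \<partial>lborel) = (\<integral>\<^sup>+y. indicator A (- y + x) \<partial>lborel) * (indicator B x :: ennreal)"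
        by (intro nn_integral_multc) measurable
      also have "(\<integral>\<^sup>+y. indicator A (- y + x) \<partial>lborel) = (\<integral>\<^sup>+y. indicator A (y + x) \<partial>lborel)"
        by (rule nn_integral_reflect[of "\<lambda>y. indicator A (y + x)"]) measurable
      also have "\<dots> = emeasure lborel A"
        using nn_integral_translate[of "indicator A" x] by (simp add: add.commute)
      finally show "(\<integral>\<^sup>+y. indicator A (- y + x) * indicator B x \<partial>lborel) = emeasure lborel A * (indicator B x :: ennreal)" .
    qed
    also have "\<dots> = emeasure lborel A * emeasure M B"
      by (rule nn_integral_cmult_indicator) simp
    finally have "emeasure M A * ennreal pi = emeasure lborel A * ennreal pi" unfolding Bval .
    then show "emeasure M A = emeasure lborel A"
      using ennreal_mult_cancel_left[of "ennreal pi" "emeasure M A" "emeasure lborel A"] pi_gt_zero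
      by (simp add: mult.commute del: pi_gt_zero)
  qed simp
qed

lemma circle_mean_le:
  fixes f :: "complex \<Rightarrow> complex" and z :: complex and r R :: real
  assumes f: "f holomorphic_on ball z R" and r: "0 \<le> r" "r < R"
  shows "ennreal (cmod (f z)) \<le> (\<integral>\<^sup>+t\<in>{0..1}. ennreal (cmod (f (z + r * exp (2 * of_real pi * \<i> * of_real t)))) \<partial>lborel)"
proof -
  define g where "g t = f (z + r * exp (2 * of_real pi * \<i> * of_real t))" for t :: real
  have sub: "cball z r \<subseteq> ball z R" using r by auto
  have cont: "continuous_on {0..1} g"
  proof -
    have "continuous_on (ball z R) f" using f by (rule holomorphic_on_imp_continuous_on)
    moreover have "(\<lambda>t::real. z + r * exp (2 * of_real pi * \<i> * of_real t)) ` {0..1} \<subseteq> ball z R"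
      using r by (auto simp: dist_norm norm_mult)
    moreover have "continuous_on {0..1} (\<lambda>t::real. z + r * exp (2 * of_real pi * \<i> * of_real t))"
      by (intro continuous_intros)
    ultimately show ?thesis unfolding g_def
      using continuous_on_compose2 by blast
  qed
  have "(g has_integral f z) {0..1}"
  proof (cases "r = 0")
    case True
    then show ?thesis unfolding g_def using has_integral_const_real[of "f z" 0 1] by simp
  next
    case False
    with r have r0: "0 < r" by simp
    have "((\<lambda>u. f u / (u - z)) has_contour_integral (2 * of_real pi * \<i> * f z)) (circlepath z r)"
      using r0 sub f by (intro Cauchy_integral_circlepath_simple holomorphic_on_subset[OF f]) auto
    then have "((\<lambda>x. f (circlepath z r x) / (circlepath z r x - z) * (2 * pi * \<i> * r * exp (2 * of_real pi * \<i> * x)))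
      has_integral (2 * of_real pi * \<i> * f z)) {0..1}"
      unfolding has_contour_integral vector_derivative_circlepath .
    moreover have "f (circlepath z r x) / (circlepath z r x - z) * (2 * pi * \<i> * r * exp (2 * of_real pi * \<i> * x))
      = 2 * of_real pi * \<i> * g x" for x
      using r0 by (simp add: circlepath g_def)
    ultimately have "((\<lambda>x. 2 * of_real pi * \<i> * g x) has_integral (2 * of_real pi * \<i> * f z)) {0..1}" by simp
    then have "((\<lambda>x. inverse (2 * of_real pi * \<i>) * (2 * of_real pi * \<i> * g x)) has_integral (inverse (2 * of_real pi * \<i>) * (2 * of_real pi * \<i> * f z))) {0..1}"
      by (rule has_integral_mult_right)
    moreover have "inverse c * (c * x) = x" if "c \<noteq> 0" for c x :: complex using that by simp
    from this[of "2 * of_real pi * \<i>"]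
    have "inverse (2 * of_real pi * \<i>) * (2 * of_real pi * \<i> * x) = x" for x by simp
    ultimately show ?thesis by (simp only:)
  qed
  then have fz: "f z = integral {0..1} g" by (simp add: integral_unique)
  have int: "(\<lambda>t. cmod (g t)) integrable_on {0..1}"
    by (intro integrable_continuous_real continuous_intros cont)
  have "cmod (f z) \<le> integral {0..1} (\<lambda>t. cmod (g t))"
    unfolding fz using cont int by (intro integral_norm_bound_integral integrable_continuous_real continuous_on_norm) auto
  then have "ennreal (cmod (f z)) \<le> ennreal (integral {0..1} (\<lambda>t. cmod (g t)))" by (rule ennreal_leI)
  also have "\<dots> = (\<integral>\<^sup>+t. ennreal (cmod (g t)) * indicator {0..1} t \<partial>lborel)"
    using int by (intro nn_integral_has_integral_lebesgue'[symmetric]) (auto simp: integrable_integral)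
  finally show ?thesis unfolding g_def .
qed

text \<open>The area integral is invariant under rotations about \<open>z\<close>, hence equal to its average over all
  rotations; by Tonelli the inner integral is then a mean over a circle. This avoids polar coordinates.\<close>

lemma area_mean_le:
  assumes f: "f holomorphic_on ball z r" and r: "0 < r"
  shows "ennreal (pi * r\<^sup>2) * ennreal (cmod (f z)) \<le> (\<integral>\<^sup>+\<xi>\<in>ball z r. ennreal (cmod (f \<xi>)) \<partial>lborel)"
proof -
  define F where "F \<zeta> = ennreal (cmod (f (z + \<zeta>))) * indicator (ball 0 r) \<zeta>" for \<zeta>
  have "(\<lambda>x. indicator (ball z r) x *\<^sub>R cmod (f x)) \<in> borel_measurable borel"
    using holomorphic_on_imp_continuous_on[OF f]
    by (intro borel_measurable_continuous_on_indicator continuous_on_norm) auto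
  then have [measurable]: "(\<lambda>x. cmod (f x) * indicator (ball z r) x) \<in> borel_measurable borel"
    by (simp add: mult.commute)
  have Feq: "F \<zeta> = ennreal (cmod (f (z + \<zeta>)) * indicator (ball z r) (z + \<zeta>))" for \<zeta>
    by (simp add: F_def indicator_def dist_norm)
  have [measurable]: "F \<in> borel_measurable borel" unfolding Feq[abs_def] by measurable
  define e where "e t = exp (2 * of_real pi * \<i> * of_real t)" for t :: real
  have [measurable]: "e \<in> borel_measurable borel"
    unfolding e_def by (intro borel_measurable_continuous_onI continuous_intros)
  have ne: "cmod (e t) = 1" for t by (simp add: e_def norm_exp_eq_Re)
  have "ennreal (pi * r\<^sup>2) * ennreal (cmod (f z)) = (\<integral>\<^sup>+\<zeta>\<in>ball (0::complex) r. ennreal (cmod (f z)) \<partial>lborel)"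
    using r by (subst nn_integral_const_ball) (auto simp: ennreal_mult' mult.commute)
  also have "\<dots> \<le> (\<integral>\<^sup>+\<zeta>. (\<integral>\<^sup>+t. F (e t * \<zeta>) * indicator {0..1} t \<partial>lborel) \<partial>lborel)"
  proof (intro nn_integral_mono)
    fix \<zeta> :: complex
    show "ennreal (cmod (f z)) * indicator (ball 0 r) \<zeta> \<le> (\<integral>\<^sup>+t. F (e t * \<zeta>) * indicator {0..1} t \<partial>lborel)"
    proof (cases "\<zeta> \<in> ball 0 r")
      case True
      \<comment> \<open>the function \<open>x \<mapsto> f (z + \<omega> * x)\<close> is used so that the circle of radius \<open>cmod \<zeta>\<close>
        is parametrized starting from \<open>z + \<zeta>\<close>\<close>
      define \<omega> where "\<omega> = sgn \<zeta>"
      have \<omega>: "of_real (cmod \<zeta>) * \<omega> = \<zeta>" "cmod \<omega> \<le> 1"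
        using norm_scaleR_sgn[of \<zeta>] by (auto simp: \<omega>_def scaleR_conv_of_real norm_sgn)
      have "(\<lambda>x. f (z + \<omega> * x)) holomorphic_on ball 0 r"
      proof (rule holomorphic_on_compose_gen[of "\<lambda>x. z + \<omega> * x", OF _ f, unfolded o_def])
        have "cmod \<omega> * cmod x < r" if "cmod x < r" for x
          using mult_left_le_one_le[of "cmod x" "cmod \<omega>"] \<omega>(2) that by simp
        then show "(\<lambda>x. z + \<omega> * x) ` ball 0 r \<subseteq> ball z r"
          by (auto simp: dist_norm norm_mult)
      qed (intro holomorphic_intros)
      then have "ennreal (cmod (f (z + \<omega> * 0))) \<le>
        (\<integral>\<^sup>+t\<in>{0..1}. ennreal (cmod (f (z + \<omega> * (0 + cmod \<zeta> * exp (2 * of_real pi * \<i> * of_real t))))) \<partial>lborel)"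
        by (rule circle_mean_le) (use True in auto)
      moreover have "z + \<omega> * (0 + cmod \<zeta> * exp (2 * of_real pi * \<i> * of_real t)) = z + e t * \<zeta>" for t
      proof -
        have "\<omega> * (cmod \<zeta> * e t) = (of_real (cmod \<zeta>) * \<omega>) * e t" by (simp only: mult_ac)
        then show ?thesis unfolding \<omega>(1) by (simp add: e_def mult.commute)
      qed
      moreover have "e t * \<zeta> \<in> ball 0 r" for t using True ne by (simp add: norm_mult)
      ultimately show ?thesis using True by (simp add: F_def)
    qed simp
  qed
  also have "\<dots> = (\<integral>\<^sup>+t. (\<integral>\<^sup>+\<zeta>. F (e t * \<zeta>) * indicator {0..1} t \<partial>lborel) \<partial>lborel)"
    by (rule pair_sigma_finite.Fubini'[symmetric]) (auto intro: pair_sigma_finite.intro sigma_finite_lborel)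
  also have "\<dots> = (\<integral>\<^sup>+t. (\<integral>\<^sup>+\<zeta>. F \<zeta> \<partial>lborel) * indicator {0..1} (t::real) \<partial>lborel)"
  proof (intro nn_integral_cong)
    fix t :: real
    have "(\<integral>\<^sup>+\<zeta>. F \<zeta> \<partial>lborel) = (\<integral>\<^sup>+\<zeta>. F \<zeta> \<partial>distr lborel borel (\<lambda>\<zeta>. e t * \<zeta>))"
      unfolding lborel_distr_rotation[OF ne] ..
    also have "\<dots> = (\<integral>\<^sup>+\<zeta>. F (e t * \<zeta>) \<partial>lborel)" by (rule nn_integral_distr) measurable
    finally show "(\<integral>\<^sup>+\<zeta>. F (e t * \<zeta>) * indicator {0..1} t \<partial>lborel) = (\<integral>\<^sup>+\<zeta>. F \<zeta> \<partial>lborel) * indicator {0..1} t"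
      by (simp add: nn_integral_multc)
  qed
  also have "\<dots> = (\<integral>\<^sup>+\<zeta>. F \<zeta> \<partial>lborel)" by (simp add: nn_integral_cmult_indicator)
  also have "\<dots> = (\<integral>\<^sup>+\<xi>\<in>ball z r. ennreal (cmod (f \<xi>)) \<partial>lborel)"
  proof -
    have "(\<integral>\<^sup>+\<zeta>. F \<zeta> \<partial>lborel) = (\<integral>\<^sup>+\<xi>. ennreal (cmod (f \<xi>) * indicator (ball z r) \<xi>) \<partial>lborel)"
      unfolding Feq by (rule nn_integral_translate) measurable
    also have "\<dots> = (\<integral>\<^sup>+\<xi>\<in>ball z r. ennreal (cmod (f \<xi>)) \<partial>lborel)"
      by (intro nn_integral_cong) (auto simp: indicator_def)
    finally show ?thesis .
  qed
  finally show ?thesis .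
qed

section \<open>Sub-mean-value estimates for powers of the modulus\<close>

lemma holomorphic_powr_measurable:
  assumes "f holomorphic_on S" "S \<in> sets borel"
  shows "(\<lambda>x. cmod (f x) powr q * indicator S x) \<in> borel_measurable borel"
proof -
  have "(\<lambda>x. indicator S x *\<^sub>R cmod (f x)) \<in> borel_measurable borel"
    using holomorphic_on_imp_continuous_on[OF assms(1)] assms(2)
    by (intro borel_measurable_continuous_on_indicator continuous_on_norm) auto
  then have "(\<lambda>x. (indicator S x *\<^sub>R cmod (f x)) powr q) \<in> borel_measurable borel"
    by measurable
  also have "(\<lambda>x. (indicator S x *\<^sub>R cmod (f x)) powr q) = (\<lambda>x. cmod (f x) powr q * indicator S x)"
    by (auto simp: indicator_def)
  finally show ?thesis .
qed

lemma holomorphic_powr_measurable_ennreal: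
  assumes "f holomorphic_on S" "S \<in> sets borel"
  shows "(\<lambda>x. ennreal (cmod (f x) powr q) * indicator S x) \<in> borel_measurable borel"
proof -
  have "(\<lambda>x. ennreal (cmod (f x) powr q) * indicator S x) = (\<lambda>x. ennreal (cmod (f x) powr q * indicator S x))"
    by (auto simp: indicator_def)
  then show ?thesis using holomorphic_powr_measurable[OF assms] by simp
qed

text \<open>Instead of Jensen's inequality, the elementary bound \<open>x \<le> l + l powr (1 - q) * x powr q\<close> is applied with
  \<open>l\<close> equal to half of the value at the center, so that the first summand is absorbed.\<close>

lemma norm_powr_submean_ge1:
  assumes q: "1 \<le> q" and f: "f holomorphic_on ball z r" and r: "0 < r"
  shows "ennreal (cmod (f z) powr q * r\<^sup>2) \<le> ennreal (2 powr q / pi) * (\<integral>\<^sup>+\<xi>\<in>ball z r. ennreal (cmod (f \<xi>) powr q) \<partial>lborel)"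
    (is "_ \<le> _ * ?J")
proof (cases "f z = 0 \<or> ?J = \<infinity>")
  case True
  then show ?thesis
  proof
    assume "?J = \<infinity>"
    then have "ennreal (2 powr q / pi) * ?J = \<infinity>" by (simp add: ennreal_mult_top)
    then show ?thesis by simp
  qed simp
next
  case False
  then obtain j where j: "?J = ennreal j" "0 \<le> j" by (cases ?J) auto
  define l where "l = cmod (f z) / 2"
  have l: "0 < l" using False by (simp add: l_def)
  have pw: "x \<le> l + l powr (1 - q) * x powr q" if "0 \<le> x" for x
  proof (cases "x \<le> l")
    case False
    then have "x powr (1 - q) \<le> l powr (1 - q)" using q l by (intro powr_mono2') auto
    then have "x powr (1 - q) * x powr q \<le> l powr (1 - q) * x powr q" by (intro mult_right_mono) auto
    moreover have "x powr (1 - q) * x powr q = x" using False l by (simp add: powr_add[symmetric])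
    ultimately show ?thesis using l by linarith
  qed (use that l in \<open>simp add: add_increasing2\<close>)
  note [measurable] = holomorphic_powr_measurable_ennreal[OF f, of q]
  have "ennreal (pi * r\<^sup>2) * ennreal (cmod (f z)) \<le> (\<integral>\<^sup>+\<xi>\<in>ball z r. ennreal (cmod (f \<xi>)) \<partial>lborel)"
    by (rule area_mean_le[OF f r])
  also have "\<dots> \<le> (\<integral>\<^sup>+\<xi>. ennreal l * indicator (ball z r) \<xi> + ennreal (l powr (1 - q)) * (ennreal (cmod (f \<xi>) powr q) * indicator (ball z r) \<xi>) \<partial>lborel)"
  proof (intro nn_integral_mono)
    fix \<xi>
    show "ennreal (cmod (f \<xi>)) * indicator (ball z r) \<xi> \<le>
      ennreal l * indicator (ball z r) \<xi> + ennreal (l powr (1 - q)) * (ennreal (cmod (f \<xi>) powr q) * indicator (ball z r) \<xi>)"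
      using pw[of "cmod (f \<xi>)"] l by (auto simp: indicator_def ennreal_mult'[symmetric] ennreal_plus[symmetric] ennreal_leI simp del: ennreal_plus)
  qed
  also have "\<dots> = ennreal l * emeasure lborel (ball z r) + ennreal (l powr (1 - q)) * ?J"
    by (subst nn_integral_add, measurable) (simp add: nn_integral_cmult nn_integral_cmult_indicator)
  also have "\<dots> = ennreal (l * (pi * r\<^sup>2) + l powr (1 - q) * j)"
    using l r j by (simp add: emeasure_ball_complex ennreal_mult'[symmetric] ennreal_plus[symmetric] del: ennreal_plus)
  finally have "pi * r\<^sup>2 * cmod (f z) \<le> l * (pi * r\<^sup>2) + l powr (1 - q) * j"
    using l j by (simp add: ennreal_mult'[symmetric] del: ennreal_plus)
  then have "l * (pi * r\<^sup>2) \<le> l powr (1 - q) * j" by (simp add: l_def field_simps)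
  then have "l powr (q - 1) * (l * (pi * r\<^sup>2)) \<le> l powr (q - 1) * (l powr (1 - q) * j)" by (intro mult_left_mono) auto
  moreover have "l powr (q - 1) * (l powr (1 - q) * j) = j" using l by (simp add: mult.assoc[symmetric] powr_add[symmetric])
  moreover have "l powr (q - 1) * (l * (pi * r\<^sup>2)) = l powr q * pi * r\<^sup>2"
    using l powr_add[of l "q - 1" 1] by simp
  ultimately have "l powr q * pi * r\<^sup>2 \<le> j" by simp
  moreover have "cmod (f z) powr q = 2 powr q * l powr q" unfolding l_def by (simp add: powr_divide)
  ultimately have "cmod (f z) powr q * r\<^sup>2 \<le> 2 powr q / pi * j"
    by (simp add: field_simps)
  then show ?thesis using j by (simp add: ennreal_mult'[symmetric] ennreal_leI)
qed

text \<open>For small exponents, maximize \<open>(\<rho> - dist z \<zeta>) powr (2 / q) * cmod (f \<zeta>)\<close> over the disk of radius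
  \<open>\<rho> = r / 2\<close>, a device of Hardy and Littlewood. Near the maximum point \<open>z0\<close> the function is bounded by a
  multiple of its value at \<open>z0\<close>, so the mean value inequality for \<open>cmod f\<close> at \<open>z0\<close> may be turned into one for
  \<open>cmod f powr q\<close>.\<close>

lemma norm_powr_submean_le1:
  assumes q: "0 < q" "q \<le> 1" and f: "f holomorphic_on ball z r" and r: "0 < r"
  shows "ennreal (cmod (f z) powr q * r\<^sup>2) \<le> ennreal (16 / pi * 2 powr (2 / q - 2)) * (\<integral>\<^sup>+\<xi>\<in>ball z r. ennreal (cmod (f \<xi>) powr q) \<partial>lborel)"
    (is "_ \<le> _ * ?J")
proof (cases "f z = 0 \<or> ?J = \<infinity>")
  case True
  then show ?thesis
  proof
    assume "?J = \<infinity>"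
    then have "ennreal (16 / pi * 2 powr (2 / q - 2)) * ?J = \<infinity>" by (simp add: ennreal_mult_top)
    then show ?thesis by simp
  qed simp
next
  case False
  then obtain j where j: "?J = ennreal j" "0 \<le> j" by (cases ?J) auto
  define \<rho> where "\<rho> = r / 2"
  have \<rho>: "0 < \<rho>" "\<rho> < r" using r by (auto simp: \<rho>_def)
  define h where "h \<zeta> = (\<rho> - dist z \<zeta>) powr (2 / q) * cmod (f \<zeta>)" for \<zeta>
  have "continuous_on (cball z \<rho>) f"
    using \<rho> by (intro holomorphic_on_imp_continuous_on holomorphic_on_subset[OF f]) auto
  then have "continuous_on (cball z \<rho>) h"
    unfolding h_def using q
    by (intro continuous_on_mult continuous_on_norm continuous_on_powr' continuous_intros) auto
  then obtain z0 where z0: "z0 \<in> cball z \<rho>" and max: "\<And>\<zeta>. \<zeta> \<in> cball z \<rho> \<Longrightarrow> h \<zeta> \<le> h z0"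
    using continuous_attains_sup[of "cball z \<rho>" h] \<rho> by (metis compact_cball centre_in_cball empty_iff less_imp_le)
  define S where "S = h z0"
  have hz: "\<rho> powr (2 / q) * cmod (f z) \<le> S" using max[of z] \<rho> by (simp add: h_def S_def)
  moreover have "0 < \<rho> powr (2 / q) * cmod (f z)" using \<rho> False by simp
  ultimately have S: "0 < S" by linarith
  define d where "d = \<rho> - dist z z0"
  have d: "0 < d" using S z0 by (cases "d = 0") (auto simp: S_def h_def d_def)
  have fz0: "cmod (f z0) = S * d powr (- (2 / q))"
    using d by (simp add: S_def h_def d_def[symmetric] powr_minus)
  define B where "B = S * (d / 2) powr (- (2 / q))"
  have B: "0 < B" using S d by (simp add: B_def)
  have in_ball: "\<xi> \<in> ball z r" "\<xi> \<in> cball z \<rho>" "d / 2 \<le> \<rho> - dist z \<xi>" if "\<xi> \<in> ball z0 (d / 2)" for \<xi>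
  proof -
    have "dist z \<xi> \<le> dist z z0 + d / 2" using that dist_triangle[of z \<xi> z0] by simp
    then show "d / 2 \<le> \<rho> - dist z \<xi>" unfolding d_def by argo
    then show "\<xi> \<in> ball z r" "\<xi> \<in> cball z \<rho>" using d \<rho> by auto
  qed
  have fB: "cmod (f \<xi>) \<le> B" if \<xi>: "\<xi> \<in> ball z0 (d / 2)" for \<xi>
  proof -
    have "(d / 2) powr (2 / q) * cmod (f \<xi>) \<le> h \<xi>"
      unfolding h_def using in_ball[OF \<xi>] d q by (intro mult_right_mono powr_mono2) auto
    also have "\<dots> \<le> S" using max[OF in_ball(2)[OF \<xi>]] by (simp add: S_def)
    finally show ?thesis using d by (simp add: B_def powr_minus field_simps)
  qed
  have "ennreal (pi * (d / 2)\<^sup>2) * ennreal (cmod (f z0)) \<le> (\<integral>\<^sup>+\<xi>\<in>ball z0 (d / 2). ennreal (cmod (f \<xi>)) \<partial>lborel)"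
    using d in_ball(1) by (intro area_mean_le holomorphic_on_subset[OF f]) auto
  also have "\<dots> \<le> (\<integral>\<^sup>+\<xi>. ennreal (B powr (1 - q)) * (ennreal (cmod (f \<xi>) powr q) * indicator (ball z r) \<xi>) \<partial>lborel)"
  proof (intro nn_integral_mono)
    fix \<xi>
    show "ennreal (cmod (f \<xi>)) * indicator (ball z0 (d / 2)) \<xi> \<le> ennreal (B powr (1 - q)) * (ennreal (cmod (f \<xi>) powr q) * indicator (ball z r) \<xi>)"
    proof (cases "\<xi> \<in> ball z0 (d / 2)")
      case True
      have "cmod (f \<xi>) = cmod (f \<xi>) powr (1 - q) * cmod (f \<xi>) powr q"
        by (cases "f \<xi> = 0") (auto simp: powr_add[symmetric])
      also have "\<dots> \<le> B powr (1 - q) * cmod (f \<xi>) powr q"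
        using fB[OF True] q by (intro mult_right_mono powr_mono2) auto
      finally show ?thesis using True in_ball(1)[OF True] by (simp add: ennreal_mult'[symmetric] ennreal_leI)
    qed simp
  qed
  also have "\<dots> = ennreal (B powr (1 - q)) * ?J"
    by (intro nn_integral_cmult) (simp add: holomorphic_powr_measurable_ennreal[OF f])
  finally have "pi * (d / 2)\<^sup>2 * cmod (f z0) \<le> B powr (1 - q) * j"
    using j by (simp add: ennreal_mult'[symmetric])
  also have "B powr (1 - q) = S powr (1 - q) * (d / 2) powr (2 - 2 / q)"
  proof -
    have "- (2 / q) * (1 - q) = 2 - 2 / q" using q by (simp add: field_simps)
    then show ?thesis unfolding B_def powr_mult powr_powr by simp
  qed
  finally have "pi * (d / 2)\<^sup>2 * (S * d powr (- (2 / q))) \<le> S powr (1 - q) * (d / 2) powr (2 - 2 / q) * j"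
    unfolding fz0 .
  moreover have "(d / 2) powr (2 - 2 / q) = d\<^sup>2 * d powr (- (2 / q)) * 2 powr (2 / q - 2)"
  proof -
    have "(d / 2) powr (2 - 2 / q) = d powr (2 - 2 / q) * 2 powr (- (2 - 2 / q))"
      unfolding powr_divide powr_minus by (rule divide_inverse)
    moreover have "d powr (2 - 2 / q) = d\<^sup>2 * d powr (- (2 / q))"
      using d powr_add[of d 2 "- (2 / q)"] by simp
    ultimately show ?thesis by simp
  qed
  ultimately have "(d\<^sup>2 * d powr (- (2 / q))) * (pi / 4 * S) \<le> (d\<^sup>2 * d powr (- (2 / q))) * (S powr (1 - q) * 2 powr (2 / q - 2) * j)"
    by (simp add: power_divide mult_ac)
  then have "pi / 4 * S \<le> S powr (1 - q) * 2 powr (2 / q - 2) * j"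
    using d by (subst (asm) mult_le_cancel_left_pos) auto
  then have "S powr (q - 1) * (pi / 4 * S) \<le> S powr (q - 1) * (S powr (1 - q) * 2 powr (2 / q - 2) * j)"
    by (intro mult_left_mono) auto
  moreover have "S powr (q - 1) * (S powr (1 - q) * 2 powr (2 / q - 2) * j) = 2 powr (2 / q - 2) * j"
    using S by (simp add: mult.assoc[symmetric] powr_add[symmetric])
  moreover have "S powr (q - 1) * (pi / 4 * S) = pi / 4 * S powr q"
    using S powr_add[of S "q - 1" 1] by simp
  ultimately have 1: "pi / 4 * S powr q \<le> 2 powr (2 / q - 2) * j" by (simp only:)
  have "(\<rho> powr (2 / q) * cmod (f z)) powr q \<le> S powr q" using hz q \<rho> by (intro powr_mono2) auto
  moreover have "(\<rho> powr (2 / q) * cmod (f z)) powr q = r\<^sup>2 / 4 * cmod (f z) powr q"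
    using \<rho> q r by (simp add: powr_mult powr_powr \<rho>_def power_divide)
  ultimately have "r\<^sup>2 / 4 * cmod (f z) powr q \<le> S powr q" by simp
  then have "pi / 4 * (r\<^sup>2 / 4 * cmod (f z) powr q) \<le> 2 powr (2 / q - 2) * j"
    using 1 by (smt (verit) mult_left_mono pi_gt_zero divide_nonneg_nonneg)
  then have "cmod (f z) powr q * r\<^sup>2 \<le> 16 / pi * 2 powr (2 / q - 2) * j"
    by (simp add: field_simps)
  then show ?thesis using j by (simp add: ennreal_mult'[symmetric] ennreal_leI)
qed

lemma norm_powr_submean:
  assumes q: "0 < q"
  obtains C where "0 < C" "\<And>f z r. f holomorphic_on ball z r \<Longrightarrow> 0 < r \<Longrightarrow>
    ennreal (cmod (f z) powr q * r\<^sup>2) \<le> ennreal C * (\<integral>\<^sup>+\<xi>\<in>ball z r. ennreal (cmod (f \<xi>) powr q) \<partial>lborel)"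
proof (cases "1 \<le> q")
  case True
  show ?thesis by (rule that[of "2 powr q / pi"]) (use norm_powr_submean_ge1[OF True] in auto)
next
  case False
  show ?thesis by (rule that[of "16 / pi * 2 powr (2 / q - 2)"]) (use norm_powr_submean_le1[of q] q False in auto)
qed

text \<open>Cauchy's estimate on the circle of radius \<open>r / 2\<close>, with the values there bounded by means over disks of
  the same radius.\<close>

lemma deriv_powr_submean:
  assumes q: "0 < q"
  obtains C where "0 < C" "\<And>f z r. f holomorphic_on ball z r \<Longrightarrow> 0 < r \<Longrightarrow>
    ennreal (cmod (deriv f z) powr q * r powr (q + 2)) \<le> ennreal C * (\<integral>\<^sup>+\<xi>\<in>ball z r. ennreal (cmod (f \<xi>) powr q) \<partial>lborel)"
proof -
  obtain C where C: "0 < C" and sub: "\<And>f z r. f holomorphic_on ball z r \<Longrightarrow> 0 < r \<Longrightarrow>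
    ennreal (cmod (f z) powr q * r\<^sup>2) \<le> ennreal C * (\<integral>\<^sup>+\<xi>\<in>ball z r. ennreal (cmod (f \<xi>) powr q) \<partial>lborel)"
    by (rule norm_powr_submean[OF q]) (rule that; blast)
  show ?thesis
  proof (rule that[of "4 * C * 2 powr q"])
    fix f z r assume f: "f holomorphic_on ball z r" and r: "0 < (r::real)"
    define J where "J = (\<integral>\<^sup>+\<xi>\<in>ball z r. ennreal (cmod (f \<xi>) powr q) \<partial>lborel)"
    show "ennreal (cmod (deriv f z) powr q * r powr (q + 2)) \<le> ennreal (4 * C * 2 powr q) * J"
    proof (cases "J = \<infinity>")
      case True
      then show ?thesis using C by (simp add: ennreal_mult_top)
    next
      case False
      then obtain j where j: "J = ennreal j" "0 \<le> j" by (cases J) auto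
      define B where "B = (C * j * 4 / r\<^sup>2) powr (1 / q)"
      have bd: "cmod (f \<xi>) \<le> B" if "cmod (z - \<xi>) = r / 2" for \<xi>
      proof -
        have sub_ball: "ball \<xi> (r / 2) \<subseteq> ball z r"
        proof
          fix x assume "x \<in> ball \<xi> (r / 2)"
          then show "x \<in> ball z r" using dist_triangle[of z x \<xi>] that by (simp add: dist_norm)
        qed
        have "ennreal (cmod (f \<xi>) powr q * (r / 2)\<^sup>2) \<le> ennreal C * (\<integral>\<^sup>+x\<in>ball \<xi> (r / 2). ennreal (cmod (f x) powr q) \<partial>lborel)"
          using sub_ball r by (intro sub holomorphic_on_subset[OF f]) auto
        also have "\<dots> \<le> ennreal C * J"
          unfolding J_def using sub_ball by (intro mult_left_mono nn_set_integral_set_mono) auto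
        finally have "cmod (f \<xi>) powr q * (r / 2)\<^sup>2 \<le> C * j"
          using C j by (simp add: ennreal_mult'[symmetric])
        then have "cmod (f \<xi>) powr q \<le> C * j * 4 / r\<^sup>2" using r by (simp add: field_simps)
        then have "(cmod (f \<xi>) powr q) powr (1 / q) \<le> B" unfolding B_def using q by (intro powr_mono2) auto
        then show ?thesis using q by (simp add: powr_powr)
      qed
      have "cmod ((deriv ^^ 1) f z) \<le> fact 1 * B / (r / 2) ^ 1"
      proof (rule Cauchy_inequality)
        show "f holomorphic_on ball z (r / 2)" using r by (intro holomorphic_on_subset[OF f]) auto
        show "continuous_on (cball z (r / 2)) f"
          using r by (intro holomorphic_on_imp_continuous_on holomorphic_on_subset[OF f]) auto
      qed (use r bd in auto)
      then have "cmod (deriv f z) * r \<le> 2 * B" using r by (simp add: field_simps)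
      then have "(cmod (deriv f z) * r) powr q \<le> (2 * B) powr q" using q r by (intro powr_mono2) auto
      also have "\<dots> = 2 powr q * (C * j * 4 / r\<^sup>2)"
        unfolding B_def using q C j by (simp add: powr_mult powr_powr)
      finally have "cmod (deriv f z) powr q * r powr q * r\<^sup>2 \<le> 4 * C * 2 powr q * j"
        using r by (simp add: powr_mult field_simps)
      then show ?thesis using r j C by (simp add: powr_add ennreal_mult'[symmetric] ennreal_leI mult.assoc)
    qed
  qed (use C in simp)
qed

section \<open>Bounds by the norm of the function\<close>

text \<open>The integral of \<open>cmod f powr q\<close> against \<open>v\<close>. For weights that vanish outside of the unit disk the integral
  over the plane is that over the disk.\<close>

abbreviation power_integral :: "real \<Rightarrow> (complex \<Rightarrow> real) \<Rightarrow> (complex \<Rightarrow> complex) \<Rightarrow> ennreal" where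
  "power_integral q v f \<equiv> \<integral>\<^sup>+z. ennreal (cmod (f z) powr q * v z) \<partial>lborel"

text \<open>The corresponding integral for the \<open>n\<close>-th derivative, with the factor \<open>bdist z powr (q * n)\<close>.\<close>

abbreviation deriv_integral :: "nat \<Rightarrow> real \<Rightarrow> (complex \<Rightarrow> real) \<Rightarrow> (complex \<Rightarrow> complex) \<Rightarrow> ennreal" where
  "deriv_integral n q v f \<equiv>
     \<integral>\<^sup>+z. ennreal (cmod ((deriv ^^ n) f z) powr q * bdist z powr (q * real n) * v z) \<partial>lborel"

lemma weighted_powr_measurable:
  assumes "f holomorphic_on unit_disk" "regular A v" "g \<in> borel_measurable borel"
  shows "(\<lambda>z. ennreal (cmod (f z) powr q * g z * v z)) \<in> borel_measurable borel"
proof -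
  have [measurable]: "v \<in> borel_measurable borel" "g \<in> borel_measurable borel"
    "(\<lambda>x. cmod (f x) powr q * indicator unit_disk x) \<in> borel_measurable borel"
    using regularD(2)[OF assms(2)] assms(3) holomorphic_powr_measurable[OF assms(1)] by simp_all
  have "(\<lambda>z. ennreal ((cmod (f z) powr q * indicator unit_disk z) * g z * v z)) \<in> borel_measurable borel"
    by measurable
  also have "(\<lambda>z. ennreal ((cmod (f z) powr q * indicator unit_disk z) * g z * v z)) = (\<lambda>z. ennreal (cmod (f z) powr q * g z * v z))"
    using regularD(3)[OF assms(2)] by (auto simp: indicator_def fun_eq_iff)
  finally show ?thesis .
qed

lemma half_ball:
  assumes "z \<in> unit_disk" "\<xi> \<in> cball z (bdist z / 2)"
  shows "\<xi> \<in> unit_disk" "bdist z / 2 \<le> bdist \<xi>" "bdist \<xi> \<le> 3 / 2 * bdist z"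
proof -
  have d: "dist z \<xi> \<le> bdist z / 2" using assms(2) by simp
  have z: "0 < bdist z" using assms(1) by simp
  have "bdist z - bdist \<xi> \<le> bdist z / 2" "bdist \<xi> - bdist z \<le> bdist z / 2"
    using d bdist_diff[of z \<xi>] by linarith+
  then show "bdist z / 2 \<le> bdist \<xi>" "bdist \<xi> \<le> 3 / 2 * bdist z" by argo+
  then have "0 < bdist \<xi>" using z by argo
  then show "\<xi> \<in> unit_disk" by simp
qed

lemma half_ball_powr:
  assumes "z \<in> unit_disk" "\<xi> \<in> cball z (bdist z / 2)"
  shows "bdist z powr p \<le> 2 powr \<bar>p\<bar> * bdist \<xi> powr p" "bdist \<xi> powr p \<le> 2 powr \<bar>p\<bar> * bdist z powr p"
proof -
  have cmp: "x powr p \<le> 2 powr \<bar>p\<bar> * y powr p" if "0 < x" "0 < y" "x \<le> 2 * y" "y \<le> 2 * x" for x y :: real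
  proof (cases "0 \<le> p")
    case True
    have "x powr p \<le> (2 * y) powr p" using that True by (intro powr_mono2) auto
    then show ?thesis using that True by (simp add: powr_mult)
  next
    case False
    have "x powr p \<le> (y / 2) powr p" using that False by (intro powr_mono2') auto
    also have "\<dots> = inverse (2 powr p) * y powr p"
      unfolding powr_divide by (subst mult.commute) (rule divide_inverse)
    also have "inverse (2 powr p) = 2 powr \<bar>p\<bar>"
      using False by (simp only: abs_of_neg not_le powr_minus)
    finally show ?thesis .
  qed
  have "0 < bdist z" "0 < bdist \<xi>" using half_ball(1)[OF assms] assms(1) by auto
  moreover from this have "bdist z \<le> 2 * bdist \<xi>" "bdist \<xi> \<le> 2 * bdist z"
    using half_ball[OF assms] by argo+
  ultimately show "bdist z powr p \<le> 2 powr \<bar>p\<bar> * bdist \<xi> powr p" "bdist \<xi> powr p \<le> 2 powr \<bar>p\<bar> * bdist z powr p"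
    using cmp by blast+
qed

text \<open>For every regular weight: \<open>deriv_powr_submean\<close> on the disks of radius \<open>bdist z / 2\<close>, on which \<open>v\<close> and
  \<open>bdist\<close> are nearly constant, followed by Tonelli.\<close>

lemma derivative_integral_le:
  assumes v: "regular A v" and q: "0 < q"
  obtains C where "0 < C" "\<And>f. f holomorphic_on unit_disk \<Longrightarrow>
    (\<integral>\<^sup>+z. ennreal (cmod (deriv f z) powr q * bdist z powr q * v z) \<partial>lborel) \<le>
      ennreal C * power_integral q v f"
proof -
  obtain C where C: "0 < C" and sub: "\<And>f z r. f holomorphic_on ball z r \<Longrightarrow> 0 < r \<Longrightarrow>
    ennreal (cmod (deriv f z) powr q * r powr (q + 2)) \<le> ennreal C * (\<integral>\<^sup>+\<xi>\<in>ball z r. ennreal (cmod (f \<xi>) powr q) \<partial>lborel)"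
    by (rule deriv_powr_submean[OF q]) (rule that; blast)
  have A: "1 \<le> A" using regularD(5)[OF v] .
  have v0: "0 \<le> v z" for z using regularD(4)[OF v] .
  define C' where "C' = 2 powr (q + 2) * C * A * 4"
  have C': "0 < C'" using C A by (simp add: C'_def)
  show ?thesis
  proof (rule that[of "C' * pi"])
    fix f assume f: "f holomorphic_on unit_disk"
    define g where "g \<xi> = ennreal (cmod (f \<xi>) powr q * bdist \<xi> powr (-2) * v \<xi>)" for \<xi>
    have [measurable]: "g \<in> borel_measurable borel"
      unfolding g_def[abs_def] by (rule weighted_powr_measurable[OF f v]) measurable
    have "(\<integral>\<^sup>+z. ennreal (cmod (deriv f z) powr q * bdist z powr q * v z) \<partial>lborel) \<le>
      (\<integral>\<^sup>+z. ennreal C' * (\<integral>\<^sup>+\<xi>\<in>{\<xi>. dist z \<xi> < 1 * bdist \<xi>}. g \<xi> \<partial>lborel) \<partial>lborel)"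
    proof (intro nn_integral_mono)
      fix z
      show "ennreal (cmod (deriv f z) powr q * bdist z powr q * v z) \<le> ennreal C' * (\<integral>\<^sup>+\<xi>\<in>{\<xi>. dist z \<xi> < 1 * bdist \<xi>}. g \<xi> \<partial>lborel)"
      proof (cases "z \<in> unit_disk")
        case z: True
        define h where "h = bdist z"
        have h: "0 < h" using z by (simp add: h_def)
        have sub_ball: "ball z (h / 2) \<subseteq> unit_disk" using half_ball(1)[OF z] by (auto simp: h_def)
        note hm = holomorphic_powr_measurable_ennreal[OF holomorphic_on_subset[OF f sub_ball], of q]
        have "ennreal (cmod (deriv f z) powr q * (h / 2) powr (q + 2)) \<le> ennreal C * (\<integral>\<^sup>+\<xi>\<in>ball z (h / 2). ennreal (cmod (f \<xi>) powr q) \<partial>lborel)"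
          by (rule sub[OF holomorphic_on_subset[OF f sub_ball]]) (use h in simp)
        then have "ennreal (2 powr (q + 2) * h powr (-2) * v z) * ennreal (cmod (deriv f z) powr q * (h / 2) powr (q + 2))
          \<le> ennreal (2 powr (q + 2) * h powr (-2) * v z) * (ennreal C * (\<integral>\<^sup>+\<xi>\<in>ball z (h / 2). ennreal (cmod (f \<xi>) powr q) \<partial>lborel))"
          by (intro mult_left_mono) auto
        also have "\<dots> = ennreal (2 powr (q + 2) * h powr (-2) * v z * C) * (\<integral>\<^sup>+\<xi>\<in>ball z (h / 2). ennreal (cmod (f \<xi>) powr q) \<partial>lborel)"
          using v0 by (intro ennreal_mult_assoc) auto
        also have "\<dots> = (\<integral>\<^sup>+\<xi>. ennreal (2 powr (q + 2) * h powr (-2) * v z * C) * (ennreal (cmod (f \<xi>) powr q) * indicator (ball z (h / 2)) \<xi>) \<partial>lborel)"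
          using hm by (intro nn_integral_cmult[symmetric]) simp_all
        also have "\<dots> \<le> (\<integral>\<^sup>+\<xi>. ennreal C' * (g \<xi> * indicator {\<xi>. dist z \<xi> < 1 * bdist \<xi>} \<xi>) \<partial>lborel)"
        proof (intro nn_integral_mono)
          fix \<xi>
          show "ennreal (2 powr (q + 2) * h powr (-2) * v z * C) * (ennreal (cmod (f \<xi>) powr q) * indicator (ball z (h / 2)) \<xi>)
            \<le> ennreal C' * (g \<xi> * indicator {\<xi>. dist z \<xi> < 1 * bdist \<xi>} \<xi>)"
          proof (cases "\<xi> \<in> ball z (h / 2)")
            case True
            then have \<xi>: "\<xi> \<in> cball z (bdist z / 2)" by (simp add: h_def)
            have "dist z \<xi> < bdist \<xi>"
              using True half_ball(2)[OF z \<xi>] by (simp only: h_def mem_ball less_le_trans)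
            have vv: "v z \<le> A * v \<xi>" using \<xi> by (intro slowD(4)[OF regularD(1)[OF v] z]) auto
            have "2 powr (q + 2) * h powr (-2) * v z * C * cmod (f \<xi>) powr q
              \<le> 2 powr (q + 2) * (2 powr \<bar>-2\<bar> * bdist \<xi> powr (-2)) * (A * v \<xi>) * C * cmod (f \<xi>) powr q"
              using vv half_ball_powr(1)[OF z \<xi>, of "-2"] v0 C
              by (intro mult_right_mono mult_mono mult_left_mono) (auto simp: h_def)
            also have "\<dots> = C' * (cmod (f \<xi>) powr q * bdist \<xi> powr (-2) * v \<xi>)" by (simp add: C'_def)
            finally show ?thesis
              using True \<open>dist z \<xi> < bdist \<xi>\<close> C' v0 by (simp add: g_def ennreal_mult'[symmetric] ennreal_mult''[symmetric] ennreal_leI)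
          qed simp
        qed
        also have "\<dots> = ennreal C' * (\<integral>\<^sup>+\<xi>\<in>{\<xi>. dist z \<xi> < 1 * bdist \<xi>}. g \<xi> \<partial>lborel)"
        proof (rule nn_integral_cmult)
          have [measurable]: "{\<xi>. dist z \<xi> < 1 * bdist \<xi>} \<in> sets borel" by measurable
          show "(\<lambda>\<xi>. g \<xi> * indicator {\<xi>. dist z \<xi> < 1 * bdist \<xi>} \<xi>) \<in> borel_measurable lborel" by measurable
        qed
        finally have *: "ennreal (2 powr (q + 2) * h powr (-2) * v z) * ennreal (cmod (deriv f z) powr q * (h / 2) powr (q + 2)) \<le> \<dots>" .
        have "2 powr (q + 2) * h powr (-2) * (h / 2) powr (q + 2) = h powr q"
        proof -
          have "(h / 2) powr (q + 2) = h powr q * h powr 2 / 2 powr (q + 2)"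
            using h by (simp add: powr_divide powr_add)
          moreover have "h powr (-2) * h powr 2 = 1" using h unfolding powr_add[symmetric] by simp
          ultimately show ?thesis by (simp add: field_simps)
        qed
        then have eq: "2 powr (q + 2) * h powr (-2) * v z * (cmod (deriv f z) powr q * (h / 2) powr (q + 2)) = cmod (deriv f z) powr q * h powr q * v z"
          by (simp add: mult_ac)
        have "ennreal (2 powr (q + 2) * h powr (-2) * v z) * ennreal (cmod (deriv f z) powr q * (h / 2) powr (q + 2))
          = ennreal (cmod (deriv f z) powr q * h powr q * v z)"
          by (subst ennreal_mult''[symmetric]) (simp, simp only: eq)
        then show ?thesis using * by (simp only: h_def)
      qed (use regularD(3)[OF v] in simp)
    qed
    also have "\<dots> = (\<integral>\<^sup>+\<xi>. g \<xi> * (\<integral>\<^sup>+z\<in>ball \<xi> (1 * bdist \<xi>). ennreal C' \<partial>lborel) \<partial>lborel)"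
      by (rule tonelli_cone) measurable
    also have "\<dots> = (\<integral>\<^sup>+\<xi>. ennreal (C' * pi) * ennreal (cmod (f \<xi>) powr q * v \<xi>) \<partial>lborel)"
    proof (intro nn_integral_cong)
      fix \<xi>
      show "g \<xi> * (\<integral>\<^sup>+z\<in>ball \<xi> (1 * bdist \<xi>). ennreal C' \<partial>lborel) = ennreal (C' * pi) * ennreal (cmod (f \<xi>) powr q * v \<xi>)"
      proof (cases "\<xi> \<in> unit_disk")
        case True
        then have b: "0 < bdist \<xi>" by simp
        have e: "bdist \<xi> powr (-2) * (bdist \<xi>)\<^sup>2 = 1"
          using b by (simp add: powr_minus del: zero_less_diff)
        have "g \<xi> * (\<integral>\<^sup>+z\<in>ball \<xi> (1 * bdist \<xi>). ennreal C' \<partial>lborel) = g \<xi> * ennreal (C' * (pi * (bdist \<xi>)\<^sup>2))"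
          using b C' by (subst nn_integral_const_ball) auto
        also have "\<dots> = ennreal ((cmod (f \<xi>) powr q * bdist \<xi> powr (-2) * v \<xi>) * (C' * (pi * (bdist \<xi>)\<^sup>2)))"
          unfolding g_def using C' v0 by (intro ennreal_mult''[symmetric]) auto
        also have "(cmod (f \<xi>) powr q * bdist \<xi> powr (-2) * v \<xi>) * (C' * (pi * (bdist \<xi>)\<^sup>2)) = (C' * pi) * (cmod (f \<xi>) powr q * v \<xi>) * (bdist \<xi> powr (-2) * (bdist \<xi>)\<^sup>2)"
          by (simp only: mult_ac)
        also have "ennreal \<dots> = ennreal (C' * pi) * ennreal (cmod (f \<xi>) powr q * v \<xi>)"
          unfolding e using C' by (simp add: ennreal_mult'[symmetric])
        finally show ?thesis .
      qed (use regularD(3)[OF v] in \<open>simp add: g_def\<close>)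
    qed
    also have "\<dots> = ennreal (C' * pi) * power_integral q v f"
      using weighted_powr_measurable[OF f v, of "\<lambda>_. 1" q] by (intro nn_integral_cmult) simp
    finally show "(\<integral>\<^sup>+z. ennreal (cmod (deriv f z) powr q * bdist z powr q * v z) \<partial>lborel) \<le>
      ennreal (C' * pi) * power_integral q v f" .
  qed (use C' in simp)
qed

lemma value_at_0_le:
  assumes v: "regular A v" and q: "0 < q"
  obtains C where "0 < C" "\<And>f. f holomorphic_on unit_disk \<Longrightarrow>
    ennreal (cmod (f 0) powr q) \<le> ennreal C * power_integral q v f"
proof -
  obtain C where C: "0 < C" and sub: "\<And>f z r. f holomorphic_on ball z r \<Longrightarrow> 0 < r \<Longrightarrow>
    ennreal (cmod (f z) powr q * r\<^sup>2) \<le> ennreal C * (\<integral>\<^sup>+\<xi>\<in>ball z r. ennreal (cmod (f \<xi>) powr q) \<partial>lborel)"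
    by (rule norm_powr_submean[OF q]) (rule that; blast)
  have A: "1 \<le> A" using regularD(5)[OF v] .
  have v0: "0 < v 0" using regularD(6)[OF v, of 0] by simp
  define C' where "C' = 4 * C * (A / v 0)"
  show ?thesis
  proof (rule that[of C'])
    show "0 < C'" using C A v0 by (simp add: C'_def)
    fix f assume f: "f holomorphic_on unit_disk"
    have half: "ball 0 (1 / 2) \<subseteq> unit_disk" by auto
    have "ennreal 4 * ennreal (cmod (f 0) powr q * (1 / 2)\<^sup>2) \<le> ennreal 4 * (ennreal C * (\<integral>\<^sup>+\<xi>\<in>ball 0 (1 / 2). ennreal (cmod (f \<xi>) powr q) \<partial>lborel))"
      by (intro mult_left_mono sub holomorphic_on_subset[OF f] half) auto
    then have "ennreal (cmod (f 0) powr q) \<le> ennreal (4 * C) * (\<integral>\<^sup>+\<xi>\<in>ball 0 (1 / 2). ennreal (cmod (f \<xi>) powr q) \<partial>lborel)"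
      by (simp add: ennreal_mult'[symmetric] ennreal_mult_assoc power2_eq_square del: ennreal_numeral)
    also have "\<dots> = (\<integral>\<^sup>+\<xi>. ennreal (4 * C) * (ennreal (cmod (f \<xi>) powr q) * indicator (ball 0 (1 / 2)) \<xi>) \<partial>lborel)"
      using holomorphic_powr_measurable_ennreal[OF holomorphic_on_subset[OF f half], of q]
      by (intro nn_integral_cmult[symmetric]) simp_all
    also have "\<dots> \<le> (\<integral>\<^sup>+\<xi>. ennreal C' * ennreal (cmod (f \<xi>) powr q * v \<xi>) \<partial>lborel)"
    proof (intro nn_integral_mono)
      fix \<xi> :: complex
      show "ennreal (4 * C) * (ennreal (cmod (f \<xi>) powr q) * indicator (ball 0 (1 / 2)) \<xi>) \<le> ennreal C' * ennreal (cmod (f \<xi>) powr q * v \<xi>)"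
      proof (cases "\<xi> \<in> ball 0 (1 / 2)")
        case True
        then have "v 0 \<le> A * v \<xi>" by (intro slowD(4)[OF regularD(1)[OF v]]) auto
        then have "1 \<le> A / v 0 * v \<xi>" using v0 by (simp add: field_simps)
        then have "4 * C * cmod (f \<xi>) powr q * 1 \<le> 4 * C * cmod (f \<xi>) powr q * (A / v 0 * v \<xi>)"
          using C by (intro mult_left_mono) auto
        also have "\<dots> = C' * (cmod (f \<xi>) powr q * v \<xi>)" by (simp add: C'_def)
        finally show ?thesis using True C A v0
          by (simp add: ennreal_mult'[symmetric] ennreal_mult''[symmetric] ennreal_leI C'_def)
      qed simp
    qed
    also have "\<dots> = ennreal C' * power_integral q v f"
      using weighted_powr_measurable[OF f v, of "\<lambda>_. 1" q] by (intro nn_integral_cmult) simp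
    finally show "ennreal (cmod (f 0) powr q) \<le> ennreal C' * power_integral q v f" .
  qed
qed

section \<open>Bounds for the function by its derivative\<close>

lemma ball_carleson_finite_mass:
  assumes "ball_carleson v" "regular A v"
  obtains V where "0 \<le> V" "(\<integral>\<^sup>+z. ennreal (v z) \<partial>lborel) = ennreal V"
proof -
  obtain C where C: "0 \<le> C" "\<And>z. z \<in> unit_disk \<Longrightarrow>
     mass v (ball z (3 * bdist z)) \<le> ennreal (C * (bdist z)\<^sup>2 * v z)"
    using assms(1) unfolding ball_carleson_def by blast
  have "(\<integral>\<^sup>+z. ennreal (v z) \<partial>lborel) \<le> mass v (ball 0 (3 * bdist 0))"
  proof (intro nn_integral_mono)
    fix z show "ennreal (v z) \<le> ennreal (v z) * indicator (ball 0 (3 * bdist 0)) z"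
      using regularD(3)[OF assms(2), of z] by (cases "z \<in> unit_disk") (auto simp: indicator_def)
  qed
  also have "\<dots> \<le> ennreal (C * (bdist 0)\<^sup>2 * v 0)" by (rule C(2)) simp
  finally have "(\<integral>\<^sup>+z. ennreal (v z) \<partial>lborel) < \<infinity>" by (rule le_less_trans) simp
  then obtain V where "0 \<le> V" "(\<integral>\<^sup>+z. ennreal (v z) \<partial>lborel) = ennreal V"
    by (cases "(\<integral>\<^sup>+z. ennreal (v z) \<partial>lborel)") auto
  then show ?thesis by (rule that)
qed

text \<open>Integrate \<open>deriv f\<close> along the radius, bounding it by the maximum of
  \<open>cmod (deriv f) * bdist powr (1 + s)\<close> on the radius, which is attained at the point with parameter \<open>t\<close>.\<close>

lemma radial_growth_bound:
  assumes f: "f holomorphic_on unit_disk" and z: "z \<in> unit_disk" and s: "0 < s"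
  obtains t where "0 \<le> t" "t \<le> 1"
    "cmod (f z - f 0) \<le> (cmod (deriv f (of_real t * z)) * bdist (of_real t * z) powr (1 + s)) * (bdist z powr (- s) / s)"
proof -
  define r where "r = cmod z"
  have r: "0 \<le> r" "r < 1" using z by (auto simp: r_def)
  have bt: "bdist (of_real t * z) = 1 - t * r" if "0 \<le> t" for t using that by (simp add: norm_mult r_def)
  have tr: "t * r \<le> r" if "0 \<le> t" "t \<le> 1" for t using that r by (simp add: mult_left_le_one_le)
  have inD: "of_real t * z \<in> unit_disk" if "0 \<le> t" "t \<le> 1" for t
    using tr[OF that] r that by (simp add: norm_mult r_def)
  have dhol: "deriv f holomorphic_on unit_disk" using f by (intro holomorphic_deriv) auto
  define h where "h t = cmod (deriv f (of_real t * z)) * bdist (of_real t * z) powr (1 + s)" for t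
  have "continuous_on {0..1} (\<lambda>t. deriv f (of_real t * z))"
    by (rule continuous_on_compose2[OF holomorphic_on_imp_continuous_on[OF dhol]])
       (use inD in \<open>auto intro!: continuous_intros\<close>)
  then have "continuous_on {0..1} h"
    unfolding h_def using inD
    by (intro continuous_on_mult continuous_on_norm continuous_on_powr continuous_intros) (auto simp: less_imp_neq)
  then obtain t where t: "t \<in> {0..1}" and max: "\<And>x. x \<in> {0..1} \<Longrightarrow> h x \<le> h t"
    using continuous_attains_sup[of "{0..1::real}" h] by force
  define S where "S = h t"
  have S: "0 \<le> S" by (simp add: S_def h_def)
  define \<phi> where "\<phi> x = S * (1 - x * r) powr (- s) / s" for x
  have pos: "0 < 1 - x * r" if "0 \<le> x" "x \<le> 1" for x using tr[OF that] r by linarith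
  have "norm (f (of_real 1 * z) - f (of_real 0 * z)) \<le> \<phi> 1 - \<phi> 0"
  proof (rule differentiable_bound_general)
    show "continuous_on {0..1} (\<lambda>t. f (of_real t * z))"
      by (rule continuous_on_compose2[OF holomorphic_on_imp_continuous_on[OF f]])
         (use inD in \<open>auto intro!: continuous_intros\<close>)
    show "continuous_on {0..1} \<phi>" unfolding \<phi>_def
      using pos s by (intro continuous_intros) (auto simp: less_imp_neq)
    fix x :: real assume x: "0 < x" "x < 1"
    then have x01: "0 \<le> x" "x \<le> 1" by auto
    have "(f has_field_derivative deriv f (of_real x * z)) (at (of_real x * z))"
      using holomorphic_derivI[OF f _ inD[OF x01]] by simp
    moreover have "((\<lambda>t. of_real t * z) has_vector_derivative z) (at x)"
      by (auto intro!: derivative_eq_intros)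
    ultimately show "((\<lambda>t. f (of_real t * z)) has_vector_derivative z * deriv f (of_real x * z)) (at x)"
      using field_vector_diff_chain_at[of "\<lambda>t. of_real t * z" z x f] by (simp add: o_def)
    have "(\<phi> has_real_derivative (S * r * (1 - x * r) powr (- s - 1))) (at x)"
      unfolding \<phi>_def using pos[OF x01] s by (auto intro!: derivative_eq_intros simp: field_simps)
    then show "(\<phi> has_vector_derivative (S * r * (1 - x * r) powr (- s - 1))) (at x)"
      by (simp add: has_real_derivative_iff_has_vector_derivative)
    have "h x \<le> S" using max[of x] x by (simp add: S_def)
    then have "cmod (deriv f (of_real x * z)) * (1 - x * r) powr (1 + s) * (1 - x * r) powr (- s - 1) \<le> S * (1 - x * r) powr (- s - 1)"
      unfolding h_def using bt[OF x01(1)] by (intro mult_right_mono) auto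
    moreover have "(1 - x * r) powr (1 + s) * (1 - x * r) powr (- s - 1) = 1"
      using pos[OF x01] unfolding powr_add[symmetric] by simp
    ultimately have "cmod (deriv f (of_real x * z)) \<le> S * (1 - x * r) powr (- s - 1)"
      by (simp only: mult.assoc mult_1_right)
    then have "r * cmod (deriv f (of_real x * z)) \<le> r * (S * (1 - x * r) powr (- s - 1))"
      using r by (intro mult_left_mono) auto
    then show "norm (z * deriv f (of_real x * z)) \<le> S * r * (1 - x * r) powr (- s - 1)"
      by (simp add: norm_mult r_def[symmetric] mult_ac)
  qed simp
  then have "cmod (f z - f 0) \<le> \<phi> 1 - \<phi> 0" by simp
  also have "\<dots> \<le> \<phi> 1" using S s by (simp add: \<phi>_def)
  also have "\<dots> = S * (bdist z powr (- s) / s)" by (simp add: \<phi>_def r_def)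
  finally show ?thesis using that t unfolding S_def h_def by auto
qed

text \<open>The only part of the norm equivalence that needs disk control. The cone integral of
  \<open>cmod (deriv f) powr q * bdist powr (q + \<epsilon> - 2)\<close> at \<open>z\<close> dominates \<open>cmod (f z - f 0) powr q\<close> up to the factor
  \<open>bdist z powr (- \<epsilon>)\<close>, and \<open>ball_carleson_improve\<close> absorbs that factor after Tonelli.\<close>

lemma integral_le_derivative_integral:
  assumes v: "regular A v" "ball_carleson v" and q: "0 < q"
  obtains C where "0 < C" "\<And>f. f holomorphic_on unit_disk \<Longrightarrow>
    power_integral q v f \<le>
      ennreal C * (ennreal (cmod (f 0) powr q) + (\<integral>\<^sup>+z. ennreal (cmod (deriv f z) powr q * bdist z powr q * v z) \<partial>lborel))"
proof -
  obtain \<epsilon> Ci where \<epsilon>: "0 < \<epsilon>" and Ci: "0 \<le> Ci" and improve: "\<And>a. a \<in> unit_disk \<Longrightarrow>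
    (\<integral>\<^sup>+z\<in>ball a (3 * bdist a). ennreal (bdist z powr (- \<epsilon>) * v z) \<partial>lborel) \<le> ennreal (Ci * bdist a powr (2 - \<epsilon>) * v a)"
    by (rule ball_carleson_improve[OF v]) (rule that; blast)
  obtain Cm where Cm: "0 < Cm" and sub: "\<And>f z r. f holomorphic_on ball z r \<Longrightarrow> 0 < r \<Longrightarrow>
    ennreal (cmod (f z) powr q * r\<^sup>2) \<le> ennreal Cm * (\<integral>\<^sup>+\<xi>\<in>ball z r. ennreal (cmod (f \<xi>) powr q) \<partial>lborel)"
    by (rule norm_powr_submean[OF q]) (rule that; blast)
  obtain V where V: "0 \<le> V" "(\<integral>\<^sup>+z. ennreal (v z) \<partial>lborel) = ennreal V"
    by (rule ball_carleson_finite_mass[OF v(2,1)])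
  have [measurable]: "v \<in> borel_measurable borel" using regularD(2)[OF v(1)] .
  have v0: "0 \<le> v z" for z using regularD(4)[OF v(1)] .
  \<comment> \<open>then the factor \<open>bdist z powr (- s)\<close> of \<open>radial_growth_bound\<close> becomes \<open>bdist z powr (- \<epsilon>)\<close> in the \<open>q\<close>-th power\<close>
  define s where "s = \<epsilon> / q"
  have s: "0 < s" using \<epsilon> q by (simp add: s_def)
  define p where "p = q + \<epsilon> - 2"
  define C1 where "C1 = (1 / s) powr q * (4 * Cm * 2 powr \<bar>p\<bar>)"
  have C1: "0 < C1" using Cm s by (simp add: C1_def)
  define C where "C = 2 powr q * (1 + V + C1 * Ci)"
  show ?thesis
  proof (rule that[of C])
    show "0 < C" using V C1 Ci by (simp add: C_def add_pos_nonneg)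
    fix f assume f: "f holomorphic_on unit_disk"
    have df: "deriv f holomorphic_on unit_disk" using f by (intro holomorphic_deriv) auto
    define g where "g \<xi> = ennreal (cmod (deriv f \<xi>) powr q * bdist \<xi> powr p) * indicator unit_disk \<xi>" for \<xi>
    have [measurable]: "g \<in> borel_measurable borel"
    proof -
      have "g = (\<lambda>\<xi>. ennreal ((cmod (deriv f \<xi>) powr q * indicator unit_disk \<xi>) * bdist \<xi> powr p))"
        unfolding g_def by (auto simp: indicator_def fun_eq_iff)
      then show ?thesis using holomorphic_powr_measurable[OF df, of q] by simp
    qed
    define cone where "cone z = {\<xi>. dist z \<xi> < 3 * bdist \<xi>}" for z :: complex
    have pw: "ennreal (cmod (f z - f 0) powr q) \<le> ennreal (C1 * bdist z powr (- \<epsilon>)) * (\<integral>\<^sup>+\<xi>\<in>cone z. g \<xi> \<partial>lborel)"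
      if z: "z \<in> unit_disk" for z
    proof -
      obtain t where t: "0 \<le> t" "t \<le> 1" and
        le: "cmod (f z - f 0) \<le> (cmod (deriv f (of_real t * z)) * bdist (of_real t * z) powr (1 + s)) * (bdist z powr (- s) / s)"
        using radial_growth_bound[OF f z s] by blast
      define y where "y = of_real t * z"
      have dzy: "dist z y = (1 - t) * cmod z"
      proof -
        have "z - y = of_real (1 - t) * z" by (simp add: y_def algebra_simps)
        then show ?thesis unfolding dist_norm using t by (simp add: norm_mult del: of_real_diff)
      qed
      have by_eq: "bdist y = bdist z + dist z y" unfolding dzy using t by (simp add: y_def norm_mult algebra_simps)
      have "0 < bdist z" using z by simp
      then have "0 < bdist y" unfolding by_eq using zero_le_dist[of z y] by linarith
      then have yD: "y \<in> unit_disk" by simp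
      define h where "h = bdist y"
      have h: "0 < h" using yD by (simp add: h_def)
      have zy: "dist z y < h" using by_eq z by (simp add: h_def)
      have half: "ball y (h / 2) \<subseteq> unit_disk" using half_ball(1)[OF yD] by (auto simp: h_def)
      have coney: "ball y (h / 2) \<subseteq> cone z"
      proof
        fix \<xi> assume \<xi>: "\<xi> \<in> ball y (h / 2)"
        then have "h / 2 \<le> bdist \<xi>" using half_ball(2)[OF yD, of \<xi>] by (simp add: h_def)
        moreover have "dist z \<xi> < h + h / 2" using zy \<xi> dist_triangle[of z \<xi> y] by simp
        ultimately show "\<xi> \<in> cone z" unfolding cone_def mem_Collect_eq by argo
      qed
      have "cmod (f z - f 0) powr q \<le> ((cmod (deriv f y) * h powr (1 + s)) * (bdist z powr (- s) / s)) powr q"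
        using le q by (intro powr_mono2) (auto simp: y_def h_def)
      also have "\<dots> = cmod (deriv f y) powr q * h powr (q + \<epsilon>) * (bdist z powr (- \<epsilon>) * (1 / s) powr q)"
      proof -
        have "(1 + s) * q = q + \<epsilon>" "- s * q = - \<epsilon>" using q by (auto simp: s_def field_simps)
        then show ?thesis unfolding divide_inverse[of _ s] powr_mult powr_powr by (simp add: inverse_eq_divide)
      qed
      finally have le2: "cmod (f z - f 0) powr q \<le> cmod (deriv f y) powr q * h powr (q + \<epsilon>) * (bdist z powr (- \<epsilon>) * (1 / s) powr q)" .
      have "ennreal (cmod (deriv f y) powr q * (h / 2)\<^sup>2) \<le> ennreal Cm * (\<integral>\<^sup>+\<xi>\<in>ball y (h / 2). ennreal (cmod (deriv f \<xi>) powr q) \<partial>lborel)"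
        by (rule sub[OF holomorphic_on_subset[OF df half]]) (use h in simp)
      then have "ennreal (4 * h powr p) * ennreal (cmod (deriv f y) powr q * (h / 2)\<^sup>2)
        \<le> ennreal (4 * h powr p) * (ennreal Cm * (\<integral>\<^sup>+\<xi>\<in>ball y (h / 2). ennreal (cmod (deriv f \<xi>) powr q) \<partial>lborel))"
        by (intro mult_left_mono) auto
      also have "\<dots> = ennreal (4 * h powr p * Cm) * (\<integral>\<^sup>+\<xi>\<in>ball y (h / 2). ennreal (cmod (deriv f \<xi>) powr q) \<partial>lborel)"
        by (rule ennreal_mult_assoc) simp
      also have "\<dots> = (\<integral>\<^sup>+\<xi>. ennreal (4 * h powr p * Cm) * (ennreal (cmod (deriv f \<xi>) powr q) * indicator (ball y (h / 2)) \<xi>) \<partial>lborel)"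
        using holomorphic_powr_measurable_ennreal[OF holomorphic_on_subset[OF df half], of q]
        by (intro nn_integral_cmult[symmetric]) simp_all
      also have "\<dots> \<le> (\<integral>\<^sup>+\<xi>. ennreal (4 * Cm * 2 powr \<bar>p\<bar>) * (g \<xi> * indicator (cone z) \<xi>) \<partial>lborel)"
      proof (intro nn_integral_mono)
        fix \<xi>
        show "ennreal (4 * h powr p * Cm) * (ennreal (cmod (deriv f \<xi>) powr q) * indicator (ball y (h / 2)) \<xi>)
          \<le> ennreal (4 * Cm * 2 powr \<bar>p\<bar>) * (g \<xi> * indicator (cone z) \<xi>)"
        proof (cases "\<xi> \<in> ball y (h / 2)")
          case True
          then have "\<xi> \<in> cball y (bdist y / 2)" by (simp add: h_def)
          note hp = half_ball_powr(1)[OF yD this, of p]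
          have "4 * h powr p * Cm * cmod (deriv f \<xi>) powr q \<le> 4 * (2 powr \<bar>p\<bar> * bdist \<xi> powr p) * Cm * cmod (deriv f \<xi>) powr q"
            using hp Cm by (intro mult_right_mono mult_left_mono) (auto simp: h_def)
          also have "\<dots> = 4 * Cm * 2 powr \<bar>p\<bar> * (cmod (deriv f \<xi>) powr q * bdist \<xi> powr p)" by simp
          finally show ?thesis using True coney half Cm
            by (auto simp: g_def ennreal_mult'[symmetric] ennreal_mult''[symmetric] subset_iff intro!: ennreal_leI)
        qed simp
      qed
      also have "\<dots> = ennreal (4 * Cm * 2 powr \<bar>p\<bar>) * (\<integral>\<^sup>+\<xi>\<in>cone z. g \<xi> \<partial>lborel)"
      proof (rule nn_integral_cmult)
        have [measurable]: "cone z \<in> sets borel" unfolding cone_def by measurable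
        show "(\<lambda>\<xi>. g \<xi> * indicator (cone z) \<xi>) \<in> borel_measurable lborel" by measurable
      qed
      finally have le3: "ennreal (4 * h powr p) * ennreal (cmod (deriv f y) powr q * (h / 2)\<^sup>2) \<le> ennreal (4 * Cm * 2 powr \<bar>p\<bar>) * (\<integral>\<^sup>+\<xi>\<in>cone z. g \<xi> \<partial>lborel)" .
      have eq: "4 * h powr p * (cmod (deriv f y) powr q * (h / 2)\<^sup>2) = cmod (deriv f y) powr q * h powr (q + \<epsilon>)"
      proof -
        have "h powr p * h\<^sup>2 = h powr (q + \<epsilon>)" using h powr_add[of h p 2] by (simp add: p_def)
        then show ?thesis by (simp add: power_divide)
      qed
      have "ennreal (4 * h powr p) * ennreal (cmod (deriv f y) powr q * (h / 2)\<^sup>2) = ennreal (cmod (deriv f y) powr q * h powr (q + \<epsilon>))"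
        by (subst ennreal_mult''[symmetric]) (simp, simp only: eq)
      then have le4: "ennreal (cmod (deriv f y) powr q * h powr (q + \<epsilon>)) \<le> ennreal (4 * Cm * 2 powr \<bar>p\<bar>) * (\<integral>\<^sup>+\<xi>\<in>cone z. g \<xi> \<partial>lborel)"
        using le3 by (simp only:)
      have "ennreal (cmod (f z - f 0) powr q) \<le> ennreal (bdist z powr (- \<epsilon>) * (1 / s) powr q) * ennreal (cmod (deriv f y) powr q * h powr (q + \<epsilon>))"
        using le2 by (simp add: ennreal_mult'[symmetric] ennreal_leI mult.commute)
      also have "\<dots> \<le> ennreal (bdist z powr (- \<epsilon>) * (1 / s) powr q) * (ennreal (4 * Cm * 2 powr \<bar>p\<bar>) * (\<integral>\<^sup>+\<xi>\<in>cone z. g \<xi> \<partial>lborel))"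
        by (intro mult_left_mono le4) simp
      also have "\<dots> = ennreal (bdist z powr (- \<epsilon>) * (1 / s) powr q * (4 * Cm * 2 powr \<bar>p\<bar>)) * (\<integral>\<^sup>+\<xi>\<in>cone z. g \<xi> \<partial>lborel)"
        by (rule ennreal_mult_assoc) simp
      also have "bdist z powr (- \<epsilon>) * (1 / s) powr q * (4 * Cm * 2 powr \<bar>p\<bar>) = C1 * bdist z powr (- \<epsilon>)" by (simp add: C1_def)
      finally show ?thesis .
    qed
    define G where "G z = ennreal (bdist z powr (- \<epsilon>) * v z) * (\<integral>\<^sup>+\<xi>\<in>cone z. g \<xi> \<partial>lborel)" for z
    have pw2: "ennreal (cmod (f z) powr q * v z) \<le> ennreal (2 powr q) * (ennreal (cmod (f 0) powr q) * ennreal (v z) + ennreal C1 * G z)" for z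
    proof (cases "z \<in> unit_disk")
      case z: True
      have "cmod (f z) \<le> 2 * max (cmod (f 0)) (cmod (f z - f 0))"
        using norm_triangle_sub[of "f z" "f 0"] by (simp add: max_def)
      then have "cmod (f z) powr q \<le> (2 * max (cmod (f 0)) (cmod (f z - f 0))) powr q" using q by (intro powr_mono2) auto
      also have "\<dots> \<le> 2 powr q * (cmod (f 0) powr q + cmod (f z - f 0) powr q)"
        unfolding powr_mult by (intro mult_left_mono) (auto simp: max_def)
      finally have "cmod (f z) powr q * v z \<le> 2 powr q * (cmod (f 0) powr q + cmod (f z - f 0) powr q) * v z"
        using v0 by (intro mult_right_mono)
      then have "ennreal (cmod (f z) powr q * v z) \<le> ennreal (2 powr q) * (ennreal (cmod (f 0) powr q) * ennreal (v z) + ennreal (v z) * ennreal (cmod (f z - f 0) powr q))"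
        using v0 by (simp add: ennreal_mult'[symmetric] ennreal_mult''[symmetric] ennreal_plus[symmetric] ennreal_leI algebra_simps del: ennreal_plus)
      also have "\<dots> \<le> ennreal (2 powr q) * (ennreal (cmod (f 0) powr q) * ennreal (v z) + ennreal (v z) * (ennreal (C1 * bdist z powr (- \<epsilon>)) * (\<integral>\<^sup>+\<xi>\<in>cone z. g \<xi> \<partial>lborel)))"
        by (intro mult_left_mono add_left_mono pw z) auto
      also have "ennreal (v z) * (ennreal (C1 * bdist z powr (- \<epsilon>)) * (\<integral>\<^sup>+\<xi>\<in>cone z. g \<xi> \<partial>lborel)) = ennreal C1 * G z"
      proof -
        have "ennreal (C1 * bdist z powr (- \<epsilon>)) = ennreal C1 * ennreal (bdist z powr (- \<epsilon>))"
          using C1 by (intro ennreal_mult') simp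
        moreover have "ennreal (bdist z powr (- \<epsilon>) * v z) = ennreal (bdist z powr (- \<epsilon>)) * ennreal (v z)"
          by (intro ennreal_mult') simp
        ultimately show ?thesis unfolding G_def by (simp only: mult_ac)
      qed
      finally show ?thesis .
    qed (use regularD(3)[OF v(1)] in simp)
    have [measurable]: "(\<lambda>z. \<integral>\<^sup>+\<xi>\<in>cone z. g \<xi> \<partial>lborel) \<in> borel_measurable borel"
      unfolding cone_def by (rule measurable_cone_integral) measurable
    have [measurable]: "G \<in> borel_measurable borel" unfolding G_def by measurable
    have GI: "(\<integral>\<^sup>+z. G z \<partial>lborel) \<le> ennreal Ci * (\<integral>\<^sup>+z. ennreal (cmod (deriv f z) powr q * bdist z powr q * v z) \<partial>lborel)"
    proof -
      have "(\<integral>\<^sup>+z. G z \<partial>lborel) = (\<integral>\<^sup>+\<xi>. g \<xi> * (\<integral>\<^sup>+z\<in>ball \<xi> (3 * bdist \<xi>). ennreal (bdist z powr (- \<epsilon>) * v z) \<partial>lborel) \<partial>lborel)"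
        unfolding G_def cone_def by (rule tonelli_cone) measurable
      also have "\<dots> \<le> (\<integral>\<^sup>+\<xi>. ennreal Ci * ennreal (cmod (deriv f \<xi>) powr q * bdist \<xi> powr q * v \<xi>) \<partial>lborel)"
      proof (intro nn_integral_mono)
        fix \<xi>
        show "g \<xi> * (\<integral>\<^sup>+z\<in>ball \<xi> (3 * bdist \<xi>). ennreal (bdist z powr (- \<epsilon>) * v z) \<partial>lborel) \<le> ennreal Ci * ennreal (cmod (deriv f \<xi>) powr q * bdist \<xi> powr q * v \<xi>)"
        proof (cases "\<xi> \<in> unit_disk")
          case True
          have "g \<xi> * (\<integral>\<^sup>+z\<in>ball \<xi> (3 * bdist \<xi>). ennreal (bdist z powr (- \<epsilon>) * v z) \<partial>lborel) \<le> g \<xi> * ennreal (Ci * bdist \<xi> powr (2 - \<epsilon>) * v \<xi>)"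
            by (intro mult_left_mono improve True) simp
          also have "\<dots> = ennreal ((cmod (deriv f \<xi>) powr q * bdist \<xi> powr p) * (Ci * bdist \<xi> powr (2 - \<epsilon>) * v \<xi>))"
            using True v0 Ci by (simp add: g_def ennreal_mult'[symmetric])
          also have "(cmod (deriv f \<xi>) powr q * bdist \<xi> powr p) * (Ci * bdist \<xi> powr (2 - \<epsilon>) * v \<xi>) = Ci * (cmod (deriv f \<xi>) powr q * (bdist \<xi> powr p * bdist \<xi> powr (2 - \<epsilon>)) * v \<xi>)" by (simp only: mult_ac)
          also have "bdist \<xi> powr p * bdist \<xi> powr (2 - \<epsilon>) = bdist \<xi> powr q" unfolding powr_add[symmetric] by (simp add: p_def)
          finally show ?thesis using Ci by (simp add: ennreal_mult')
        qed (simp add: g_def)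
      qed
      also have "\<dots> = ennreal Ci * (\<integral>\<^sup>+z. ennreal (cmod (deriv f z) powr q * bdist z powr q * v z) \<partial>lborel)"
        using weighted_powr_measurable[OF df v(1), of "\<lambda>z. bdist z powr q" q] by (intro nn_integral_cmult) simp
      finally show ?thesis .
    qed
    define I where "I = (\<integral>\<^sup>+z. ennreal (cmod (deriv f z) powr q * bdist z powr q * v z) \<partial>lborel)"
    have "power_integral q v f \<le>
      (\<integral>\<^sup>+z. ennreal (2 powr q) * (ennreal (cmod (f 0) powr q) * ennreal (v z) + ennreal C1 * G z) \<partial>lborel)"
      by (intro nn_integral_mono pw2)
    also have "\<dots> = ennreal (2 powr q) * (ennreal (cmod (f 0) powr q) * ennreal V + ennreal C1 * (\<integral>\<^sup>+z. G z \<partial>lborel))"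
      by (simp add: nn_integral_cmult nn_integral_add V(2))
    also have "\<dots> \<le> ennreal (2 powr q) * (ennreal (cmod (f 0) powr q) * ennreal V + ennreal C1 * (ennreal Ci * I))"
      unfolding I_def by (intro mult_left_mono add_left_mono GI) auto
    also have "\<dots> \<le> ennreal (2 powr q) * (ennreal (1 + V + C1 * Ci) * (ennreal (cmod (f 0) powr q) + I))"
    proof (intro mult_left_mono)
      have "ennreal (cmod (f 0) powr q) * ennreal V \<le> ennreal (1 + V + C1 * Ci) * ennreal (cmod (f 0) powr q)"
        using V(1) C1 Ci by (subst mult.commute, intro mult_right_mono ennreal_leI) auto
      moreover have "ennreal C1 * (ennreal Ci * I) \<le> ennreal (1 + V + C1 * Ci) * I"
        using V(1) C1 Ci by (subst ennreal_mult_assoc) (auto intro!: mult_right_mono ennreal_leI)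
      ultimately show "ennreal (cmod (f 0) powr q) * ennreal V + ennreal C1 * (ennreal Ci * I) \<le> ennreal (1 + V + C1 * Ci) * (ennreal (cmod (f 0) powr q) + I)"
        unfolding distrib_left by (rule add_mono)
    qed simp
    also have "\<dots> = ennreal C * (ennreal (cmod (f 0) powr q) + I)"
      unfolding C_def by (rule ennreal_mult_assoc) simp
    finally show "power_integral q v f \<le> ennreal C * (ennreal (cmod (f 0) powr q) + (\<integral>\<^sup>+z. ennreal (cmod (deriv f z) powr q * bdist z powr q * v z) \<partial>lborel))"
      unfolding I_def .
  qed
qed

section \<open>The Littlewood--Paley estimates of arbitrary order\<close>

text \<open>The class of regular weights with disk control is stable under multiplication with powers of the
  distance to the circle, which makes the induction on the order possible.\<close>

lemma regular_bdist_powr: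
  assumes v: "regular A v" and p: "0 \<le> p"
  shows "regular (2 powr p * A) (\<lambda>z. bdist z powr p * v z)"
proof -
  have A: "1 \<le> A" using regularD(5)[OF v] .
  have [measurable]: "v \<in> borel_measurable borel" using regularD(2)[OF v] .
  have "slow (2 powr p * A) (\<lambda>z. bdist z powr p * v z)"
    unfolding slow_def
  proof (intro conjI ballI allI impI)
    have "1 \<le> 2 powr p" using p by (simp add: ge_one_powr_ge_zero)
    then show "1 \<le> 2 powr p * A" using A mult_mono[of 1 "2 powr p" 1 A] by simp
    fix z :: complex assume z: "z \<in> unit_disk"
    show "0 < bdist z powr p * v z" using z regularD(6)[OF v z] by (intro mult_pos_pos) auto
    fix \<xi> assume d: "dist z \<xi> \<le> bdist z / 2"
    then have c: "\<xi> \<in> cball z (bdist z / 2)" by simp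
    note h = half_ball_powr[OF z c, of p]
    have "bdist \<xi> powr p * v \<xi> \<le> (2 powr p * bdist z powr p) * (A * v z)"
      using h(2) p slowD(3)[OF regularD(1)[OF v] z d] regularD(4)[OF v] by (intro mult_mono) auto
    then show "bdist \<xi> powr p * v \<xi> \<le> 2 powr p * A * (bdist z powr p * v z)" by (simp only: mult_ac)
    have "bdist z powr p * v z \<le> (2 powr p * bdist \<xi> powr p) * (A * v \<xi>)"
      using h(1) p slowD(4)[OF regularD(1)[OF v] z d] regularD(4)[OF v] by (intro mult_mono) auto
    then show "bdist z powr p * v z \<le> 2 powr p * A * (bdist \<xi> powr p * v \<xi>)" by (simp only: mult_ac)
  qed
  then show ?thesis unfolding regular_def using regularD(3)[OF v] by simp
qed

lemma ball_carleson_bdist_powr: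
  assumes v: "regular A v" "ball_carleson v" and p: "0 \<le> p"
  shows "ball_carleson (\<lambda>z. bdist z powr p * v z)"
proof -
  obtain C where C: "0 \<le> C" "\<And>z. z \<in> unit_disk \<Longrightarrow>
     mass v (ball z (3 * bdist z)) \<le> ennreal (C * (bdist z)\<^sup>2 * v z)"
    using v(2) unfolding ball_carleson_def by blast
  have [measurable]: "v \<in> borel_measurable borel" using regularD(2)[OF v(1)] .
  have v0: "0 \<le> v z" for z using regularD(4)[OF v(1)] .
  show ?thesis
    unfolding ball_carleson_def
  proof (intro exI conjI ballI)
    show "0 \<le> 4 powr p * C" using C by simp
    fix z :: complex assume z: "z \<in> unit_disk"
    have "(\<integral>\<^sup>+\<xi>\<in>ball z (3 * bdist z). ennreal (bdist \<xi> powr p * v \<xi>) \<partial>lborel) \<le>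
      (\<integral>\<^sup>+\<xi>. ennreal (4 powr p * bdist z powr p) * (ennreal (v \<xi>) * indicator (ball z (3 * bdist z)) \<xi>) \<partial>lborel)"
    proof (intro nn_integral_mono)
      fix \<xi>
      show "ennreal (bdist \<xi> powr p * v \<xi>) * indicator (ball z (3 * bdist z)) \<xi> \<le> ennreal (4 powr p * bdist z powr p) * (ennreal (v \<xi>) * indicator (ball z (3 * bdist z)) \<xi>)"
      proof (cases "\<xi> \<in> unit_disk \<and> \<xi> \<in> ball z (3 * bdist z)")
        case True
        then have "0 \<le> bdist \<xi>" "bdist \<xi> \<le> 4 * bdist z" using bdist_ge[of \<xi> z] by (auto simp: dist_commute)
        then have "bdist \<xi> powr p \<le> (4 * bdist z) powr p" using p by (intro powr_mono2) auto
        also have "\<dots> = 4 powr p * bdist z powr p" by (rule powr_mult)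
        finally have "bdist \<xi> powr p * v \<xi> \<le> 4 powr p * bdist z powr p * v \<xi>" using v0 by (intro mult_right_mono)
        then show ?thesis using True by (simp add: ennreal_mult'[symmetric] ennreal_leI)
      next
        case False
        then show ?thesis using regularD(3)[OF v(1), of \<xi>] by (cases "\<xi> \<in> unit_disk") auto
      qed
    qed
    also have "\<dots> = ennreal (4 powr p * bdist z powr p) * mass v (ball z (3 * bdist z))"
      by (rule nn_integral_cmult) measurable
    also have "\<dots> \<le> ennreal (4 powr p * bdist z powr p) * ennreal (C * (bdist z)\<^sup>2 * v z)"
      by (intro mult_left_mono C(2) z) simp
    also have "\<dots> = ennreal (4 powr p * C * (bdist z)\<^sup>2 * (bdist z powr p * v z))"
      by (subst ennreal_mult'[symmetric]) (simp, simp only: mult_ac)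
    finally show "(\<integral>\<^sup>+\<xi>\<in>ball z (3 * bdist z). ennreal (bdist \<xi> powr p * v \<xi>) \<partial>lborel) \<le> ennreal (4 powr p * C * (bdist z)\<^sup>2 * (bdist z powr p * v z))" .
  qed
qed

lemma holomorphic_higher_deriv_disk: "f holomorphic_on unit_disk \<Longrightarrow> (deriv ^^ n) f holomorphic_on unit_disk"
  by (rule holomorphic_higher_deriv) auto

lemma bdist_powr_weight_Suc:
  "ennreal (cmod (g z) powr q * bdist z powr q * (bdist z powr (q * real n) * v z)) = ennreal (cmod (g z) powr q * bdist z powr (q * real (Suc n)) * v z)"
proof -
  have "bdist z powr q * bdist z powr (q * real n) = bdist z powr (q * real (Suc n))"
    unfolding powr_add[symmetric] by (simp add: algebra_simps)
  then show ?thesis by (simp only: mult.assoc flip: mult.assoc[of "bdist z powr q"])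
qed

lemma bdist_powr_weight_0:
  assumes "regular A v"
  shows "ennreal (cmod (g z) powr q * bdist z powr (q * real 0) * v z) = ennreal (cmod (g z) powr q * v z)"
  using regularD(3)[OF assms, of z] by (cases "z \<in> unit_disk") auto

lemma littlewood_paley_upper:
  assumes v: "regular A v" "ball_carleson v" and q: "0 < q"
  obtains C where "0 < C" "\<And>f. f holomorphic_on unit_disk \<Longrightarrow>
    power_integral q v f \<le>
      ennreal C * ((\<Sum>j<n. ennreal (cmod ((deriv ^^ j) f 0) powr q)) +
        deriv_integral n q v f)"
proof -
  have "\<exists>C>0. \<forall>f. f holomorphic_on unit_disk \<longrightarrow>
    power_integral q v f \<le>
      ennreal C * ((\<Sum>j<n. ennreal (cmod ((deriv ^^ j) f 0) powr q)) +
        deriv_integral n q v f)"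
  proof (induction n)
    case 0
    show ?case unfolding bdist_powr_weight_0[OF v(1)] by (intro exI[of _ 1]) simp
  next
    case (Suc n)
    then obtain C where C: "0 < C" and IH: "\<And>f. f holomorphic_on unit_disk \<Longrightarrow>
      power_integral q v f \<le>
        ennreal C * ((\<Sum>j<n. ennreal (cmod ((deriv ^^ j) f 0) powr q)) +
          deriv_integral n q v f)"
      by blast
    have p: "0 \<le> q * real n" using q by simp
    obtain C' where C': "0 < C'" and up: "\<And>f. f holomorphic_on unit_disk \<Longrightarrow>
      (\<integral>\<^sup>+z. ennreal (cmod (f z) powr q * (bdist z powr (q * real n) * v z)) \<partial>lborel) \<le>
      ennreal C' * (ennreal (cmod (f 0) powr q) + (\<integral>\<^sup>+z. ennreal (cmod (deriv f z) powr q * bdist z powr q * (bdist z powr (q * real n) * v z)) \<partial>lborel))"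
      by (rule integral_le_derivative_integral[OF regular_bdist_powr[OF v(1) p] ball_carleson_bdist_powr[OF v p] q]) (rule that; blast)
    show ?case
    proof (intro exI[of _ "C * (1 + C')"] conjI allI impI)
      show "0 < C * (1 + C')" using C C' by simp
      fix f assume f: "f holomorphic_on unit_disk"
      define S where "S = (\<Sum>j<n. ennreal (cmod ((deriv ^^ j) f 0) powr q))"
      define a where "a = ennreal (cmod ((deriv ^^ n) f 0) powr q)"
      define I where "I = deriv_integral (Suc n) q v f"
      have "deriv_integral n q v f \<le> ennreal C' * (a + I)"
        using up[OF holomorphic_higher_deriv_disk[OF f, of n]] unfolding bdist_powr_weight_Suc a_def I_def by (simp add: mult.assoc)
      then have "power_integral q v f \<le> ennreal C * (S + ennreal C' * (a + I))"
        using IH[OF f] unfolding S_def by (meson add_left_mono mult_left_mono order_trans zero_le)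
      also have "\<dots> \<le> ennreal C * (ennreal (1 + C') * S + ennreal (1 + C') * (a + I))"
      proof (intro mult_left_mono add_mono)
        show "S \<le> ennreal (1 + C') * S" using mult_right_mono[of 1 "ennreal (1 + C')" S] C' by simp
        show "ennreal C' * (a + I) \<le> ennreal (1 + C') * (a + I)" using C' by (intro mult_right_mono ennreal_leI) auto
      qed simp
      also have "\<dots> = ennreal (C * (1 + C')) * ((\<Sum>j<Suc n. ennreal (cmod ((deriv ^^ j) f 0) powr q)) + I)"
        unfolding distrib_left[symmetric] using C by (subst ennreal_mult_assoc) (auto simp: S_def a_def add.assoc)
      finally show "power_integral q v f \<le>
        ennreal (C * (1 + C')) * ((\<Sum>j<Suc n. ennreal (cmod ((deriv ^^ j) f 0) powr q)) +
          deriv_integral (Suc n) q v f)"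
        unfolding I_def .
    qed
  qed
  then show ?thesis using that by blast
qed

lemma littlewood_paley_lower:
  assumes v: "regular A v" and q: "0 < q"
  obtains C where "0 < C" "\<And>f. f holomorphic_on unit_disk \<Longrightarrow>
    deriv_integral n q v f \<le>
      ennreal C * power_integral q v f"
proof -
  have "\<exists>C>0. \<forall>f. f holomorphic_on unit_disk \<longrightarrow>
    deriv_integral n q v f \<le>
      ennreal C * power_integral q v f"
  proof (induction n)
    case 0
    show ?case unfolding bdist_powr_weight_0[OF v] by (intro exI[of _ 1]) simp
  next
    case (Suc n)
    then obtain C where C: "0 < C" and IH: "\<And>f. f holomorphic_on unit_disk \<Longrightarrow>
      deriv_integral n q v f \<le>
      ennreal C * power_integral q v f"
      by blast
    have p: "0 \<le> q * real n" using q by simp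
    obtain C' where C': "0 < C'" and low: "\<And>f. f holomorphic_on unit_disk \<Longrightarrow>
      (\<integral>\<^sup>+z. ennreal (cmod (deriv f z) powr q * bdist z powr q * (bdist z powr (q * real n) * v z)) \<partial>lborel) \<le>
      ennreal C' * (\<integral>\<^sup>+z. ennreal (cmod (f z) powr q * (bdist z powr (q * real n) * v z)) \<partial>lborel)"
      by (rule derivative_integral_le[OF regular_bdist_powr[OF v p] q]) (rule that; blast)
    show ?case
    proof (intro exI[of _ "C' * C"] conjI allI impI)
      show "0 < C' * C" using C C' by simp
      fix f assume f: "f holomorphic_on unit_disk"
      have "deriv_integral (Suc n) q v f
        \<le> ennreal C' * deriv_integral n q v f"
        using low[OF holomorphic_higher_deriv_disk[OF f, of n]] unfolding bdist_powr_weight_Suc by (simp add: mult.assoc)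
      also have "\<dots> \<le> ennreal C' * (ennreal C * power_integral q v f)"
        by (intro mult_left_mono IH f) simp
      also have "\<dots> = ennreal (C' * C) * power_integral q v f"
        using C' by (intro ennreal_mult_assoc) simp
      finally show "deriv_integral (Suc n) q v f
        \<le> ennreal (C' * C) * power_integral q v f" .
    qed
  qed
  then show ?thesis using that by blast
qed

text \<open>The bound for the value at 0, applied to the \<open>j\<close>-th derivative and the weight
  \<open>bdist z powr (q * j) * v z\<close>.\<close>

lemma coefficient_le:
  assumes v: "regular A v" and q: "0 < q"
  obtains C where "0 < C" "\<And>f. f holomorphic_on unit_disk \<Longrightarrow>
    ennreal (cmod ((deriv ^^ j) f 0) powr q) \<le> ennreal C * power_integral q v f"
proof -
  have p: "0 \<le> q * real j" using q by simp
  obtain C where C: "0 < C" and at0: "\<And>f. f holomorphic_on unit_disk \<Longrightarrow>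
    ennreal (cmod (f 0) powr q) \<le> ennreal C * (\<integral>\<^sup>+z. ennreal (cmod (f z) powr q * (bdist z powr (q * real j) * v z)) \<partial>lborel)"
    by (rule value_at_0_le[OF regular_bdist_powr[OF v p] q]) (rule that; blast)
  obtain C' where C': "0 < C'" and low: "\<And>f. f holomorphic_on unit_disk \<Longrightarrow>
    deriv_integral j q v f \<le>
      ennreal C' * power_integral q v f"
    by (rule littlewood_paley_lower[OF v q]) (rule that; blast)
  show ?thesis
  proof (rule that[of "C * C'"])
    show "0 < C * C'" using C C' by simp
    fix f assume f: "f holomorphic_on unit_disk"
    have "ennreal (cmod ((deriv ^^ j) f 0) powr q) \<le> ennreal C * deriv_integral j q v f"
      using at0[OF holomorphic_higher_deriv_disk[OF f, of j]] by (simp add: mult.assoc)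
    also have "\<dots> \<le> ennreal C * (ennreal C' * power_integral q v f)"
      by (intro mult_left_mono low f) simp
    also have "\<dots> = ennreal (C * C') * power_integral q v f"
      using C by (intro ennreal_mult_assoc) simp
    finally show "ennreal (cmod ((deriv ^^ j) f 0) powr q) \<le> ennreal (C * C') * power_integral q v f" .
  qed
qed

lemma ennpowr_ennreal: "0 \<le> r \<Longrightarrow> ennpowr (ennreal r) a = ennreal (r powr a)"
  by (simp add: ennpowr_def)

lemma ennpowr_top [simp]: "ennpowr top a = top"
  by (simp add: ennpowr_def)

lemma ennpowr_mono:
  assumes "x \<le> y" "0 < a"
  shows "ennpowr x a \<le> ennpowr y a"
proof (cases "y = \<infinity>")
  case False
  then obtain s where s: "y = ennreal s" "0 \<le> s" by (cases y) auto
  then obtain r where r: "x = ennreal r" "0 \<le> r" using assms(1) by (cases x) (auto simp: top_unique)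
  then show ?thesis using s assms by (simp add: ennpowr_ennreal ennreal_leI powr_mono2)
qed (simp add: ennpowr_def)

lemma ennpowr_cmult:
  assumes "0 < c"
  shows "ennpowr (ennreal c * x) a = ennreal (c powr a) * ennpowr x a"
proof (cases x)
  case (real r)
  then show ?thesis using assms by (simp add: ennreal_mult'[symmetric] ennpowr_ennreal powr_mult)
next
  case top
  then show ?thesis using assms by (simp add: ennreal_mult_top ennpowr_def)
qed

text \<open>Estimates of \<open>q\<close>-th powers are turned into estimates of norms, with the same constant on both sides. No triangle
  inequality is available for \<open>q < 1\<close>; each summand is compared with the total instead.\<close>

lemma norm_equivalence_roots:
  fixes X Y :: ennreal and s :: "nat \<Rightarrow> real"
  assumes q: "0 < q" and s: "\<And>j. 0 \<le> s j" and C: "1 \<le> C"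
    and up: "X \<le> ennreal C * ((\<Sum>j<n. ennreal (s j powr q)) + Y)"
    and low: "Y \<le> ennreal C * X" and coeff: "\<And>j. j < n \<Longrightarrow> ennreal (s j powr q) \<le> ennreal C * X"
    and K: "K = (real n + 1) * (C * (real n + 1)) powr (1 / q)"
  shows "ennreal (inverse K) * (ennreal (\<Sum>j<n. s j) + ennpowr Y (1 / q)) \<le> ennpowr X (1 / q)"
    "ennpowr X (1 / q) \<le> ennreal K * (ennreal (\<Sum>j<n. s j) + ennpowr Y (1 / q))"
proof -
  define P where "P x = ennpowr x (1 / q)" for x
  have a: "0 < 1 / q" using q by simp
  have Ps: "P (ennreal (s j powr q)) = ennreal (s j)" for j
    using q s by (simp add: P_def ennpowr_ennreal powr_powr)
  define c where "c = C powr (1 / q)"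
  have c: "1 \<le> c" using C q by (simp add: c_def ge_one_powr_ge_zero)
  define m where "m = (C * (real n + 1)) powr (1 / q)"
  have cm: "c \<le> m" unfolding c_def m_def using C q by (intro powr_mono2) auto
  have K': "K = (real n + 1) * m" using K by (simp add: m_def)
  have Kpos: "0 < K" unfolding K' using c cm by (intro mult_pos_pos) auto
  have PC: "P (ennreal C * X) = ennreal c * P X" using C by (simp add: P_def ennpowr_cmult c_def)
  have PY: "P Y \<le> ennreal c * P X" unfolding PC[symmetric] unfolding P_def by (rule ennpowr_mono[OF low a])
  have sj: "ennreal (s j) \<le> ennreal c * P X" if "j < n" for j
    unfolding PC[symmetric] Ps[symmetric] unfolding P_def by (rule ennpowr_mono[OF coeff[OF that] a])
  have "ennreal (\<Sum>j<n. s j) = (\<Sum>j<n. ennreal (s j))" using s by (simp add: sum_ennreal)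
  also have "\<dots> \<le> (\<Sum>j<n. ennreal c * P X)" by (intro sum_mono sj) simp
  finally have "ennreal (\<Sum>j<n. s j) \<le> of_nat n * (ennreal c * P X)" by simp
  with PY have "ennreal (\<Sum>j<n. s j) + P Y \<le> of_nat n * (ennreal c * P X) + 1 * (ennreal c * P X)"
    by (simp add: add_mono)
  also have "\<dots> = ennreal ((real n + 1) * c) * P X"
    unfolding distrib_right[symmetric] using c by (simp add: ennreal_mult' mult.assoc ennreal_of_nat_eq_real_of_nat)
  also have "\<dots> \<le> ennreal K * P X"
    unfolding K' using cm by (intro mult_right_mono ennreal_leI mult_left_mono) auto
  finally have le: "ennreal (\<Sum>j<n. s j) + P Y \<le> ennreal K * P X" .
  have "ennreal (inverse K) * (ennreal (\<Sum>j<n. s j) + P Y) \<le> ennreal (inverse K) * (ennreal K * P X)"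
    by (intro mult_left_mono le) simp
  also have "\<dots> = P X" using Kpos by (subst ennreal_mult_assoc) auto
  finally show "ennreal (inverse K) * (ennreal (\<Sum>j<n. s j) + ennpowr Y (1 / q)) \<le> ennpowr X (1 / q)"
    unfolding P_def .
  show "ennpowr X (1 / q) \<le> ennreal K * (ennreal (\<Sum>j<n. s j) + ennpowr Y (1 / q))"
  proof (cases "ennpowr Y (1 / q) = \<infinity>")
    case True
    then show ?thesis using Kpos by (simp add: ennreal_mult_top)
  next
    case False
    then have "Y \<noteq> \<infinity>" by auto
    then obtain y where y: "Y = ennreal y" "0 \<le> y" by (cases Y) auto
    define Z where "Z = (\<Sum>j<n. s j) + y powr (1 / q)"
    have S: "0 \<le> (\<Sum>j<n. s j)" using s by (simp add: sum_nonneg)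
    have Z: "0 \<le> Z" using S by (simp add: Z_def)
    have "s j powr q \<le> Z powr q" if "j < n" for j
    proof -
      have "s j \<le> (\<Sum>j<n. s j)" using that s by (intro member_le_sum) auto
      then have "s j \<le> Z" by (simp add: Z_def add_increasing2)
      then show ?thesis using q s by (intro powr_mono2) auto
    qed
    then have "(\<Sum>j<n. s j powr q) \<le> real n * Z powr q" using sum_bounded_above[of "{..<n}" "\<lambda>j. s j powr q" "Z powr q"] by simp
    moreover have "y \<le> Z powr q"
    proof -
      have "(y powr (1 / q)) powr q \<le> Z powr q" using S q by (intro powr_mono2) (auto simp: Z_def)
      then show ?thesis using y q by (simp add: powr_powr)
    qed
    ultimately have le: "C * ((\<Sum>j<n. s j powr q) + y) \<le> C * (real n + 1) * Z powr q"
      using C mult_left_mono[of "(\<Sum>j<n. s j powr q) + y" "(real n + 1) * Z powr q" C] by (simp add: algebra_simps)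
    have "X \<le> ennreal (C * ((\<Sum>j<n. s j powr q) + y))"
      using up C y(2) unfolding y(1) by (simp add: sum_ennreal ennreal_mult' ennreal_plus sum_nonneg)
    also have "\<dots> \<le> ennreal (C * (real n + 1)) * ennreal (Z powr q)"
      using le C by (simp add: ennreal_mult'[symmetric] ennreal_leI)
    finally have "ennpowr X (1 / q) \<le> ennpowr (ennreal (C * (real n + 1)) * ennreal (Z powr q)) (1 / q)"
      using a by (rule ennpowr_mono)
    also have "\<dots> = ennreal m * ennreal Z"
      using C q Z by (simp add: ennpowr_cmult ennpowr_ennreal powr_powr m_def add_pos_nonneg)
    also have "\<dots> \<le> ennreal K * ennreal Z"
    proof (intro mult_right_mono ennreal_leI)
      show "m \<le> K" unfolding K' using c cm by (simp add: algebra_simps)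
    qed simp
    also have "ennreal Z = ennreal (\<Sum>j<n. s j) + ennpowr Y (1 / q)"
      using S y by (simp add: Z_def ennpowr_ennreal)
    finally show ?thesis .
  qed
qed

section \<open>The norm equivalence and disk control\<close>

text \<open>Integrals against \<open>w\<close> with respect to the completed measure and integrals against a comparable Borel
  weight \<open>v\<close> bound each other.\<close>

lemma weighted_integral_comparable:
  assumes A: "1 \<le> A" and cmp: "\<And>z. z \<in> unit_disk \<Longrightarrow> w z \<le> v z" "\<And>z. z \<in> unit_disk \<Longrightarrow> v z \<le> A * w z"
    and v: "\<And>z. z \<notin> unit_disk \<Longrightarrow> v z = 0" and F: "\<And>z. 0 \<le> F z"
    and meas: "(\<lambda>z. ennreal (F z * v z)) \<in> borel_measurable borel"
  shows "(\<integral>\<^sup>+z\<in>unit_disk. ennreal (F z * w z) \<partial>lebesgue) \<le> (\<integral>\<^sup>+z. ennreal (F z * v z) \<partial>lborel)"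
    "(\<integral>\<^sup>+z. ennreal (F z * v z) \<partial>lborel) \<le> ennreal A * (\<integral>\<^sup>+z\<in>unit_disk. ennreal (F z * w z) \<partial>lebesgue)"
proof -
  have "(\<integral>\<^sup>+z\<in>unit_disk. ennreal (F z * w z) \<partial>lebesgue) \<le> (\<integral>\<^sup>+z. ennreal (F z * v z) \<partial>lebesgue)"
    using cmp(1) F by (intro nn_integral_mono) (auto simp: indicator_def ennreal_leI mult_left_mono)
  then show "(\<integral>\<^sup>+z\<in>unit_disk. ennreal (F z * w z) \<partial>lebesgue) \<le> (\<integral>\<^sup>+z. ennreal (F z * v z) \<partial>lborel)"
    by (simp add: nn_integral_completion)
  have "ennreal (1 / A) * (\<integral>\<^sup>+z. ennreal (F z * v z) \<partial>lborel) = (\<integral>\<^sup>+z. ennreal (1 / A) * ennreal (F z * v z) \<partial>lebesgue)"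
    unfolding nn_integral_completion using meas by (intro nn_integral_cmult[symmetric]) simp
  also have "\<dots> \<le> (\<integral>\<^sup>+z\<in>unit_disk. ennreal (F z * w z) \<partial>lebesgue)"
  proof (intro nn_integral_mono)
    fix z
    show "ennreal (1 / A) * ennreal (F z * v z) \<le> ennreal (F z * w z) * indicator unit_disk z"
    proof (cases "z \<in> unit_disk")
      case True
      have "1 / A * (F z * v z) \<le> 1 / A * (F z * (A * w z))"
        using cmp(2)[OF True] F[of z] A by (intro mult_left_mono) auto
      then show ?thesis using True A by (simp add: ennreal_mult'[symmetric] ennreal_leI)
    qed (use v in simp)
  qed
  finally have "ennreal A * (ennreal (1 / A) * (\<integral>\<^sup>+z. ennreal (F z * v z) \<partial>lborel)) \<le> ennreal A * (\<integral>\<^sup>+z\<in>unit_disk. ennreal (F z * w z) \<partial>lebesgue)"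
    by (intro mult_left_mono) auto
  then show "(\<integral>\<^sup>+z. ennreal (F z * v z) \<partial>lborel) \<le> ennreal A * (\<integral>\<^sup>+z\<in>unit_disk. ennreal (F z * w z) \<partial>lebesgue)"
    using A by (simp add: ennreal_mult_assoc)
qed

lemma ball_carleson_imp_norm_equivalence:
  assumes v: "regular B v" "ball_carleson v" and A: "1 \<le> A"
    and cmp: "\<And>z. z \<in> unit_disk \<Longrightarrow> w z \<le> v z" "\<And>z. z \<in> unit_disk \<Longrightarrow> v z \<le> A * w z"
    and q: "0 < q"
  shows "\<exists>C>0. \<forall>f. f analytic_on unit_disk \<longrightarrow>
        (let X = Lq_norm q w f;
             Y = ennreal (\<Sum>j<n. cmod ((deriv ^^ j) f 0)) +
                 ennpowr (\<integral>\<^sup>+z\<in>unit_disk. ennreal (cmod ((deriv ^^ n) f z) powr q *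
                   (1 - cmod z) powr (q * real n) * w z) \<partial>lebesgue) (1 / q)
         in ennreal (inverse C) * Y \<le> X \<and> X \<le> ennreal C * Y)"
proof -
  obtain C1 where C1: "0 < C1" and up: "\<And>f. f holomorphic_on unit_disk \<Longrightarrow>
    power_integral q v f \<le>
      ennreal C1 * ((\<Sum>j<n. ennreal (cmod ((deriv ^^ j) f 0) powr q)) +
        deriv_integral n q v f)"
    by (rule littlewood_paley_upper[OF v q]) (rule that; blast)
  obtain C2 where C2: "0 < C2" and low: "\<And>f. f holomorphic_on unit_disk \<Longrightarrow>
    deriv_integral n q v f \<le>
      ennreal C2 * power_integral q v f"
    by (rule littlewood_paley_lower[OF v(1) q]) (rule that; blast)
  have "\<exists>c. \<forall>j. 0 < c j \<and> (\<forall>f. f holomorphic_on unit_disk \<longrightarrow>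
    ennreal (cmod ((deriv ^^ j) f 0) powr q) \<le> ennreal (c j) * power_integral q v f)"
  proof (intro choice allI)
    fix j
    show "\<exists>c>0. \<forall>f. f holomorphic_on unit_disk \<longrightarrow>
      ennreal (cmod ((deriv ^^ j) f 0) powr q) \<le> ennreal c * power_integral q v f"
      by (rule coefficient_le[OF v(1) q, of j]) blast
  qed
  then obtain c where c: "\<And>j. 0 < c j" and coeff: "\<And>j f. f holomorphic_on unit_disk \<Longrightarrow>
    ennreal (cmod ((deriv ^^ j) f 0) powr q) \<le> ennreal (c j) * power_integral q v f"
    by blast
  define S where "S = (\<Sum>j<n. c j)"
  have S: "0 \<le> S" using c by (simp add: S_def sum_nonneg less_imp_le)
  define D where "D = 1 + C1 + C2 + S"
  have D: "C1 \<le> D" "C2 \<le> D" "1 \<le> D" using C1 C2 S by (auto simp: D_def)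
  have cD: "c j \<le> D" if "j < n" for j
  proof -
    have "c j \<le> S" unfolding S_def using that c by (intro member_le_sum) (auto simp: less_imp_le)
    then show ?thesis using C1 C2 by (simp add: D_def)
  qed
  define C where "C = D * A"
  have C: "1 \<le> C" unfolding C_def using D A mult_mono[of 1 D 1 A] by simp
  define K where "K = (real n + 1) * (C * (real n + 1)) powr (1 / q)"
  have K: "0 < K" using C by (simp add: K_def add_nonneg_pos)
  show ?thesis
  proof (intro exI[of _ K] conjI allI impI K)
    fix f assume "f analytic_on unit_disk"
    then have f: "f holomorphic_on unit_disk" by (rule analytic_imp_holomorphic)
    note fn = holomorphic_higher_deriv_disk[OF f, of n]
    define X where "X = (\<integral>\<^sup>+z\<in>unit_disk. ennreal (cmod (f z) powr q * w z) \<partial>lebesgue)"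
    define Y where "Y = (\<integral>\<^sup>+z\<in>unit_disk. ennreal (cmod ((deriv ^^ n) f z) powr q * bdist z powr (q * real n) * w z) \<partial>lebesgue)"
    define X' where "X' = power_integral q v f"
    define Y' where "Y' = deriv_integral n q v f"
    have X: "X \<le> X'" "X' \<le> ennreal A * X"
      unfolding X_def X'_def
      using weighted_powr_measurable[OF f v(1), of "\<lambda>_. 1" q]
      by (intro weighted_integral_comparable[of A w v "\<lambda>z. cmod (f z) powr q", OF A cmp regularD(3)[OF v(1)]]; simp)+
    have Y: "Y \<le> Y'" "Y' \<le> ennreal A * Y"
      unfolding Y_def Y'_def
      using weighted_powr_measurable[OF fn v(1), of "\<lambda>z. bdist z powr (q * real n)" q]
      by (intro weighted_integral_comparable[of A w v "\<lambda>z. cmod ((deriv ^^ n) f z) powr q * bdist z powr (q * real n)", OF A cmp regularD(3)[OF v(1)]]; simp)+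
    define s where "s j = cmod ((deriv ^^ j) f 0)" for j
    define T where "T = (\<Sum>j<n. ennreal (s j powr q))"
    have "X \<le> ennreal C1 * (T + Y')"
      using order_trans[OF X(1)] up[OF f] unfolding X'_def Y'_def T_def s_def by blast
    also have "\<dots> \<le> ennreal D * (ennreal A * T + ennreal A * Y)"
      using D A Y(2) mult_right_mono[of 1 "ennreal A" T]
      by (intro mult_mono add_mono ennreal_leI) auto
    also have "\<dots> = ennreal C * (T + Y)"
      unfolding distrib_left[symmetric] C_def using D by (intro ennreal_mult_assoc) simp
    finally have 1: "X \<le> ennreal C * (T + Y)" .
    have XC: "ennreal D * X' \<le> ennreal C * X"
    proof -
      have "ennreal D * X' \<le> ennreal D * (ennreal A * X)" by (intro mult_left_mono X) simp
      also have "\<dots> = ennreal C * X" unfolding C_def using D by (intro ennreal_mult_assoc) simp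
      finally show ?thesis .
    qed
    have "Y \<le> ennreal C2 * X'" using order_trans[OF Y(1)] low[OF f] unfolding X'_def Y'_def by blast
    also have "\<dots> \<le> ennreal D * X'" using D by (intro mult_right_mono ennreal_leI) auto
    finally have 2: "Y \<le> ennreal C * X" using XC by (rule order_trans)
    have 3: "ennreal (s j powr q) \<le> ennreal C * X" if "j < n" for j
    proof -
      have "ennreal (s j powr q) \<le> ennreal (c j) * X'" unfolding s_def X'_def by (rule coeff[OF f])
      also have "\<dots> \<le> ennreal D * X'" using cD[OF that] by (intro mult_right_mono ennreal_leI) auto
      finally show ?thesis using XC by (rule order_trans)
    qed
    note eq = norm_equivalence_roots[OF q _ C 1[unfolded T_def] 2 3 K_def]
    show "let X = Lq_norm q w f;
             Y = ennreal (\<Sum>j<n. cmod ((deriv ^^ j) f 0)) +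
                 ennpowr (\<integral>\<^sup>+z\<in>unit_disk. ennreal (cmod ((deriv ^^ n) f z) powr q *
                   (1 - cmod z) powr (q * real n) * w z) \<partial>lebesgue) (1 / q)
         in ennreal (inverse K) * Y \<le> X \<and> X \<le> ennreal K * Y"
      unfolding Let_def Lq_norm_def X_def[symmetric] Y_def[symmetric] s_def[symmetric]
      using eq by (simp add: s_def)
  qed
qed

text \<open>Disk control from the norm estimate with \<open>q = n = 1\<close>, tested on \<open>f z = inverse ((1 - cnj a * z) ^ N)\<close>.
  Put \<open>k z = cmod (1 - cnj z * a)\<close>. Where \<open>bdist z < e * k z\<close> the integrand \<open>cmod (deriv f z) * bdist z * v z\<close>
  is so small that, even after multiplication by \<open>C\<close>, it is at most half of \<open>cmod (f z) * v z\<close>. Elsewhere \<open>z\<close> has depth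
  comparable to \<open>k z\<close>, so \<open>slow_growth\<close> bounds \<open>v z\<close> by a power of \<open>k z / bdist a\<close> times \<open>v a\<close>; the exponent
  \<open>N \<ge> \<kappa> + 3\<close> makes the resulting kernel integrable.\<close>

lemma derivative_bound_imp_ball_carleson:
  assumes v: "regular A v" and C: "0 < C"
    and est: "\<And>f. f holomorphic_on unit_disk \<Longrightarrow>
      (\<integral>\<^sup>+z. ennreal (cmod (f z) * v z) \<partial>lborel) \<le>
        ennreal C * (ennreal (cmod (f 0)) + (\<integral>\<^sup>+z. ennreal (cmod (deriv f z) * bdist z * v z) \<partial>lborel))"
  shows "ball_carleson v"
proof -
  obtain \<kappa> C2 where \<kappa>: "0 \<le> \<kappa>" and C2: "1 \<le> C2" and gr: "\<And>z \<xi> R. z \<in> unit_disk \<Longrightarrow> \<xi> \<in> unit_disk \<Longrightarrow> dist z \<xi> \<le> R \<Longrightarrow> bdist z \<le> R \<Longrightarrow> bdist \<xi> \<le> R \<Longrightarrow>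
      v \<xi> \<le> C2 * (R / bdist z) powr \<kappa> * (R / bdist \<xi>) powr \<kappa> * v z"
    by (rule slow_growth[OF regularD(1)[OF v]]) (rule that; blast)
  have [measurable]: "v \<in> borel_measurable borel" using regularD(2)[OF v] .
  have v0: "0 \<le> v z" for z using regularD(4)[OF v] .
  have v00: "0 < v 0" using regularD(6)[OF v, of 0] by simp
  have vout: "v z = 0" if "z \<notin> unit_disk" for z using regularD(3)[OF v that] .
  obtain N :: nat where N: "\<kappa> + 3 \<le> real N" using real_arch_simple by blast
  have N0: "0 < real N" using N \<kappa> by linarith
  define e where "e = 1 / (2 * C * N)"
  have e: "0 < e" "C * N * e = 1 / 2" using C N0 by (auto simp: e_def)
  \<comment> \<open>the estimate for \<open>f = 1\<close> shows that the total mass is finite\<close>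
  obtain V where V: "0 \<le> V" "(\<integral>\<^sup>+z. ennreal (v z) \<partial>lborel) \<le> ennreal V"
  proof -
    have "(\<integral>\<^sup>+z. ennreal (cmod 1 * v z) \<partial>lborel) \<le> ennreal C * (ennreal (cmod 1) + (\<integral>\<^sup>+z. ennreal (cmod (deriv (\<lambda>_. 1) z) * bdist z * v z) \<partial>lborel))"
      by (rule est) simp
    then show ?thesis using that[of C] C by simp
  qed
  define E1 where "E1 = C * N * C2 * (1 / e) powr \<kappa>"
  have E1: "0 \<le> E1" using C C2 by (simp add: E1_def)
  define E where "E = 2 * C * (C2 / v 0) + 32 * pi * E1"
  have E: "0 \<le> E" using C C2 v00 E1 by (simp add: E_def)
  show ?thesis
    unfolding ball_carleson_def
  proof (intro exI conjI ballI)
    show "0 \<le> 5 ^ N * E" using E by simp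
    fix a :: complex assume a: "a \<in> unit_disk"
    define h where "h = bdist a"
    have h: "0 < h" "h \<le> 1" using a by (auto simp: h_def)
    have va: "0 < v a" using regularD(6)[OF v a] .
    define k where "k z = cmod (1 - cnj z * a)" for z
    have kz: "h \<le> k z" "dist a z \<le> k z" "k z \<le> 2 * h + dist a z" "bdist z \<le> k z" "0 < k z" if "z \<in> unit_disk" for z
      using kernel_bounds[OF a that] h by (auto simp: k_def h_def)
    have kconj: "cmod (1 - cnj a * z) = k z" for z
    proof -
      have "cnj (1 - cnj a * z) = 1 - cnj z * a" by (simp add: mult.commute)
      then show ?thesis unfolding k_def by (metis complex_mod_cnj)
    qed
    define f where "f z = inverse ((1 - cnj a * z) ^ N)" for z
    have nz: "1 - cnj a * z \<noteq> 0" if "z \<in> unit_disk" for z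
      using kconj[of z] kz(5)[OF that] by auto
    have df: "(f has_field_derivative (of_nat N * cnj a * inverse ((1 - cnj a * z) ^ Suc N))) (at z)" if "z \<in> unit_disk" for z
    proof -
      have "((\<lambda>z. (1 - cnj a * z) ^ N) has_field_derivative (of_nat N * (1 - cnj a * z) ^ (N - 1) * (- cnj a))) (at z)"
        by (auto intro!: derivative_eq_intros)
      then have "(f has_field_derivative - (inverse ((1 - cnj a * z) ^ N) * (of_nat N * (1 - cnj a * z) ^ (N - 1) * (- cnj a)) * inverse ((1 - cnj a * z) ^ N))) (at z)"
        unfolding f_def using nz[OF that] by (intro DERIV_inverse') auto
      moreover have alg: "inverse (x ^ N) * (of_nat N * x ^ (N - 1) * c) * inverse (x ^ N) = of_nat N * c * inverse (x ^ Suc N)"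
        if "x \<noteq> 0" for x c :: complex
      proof -
        have "x ^ N = x ^ (N - 1) * x" using N0 by (cases N) auto
        then show ?thesis using that by (simp add: field_simps)
      qed
      ultimately show ?thesis
        by (simp only: mult_minus_right mult_minus_left minus_minus alg[OF nz[OF that]])
    qed
    have fh: "f holomorphic_on unit_disk"
      unfolding holomorphic_on_open[OF open_ball] using df by blast
    have nf: "cmod (f z) = k z powr (- real N)" if "z \<in> unit_disk" for z
      using kz(5)[OF that] kconj[of z] by (simp add: f_def norm_inverse norm_power powr_minus powr_realpow)
    have ndf: "cmod (deriv f z) \<le> N * k z powr (- real N - 1)" if "z \<in> unit_disk" for z
    proof -
      have "deriv f z = of_nat N * cnj a * inverse ((1 - cnj a * z) ^ Suc N)" by (rule DERIV_imp_deriv[OF df[OF that]])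
      then have "cmod (deriv f z) = real N * cmod a * inverse (k z ^ Suc N)"
        using kconj[of z] by (simp add: norm_mult norm_inverse norm_power del: power_Suc)
      also have "inverse (k z ^ Suc N) = k z powr (- real N - 1)"
      proof -
        have "- real N - 1 = - real (Suc N)" by simp
        then have "k z powr (- real N - 1) = k z powr (- real (Suc N))" by (simp only:)
        also have "\<dots> = inverse (k z powr (real (Suc N)))" by (rule powr_minus)
        also have "\<dots> = inverse (k z ^ Suc N)" by (subst powr_realpow[OF kz(5)[OF that]]) simp
        finally show ?thesis by simp
      qed
      also have "real N * cmod a * k z powr (- real N - 1) \<le> real N * 1 * k z powr (- real N - 1)"
        using a by (intro mult_right_mono mult_left_mono) auto
      finally show ?thesis by simp
    qed
    define B where "B = E1 * h powr (3 - real N) * v a"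
    have B: "0 \<le> B" using E1 va by (simp add: B_def)
    have pw: "ennreal C * ennreal (cmod (deriv f z) * bdist z * v z) \<le>
      ennreal (1 / 2) * ennreal (cmod (f z) * v z) + ennreal B * (1 * ennreal (inverse (cmod (1 - cnj z * a) powr (2 + 1))) * indicator unit_disk z)" for z
    proof (cases "z \<in> unit_disk")
      case z: True
      note k = kz[OF z]
      have b: "0 < bdist z" using z by simp
      have d1: "C * (cmod (deriv f z) * bdist z * v z) \<le> C * (N * k z powr (- real N - 1) * bdist z * v z)"
        using ndf[OF z] C b v0 by (intro mult_left_mono mult_right_mono) auto
      have kk: "k z powr (- real N - 1) * k z = k z powr (- real N)"
        using k(5) powr_add[of "k z" "- real N - 1" 1] by simp
      have "C * (N * k z powr (- real N - 1) * bdist z * v z) \<le> 1 / 2 * (k z powr (- real N) * v z) + B * k z powr (-3)"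
      proof (cases "bdist z < e * k z")
        case True
        have "C * (N * k z powr (- real N - 1) * bdist z * v z) \<le> C * (N * k z powr (- real N - 1) * (e * k z) * v z)"
          using True C v0 by (intro mult_left_mono mult_right_mono) auto
        also have "\<dots> = (C * N * e) * ((k z powr (- real N - 1) * k z) * v z)" by simp
        also have "\<dots> = 1 / 2 * (k z powr (- real N) * v z)" unfolding kk e(2) ..
        finally show ?thesis using B by (simp add: add_increasing2)
      next
        case False
        have "k z / bdist z \<le> 1 / e" using False b e by (simp add: field_simps)
        then have r1: "(k z / bdist z) powr \<kappa> \<le> (1 / e) powr \<kappa>" using \<kappa> k b by (intro powr_mono2) auto
        have "v z \<le> C2 * (k z / h) powr \<kappa> * (k z / bdist z) powr \<kappa> * v a"
          using gr[OF a z k(2)] k by (simp add: h_def)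
        also have "\<dots> \<le> C2 * (k z / h) powr \<kappa> * (1 / e) powr \<kappa> * v a"
          using r1 C2 va by (intro mult_right_mono mult_left_mono) auto
        finally have vz: "v z \<le> C2 * (k z / h) powr \<kappa> * (1 / e) powr \<kappa> * v a" .
        have "C * (N * k z powr (- real N - 1) * bdist z * v z) \<le> C * (N * k z powr (- real N - 1) * k z * v z)"
          using k C v0 by (intro mult_left_mono mult_right_mono) auto
        also have "\<dots> = C * N * k z powr (- real N) * v z" by (simp add: kk mult.assoc)
        also have "\<dots> \<le> C * N * k z powr (- real N) * (C2 * (k z / h) powr \<kappa> * (1 / e) powr \<kappa> * v a)"
          using vz C by (intro mult_left_mono) auto
        also have "\<dots> = E1 * v a * (k z powr (- real N) * (k z / h) powr \<kappa>)" by (simp add: E1_def)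
        also have "k z powr (- real N) * (k z / h) powr \<kappa> = k z powr (-3) * (k z powr (\<kappa> + 3 - N) * h powr (- \<kappa>))"
        proof -
          have "(k z / h) powr \<kappa> = k z powr \<kappa> * h powr (- \<kappa>)" unfolding powr_divide powr_minus by (rule divide_inverse)
          moreover have "k z powr (- real N) * k z powr \<kappa> = k z powr (-3) * k z powr (\<kappa> + 3 - N)"
            unfolding powr_add[symmetric] by simp
          ultimately show ?thesis by simp
        qed
        also have "E1 * v a * \<dots> \<le> E1 * v a * (k z powr (-3) * (h powr (\<kappa> + 3 - N) * h powr (- \<kappa>)))"
          using E1 va k h N by (intro mult_left_mono mult_right_mono powr_mono2') auto
        also have "h powr (\<kappa> + 3 - N) * h powr (- \<kappa>) = h powr (3 - real N)" unfolding powr_add[symmetric] by simp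
        finally show ?thesis using v0 by (simp add: B_def mult_ac add_increasing)
      qed
      with d1 have "C * (cmod (deriv f z) * bdist z * v z) \<le> 1 / 2 * (cmod (f z) * v z) + B * k z powr (-3)"
        unfolding nf[OF z] by (rule order_trans)
      then have "ennreal (C * (cmod (deriv f z) * bdist z * v z)) \<le> ennreal (1 / 2 * (cmod (f z) * v z) + B * k z powr (-3))"
        by (rule ennreal_leI)
      also have "\<dots> = ennreal (1 / 2 * (cmod (f z) * v z)) + ennreal (B * k z powr (-3))"
        using B v0 by (intro ennreal_plus) auto
      finally have "ennreal (C * (cmod (deriv f z) * bdist z * v z)) \<le> \<dots>" .
      moreover have "1 * ennreal (inverse (cmod (1 - cnj z * a) powr (2 + 1))) * indicator unit_disk z = ennreal (k z powr (-3))"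
        using z powr_minus[of "k z" 3] by (simp add: k_def del: powr_numeral)
      moreover have "ennreal (C * (cmod (deriv f z) * bdist z * v z)) = ennreal C * ennreal (cmod (deriv f z) * bdist z * v z)"
        "ennreal (1 / 2 * (cmod (f z) * v z)) = ennreal (1 / 2) * ennreal (cmod (f z) * v z)"
        "ennreal (B * k z powr (-3)) = ennreal B * ennreal (k z powr (-3))"
        using C B by (intro ennreal_mult'; simp)+
      ultimately show ?thesis by (simp only:)
    qed (use vout in simp)
    define X where "X = (\<integral>\<^sup>+z. ennreal (cmod (f z) * v z) \<partial>lborel)"
    have meas [measurable]: "(\<lambda>z. ennreal (cmod (f z) * v z)) \<in> borel_measurable borel"
      using weighted_powr_measurable[OF fh v, of "\<lambda>_. 1" 1] by simp
    have measd [measurable]: "(\<lambda>z. ennreal (cmod (deriv f z) * bdist z * v z)) \<in> borel_measurable borel"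
      using weighted_powr_measurable[OF holomorphic_deriv[OF fh open_ball] v, of bdist 1] by simp
    \<comment> \<open>finiteness of the left-hand side is needed for the absorption\<close>
    have Xfin: "X \<le> ennreal (h powr (- real N) * V)"
    proof -
      have "X \<le> (\<integral>\<^sup>+z. ennreal (h powr (- real N)) * ennreal (v z) \<partial>lborel)"
        unfolding X_def
      proof (intro nn_integral_mono)
        fix z
        show "ennreal (cmod (f z) * v z) \<le> ennreal (h powr (- real N)) * ennreal (v z)"
        proof (cases "z \<in> unit_disk")
          case True
          have "k z powr (- real N) \<le> h powr (- real N)" using kz[OF True] h by (intro powr_mono2') auto
          then show ?thesis unfolding nf[OF True] using v0 by (simp add: ennreal_mult'[symmetric] ennreal_leI mult_right_mono)
        qed (use vout in simp)
      qed
      also have "\<dots> = ennreal (h powr (- real N)) * (\<integral>\<^sup>+z. ennreal (v z) \<partial>lborel)" by (intro nn_integral_cmult) simp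
      also have "\<dots> \<le> ennreal (h powr (- real N)) * ennreal V" by (intro mult_left_mono V) simp
      finally show ?thesis by (simp add: ennreal_mult')
    qed
    then obtain x where x: "X = ennreal x" "0 \<le> x" by (cases X) (auto simp: top_unique)
    have ker: "(\<integral>\<^sup>+\<xi>\<in>unit_disk. 1 * ennreal (inverse (cmod (1 - cnj \<xi> * a) powr (2 + 1))) \<partial>lborel)
       \<le> ennreal (2 powr (2 + 2) * (pi * h\<^sup>2) / bdist a powr (2 + 1))"
    proof (rule kernel_integral_le[OF _ a])
      fix R assume R: "bdist a \<le> R"
      have "(\<integral>\<^sup>+\<xi>\<in>unit_disk \<inter> ball a R. 1 \<partial>lborel) \<le> (\<integral>\<^sup>+\<xi>\<in>ball a R. ennreal 1 \<partial>lborel)"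
        by (intro nn_integral_mono) (auto simp: indicator_def)
      also have "\<dots> = ennreal (1 * (pi * R\<^sup>2))" using R h by (intro nn_integral_const_ball) (auto simp: h_def)
      also have "1 * (pi * R\<^sup>2) = pi * h\<^sup>2 * (R / bdist a) powr 2" using R h by (simp add: h_def[symmetric] power_divide)
      finally show "(\<integral>\<^sup>+\<xi>\<in>unit_disk \<inter> ball a R. 1 \<partial>lborel) \<le> ennreal (pi * h\<^sup>2 * (R / bdist a) powr 2)" .
    qed auto
    have kval: "2 powr (2 + 2) * (pi * h\<^sup>2) / bdist a powr (2 + 1) = 16 * pi * h powr (-1)"
      using h by (simp add: h_def[symmetric] powr_minus field_simps power2_eq_square power3_eq_cube)
    have "X \<le> ennreal C * (ennreal (cmod (f 0)) + (\<integral>\<^sup>+z. ennreal (cmod (deriv f z) * bdist z * v z) \<partial>lborel))"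
      unfolding X_def by (rule est[OF fh])
    also have "\<dots> = ennreal C + (\<integral>\<^sup>+z. ennreal C * ennreal (cmod (deriv f z) * bdist z * v z) \<partial>lborel)"
      by (simp add: distrib_left nn_integral_cmult f_def)
    also have "\<dots> \<le> ennreal C + (\<integral>\<^sup>+z. ennreal (1 / 2) * ennreal (cmod (f z) * v z) + ennreal B * (1 * ennreal (inverse (cmod (1 - cnj z * a) powr (2 + 1))) * indicator unit_disk z) \<partial>lborel)"
      by (intro add_left_mono nn_integral_mono pw)
    also have "\<dots> = ennreal C + (ennreal (1 / 2) * X + ennreal B * (\<integral>\<^sup>+\<xi>\<in>unit_disk. 1 * ennreal (inverse (cmod (1 - cnj \<xi> * a) powr (2 + 1))) \<partial>lborel))"
      unfolding X_def by (subst nn_integral_add, measurable, subst nn_integral_cmult, measurable, subst nn_integral_cmult, measurable)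
    also have "\<dots> \<le> ennreal C + (ennreal (1 / 2) * X + ennreal B * ennreal (16 * pi * h powr (-1)))"
      using ker unfolding kval by (intro add_left_mono mult_left_mono) auto
    also have "\<dots> = ennreal (C + (1 / 2 * x + B * (16 * pi * h powr (-1))))"
    proof -
      define m where "m = 16 * pi * h powr (-1)"
      have m: "0 \<le> m" by (simp add: m_def)
      have "ennreal (1 / 2) * ennreal x = ennreal (1 / 2 * x)" "ennreal B * ennreal m = ennreal (B * m)"
        using B by (intro ennreal_mult'[symmetric]; simp)+
      moreover have "ennreal C + (ennreal (1 / 2 * x) + ennreal (B * m)) = ennreal (C + (1 / 2 * x + B * m))"
        using x B C m by (subst ennreal_plus[symmetric]; simp)+
      ultimately show ?thesis unfolding x(1) m_def[symmetric] by (simp only:)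
    qed
    finally have "ennreal x \<le> ennreal (C + (1 / 2 * x + B * (16 * pi * h powr (-1))))" unfolding x(1) .
    then have "x \<le> C + (1 / 2 * x + B * (16 * pi * h powr (-1)))"
      by (rule ennreal_le_iff[THEN iffD1, rotated]) (use x C B in simp)
    moreover have "B * (16 * pi * h powr (-1)) = 16 * (pi * (B * h powr (-1)))" by (simp only: mult_ac)
    ultimately have x1: "x \<le> 2 * C + 32 * (pi * (B * h powr (-1)))" by linarith
    have Bh: "B * h powr (-1) = E1 * h powr (2 - real N) * v a"
    proof -
      have "h powr (3 - real N) * h powr (-1) = h powr (2 - real N)" unfolding powr_add[symmetric] by simp
      moreover have "B * h powr (-1) = E1 * (h powr (3 - real N) * h powr (-1)) * v a"
        by (simp only: B_def mult_ac)
      ultimately show ?thesis by (simp only:)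
    qed
    have "v 0 \<le> C2 * (1 / h) powr \<kappa> * v a"
      using gr[OF a, of 0 1] h C2 va by (simp add: h_def)
    also have "(1 / h) powr \<kappa> = h powr (- \<kappa>)" by (simp add: powr_minus powr_divide inverse_eq_divide)
    also have "C2 * h powr (- \<kappa>) * v a \<le> C2 * h powr (2 - real N) * v a"
      using h N C2 va by (intro mult_right_mono mult_left_mono powr_mono') auto
    finally have "1 \<le> C2 / v 0 * h powr (2 - real N) * v a" using v00 by (simp add: field_simps)
    then have "2 * C * 1 \<le> 2 * C * (C2 / v 0 * h powr (2 - real N) * v a)" using C by (intro mult_left_mono) auto
    then have xE: "x \<le> E * (h powr (2 - real N) * v a)"
      using x1 unfolding Bh E_def by (simp only: algebra_simps)
    have "mass v (ball a (3 * bdist a)) \<le> (\<integral>\<^sup>+z. ennreal ((5 * h) ^ N) * ennreal (cmod (f z) * v z) \<partial>lborel)"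
    proof (intro nn_integral_mono)
      fix z
      show "ennreal (v z) * indicator (ball a (3 * bdist a)) z \<le> ennreal ((5 * h) ^ N) * ennreal (cmod (f z) * v z)"
      proof (cases "z \<in> unit_disk \<and> z \<in> ball a (3 * h)")
        case True
        then have k5: "k z \<le> 5 * h" "0 < k z" using kz[of z] by auto
        have "1 = k z ^ N * k z powr (- real N)" using k5 by (simp add: powr_minus powr_realpow)
        also have "\<dots> \<le> (5 * h) ^ N * k z powr (- real N)" using k5 by (intro mult_right_mono power_mono) auto
        finally have "1 * v z \<le> (5 * h) ^ N * k z powr (- real N) * v z" using v0 by (intro mult_right_mono)
        then show ?thesis using True nf[of z] h by (simp add: ennreal_mult'[symmetric] ennreal_leI mult.assoc h_def[symmetric])
      next
        case False
        then show ?thesis using vout[of z] by (cases "z \<in> unit_disk") (auto simp: h_def)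
      qed
    qed
    also have "\<dots> = ennreal ((5 * h) ^ N) * X" unfolding X_def by (intro nn_integral_cmult) simp
    also have "\<dots> \<le> ennreal ((5 * h) ^ N) * ennreal (E * (h powr (2 - real N) * v a))"
      unfolding x using xE by (intro mult_left_mono ennreal_leI) auto
    also have "\<dots> = ennreal ((5 * h) ^ N * (E * (h powr (2 - real N) * v a)))"
      using h by (intro ennreal_mult'[symmetric]) simp
    also have "(5 * h) ^ N * (E * (h powr (2 - real N) * v a)) = 5 ^ N * E * (h ^ N * h powr (2 - real N)) * v a"
      by (simp add: power_mult_distrib)
    also have "h ^ N * h powr (2 - real N) = h\<^sup>2"
    proof -
      have "h ^ N * h powr (2 - real N) = h powr N * h powr (2 - real N)" using h by (simp add: powr_realpow)
      also have "\<dots> = h\<^sup>2" unfolding powr_add[symmetric] using h by simp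
      finally show ?thesis .
    qed
    finally show "mass v (ball a (3 * bdist a)) \<le> ennreal (5 ^ N * E * (bdist a)\<^sup>2 * v a)"
      by (simp add: h_def)
  qed
qed

section \<open>Geometry of Carleson boxes\<close>

lemma carleson_box_mem:
  "z \<in> carleson_box (\<theta>, L) \<longleftrightarrow> (\<exists>r \<alpha>. z = rcis r \<alpha> \<and> 0 \<le> r \<and> 1 - L < r \<and> r < 1 \<and> \<bar>\<theta> - \<alpha>\<bar> < L / 2)"
  by (auto simp: carleson_box_def)

lemma box_top_mem:
  "z \<in> box_top \<rho> (\<theta>, L) \<longleftrightarrow> (\<exists>r \<alpha>. z = rcis r \<alpha> \<and> 0 \<le> r \<and> 1 - L < r \<and> r < 1 - (1 - \<rho>) * L \<and> \<bar>\<theta> - \<alpha>\<bar> < L / 2)"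
  by (auto simp: box_top_def)

lemma carleson_box_subset: "carleson_box I \<subseteq> unit_disk"
  by (cases I) (auto simp: carleson_box_mem)

text \<open>A box is a countable union of compact sets, the images of closed rectangles in polar coordinates.\<close>

lemma carleson_box_borel [measurable]: "carleson_box I \<in> sets borel"
proof -
  obtain \<theta> L where I: "I = (\<theta>, L)" by (cases I)
  define K where "K n = {max 0 (1 - L + inverse (real (Suc n)))..1 - inverse (real (Suc n))} \<times>
    {\<theta> - L / 2 + inverse (real (Suc n))..\<theta> + L / 2 - inverse (real (Suc n))}" for n
  have "carleson_box I = (\<Union>n. (\<lambda>p. rcis (fst p) (snd p)) ` K n)"
  proof (intro set_eqI iffI)
    fix z assume "z \<in> carleson_box I"
    then obtain r \<alpha> where z: "z = rcis r \<alpha>" "0 \<le> r" "1 - L < r" "r < 1" "\<bar>\<theta> - \<alpha>\<bar> < L / 2"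
      unfolding I carleson_box_mem by blast
    define \<epsilon> where "\<epsilon> = min (min (r - (1 - L)) (1 - r)) (L / 2 - \<bar>\<theta> - \<alpha>\<bar>)"
    have "0 < \<epsilon>" using z by (simp add: \<epsilon>_def)
    then obtain n where n: "inverse (real (Suc n)) < \<epsilon>" using reals_Archimedean by blast
    have "(r, \<alpha>) \<in> K n" unfolding K_def using n z by (auto simp: \<epsilon>_def)
    then show "z \<in> (\<Union>n. (\<lambda>p. rcis (fst p) (snd p)) ` K n)" using z(1) by force
  next
    fix z assume "z \<in> (\<Union>n. (\<lambda>p. rcis (fst p) (snd p)) ` K n)"
    then obtain n r \<alpha> where z: "z = rcis r \<alpha>" "(r, \<alpha>) \<in> K n" by auto
    define e where "e = inverse (real (Suc n))"
    have e: "0 < e" by (simp add: e_def)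
    have "max 0 (1 - L + e) \<le> r" "r \<le> 1 - e" "\<theta> - L / 2 + e \<le> \<alpha>" "\<alpha> \<le> \<theta> + L / 2 - e"
      using z(2) unfolding K_def e_def by auto
    then have "0 \<le> r \<and> 1 - L < r \<and> r < 1 \<and> \<bar>\<theta> - \<alpha>\<bar> < L / 2"
      using e by linarith
    then show "z \<in> carleson_box I" unfolding I carleson_box_mem using z(1) by blast
  qed
  moreover have "closed ((\<lambda>p. rcis (fst p) (snd p)) ` K n)" for n
    unfolding K_def rcis_def cis_conv_exp
    by (intro compact_imp_closed compact_continuous_image compact_Times compact_Icc continuous_intros)
  ultimately show ?thesis by simp
qed

text \<open>The center of the box over the arc with midpoint \<open>\<theta>\<close> and length \<open>L\<close>: its depth is half of \<open>min L 1\<close>,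
  because the radii in a box with \<open>L > 1\<close> range over all of \<open>[0, 1)\<close>.\<close>

definition box_center :: "real \<times> real \<Rightarrow> complex" where
  "box_center I = rcis (1 - min (snd I) 1 / 2) (fst I)"

lemma box_center:
  assumes "I \<in> intervals"
  shows "bdist (box_center I) = min (snd I) 1 / 2" "box_center I \<in> unit_disk"
    "0 < bdist (box_center I)" "bdist (box_center I) \<le> 1 / 2"
proof -
  have "0 < snd I" using assms by (auto simp: intervals_def)
  then show *: "bdist (box_center I) = min (snd I) 1 / 2" by (simp add: box_center_def)
  with \<open>0 < snd I\<close> show "0 < bdist (box_center I)" "bdist (box_center I) \<le> 1 / 2" by auto
  then show "box_center I \<in> unit_disk" by simp
qed

lemma cmod_cis_diff_le: "cmod (cis \<alpha> - cis \<beta>) \<le> \<bar>\<alpha> - \<beta>\<bar>"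
proof -
  have "cis \<alpha> - cis \<beta> = cis \<beta> * (cis (\<alpha> - \<beta>) - 1)" by (simp add: algebra_simps cis_mult)
  then have "cmod (cis \<alpha> - cis \<beta>) = cmod (exp (\<i> * of_real (\<alpha> - \<beta>)) - 1)"
    by (simp add: norm_mult cis_conv_exp)
  also have "\<dots> = 2 * \<bar>sin ((\<alpha> - \<beta>) / 2)\<bar>" using dist_exp_i_1[of "\<alpha> - \<beta>"] by (simp add: mult.commute)
  also have "\<dots> \<le> 2 * \<bar>(\<alpha> - \<beta>) / 2\<bar>" by (intro mult_left_mono abs_sin_x_le_abs_x) simp
  finally show ?thesis by simp
qed

lemma dist_rcis_le:
  assumes "0 \<le> r" "r \<le> 1"
  shows "dist (rcis r \<alpha>) (rcis s \<beta>) \<le> \<bar>r - s\<bar> + \<bar>\<alpha> - \<beta>\<bar>"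
proof -
  have "rcis r \<alpha> - rcis s \<beta> = of_real r * (cis \<alpha> - cis \<beta>) + of_real (r - s) * cis \<beta>"
    by (simp add: rcis_def algebra_simps)
  then have "dist (rcis r \<alpha>) (rcis s \<beta>) \<le> cmod (of_real r * (cis \<alpha> - cis \<beta>)) + cmod (of_real (r - s) * cis \<beta>)"
    unfolding dist_norm by (metis norm_triangle_ineq)
  also have "\<dots> = r * cmod (cis \<alpha> - cis \<beta>) + \<bar>r - s\<bar>" using assms by (simp add: norm_mult del: of_real_diff)
  also have "r * cmod (cis \<alpha> - cis \<beta>) \<le> 1 * \<bar>\<alpha> - \<beta>\<bar>" using assms cmod_cis_diff_le by (intro mult_mono) auto
  finally show ?thesis by simp
qed

text \<open>Points near \<open>rcis r \<theta>\<close> have an argument near \<open>\<theta>\<close>, with the angle not reduced modulo \<open>2 * pi\<close>. It is obtained from the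
  principal logarithm of the quotient of the two points, which is close to 1.\<close>

lemma rcis_near:
  assumes r: "0 < r" and d: "dist (rcis r \<theta>) u < r / 2"
  obtains \<beta> where "u = rcis (cmod u) \<beta>" "\<bar>\<beta> - \<theta>\<bar> \<le> 2 * dist (rcis r \<theta>) u / r"
proof -
  define z where "z = rcis r \<theta>"
  have z: "cmod z = r" "z \<noteq> 0" using r by (auto simp: z_def)
  define x where "x = u / z - 1"
  have "x = (u - z) / z" using z by (simp add: x_def diff_divide_distrib)
  then have x: "cmod x = dist z u / r" using z by (simp add: norm_divide dist_norm norm_minus_commute)
  then have x2: "cmod x < 1 / 2" using d r by (simp add: z_def[symmetric] pos_divide_less_eq)
  have "1 + x \<noteq> 0"
  proof
    assume "1 + x = 0"
    then have "x = - 1" by (simp add: add_eq_0_iff)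
    with x2 show False by simp
  qed
  define l where "l = Ln (1 + x)"
  have "exp l = 1 + x" unfolding l_def using \<open>1 + x \<noteq> 0\<close> by simp
  then have "u = z * exp l" using z by (simp add: x_def)
  also have "\<dots> = rcis (r * exp (Re l)) (\<theta> + Im l)"
    unfolding z_def exp_eq_polar by (simp add: rcis_def cis_mult[symmetric] mult_ac)
  finally have u: "u = rcis (r * exp (Re l)) (\<theta> + Im l)" .
  then have "cmod u = r * exp (Re l)" using r by simp
  with u have "u = rcis (cmod u) (\<theta> + Im l)" by simp
  moreover have "\<bar>\<theta> + Im l - \<theta>\<bar> \<le> 2 * dist (rcis r \<theta>) u / r"
  proof -
    have "\<bar>Im l\<bar> \<le> cmod l" by (rule abs_Im_le_cmod)
    also have "\<dots> \<le> 2 * cmod x" unfolding l_def by (rule norm_Ln_le[OF x2])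
    finally show ?thesis by (simp add: x z_def)
  qed
  ultimately show ?thesis by (rule that)
qed

lemma box_subset_ball:
  assumes I: "I \<in> intervals"
  shows "carleson_box I \<subseteq> ball (box_center I) (3 * bdist (box_center I))"
proof
  fix z assume zI: "z \<in> carleson_box I"
  obtain \<theta> L where IL: "I = (\<theta>, L)" by (cases I)
  then have L: "0 < L" using I by (auto simp: intervals_def)
  obtain r \<alpha> where z: "z = rcis r \<alpha>" "0 \<le> r" "1 - L < r" "r < 1" "\<bar>\<theta> - \<alpha>\<bar> < L / 2"
    using zI unfolding IL carleson_box_mem by blast
  note a = box_center[OF I]
  show "z \<in> ball (box_center I) (3 * bdist (box_center I))"
  proof (cases "L \<le> 1")
    case True
    have "dist z (box_center I) \<le> \<bar>r - (1 - L / 2)\<bar> + \<bar>\<alpha> - \<theta>\<bar>"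
      unfolding z(1) box_center_def IL using True z by (simp add: min_absorb1 dist_rcis_le)
    also have "\<dots> < L" using z by argo
    also have "L \<le> 3 * bdist (box_center I)" unfolding a(1) using True L by (simp add: IL)
    finally show ?thesis by (simp add: dist_commute)
  next
    case False
    then have b: "bdist (box_center I) = 1 / 2" unfolding a(1) by (simp add: IL)
    have "cmod z < 1" using z by simp
    then have "dist (box_center I) z < cmod (box_center I) + 1"
      using norm_triangle_ineq4[of "box_center I" z] by (simp add: dist_norm)
    then show ?thesis using b by simp
  qed
qed

lemma ball_subset_box:
  assumes I: "I \<in> intervals"
  shows "ball (box_center I) (bdist (box_center I) / 4) \<subseteq> carleson_box I"
proof
  fix u assume u: "u \<in> ball (box_center I) (bdist (box_center I) / 4)"
  obtain \<theta> L where IL: "I = (\<theta>, L)" by (cases I)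
  then have L: "0 < L" using I by (auto simp: intervals_def)
  define h where "h = min L 1"
  have h: "0 < h" "h \<le> 1" "h \<le> L" using L by (auto simp: h_def)
  have c: "box_center I = rcis (1 - h / 2) \<theta>" by (simp add: box_center_def IL h_def)
  have b: "bdist (box_center I) = h / 2" unfolding box_center(1)[OF I] by (simp add: IL h_def)
  have d: "dist (rcis (1 - h / 2) \<theta>) u < h / 8" using u unfolding b c by simp
  have "dist (rcis (1 - h / 2) \<theta>) u < (1 - h / 2) / 2" using d h by argo
  moreover have r: "0 < 1 - h / 2" using h by simp
  ultimately obtain \<beta> where \<beta>: "u = rcis (cmod u) \<beta>" "\<bar>\<beta> - \<theta>\<bar> \<le> 2 * dist (rcis (1 - h / 2) \<theta>) u / (1 - h / 2)"
    using rcis_near by blast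
  have "2 * dist (rcis (1 - h / 2) \<theta>) u / (1 - h / 2) \<le> 2 * dist (rcis (1 - h / 2) \<theta>) u / (1 / 2)"
    using h by (intro divide_left_mono) auto
  then have "\<bar>\<beta> - \<theta>\<bar> < L / 2" using \<beta>(2) d h by argo
  moreover have "bdist u < h \<and> 0 < bdist u"
  proof -
    have "bdist u - bdist (box_center I) \<le> dist (box_center I) u" "bdist (box_center I) - bdist u \<le> dist (box_center I) u"
      using bdist_diff[of "box_center I" u] by linarith+
    then show ?thesis unfolding b using d h unfolding c by argo
  qed
  ultimately have "0 \<le> cmod u \<and> 1 - L < cmod u \<and> cmod u < 1 \<and> \<bar>\<theta> - \<beta>\<bar> < L / 2"
    using h by (auto simp: abs_minus_commute)
  then show "u \<in> carleson_box I"
    unfolding IL carleson_box_mem using \<beta>(1) by blast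
qed

text \<open>The box over the arc of length \<open>16 * bdist \<xi>\<close> centered at the direction of \<open>\<xi>\<close> contains the part in the unit
  disk of the disk of radius \<open>3 * bdist \<xi>\<close> about \<open>\<xi>\<close>, provided \<open>\<xi>\<close> is close to the circle.\<close>

lemma box_around:
  assumes \<xi>: "\<xi> \<in> unit_disk" "bdist \<xi> \<le> 1 / 24"
  obtains J where "J \<in> intervals" "\<xi> \<in> carleson_box J" "box_center J = radial (8 * bdist \<xi>) \<xi>" "bdist (box_center J) = 8 * bdist \<xi>"
    "unit_disk \<inter> ball \<xi> (3 * bdist \<xi>) \<subseteq> carleson_box J"
proof -
  define d where "d = bdist \<xi>"
  have d: "0 < d" "d \<le> 1 / 24" using \<xi> by (auto simp: d_def)
  define \<theta> where "\<theta> = Arg \<xi>"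
  have \<xi>_eq: "rcis (1 - d) \<theta> = \<xi>" by (simp add: d_def \<theta>_def rcis_cmod_Arg)
  define J where "J = (\<theta>, 16 * d)"
  have "16 * d \<le> 2 * pi" using d pi_gt3 by simp
  then have J: "J \<in> intervals" using d by (simp add: J_def intervals_def)
  have b: "bdist (box_center J) = 8 * bdist \<xi>" unfolding box_center(1)[OF J] using d by (simp add: J_def d_def[symmetric])
  have sgn: "sgn \<xi> = cis \<theta>"
  proof -
    have "\<xi> = (1 - d) *\<^sub>R cis \<theta>" unfolding \<xi>_eq[symmetric] by (simp add: rcis_def scaleR_conv_of_real)
    moreover have "sgn ((1 - d) *\<^sub>R cis \<theta>) = cis \<theta>"
      unfolding sgn_scaleR using d by (simp add: sgn_div_norm)
    ultimately show ?thesis by (simp only:)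
  qed
  have c: "box_center J = radial (8 * bdist \<xi>) \<xi>"
    using d unfolding box_center_def J_def radial_def sgn d_def[symmetric] by (simp add: rcis_def scaleR_conv_of_real min_absorb1)
  have sub: "z \<in> carleson_box J" if z: "z \<in> unit_disk" "z \<in> ball \<xi> (3 * d)" for z
  proof -
    have dz: "dist (rcis (1 - d) \<theta>) z < 3 * d" using z unfolding \<xi>_eq by simp
    have "dist (rcis (1 - d) \<theta>) z < (1 - d) / 2" using dz d by argo
    moreover have r: "0 < 1 - d" using d by simp
    ultimately obtain \<beta> where \<beta>: "z = rcis (cmod z) \<beta>" "\<bar>\<beta> - \<theta>\<bar> \<le> 2 * dist (rcis (1 - d) \<theta>) z / (1 - d)"
      using rcis_near by blast
    have "2 * dist (rcis (1 - d) \<theta>) z / (1 - d) \<le> 2 * dist (rcis (1 - d) \<theta>) z / (9 / 10)"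
      using d by (intro divide_left_mono) auto
    then have "\<bar>\<beta> - \<theta>\<bar> < 16 * d / 2" using \<beta>(2) dz d by argo
    moreover have "bdist z < 16 * d"
      using bdist_ge[of z \<xi>] z(2) d by (simp add: d_def dist_commute)
    ultimately have "0 \<le> cmod z \<and> 1 - 16 * d < cmod z \<and> cmod z < 1 \<and> \<bar>\<theta> - \<beta>\<bar> < 16 * d / 2"
      using z(1) by (auto simp: abs_minus_commute)
    then show ?thesis unfolding J_def carleson_box_mem using \<beta>(1) by blast
  qed
  show ?thesis
    by (rule that[OF J sub c b]) (use \<xi> d sub in \<open>auto simp: d_def\<close>)
qed

lemma disk_subset_boxes: "unit_disk \<subseteq> carleson_box (0, 2 * pi) \<union> carleson_box (pi, 2 * pi)"
proof
  fix z :: complex assume "z \<in> unit_disk"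
  then have z: "cmod z < 1" "z = rcis (cmod z) (Arg z)" by (simp_all add: rcis_cmod_Arg)
  have p: "1 - 2 * pi < cmod z" using pi_gt3 norm_ge_zero[of z] by linarith
  have "- pi < Arg z \<and> Arg z \<le> pi" by (simp add: Arg_bounded mpi_less_Arg Arg_le_pi)
  then have "\<bar>0 - Arg z\<bar> < 2 * pi / 2 \<or> \<bar>pi - Arg z\<bar> < 2 * pi / 2" by auto
  then show "z \<in> carleson_box (0, 2 * pi) \<union> carleson_box (pi, 2 * pi)"
    unfolding Un_iff carleson_box_mem using z p norm_ge_zero[of z] by blast
qed

text \<open>The counterpart of disk control for boxes: the mass of a box is at most a constant times the value of \<open>v\<close>
  at the center times the square of the depth of the center, which is comparable to the area of the box.\<close>

definition box_carleson :: "(complex \<Rightarrow> real) \<Rightarrow> bool" where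
  "box_carleson v \<longleftrightarrow> (\<exists>C\<ge>0. \<forall>I\<in>intervals.
     mass v (carleson_box I) \<le> ennreal (C * (bdist (box_center I))\<^sup>2 * v (box_center I)))"

lemma ball_carleson_imp_box_carleson:
  assumes "ball_carleson v"
  shows "box_carleson v"
proof -
  obtain C where C: "0 \<le> C" "\<And>z. z \<in> unit_disk \<Longrightarrow>
     mass v (ball z (3 * bdist z)) \<le> ennreal (C * (bdist z)\<^sup>2 * v z)"
    using assms unfolding ball_carleson_def by blast
  show ?thesis
    unfolding box_carleson_def
  proof (intro exI[of _ C] conjI ballI C(1))
    fix I assume I: "I \<in> intervals"
    have "mass v (carleson_box I) \<le> mass v (ball (box_center I) (3 * bdist (box_center I)))"
      by (intro nn_set_integral_set_mono box_subset_ball I)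
    also have "\<dots> \<le> ennreal (C * (bdist (box_center I))\<^sup>2 * v (box_center I))" by (rule C(2)[OF box_center(2)[OF I]])
    finally show "mass v (carleson_box I) \<le> ennreal (C * (bdist (box_center I))\<^sup>2 * v (box_center I))" .
  qed
qed

text \<open>Near the circle \<open>box_around\<close> applies. The remaining points have depth at least 1/24, and for them the finite
  total mass is a bound.\<close>

lemma box_carleson_imp_ball_carleson:
  assumes v: "regular A v" and "box_carleson v"
  shows "ball_carleson v"
proof -
  obtain C where C: "0 \<le> C" "\<And>I. I \<in> intervals \<Longrightarrow>
     mass v (carleson_box I) \<le> ennreal (C * (bdist (box_center I))\<^sup>2 * v (box_center I))"
    using assms(2) unfolding box_carleson_def by blast
  obtain \<kappa> C2 where \<kappa>: "0 \<le> \<kappa>" and C2: "1 \<le> C2" and gr: "\<And>z \<xi> R. z \<in> unit_disk \<Longrightarrow> \<xi> \<in> unit_disk \<Longrightarrow> dist z \<xi> \<le> R \<Longrightarrow> bdist z \<le> R \<Longrightarrow> bdist \<xi> \<le> R \<Longrightarrow>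
      v \<xi> \<le> C2 * (R / bdist z) powr \<kappa> * (R / bdist \<xi>) powr \<kappa> * v z"
    by (rule slow_growth[OF regularD(1)[OF v]]) (rule that; blast)
  have [measurable]: "v \<in> borel_measurable borel" using regularD(2)[OF v] .
  have v0: "0 \<le> v z" for z using regularD(4)[OF v] .
  have vout: "v z = 0" if "z \<notin> unit_disk" for z using regularD(3)[OF v that] .
  define I1 where "I1 = (0::real, 2 * pi)"
  define I2 where "I2 = (pi, 2 * pi)"
  have I12: "I1 \<in> intervals" "I2 \<in> intervals" by (auto simp: I1_def I2_def intervals_def)
  define W where "W = C * (bdist (box_center I1))\<^sup>2 * v (box_center I1) + C * (bdist (box_center I2))\<^sup>2 * v (box_center I2)"
  have W: "0 \<le> W" unfolding W_def using C v0 by (intro add_nonneg_nonneg mult_nonneg_nonneg) auto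
  have total: "(\<integral>\<^sup>+z. ennreal (v z) \<partial>lborel) \<le> ennreal W"
  proof -
    have "(\<integral>\<^sup>+z. ennreal (v z) \<partial>lborel) \<le> (\<integral>\<^sup>+z. ennreal (v z) * indicator (carleson_box I1) z + ennreal (v z) * indicator (carleson_box I2) z \<partial>lborel)"
    proof (intro nn_integral_mono)
      fix z
      show "ennreal (v z) \<le> ennreal (v z) * indicator (carleson_box I1) z + ennreal (v z) * indicator (carleson_box I2) z"
        using disk_subset_boxes vout[of z] by (cases "z \<in> unit_disk") (auto simp: I1_def I2_def indicator_def)
    qed
    also have "\<dots> = mass v (carleson_box I1) + mass v (carleson_box I2)"
      by (intro nn_integral_add) measurable
    also have "\<dots> \<le> ennreal (C * (bdist (box_center I1))\<^sup>2 * v (box_center I1)) + ennreal (C * (bdist (box_center I2))\<^sup>2 * v (box_center I2))"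
      by (intro add_mono C(2) I12)
    also have "\<dots> = ennreal W" unfolding W_def using C v0 by (intro ennreal_plus[symmetric] mult_nonneg_nonneg) auto
    finally show ?thesis .
  qed
  define D1 where "D1 = C * 64 * (C2 * 8 powr \<kappa>)"
  define D2 where "D2 = 576 * W * (C2 * 24 powr \<kappa> / v 0)"
  have v00: "0 < v 0" using regularD(6)[OF v, of 0] by simp
  have D: "0 \<le> D1" "0 \<le> D2" using C C2 W v00 by (auto simp: D1_def D2_def)
  show ?thesis
    unfolding ball_carleson_def
  proof (intro exI[of _ "D1 + D2"] conjI ballI)
    show "0 \<le> D1 + D2" using D by simp
    fix z :: complex assume z: "z \<in> unit_disk"
    define d where "d = bdist z"
    have d: "0 < d" using z by (simp add: d_def)
    have "mass v (ball z (3 * bdist z)) \<le> ennreal (D1 * d\<^sup>2 * v z) \<or>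
      mass v (ball z (3 * bdist z)) \<le> ennreal (D2 * d\<^sup>2 * v z)"
    proof (cases "d \<le> 1 / 24")
      case True
      obtain J where J: "J \<in> intervals" "box_center J = radial (8 * bdist z) z" "bdist (box_center J) = 8 * bdist z"
        "unit_disk \<inter> ball z (3 * bdist z) \<subseteq> carleson_box J"
        using box_around[OF z True[unfolded d_def]] by metis
      have "mass v (ball z (3 * bdist z)) \<le> mass v (carleson_box J)"
      proof (intro nn_integral_mono)
        fix \<xi> show "ennreal (v \<xi>) * indicator (ball z (3 * bdist z)) \<xi> \<le> ennreal (v \<xi>) * indicator (carleson_box J) \<xi>"
          using J(4) vout[of \<xi>] by (cases "\<xi> \<in> unit_disk") (auto simp: indicator_def subset_iff)
      qed
      also have "\<dots> \<le> ennreal (C * (8 * d)\<^sup>2 * v (box_center J))" using C(2)[OF J(1)] J(3) by (simp add: d_def)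
      also have "\<dots> \<le> ennreal (C * (8 * d)\<^sup>2 * (C2 * 8 powr \<kappa> * v z))"
      proof (intro ennreal_leI mult_left_mono)
        have "dist z (box_center J) \<le> 8 * d"
          unfolding J(2) using radial(2)[OF z, of "8 * bdist z"] True d by (simp add: d_def)
        then have "v (box_center J) \<le> C2 * (8 * d / bdist z) powr \<kappa> * (8 * d / bdist (box_center J)) powr \<kappa> * v z"
          using d J(3) by (intro gr[OF z box_center(2)[OF J(1)]]) (auto simp: d_def)
        also have "8 * d / bdist z = 8" using d by (simp add: d_def[symmetric])
        also have "8 * d / bdist (box_center J) = 1" unfolding J(3) d_def[symmetric] using d by simp
        finally show "v (box_center J) \<le> C2 * 8 powr \<kappa> * v z" by simp
      qed (use C in auto)
      also have "C * (8 * d)\<^sup>2 * (C2 * 8 powr \<kappa> * v z) = D1 * d\<^sup>2 * v z"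
        by (simp add: D1_def power_mult_distrib)
      finally show ?thesis ..
    next
      case False
      have "mass v (ball z (3 * bdist z)) \<le> (\<integral>\<^sup>+z. ennreal (v z) \<partial>lborel)"
        by (intro nn_integral_mono) (auto simp: indicator_def)
      also have "\<dots> \<le> ennreal W" by (rule total)
      also have "\<dots> \<le> ennreal (D2 * d\<^sup>2 * v z)"
      proof (intro ennreal_leI)
        have "v 0 \<le> C2 * (1 / bdist z) powr \<kappa> * (1 / bdist 0) powr \<kappa> * v z"
          using z by (intro gr) auto
        also have "\<dots> \<le> C2 * 24 powr \<kappa> * 1 * v z"
          using False d C2 \<kappa> v0 by (intro mult_right_mono mult_mono mult_left_mono powr_mono2) (auto simp: d_def[symmetric] field_simps)
        finally have "1 \<le> C2 * 24 powr \<kappa> / v 0 * v z" using v00 by (simp add: field_simps)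
        moreover have "1 \<le> 576 * d\<^sup>2"
        proof -
          have "(1 / 24)\<^sup>2 \<le> d\<^sup>2" using False by (intro power_mono) auto
          then show ?thesis by (simp add: power2_eq_square)
        qed
        ultimately have "1 * 1 \<le> (576 * d\<^sup>2) * (C2 * 24 powr \<kappa> / v 0 * v z)" by (intro mult_mono) auto
        then have "W * 1 \<le> W * ((576 * d\<^sup>2) * (C2 * 24 powr \<kappa> / v 0 * v z))" using W by (intro mult_left_mono) auto
        then show "W \<le> D2 * d\<^sup>2 * v z" by (simp add: D2_def mult_ac)
      qed
      finally show ?thesis ..
    qed
    moreover have "ennreal (D1 * d\<^sup>2 * v z) \<le> ennreal ((D1 + D2) * d\<^sup>2 * v z)" "ennreal (D2 * d\<^sup>2 * v z) \<le> ennreal ((D1 + D2) * d\<^sup>2 * v z)"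
      using D v0 by (auto intro!: ennreal_leI mult_right_mono)
    ultimately show "mass v (ball z (3 * bdist z)) \<le> ennreal ((D1 + D2) * (bdist z)\<^sup>2 * v z)"
      unfolding d_def by (meson order_trans)
  qed
qed

section \<open>From tops of boxes to disks\<close>

text \<open>Every point \<open>z\<close> lies well inside the \<open>\<rho>\<close>-top of the arc centered at the direction of \<open>z\<close> whose length \<open>L\<close> is
  \<open>bdist z / (1 - \<rho> / 2)\<close>, so this top contains a disk of radius comparable to \<open>bdist z\<close>. The exception is a neighborhood of
  the origin, where \<open>z\<close> has no well-defined direction; there \<open>w\<close> is compared with \<open>w 0\<close>, using
  arcs of a length greater than 1 for which the top still contains the origin.\<close>

lemma nearly_constant_local:
  assumes nc: "nearly_constant_on_tops w" and pos: "\<And>z. z \<in> unit_disk \<Longrightarrow> 0 < w z"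
  obtains c A where "0 < c" "c \<le> 1 / 2" "1 \<le> A"
    "\<And>z \<xi>. z \<in> unit_disk \<Longrightarrow> dist z \<xi> \<le> c * bdist z \<Longrightarrow> w \<xi> \<le> A * w z \<and> w z \<le> A * w \<xi>"
proof -
  obtain \<rho> C0 where \<rho>: "0 < \<rho>" "\<rho> < 1" and C0: "0 < C0"
    and top0: "\<And>I z \<xi>. I \<in> intervals \<Longrightarrow> z \<in> box_top \<rho> I \<Longrightarrow> \<xi> \<in> box_top \<rho> I \<Longrightarrow> w z \<le> C0 * w \<xi>"
    using nc unfolding nearly_constant_on_tops_def by blast
  define C where "C = max 1 C0"
  have C: "1 \<le> C" by (simp add: C_def)
  have top: "w z \<le> C * w \<xi>" if "I \<in> intervals" "z \<in> box_top \<rho> I" "\<xi> \<in> box_top \<rho> I" "\<xi> \<in> unit_disk" for I z \<xi>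
  proof -
    have "C0 * w \<xi> \<le> C * w \<xi>" using pos[OF that(4)] by (intro mult_right_mono) (auto simp: C_def)
    then show ?thesis using top0[OF that(1-3)] by linarith
  qed
  have CC: "x \<le> C * C * y" if "x \<le> C * y" "0 \<le> y" for x y :: real
  proof -
    have "C * y \<le> C * (C * y)" using C that(2) mult_right_mono[of 1 C "C * y"] by simp
    then show ?thesis using that(1) by (simp add: mult.assoc)
  qed
  have central: "w u \<le> C * w 0 \<and> w 0 \<le> C * w u" if u: "cmod u < \<rho> / 2" for u
  proof -
    define L where "L = min ((1 - \<rho> / 2) / (1 - \<rho>)) 2"
    have "1 < (1 - \<rho> / 2) / (1 - \<rho>)" using \<rho> by (simp add: field_simps)
    then have L: "1 < L" "L \<le> 2" by (auto simp: L_def)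
    have "(1 - \<rho>) * L \<le> (1 - \<rho>) * ((1 - \<rho> / 2) / (1 - \<rho>))" using \<rho> by (intro mult_left_mono) (auto simp: L_def)
    then have tp: "\<rho> / 2 \<le> 1 - (1 - \<rho>) * L" using \<rho> by simp
    have I: "(Arg u, L) \<in> intervals" using L pi_gt3 by (simp add: intervals_def)
    have "0 = rcis 0 (Arg u)" by simp
    moreover have "(0::real) \<le> 0 \<and> 1 - L < 0 \<and> 0 < 1 - (1 - \<rho>) * L \<and> \<bar>Arg u - Arg u\<bar> < L / 2"
      using L tp \<rho> by auto
    ultimately have 1: "0 \<in> box_top \<rho> (Arg u, L)" unfolding box_top_mem by blast
    have "u = rcis (cmod u) (Arg u)" by (simp add: rcis_cmod_Arg)
    moreover have "0 \<le> cmod u \<and> 1 - L < cmod u \<and> cmod u < 1 - (1 - \<rho>) * L \<and> \<bar>Arg u - Arg u\<bar> < L / 2"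
      using L tp u norm_ge_zero[of u] by (intro conjI; linarith)
    ultimately have 2: "u \<in> box_top \<rho> (Arg u, L)" unfolding box_top_mem by blast
    have "u \<in> unit_disk" using u \<rho> by simp
    then show ?thesis using top[OF I 2 1] top[OF I 1 2] by simp
  qed
  define c where "c = \<rho> / 32"
  have c: "0 < c" "c \<le> 1 / 2" using \<rho> by (auto simp: c_def)
  have c': "1 \<le> C * C" using C mult_mono[of 1 C 1 C] by simp
  show ?thesis
  proof (rule that[OF c c'])
    fix z \<xi> assume z: "z \<in> unit_disk" and d: "dist z \<xi> \<le> c * bdist z"
    define \<delta> where "\<delta> = bdist z"
    have \<delta>: "0 < \<delta>" "\<delta> \<le> 1" using z by (auto simp: \<delta>_def)
    have c\<delta>: "c * \<delta> \<le> c" "c * \<delta> \<le> \<delta> / 32" using c \<rho> \<delta> by (auto simp: c_def mult_left_le)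
    have bd: "bdist \<xi> - \<delta> \<le> c * \<delta>" "\<delta> - bdist \<xi> \<le> c * \<delta>"
      using d bdist_diff[of z \<xi>] by (auto simp: \<delta>_def)
    then have "0 < bdist \<xi>" using c\<delta> \<delta> by linarith
    then have \<xi>: "\<xi> \<in> unit_disk" by simp
    show "w \<xi> \<le> C * C * w z \<and> w z \<le> C * C * w \<xi>"
    proof (cases "cmod z < \<rho> / 4")
      case True
      have "cmod \<xi> < \<rho> / 2" using bd c\<delta>(1) True \<rho> unfolding \<delta>_def c_def by linarith
      note 1 = central[OF this]
      have "cmod z < \<rho> / 2" using True \<rho> by simp
      note 2 = central[OF this]
      have "C * w 0 \<le> C * (C * w z)" "C * w 0 \<le> C * (C * w \<xi>)" using 1 2 C by (auto intro!: mult_left_mono)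
      then show ?thesis using 1 2 by (simp add: mult.assoc)
    next
      case False
      define r where "r = cmod z"
      have r: "\<rho> / 4 \<le> r" "\<delta> = 1 - r" using False by (auto simp: r_def \<delta>_def)
      define L where "L = \<delta> / (1 - \<rho> / 2)"
      have "L * (1 - \<rho> / 2) = \<delta>" "0 < L" using \<rho> \<delta> by (auto simp: L_def)
      then have L: "\<delta> = L - \<rho> * L / 2" "0 < L" by (auto simp: algebra_simps)
      have \<rho>L: "0 < \<rho> * L" "\<rho> * L < L" using \<rho> L(2) by auto
      have "L \<le> 2"
        using \<rho> \<delta> by (simp add: L_def pos_divide_le_eq)
      then have I: "(Arg z, L) \<in> intervals" using L pi_gt3 by (simp add: intervals_def)
      have zr: "rcis r (Arg z) = z" by (simp add: r_def rcis_cmod_Arg)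
      have \<delta>L: "\<delta> < L" using L \<rho>L by linarith
      have c\<delta>L: "c * \<delta> < \<rho> * L / 32"
        using \<delta>L \<rho> by (simp add: c_def)
      have "0 \<le> r \<and> 1 - L < r \<and> r < 1 - (1 - \<rho>) * L \<and> \<bar>Arg z - Arg z\<bar> < L / 2"
        using r L \<rho>L \<rho> by (auto simp: algebra_simps)
      then have zT: "z \<in> box_top \<rho> (Arg z, L)" unfolding box_top_mem using zr by metis
      have r0: "0 < r" using r \<rho> by simp
      have "dist (rcis r (Arg z)) \<xi> \<le> c * \<delta>" using d unfolding zr \<delta>_def .
      moreover have "c * \<delta> < r / 2" using c\<delta>(1) r(1) \<rho> unfolding c_def by linarith
      ultimately have "dist (rcis r (Arg z)) \<xi> < r / 2" by linarith
      then obtain \<beta> where \<beta>: "\<xi> = rcis (cmod \<xi>) \<beta>" "\<bar>\<beta> - Arg z\<bar> \<le> 2 * dist (rcis r (Arg z)) \<xi> / r"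
        using rcis_near[OF r0] by blast
      have "2 * dist (rcis r (Arg z)) \<xi> / r \<le> 2 * (c * \<delta>) / (\<rho> / 4)"
        using d r \<rho> c \<delta> unfolding zr by (intro frac_le) (auto simp: \<delta>_def)
      also have "\<dots> = \<delta> / 4" using \<rho> by (simp add: c_def)
      finally have "\<bar>Arg z - \<beta>\<bar> < L / 2" using \<beta>(2) \<delta>L L(2) \<delta>(1) by linarith
      moreover have "1 - L < cmod \<xi>" "cmod \<xi> < 1 - (1 - \<rho>) * L"
        using bd c\<delta>L L \<rho>L by (auto simp: algebra_simps)
      ultimately have "0 \<le> cmod \<xi> \<and> 1 - L < cmod \<xi> \<and> cmod \<xi> < 1 - (1 - \<rho>) * L \<and> \<bar>Arg z - \<beta>\<bar> < L / 2"
        by simp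
      then have \<xi>T: "\<xi> \<in> box_top \<rho> (Arg z, L)" unfolding box_top_mem using \<beta>(1) by blast
      show ?thesis
        using CC[OF top[OF I zT \<xi>T \<xi>]] CC[OF top[OF I \<xi>T zT z]] pos[OF z] pos[OF \<xi>] by simp
    qed
  qed
qed

text \<open>Chaining passes from the scale \<open>c\<close> to the scale 1/2.\<close>

lemma nearly_constant_imp_slow:
  assumes w: "nearly_constant_on_tops w" "\<And>z. z \<in> unit_disk \<Longrightarrow> 0 < w z"
  obtains A where "slow A w"
proof -
  obtain c A where c: "0 < c" "c \<le> 1 / 2" and A: "1 \<le> A"
    and loc: "\<And>z \<xi>. z \<in> unit_disk \<Longrightarrow> dist z \<xi> \<le> c * bdist z \<Longrightarrow> w \<xi> \<le> A * w z \<and> w z \<le> A * w \<xi>"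
    by (rule nearly_constant_local[OF w]) (assumption, (rule that; blast))
  obtain n :: nat where n: "1 / c \<le> real n" using real_arch_simple by blast
  have nc: "1 \<le> real n * c" using n c by (simp add: field_simps)
  have "slow (A ^ n) w"
    unfolding slow_def
  proof (intro conjI ballI allI impI)
    show "1 \<le> A ^ n" using A by simp
    fix z :: complex assume z: "z \<in> unit_disk"
    show "0 < w z" using w(2)[OF z] .
    fix \<xi> assume d: "dist z \<xi> \<le> bdist z / 2"
    define s where "s = bdist z / 2"
    have s: "0 < s" "s \<le> bdist z" using z by (auto simp: s_def)
    have \<xi>: "s \<le> bdist \<xi>" using half_ball(2)[OF z, of \<xi>] d by (simp add: s_def)
    have "1 * s \<le> (real n * c) * s" using nc s by (intro mult_right_mono) auto
    then have dn: "dist z \<xi> \<le> real n * (c * s)" using d by (simp add: s_def)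
    have step: "\<And>z \<xi>. z \<in> unit_disk \<Longrightarrow> dist z \<xi> \<le> c * bdist z \<Longrightarrow> w \<xi> \<le> A * w z" using loc by blast
    show "w \<xi> \<le> A ^ n * w z" by (rule local_chain[OF A c(1) _ step s \<xi> dn]) (use c in auto)
    have dn': "dist \<xi> z \<le> real n * (c * s)" using dn by (simp add: dist_commute)
    show "w z \<le> A ^ n * w \<xi>" by (rule local_chain[OF A c(1) _ step s(1) \<xi> s(2) dn']) (use c in auto)
  qed
  then show ?thesis by (rule that)
qed

section \<open>The maximal function over Carleson boxes\<close>

text \<open>The same comparison for the masses of Borel sets.\<close>

lemma mass_comparable:
  assumes A: "1 \<le> A" and cmp: "\<And>z. z \<in> unit_disk \<Longrightarrow> w z \<le> v z" "\<And>z. z \<in> unit_disk \<Longrightarrow> v z \<le> A * w z"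
    and v: "regular B v" and E: "E \<in> sets borel" "E \<subseteq> unit_disk"
  shows "(\<integral>\<^sup>+z\<in>E. ennreal (w z) \<partial>lebesgue) \<le> mass v E"
    "mass v E \<le> ennreal A * (\<integral>\<^sup>+z\<in>E. ennreal (w z) \<partial>lebesgue)"
proof -
  have [measurable]: "v \<in> borel_measurable borel" "E \<in> sets borel" using regularD(2)[OF v] E by auto
  note c = weighted_integral_comparable[of A w v "indicator E", OF A cmp regularD(3)[OF v]]
  have 1: "ennreal (indicator E z * w z) * indicator unit_disk z = ennreal (w z) * indicator E z" for z
    using E(2) by (auto simp: indicator_def)
  have 2: "ennreal (indicator E z * v z) = ennreal (v z) * indicator E z" for z by (auto simp: indicator_def)
  show "(\<integral>\<^sup>+z\<in>E. ennreal (w z) \<partial>lebesgue) \<le> mass v E"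
    "mass v E \<le> ennreal A * (\<integral>\<^sup>+z\<in>E. ennreal (w z) \<partial>lebesgue)"
    using c unfolding 1 2 by simp_all
qed

lemma box_area_bounds:
  assumes I: "I \<in> intervals"
  shows "ennreal (pi / 16 * (bdist (box_center I))\<^sup>2) \<le> emeasure lebesgue (carleson_box I)"
    "emeasure lebesgue (carleson_box I) \<le> ennreal (9 * pi * (bdist (box_center I))\<^sup>2)"
proof -
  have h: "0 < bdist (box_center I)" using box_center(3)[OF I] .
  have "ennreal (pi * (bdist (box_center I) / 4)\<^sup>2) = emeasure lborel (ball (box_center I) (bdist (box_center I) / 4))"
    using h by (subst emeasure_ball_complex) auto
  also have "\<dots> \<le> emeasure lborel (carleson_box I)" by (intro emeasure_mono ball_subset_box I) simp
  finally show "ennreal (pi / 16 * (bdist (box_center I))\<^sup>2) \<le> emeasure lebesgue (carleson_box I)"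
    by (simp add: power_divide)
  have "emeasure lborel (carleson_box I) \<le> emeasure lborel (ball (box_center I) (3 * bdist (box_center I)))"
    by (intro emeasure_mono box_subset_ball I) simp
  also have "\<dots> = ennreal (pi * (3 * bdist (box_center I))\<^sup>2)"
    using h by (subst emeasure_ball_complex) auto
  also have "pi * (3 * bdist (box_center I))\<^sup>2 = 9 * pi * (bdist (box_center I))\<^sup>2"
    by (simp only: power_mult_distrib) simp
  finally show "emeasure lebesgue (carleson_box I) \<le> ennreal (9 * pi * (bdist (box_center I))\<^sup>2)" by simp
qed

lemma box_mass_ge:
  assumes v: "regular A v" and I: "I \<in> intervals"
  shows "ennreal (pi / (16 * A) * (bdist (box_center I))\<^sup>2 * v (box_center I)) \<le> mass v (carleson_box I)"
proof -
  define a where "a = box_center I"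
  have a: "a \<in> unit_disk" "0 < bdist a" using box_center(2,3)[OF I] by (auto simp: a_def)
  have A: "1 \<le> A" and va: "0 \<le> v a" using regularD(4,5)[OF v] by auto
  have "ennreal (v a / A * (pi * (bdist a / 4)\<^sup>2)) \<le> mass v (carleson_box I)"
  proof (rule ball_integral_ge[of _ _ a])
    fix \<xi> assume \<xi>: "\<xi> \<in> ball a (bdist a / 4)"
    then have "dist a \<xi> \<le> bdist a / 2" using a(2) by simp
    then have "v a \<le> A * v \<xi>" by (rule slowD(4)[OF regularD(1)[OF v] a(1)])
    then have "v a / A \<le> v \<xi>" using A by (simp add: field_simps)
    then show "\<xi> \<in> carleson_box I \<and> ennreal (v a / A) \<le> ennreal (v \<xi>)"
      using ball_subset_box[OF I] \<xi> by (auto simp: a_def intro: ennreal_leI)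
  qed (use a A va in auto)
  also have "v a / A * (pi * (bdist a / 4)\<^sup>2) = pi / (16 * A) * (bdist a)\<^sup>2 * v a"
    by (simp add: power_divide mult_ac)
  finally show ?thesis unfolding a_def .
qed

lemma maximal_ge:
  assumes "J \<in> intervals" "z \<in> carleson_box J"
  shows "(\<integral>\<^sup>+\<xi>\<in>carleson_box J. ennreal \<bar>f \<xi>\<bar> \<partial>lebesgue) / emeasure lebesgue (carleson_box J) \<le> carleson_maximal f z"
  unfolding carleson_maximal_def using assms by (intro SUP_upper) auto

lemma divide_le_ennreal:
  assumes r: "0 < r" "ennreal r \<le> E"
  shows "x / E \<le> ennreal (1 / r) * x"
proof -
  have "0 < ennreal r" using r by simp
  then have "0 < E" using r(2) by (rule less_le_trans)
  have "ennreal (1 / r) * ennreal r \<le> ennreal (1 / r) * E" using r by (intro mult_left_mono) auto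
  moreover have "ennreal (1 / r) * ennreal r = 1" using r by (simp add: ennreal_mult'[symmetric])
  ultimately have "x * 1 \<le> x * (ennreal (1 / r) * E)" by (intro mult_left_mono) auto
  then have "x \<le> ennreal (1 / r) * x * E" by (simp add: mult_ac)
  with \<open>0 < E\<close> show ?thesis by (intro divide_le_posI_ennreal) (simp_all add: mult_ac)
qed

text \<open>Let \<open>z\<close> be in the box \<open>Q\<close> of the arc \<open>I\<close>, whose center \<open>a\<close> has depth \<open>h\<close>. The average over a box containing \<open>z\<close> whose
  center \<open>b\<close> has depth \<open>k > h\<close> is at most a constant times the average over \<open>Q\<close>. If \<open>k \<le> h\<close>, disk control bounds the
  average by a multiple of \<open>v b\<close>, and \<open>v b\<close> by the integral \<open>G z\<close> of \<open>v \<xi> / (bdist \<xi>)\<^sup>2\<close> over the part near \<open>a\<close> of the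
  cone of \<open>z\<close>, since this part contains the disk of radius \<open>k / 2\<close> about \<open>b\<close>. By Tonelli the integral of \<open>G\<close> is at most a constant times the
  mass of a disk about \<open>a\<close>.\<close>

lemma ball_carleson_imp_B_infty:
  assumes v: "regular B v" "ball_carleson v" and A: "1 \<le> A"
    and cmp: "\<And>z. z \<in> unit_disk \<Longrightarrow> w z \<le> v z" "\<And>z. z \<in> unit_disk \<Longrightarrow> v z \<le> A * w z"
    and w: "\<And>z. z \<in> unit_disk \<Longrightarrow> 0 < w z"
  shows "B_infty w"
proof -
  have [measurable]: "v \<in> borel_measurable borel" using regularD(2)[OF v(1)] .
  have v0: "0 \<le> v z" for z using regularD(4)[OF v(1)] .
  have vout: "v z = 0" if "z \<notin> unit_disk" for z using regularD(3)[OF v(1) that] .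
  have B: "1 \<le> B" using regularD(5)[OF v(1)] .
  obtain C where C: "0 \<le> C" "\<And>I. I \<in> intervals \<Longrightarrow>
     mass v (carleson_box I) \<le> ennreal (C * (bdist (box_center I))\<^sup>2 * v (box_center I))"
    using ball_carleson_imp_box_carleson[OF v(2)] unfolding box_carleson_def by blast
  obtain \<kappa> Cg where \<kappa>: "0 \<le> \<kappa>" and Cg: "1 \<le> Cg" and growth: "\<And>z R. z \<in> unit_disk \<Longrightarrow> bdist z \<le> R \<Longrightarrow>
      mass v (ball z R) \<le> ennreal (Cg * (R / bdist z) powr \<kappa> * R\<^sup>2 * v z)"
    by (rule ball_carleson_growth[OF v]) (rule that; blast)
  have fin: "(\<integral>\<^sup>+z\<in>carleson_box I. ennreal (w z) \<partial>lebesgue) < \<infinity>" if I: "I \<in> intervals" for I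
  proof -
    have "(\<integral>\<^sup>+z\<in>carleson_box I. ennreal (w z) \<partial>lebesgue) \<le> mass v (carleson_box I)"
      by (rule mass_comparable[OF A cmp v(1)]) (auto intro: carleson_box_subset[THEN subsetD])
    also have "\<dots> \<le> ennreal (C * (bdist (box_center I))\<^sup>2 * v (box_center I))" by (rule C(2)[OF I])
    finally show ?thesis by (rule le_less_trans) simp
  qed
  define C3 where "C3 = 16 * C / pi * (9 * B / pi)"
  have C3: "0 \<le> C3" using C B by (simp add: C3_def)
  define K where "K = C3 * (49 * pi) * (Cg * 7 powr \<kappa> * 49) * (16 * B / pi) * A + 144"
  have K: "0 \<le> K" using C3 Cg B A by (simp add: K_def)
  have main: "(\<integral>\<^sup>+z\<in>carleson_box I. carleson_maximal (\<lambda>\<xi>. w \<xi> * indicator (carleson_box I) \<xi>) z \<partial>lebesgue)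
      \<le> ennreal K * (\<integral>\<^sup>+z\<in>carleson_box I. ennreal (w z) \<partial>lebesgue)" if I: "I \<in> intervals" for I
  proof -
    define Q where "Q = carleson_box I"
    have [measurable]: "Q \<in> sets borel" by (simp add: Q_def)
    have QD: "Q \<subseteq> unit_disk" unfolding Q_def by (rule carleson_box_subset)
    define a where "a = box_center I"
    define h where "h = bdist a"
    have a: "a \<in> unit_disk" "0 < h" using box_center(2,3)[OF I] by (auto simp: a_def h_def)
    define W where "W = (\<integral>\<^sup>+z\<in>Q. ennreal (w z) \<partial>lebesgue)"
    define S where "S = unit_disk \<inter> ball a (7 * h)"
    have [measurable]: "S \<in> sets borel" by (simp add: S_def)
    define g where "g \<xi> = ennreal (v \<xi> * bdist \<xi> powr (-2)) * indicator S \<xi>" for \<xi>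
    have [measurable]: "g \<in> borel_measurable borel" unfolding g_def by measurable
    define G where "G z = (\<integral>\<^sup>+\<xi>\<in>{\<xi>. dist z \<xi> < 7 * bdist \<xi>}. g \<xi> \<partial>lborel)" for z
    have [measurable]: "G \<in> borel_measurable borel"
      unfolding G_def by (rule measurable_cone_integral) measurable
    have M: "carleson_maximal (\<lambda>\<xi>. w \<xi> * indicator Q \<xi>) z \<le> ennreal C3 * G z + ennreal (16 / (pi * h\<^sup>2)) * W" if z: "z \<in> Q" for z
      unfolding carleson_maximal_def
    proof (rule SUP_least)
      fix J assume "J \<in> {I \<in> intervals. z \<in> carleson_box I}"
      then have J: "J \<in> intervals" "z \<in> carleson_box J" by auto
      define b where "b = box_center J"
      define k where "k = bdist b"
      have b: "b \<in> unit_disk" "0 < k" using box_center(2,3)[OF J(1)] by (auto simp: b_def k_def)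
      define X where "X = (\<integral>\<^sup>+\<xi>\<in>carleson_box J. ennreal \<bar>w \<xi> * indicator Q \<xi>\<bar> \<partial>lebesgue)"
      have "X / emeasure lebesgue (carleson_box J) \<le> ennreal (1 / (pi / 16 * k\<^sup>2)) * X"
        using box_area_bounds(1)[OF J(1)] b by (intro divide_le_ennreal) (auto simp: b_def k_def)
      then have q: "X / emeasure lebesgue (carleson_box J) \<le> ennreal (16 / (pi * k\<^sup>2)) * X" by simp
      have "ennreal (16 / (pi * k\<^sup>2)) * X \<le> ennreal C3 * G z + ennreal (16 / (pi * h\<^sup>2)) * W"
      proof (cases "h < k")
        case True
        have "X \<le> W"
          unfolding X_def W_def using w QD
          by (intro nn_integral_mono) (auto simp: indicator_def abs_of_pos subset_iff)
        moreover have "16 / (pi * k\<^sup>2) \<le> 16 / (pi * h\<^sup>2)"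
          using True a by (intro divide_left_mono mult_left_mono power_mono mult_pos_pos) auto
        ultimately have "ennreal (16 / (pi * k\<^sup>2)) * X \<le> ennreal (16 / (pi * h\<^sup>2)) * W"
          by (intro mult_mono ennreal_leI) auto
        then show ?thesis by (rule add_increasing[OF zero_le])
      next
        case False
        have "X \<le> (\<integral>\<^sup>+\<xi>\<in>carleson_box J. ennreal (w \<xi>) \<partial>lebesgue)"
          unfolding X_def using w QD
          by (intro nn_integral_mono) (auto simp: indicator_def abs_of_pos subset_iff)
        also have "\<dots> \<le> mass v (carleson_box J)"
          by (rule mass_comparable[OF A cmp v(1)]) (auto intro: carleson_box_subset[THEN subsetD])
        also have "\<dots> \<le> ennreal (C * k\<^sup>2 * v b)" using C(2)[OF J(1)] by (simp add: b_def k_def)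
        finally have "ennreal (16 / (pi * k\<^sup>2)) * X \<le> ennreal (16 / (pi * k\<^sup>2)) * ennreal (C * k\<^sup>2 * v b)"
          by (intro mult_left_mono) auto
        also have "\<dots> = ennreal (16 / (pi * k\<^sup>2) * (C * k\<^sup>2 * v b))" by (intro ennreal_mult'[symmetric]) simp
        also have "16 / (pi * k\<^sup>2) * (C * k\<^sup>2 * v b) = 16 * C / pi * v b" using b by (simp add: field_simps)
        finally have 1: "ennreal (16 / (pi * k\<^sup>2)) * X \<le> ennreal (16 * C / pi * v b)" .
        have zb: "dist z b < 3 * k" using box_subset_ball[OF J(1)] J(2) by (auto simp: b_def k_def dist_commute)
        have za: "dist a z < 3 * h" using box_subset_ball[OF I] z by (auto simp: a_def h_def Q_def)
        have "ennreal (v b / B * (4 / 9 * k powr (-2)) * (pi * (k / 2)\<^sup>2)) \<le> G z"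
          unfolding G_def
        proof (rule ball_integral_ge[of _ _ b])
          fix \<xi> assume \<xi>: "\<xi> \<in> ball b (k / 2)"
          then have \<xi>c: "\<xi> \<in> cball b (bdist b / 2)" by (simp add: k_def)
          note hb = half_ball[OF b(1) \<xi>c]
          have d: "dist b \<xi> < k / 2" using \<xi> by simp
          have "dist z \<xi> < 3 * k + k / 2" using zb d dist_triangle[of z \<xi> b] by linarith
          then have cone: "dist z \<xi> < 7 * bdist \<xi>" using hb(2) unfolding k_def by argo
          have "dist a \<xi> < 7 * h"
            using dist_triangle[of a \<xi> z] za \<open>dist z \<xi> < 3 * k + k / 2\<close> False b(2) by linarith
          then have S: "\<xi> \<in> S" using hb(1) by (simp add: S_def)
          have "v b \<le> B * v \<xi>" using d by (intro slowD(4)[OF regularD(1)[OF v(1)] b(1)]) (simp add: k_def)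
          then have 2: "v b / B \<le> v \<xi>" using B by (simp add: field_simps)
          have "(3 / 2 * k) powr (-2) \<le> bdist \<xi> powr (-2)" using hb b by (intro powr_mono2') (auto simp: k_def)
          moreover have "(3 / 2 * k) powr (-2) = 4 / 9 * k powr (-2)"
            using b(2) by (simp add: powr_minus power2_eq_square divide_simps)
          ultimately have "v b / B * (4 / 9 * k powr (-2)) \<le> v \<xi> * bdist \<xi> powr (-2)"
            using 2 v0 B by (intro mult_mono) auto
          then show "\<xi> \<in> {\<xi>. dist z \<xi> < 7 * bdist \<xi>} \<and> ennreal (v b / B * (4 / 9 * k powr (-2))) \<le> g \<xi>"
            using cone S by (simp add: g_def ennreal_leI)
        qed (use b B v0 in auto)
        also have "v b / B * (4 / 9 * k powr (-2)) * (pi * (k / 2)\<^sup>2) = pi / (9 * B) * v b"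
          using b B by (simp add: powr_minus field_simps power2_eq_square)
        finally have "ennreal C3 * ennreal (pi / (9 * B) * v b) \<le> ennreal C3 * G z" by (intro mult_left_mono) auto
        moreover have "ennreal C3 * ennreal (pi / (9 * B) * v b) = ennreal (16 * C / pi * v b)"
        proof -
          have "C3 * (pi / (9 * B) * v b) = 16 * C / pi * v b" using B by (simp add: C3_def)
          then show ?thesis using C3 by (simp only: ennreal_mult'[symmetric])
        qed
        ultimately have "ennreal (16 / (pi * k\<^sup>2)) * X \<le> ennreal C3 * G z" using 1 by simp
        then show ?thesis by (rule add_increasing2[OF zero_le])
      qed
      with q show "(\<integral>\<^sup>+\<xi>\<in>carleson_box J. ennreal \<bar>w \<xi> * indicator Q \<xi>\<bar> \<partial>lebesgue) / emeasure lebesgue (carleson_box J)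
        \<le> ennreal C3 * G z + ennreal (16 / (pi * h\<^sup>2)) * W"
        unfolding X_def by (rule order_trans)
    qed
    have "(\<integral>\<^sup>+z\<in>Q. carleson_maximal (\<lambda>\<xi>. w \<xi> * indicator Q \<xi>) z \<partial>lebesgue)
      \<le> (\<integral>\<^sup>+z. ennreal C3 * G z + ennreal (16 / (pi * h\<^sup>2)) * W * indicator Q z \<partial>lborel)"
      unfolding nn_integral_completion using M
      by (intro nn_integral_mono) (auto simp: indicator_def)
    also have "\<dots> = ennreal C3 * (\<integral>\<^sup>+z. G z \<partial>lborel) + ennreal (16 / (pi * h\<^sup>2)) * W * emeasure lborel Q"
      by (subst nn_integral_add) (simp_all add: nn_integral_cmult nn_integral_cmult_indicator)
    also have "\<dots> \<le> ennreal (K - 144) * W + ennreal 144 * W"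
    proof (intro add_mono)
      have "(\<integral>\<^sup>+z. 1 * G z \<partial>lborel) = (\<integral>\<^sup>+\<xi>. g \<xi> * (\<integral>\<^sup>+z\<in>ball \<xi> (7 * bdist \<xi>). 1 \<partial>lborel) \<partial>lborel)"
        unfolding G_def by (rule tonelli_cone) measurable
      also have "\<dots> \<le> (\<integral>\<^sup>+\<xi>. ennreal (49 * pi) * (ennreal (v \<xi>) * indicator (ball a (7 * h)) \<xi>) \<partial>lborel)"
      proof (intro nn_integral_mono)
        fix \<xi>
        show "g \<xi> * (\<integral>\<^sup>+z\<in>ball \<xi> (7 * bdist \<xi>). 1 \<partial>lborel) \<le> ennreal (49 * pi) * (ennreal (v \<xi>) * indicator (ball a (7 * h)) \<xi>)"
        proof (cases "\<xi> \<in> S")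
          case True
          then have \<xi>: "0 < bdist \<xi>" "\<xi> \<in> ball a (7 * h)" by (auto simp: S_def)
          define d where "d = bdist \<xi>"
          have d: "0 < d" using \<xi> by (simp add: d_def)
          have "(\<integral>\<^sup>+z\<in>ball \<xi> (7 * d). 1 \<partial>lborel) = ennreal (1 * (pi * (7 * d)\<^sup>2))"
            using nn_integral_const_ball[of "7 * d" 1 \<xi>] d by simp
          then have "g \<xi> * (\<integral>\<^sup>+z\<in>ball \<xi> (7 * bdist \<xi>). 1 \<partial>lborel) = ennreal (v \<xi> * d powr (-2)) * ennreal (1 * (pi * (7 * d)\<^sup>2))"
            using True by (simp add: g_def d_def)
          also have "\<dots> = ennreal (v \<xi> * d powr (-2) * (1 * (pi * (7 * d)\<^sup>2)))"
            by (intro ennreal_mult''[symmetric]) simp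
          also have "v \<xi> * d powr (-2) * (1 * (pi * (7 * d)\<^sup>2)) = 49 * pi * v \<xi>"
            using d by (simp add: powr_minus power_mult_distrib)
          finally show ?thesis using \<xi> by (simp add: ennreal_mult')
        qed (simp add: g_def)
      qed
      also have "\<dots> = ennreal (49 * pi) * mass v (ball a (7 * h))"
        by (rule nn_integral_cmult) measurable
      also have "\<dots> \<le> ennreal (49 * pi) * ennreal (Cg * 7 powr \<kappa> * 49 * h\<^sup>2 * v a)"
      proof (intro mult_left_mono)
        have "mass v (ball a (7 * h)) \<le> ennreal (Cg * (7 * h / h) powr \<kappa> * (7 * h)\<^sup>2 * v a)"
          using growth[OF a(1), of "7 * h", folded h_def] a by simp
        also have "Cg * (7 * h / h) powr \<kappa> * (7 * h)\<^sup>2 * v a = Cg * 7 powr \<kappa> * 49 * h\<^sup>2 * v a"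
          using a by (simp add: power_mult_distrib)
        finally show "mass v (ball a (7 * h)) \<le> ennreal (Cg * 7 powr \<kappa> * 49 * h\<^sup>2 * v a)" .
      qed simp
      also have "\<dots> = ennreal (49 * pi * (Cg * 7 powr \<kappa> * 49) * (16 * B / pi)) * ennreal (pi / (16 * B) * h\<^sup>2 * v a)"
      proof -
        define D where "D = Cg * 7 powr \<kappa> * 49"
        have D: "0 \<le> D" using Cg by (simp add: D_def)
        have "49 * pi * (D * h\<^sup>2 * v a) = 49 * pi * D * (16 * B / pi) * (pi / (16 * B) * h\<^sup>2 * v a)"
          using B by simp
        moreover have "ennreal (49 * pi) * ennreal (D * h\<^sup>2 * v a) = ennreal (49 * pi * (D * h\<^sup>2 * v a))"
          by (rule ennreal_mult'[symmetric]) simp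
        moreover have "ennreal (49 * pi * D * (16 * B / pi)) * ennreal (pi / (16 * B) * h\<^sup>2 * v a)
          = ennreal (49 * pi * D * (16 * B / pi) * (pi / (16 * B) * h\<^sup>2 * v a))"
          using D B by (intro ennreal_mult'[symmetric]) simp
        ultimately show ?thesis unfolding D_def[symmetric] by (simp only:)
      qed
      also have "\<dots> \<le> ennreal (49 * pi * (Cg * 7 powr \<kappa> * 49) * (16 * B / pi)) * (ennreal A * W)"
      proof (intro mult_left_mono)
        have "ennreal (pi / (16 * B) * h\<^sup>2 * v a) \<le> mass v Q"
          using box_mass_ge[OF v(1) I] by (simp add: a_def h_def Q_def)
        also have "\<dots> \<le> ennreal A * W"
          unfolding W_def by (rule mass_comparable[OF A cmp v(1)]) (use QD in auto)
        finally show "ennreal (pi / (16 * B) * h\<^sup>2 * v a) \<le> ennreal A * W" .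
      qed simp
      also have "\<dots> = ennreal (49 * pi * (Cg * 7 powr \<kappa> * 49) * (16 * B / pi) * A) * W"
        using Cg B by (intro ennreal_mult_assoc) simp
      finally have "ennreal C3 * (\<integral>\<^sup>+z. G z \<partial>lborel) \<le> ennreal C3 * (ennreal (49 * pi * (Cg * 7 powr \<kappa> * 49) * (16 * B / pi) * A) * W)"
        by (intro mult_left_mono) auto
      also have "\<dots> = ennreal (C3 * (49 * pi * (Cg * 7 powr \<kappa> * 49) * (16 * B / pi) * A)) * W"
        using C3 by (rule ennreal_mult_assoc)
      also have "C3 * (49 * pi * (Cg * 7 powr \<kappa> * 49) * (16 * B / pi) * A) = K - 144" by (simp add: K_def mult.assoc)
      finally show "ennreal C3 * (\<integral>\<^sup>+z. G z \<partial>lborel) \<le> ennreal (K - 144) * W" .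
      have "ennreal (16 / (pi * h\<^sup>2)) * W * emeasure lborel Q \<le> ennreal (16 / (pi * h\<^sup>2)) * W * ennreal (9 * pi * h\<^sup>2)"
        using box_area_bounds(2)[OF I] by (intro mult_left_mono) (auto simp: Q_def a_def h_def)
      also have "\<dots> = ennreal (16 / (pi * h\<^sup>2) * (9 * pi * h\<^sup>2)) * W"
        by (subst ennreal_mult') (simp_all add: mult_ac)
      also have "16 / (pi * h\<^sup>2) * (9 * pi * h\<^sup>2) = 144" using a by simp
      finally show "ennreal (16 / (pi * h\<^sup>2)) * W * emeasure lborel Q \<le> ennreal 144 * W" .
    qed
    also have "\<dots> = ennreal K * W"
    proof -
      have "0 \<le> K - 144" using C3 Cg B A by (simp add: K_def)
      then have "ennreal (K - 144) + ennreal 144 = ennreal K" by (subst ennreal_plus[symmetric]) auto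
      then show ?thesis unfolding distrib_right[symmetric] by (simp only:)
    qed
    finally show ?thesis unfolding W_def Q_def .
  qed
  have "B_infty_const w \<le> ennreal K"
    unfolding B_infty_const_def
  proof (rule SUP_least)
    fix I assume I: "I \<in> intervals"
    define W where "W = (\<integral>\<^sup>+z\<in>carleson_box I. ennreal (w z) \<partial>lebesgue)"
    have "0 < pi / (16 * B) * (bdist (box_center I))\<^sup>2 * v (box_center I)"
      using B box_center[OF I] regularD(6)[OF v(1)] by (intro mult_pos_pos) auto
    then have "0 < ennreal (pi / (16 * B) * (bdist (box_center I))\<^sup>2 * v (box_center I))" by simp
    also have "\<dots> \<le> mass v (carleson_box I)" by (rule box_mass_ge[OF v(1) I])
    also have "\<dots> \<le> ennreal A * W"
      unfolding W_def by (rule mass_comparable[OF A cmp v(1)]) (auto intro: carleson_box_subset[THEN subsetD])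
    finally have "W \<noteq> 0" by auto
    then show "(\<integral>\<^sup>+z\<in>carleson_box I. carleson_maximal (\<lambda>\<xi>. w \<xi> * indicator (carleson_box I) \<xi>) z \<partial>lebesgue)
       / (\<integral>\<^sup>+z\<in>carleson_box I. ennreal (w z) \<partial>lebesgue) \<le> ennreal K"
      using main[OF I] unfolding W_def[symmetric] by (intro divide_le_posI_ennreal) (auto simp: zero_less_iff_neq_zero mult.commute)
  qed
  then have "B_infty_const w < \<infinity>" by (rule le_less_trans) simp
  then show ?thesis unfolding B_infty_def using fin by blast
qed

text \<open>The disk required by \<open>shell_transfer\<close> within a box: starting from \<open>z\<close>, go inwards to depth \<open>3 / 2 * s\<close> and
  rotate towards the midpoint of the arc, in order to stay away from the sides of the box.\<close>

lemma shell_point: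
  assumes I: "I \<in> intervals" and z: "z \<in> carleson_box I" "bdist z < s"
    and s: "0 < s" "2 * s \<le> bdist (box_center I)"
  obtains b where "ball b (s / 8) \<subseteq> carleson_box I \<inter> {\<xi>. s \<le> bdist \<xi> \<and> bdist \<xi> < 2 * s} \<inter> {\<xi>. dist z \<xi> < 3 * bdist \<xi>}"
proof -
  obtain \<theta> L where IL: "I = (\<theta>, L)" by (cases I)
  then have L: "0 < L" using I by (auto simp: intervals_def)
  have sL: "4 * s \<le> L" "4 * s \<le> 1" using s(2) unfolding box_center(1)[OF I] by (auto simp: IL)
  obtain r \<alpha> where zr: "z = rcis r \<alpha>" "0 \<le> r" "1 - L < r" "r < 1" "\<bar>\<theta> - \<alpha>\<bar> < L / 2"
    using z(1) unfolding IL carleson_box_mem by blast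
  have rs: "1 - r < s" using z(2) zr by simp
  \<comment> \<open>the proportion of the way to the midpoint for which the distance to the sides is at least \<open>s\<close>\<close>
  define t where "t = 2 * s / L"
  have t: "0 \<le> t" "t \<le> 1" "t * (L / 2) = s" using s sL L by (auto simp: t_def field_simps)
  define \<beta> where "\<beta> = \<alpha> + t * (\<theta> - \<alpha>)"
  have \<beta>1: "\<bar>\<theta> - \<beta>\<bar> \<le> L / 2 - s"
  proof -
    have "\<theta> - \<beta> = (1 - t) * (\<theta> - \<alpha>)" by (simp add: \<beta>_def algebra_simps)
    then have "\<bar>\<theta> - \<beta>\<bar> = (1 - t) * \<bar>\<theta> - \<alpha>\<bar>" using t by (simp add: abs_mult)
    also have "\<dots> \<le> (1 - t) * (L / 2)" using t zr by (intro mult_left_mono) auto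
    also have "\<dots> = L / 2 - s" by (simp only: left_diff_distrib t(3) mult_1)
    finally show ?thesis .
  qed
  have \<beta>2: "\<bar>\<alpha> - \<beta>\<bar> \<le> s"
  proof -
    have "\<bar>\<alpha> - \<beta>\<bar> = t * \<bar>\<theta> - \<alpha>\<bar>" using t by (simp add: \<beta>_def abs_mult)
    also have "\<dots> \<le> t * (L / 2)" using t zr by (intro mult_left_mono) auto
    finally show ?thesis using t(3) by simp
  qed
  define \<rho> where "\<rho> = 1 - 3 / 2 * s"
  have \<rho>: "1 / 2 \<le> \<rho>" using sL by (simp add: \<rho>_def)
  define b where "b = rcis \<rho> \<beta>"
  have bb: "bdist b = 3 / 2 * s" using \<rho> by (simp add: b_def \<rho>_def)
  have zb: "dist z b \<le> 5 / 2 * s"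
  proof -
    have "dist z b \<le> \<bar>r - \<rho>\<bar> + \<bar>\<alpha> - \<beta>\<bar>" unfolding zr(1) b_def using zr by (intro dist_rcis_le) auto
    moreover have "\<bar>r - \<rho>\<bar> \<le> 3 / 2 * s" using rs zr(4) s(1) unfolding \<rho>_def by linarith
    ultimately show ?thesis using \<beta>2 by linarith
  qed
  have "ball b (s / 8) \<subseteq> carleson_box I \<inter> {\<xi>. s \<le> bdist \<xi> \<and> bdist \<xi> < 2 * s} \<inter> {\<xi>. dist z \<xi> < 3 * bdist \<xi>}"
  proof
    fix \<xi> assume "\<xi> \<in> ball b (s / 8)"
    then have d: "dist b \<xi> < s / 8" by simp
    have bd: "11 / 8 * s < bdist \<xi>" "bdist \<xi> < 13 / 8 * s"
      using bdist_diff[of b \<xi>] d unfolding bb by linarith+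
    have "dist (rcis \<rho> \<beta>) \<xi> < \<rho> / 2" using d sL \<rho> unfolding b_def by linarith
    then obtain \<phi> where \<phi>: "\<xi> = rcis (cmod \<xi>) \<phi>" "\<bar>\<phi> - \<beta>\<bar> \<le> 2 * dist (rcis \<rho> \<beta>) \<xi> / \<rho>"
      using rcis_near[of \<rho> \<beta> \<xi>] \<rho> by auto
    have "2 * dist (rcis \<rho> \<beta>) \<xi> / \<rho> \<le> 2 * (s / 8) / (1 / 2)"
      using d \<rho> s by (intro frac_le) (auto simp: b_def)
    also have "\<dots> = s / 2" by simp
    finally have "\<bar>\<phi> - \<beta>\<bar> \<le> s / 2" using \<phi>(2) by (rule order_trans[rotated])
    then have "\<bar>\<theta> - \<phi>\<bar> < L / 2" using \<beta>1 s(1) by linarith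
    then have "0 \<le> cmod \<xi> \<and> 1 - L < cmod \<xi> \<and> cmod \<xi> < 1 \<and> \<bar>\<theta> - \<phi>\<bar> < L / 2"
      using bd sL s by auto
    then have 1: "\<xi> \<in> carleson_box I" unfolding IL carleson_box_mem using \<phi>(1) by blast
    have "dist z \<xi> < 5 / 2 * s + s / 8" using zb d dist_triangle[of z \<xi> b] by linarith
    then have "dist z \<xi> < 3 * bdist \<xi>" using bd s(1) by argo
    then show "\<xi> \<in> carleson_box I \<inter> {\<xi>. s \<le> bdist \<xi> \<and> bdist \<xi> < 2 * s} \<inter> {\<xi>. dist z \<xi> < 3 * bdist \<xi>}"
      using 1 bd s by auto
  qed
  then show ?thesis by (rule that)
qed

lemma ennreal_divide_mult_self: "y \<noteq> 0 \<Longrightarrow> y \<noteq> top \<Longrightarrow> x / y * y = (x::ennreal)"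
  by (metis ennreal_times_divide mult.commute mult_divide_eq_ennreal)

text \<open>At a point \<open>\<xi>\<close> of depth between \<open>s\<close> and \<open>2 * s\<close>, the maximal function is at least a constant times
  \<open>inner \<xi> / (bdist \<xi>)\<^sup>2\<close>, where \<open>inner \<xi>\<close> is the mass of the part of the box in the disk of radius \<open>3 * bdist \<xi>\<close>. Integrated over the shell this gives, by
  \<open>shell_transfer\<close>, at least a constant times the mass of the box below depth \<open>s\<close>. Summing over \<open>N\<close> disjoint shells, \<open>N\<close>
  times the mass below the last shell is at most a constant times the mass of the box, and for large \<open>N\<close> at least half of
  the mass lies above, where the weight is comparable to its value at the center.\<close>

lemma B_infty_imp_box_carleson:
  assumes v: "regular B v" and A: "1 \<le> A"
    and cmp: "\<And>z. z \<in> unit_disk \<Longrightarrow> w z \<le> v z" "\<And>z. z \<in> unit_disk \<Longrightarrow> v z \<le> A * w z"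
    and w: "\<And>z. z \<in> unit_disk \<Longrightarrow> 0 < w z" and "B_infty w"
  shows "box_carleson v"
proof -
  have [measurable]: "v \<in> borel_measurable borel" using regularD(2)[OF v] .
  have v0: "0 \<le> v z" for z using regularD(4)[OF v] .
  have vout: "v z = 0" if "z \<notin> unit_disk" for z using regularD(3)[OF v that] .
  have fin: "(\<integral>\<^sup>+z\<in>carleson_box I. ennreal (w z) \<partial>lebesgue) < \<infinity>" if "I \<in> intervals" for I
    using \<open>B_infty w\<close> that unfolding B_infty_def by auto
  have const: "B_infty_const w < \<infinity>" using \<open>B_infty w\<close> unfolding B_infty_def by auto
  obtain K where K: "0 \<le> K" "B_infty_const w = ennreal K"
    using const by (cases "B_infty_const w") auto
  obtain \<kappa> C2 where \<kappa>: "0 \<le> \<kappa>" and C2: "1 \<le> C2" and gr: "\<And>z \<xi> R. z \<in> unit_disk \<Longrightarrow> \<xi> \<in> unit_disk \<Longrightarrow> dist z \<xi> \<le> R \<Longrightarrow> bdist z \<le> R \<Longrightarrow> bdist \<xi> \<le> R \<Longrightarrow>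
      v \<xi> \<le> C2 * (R / bdist z) powr \<kappa> * (R / bdist \<xi>) powr \<kappa> * v z"
    by (rule slow_growth[OF regularD(1)[OF v]]) (rule that; blast)
  define c where "c = 1 / (576 * pi * A)"
  have c: "0 < c" using A by (simp add: c_def)
  \<comment> \<open>enough shells for the mass below the last one to be at most half of the total\<close>
  obtain N :: nat where N: "512 * K / (c * pi) + 1 \<le> real N" using real_arch_simple by blast
  define D where "D = 2 * C2 * (192 * 2 ^ N) powr \<kappa> * 4 powr \<kappa> * (9 * pi)"
  show ?thesis
    unfolding box_carleson_def
  proof (intro exI[of _ D] conjI ballI)
    show "0 \<le> D" using C2 by (simp add: D_def)
    fix I assume I: "I \<in> intervals"
    define Q where "Q = carleson_box I"
    have [measurable]: "Q \<in> sets borel" by (simp add: Q_def)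
    have QD: "Q \<subseteq> unit_disk" unfolding Q_def by (rule carleson_box_subset)
    define a where "a = box_center I"
    define h where "h = bdist a"
    have a: "a \<in> unit_disk" "0 < h" "h \<le> 1 / 2" using box_center(2-4)[OF I] by (auto simp: a_def h_def)
    define W where "W = (\<integral>\<^sup>+z\<in>Q. ennreal (w z) \<partial>lebesgue)"
    define m where "m E = mass v E" for E
    have mono: "m E \<le> m F" if "E \<subseteq> F" for E F unfolding m_def using that by (intro nn_set_integral_set_mono)
    have WQ: "W \<le> m Q" "m Q \<le> ennreal A * W"
      unfolding W_def m_def by (rule mass_comparable[OF A cmp v]; use QD in simp)+
    have mfin: "m Q < \<infinity>"
    proof -
      have "ennreal A * W < \<infinity>" using fin[OF I] unfolding W_def Q_def by (simp add: ennreal_mult_less_top)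
      with WQ(2) show ?thesis by (rule le_less_trans)
    qed
    have mpos: "0 < m Q"
    proof -
      have "0 < pi / (16 * B) * h\<^sup>2 * v a"
        using regularD(5)[OF v] a regularD(6)[OF v a(1)] by (intro mult_pos_pos) auto
      then have "0 < ennreal (pi / (16 * B) * h\<^sup>2 * v a)" by simp
      also have "\<dots> \<le> m Q" using box_mass_ge[OF v I] by (simp add: m_def Q_def a_def h_def)
      finally show ?thesis .
    qed
    have "W \<noteq> 0" using mpos WQ(2) by auto
    then have Wpos: "0 < W" by (simp add: zero_less_iff_neq_zero)
    define M where "M z = carleson_maximal (\<lambda>\<xi>. w \<xi> * indicator Q \<xi>) z" for z
    have MK: "(\<integral>\<^sup>+z\<in>Q. M z \<partial>lebesgue) \<le> ennreal K * W"
    proof -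
      have "(\<integral>\<^sup>+z\<in>Q. M z \<partial>lebesgue) / W \<le> ennreal K"
        unfolding K(2)[symmetric] B_infty_const_def M_def W_def Q_def using I by (intro SUP_upper)
      then have "(\<integral>\<^sup>+z\<in>Q. M z \<partial>lebesgue) / W * W \<le> ennreal K * W" by (rule mult_right_mono) simp
      moreover have "(\<integral>\<^sup>+z\<in>Q. M z \<partial>lebesgue) / W * W = (\<integral>\<^sup>+z\<in>Q. M z \<partial>lebesgue)"
        using Wpos fin[OF I] unfolding W_def[symmetric, unfolded Q_def]
        by (intro ennreal_divide_mult_self) auto
      ultimately show ?thesis by simp
    qed
    define inner where "inner \<xi> = m (Q \<inter> ball \<xi> (3 * bdist \<xi>))" for \<xi>
    have [measurable]: "inner \<in> borel_measurable borel"
      unfolding inner_def m_def by (intro measurable_ball_integral) measurable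
    have Mge: "ennreal (c * bdist \<xi> powr (-2)) * inner \<xi> \<le> M \<xi>" if \<xi>: "\<xi> \<in> Q" "bdist \<xi> \<le> 1 / 24" for \<xi>
    proof -
      have \<xi>D: "\<xi> \<in> unit_disk" using \<xi> QD by blast
      define d where "d = bdist \<xi>"
      have d: "0 < d" using \<xi>D by (simp add: d_def)
      obtain J where J: "J \<in> intervals" "\<xi> \<in> carleson_box J" "bdist (box_center J) = 8 * bdist \<xi>"
        "unit_disk \<inter> ball \<xi> (3 * bdist \<xi>) \<subseteq> carleson_box J"
        using box_around[OF \<xi>D \<xi>(2)] by metis
      define X where "X = (\<integral>\<^sup>+z\<in>carleson_box J. ennreal \<bar>w z * indicator Q z\<bar> \<partial>lebesgue)"
      define E where "E = Q \<inter> ball \<xi> (3 * bdist \<xi>)"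
      have [measurable]: "E \<in> sets borel" unfolding E_def by measurable
      have "inner \<xi> \<le> ennreal A * (\<integral>\<^sup>+z\<in>E. ennreal (w z) \<partial>lebesgue)"
        unfolding inner_def m_def E_def[symmetric]
        by (rule mass_comparable[OF A cmp v]) (use QD in \<open>auto simp: E_def\<close>)
      also have "\<dots> \<le> ennreal A * X"
      proof (intro mult_left_mono)
        have "E \<subseteq> carleson_box J" using J(4) QD by (auto simp: E_def)
        then show "(\<integral>\<^sup>+z\<in>E. ennreal (w z) \<partial>lebesgue) \<le> X"
          unfolding X_def using w QD by (intro nn_integral_mono) (auto simp: indicator_def E_def abs_of_pos subset_iff)
      qed simp
      finally have in1: "inner \<xi> \<le> ennreal A * X" .
      have emJ: "emeasure lebesgue (carleson_box J) \<le> ennreal (576 * pi * d\<^sup>2)"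
      proof -
        have "9 * pi * (8 * d)\<^sup>2 = 576 * pi * d\<^sup>2" by (simp add: power_mult_distrib)
        then show ?thesis using box_area_bounds(2)[OF J(1)] unfolding J(3) d_def[symmetric] by (simp only:)
      qed
      have emJ0: "0 < emeasure lebesgue (carleson_box J)"
      proof -
        have "0 < ennreal (pi / 16 * (8 * d)\<^sup>2)" using d by simp
        also have "\<dots> \<le> emeasure lebesgue (carleson_box J)" using box_area_bounds(1)[OF J(1)] unfolding J(3) d_def .
        finally show ?thesis .
      qed
      define em where "em = emeasure lebesgue (carleson_box J)"
      have "X = X / em * em"
        using emJ0 emJ unfolding em_def by (intro ennreal_divide_mult_self[symmetric]) (auto simp: top_unique)
      also have "\<dots> \<le> X / em * ennreal (576 * pi * d\<^sup>2)" using emJ unfolding em_def by (intro mult_left_mono) auto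
      also have "\<dots> \<le> M \<xi> * ennreal (576 * pi * d\<^sup>2)"
        unfolding X_def em_def M_def by (intro mult_right_mono maximal_ge J) simp
      finally have "ennreal (c * d powr (-2)) * inner \<xi> \<le> ennreal (c * d powr (-2)) * (ennreal A * (M \<xi> * ennreal (576 * pi * d\<^sup>2)))"
        using in1 by (meson mult_left_mono order_trans zero_le)
      also have "\<dots> = ennreal (c * d powr (-2) * A * (576 * pi * d\<^sup>2)) * M \<xi>"
        using c A by (simp add: ennreal_mult' mult_ac)
      also have "c * d powr (-2) * A * (576 * pi * d\<^sup>2) = 1"
        using A d by (simp add: c_def powr_minus)
      finally show ?thesis by (simp add: d_def)
    qed
    define g where "g \<xi> = ennreal (c * bdist \<xi> powr (-2)) * inner \<xi> * indicator (Q \<inter> {\<xi>. bdist \<xi> \<le> 1 / 24}) \<xi>" for \<xi>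
    have [measurable]: "g \<in> borel_measurable borel" unfolding g_def by measurable
    \<comment> \<open>as \<open>h \<le> 1 / 2\<close>, all shells have depth at most 1/24, as \<open>box_around\<close> requires\<close>
    define s where "s j = h / (48 * 2 ^ j)" for j :: nat
    have s0: "0 < s j" "s (Suc j) = s j / 2" for j using a by (auto simp: s_def)
    have s_le: "s j \<le> h / 48" for j
    proof (induction j)
      case (Suc j)
      then show ?case using s0(1)[of j] s0(2)[of j] by linarith
    qed (simp add: s_def)
    define Z where "Z j = Q \<inter> {z. bdist z < s j}" for j
    define S where "S j = Q \<inter> {\<xi>. s j \<le> bdist \<xi> \<and> bdist \<xi> < 2 * s j}" for j
    have [measurable]: "Z j \<in> sets borel" "S j \<in> sets borel" for j unfolding Z_def S_def by measurable
    have s_anti: "s k \<le> s j" if "j \<le> k" for j k using that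
    proof (induction rule: dec_induct)
      case (step n)
      then show ?case using s0(1)[of n] s0(2)[of n] by linarith
    qed simp
    have shell: "m (Z N) \<le> ennreal (256 / (c * pi)) * (\<integral>\<^sup>+\<xi>\<in>S j. g \<xi> \<partial>lborel)" if j: "j < N" for j
    proof -
      have "m (Z N) \<le> m (Z j)" using s_anti[of j N] j by (intro mono) (auto simp: Z_def)
      also have "m (Z j) \<le> ennreal (64 / (pi * (s j)\<^sup>2)) * (\<integral>\<^sup>+\<xi>\<in>S j. mass v (Z j \<inter> ball \<xi> (3 * bdist \<xi>)) \<partial>lborel)"
        unfolding m_def
      proof (rule shell_transfer)
        fix z assume "z \<in> Z j"
        then have z: "z \<in> carleson_box I" "bdist z < s j" by (auto simp: Z_def Q_def)
        have "2 * s j \<le> bdist (box_center I)" using s_le[of j] a by (simp add: h_def[unfolded a_def, symmetric])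
        then obtain b where "ball b (s j / 8) \<subseteq> carleson_box I \<inter> {\<xi>. s j \<le> bdist \<xi> \<and> bdist \<xi> < 2 * s j} \<inter> {\<xi>. dist z \<xi> < 3 * bdist \<xi>}"
          using shell_point[OF I z s0(1)] by blast
        then show "\<exists>b. ball b (s j / 8) \<subseteq> S j \<inter> {\<xi>. dist z \<xi> < 3 * bdist \<xi>}"
          unfolding S_def Q_def by blast
      qed (use s0 in auto)
      also have "\<dots> \<le> ennreal (64 / (pi * (s j)\<^sup>2)) * (\<integral>\<^sup>+\<xi>. ennreal (4 * (s j)\<^sup>2 / c) * (g \<xi> * indicator (S j) \<xi>) \<partial>lborel)"
      proof (intro mult_left_mono nn_integral_mono)
        fix \<xi>
        show "mass v (Z j \<inter> ball \<xi> (3 * bdist \<xi>)) * indicator (S j) \<xi> \<le> ennreal (4 * (s j)\<^sup>2 / c) * (g \<xi> * indicator (S j) \<xi>)"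
        proof (cases "\<xi> \<in> S j")
          case True
          then have \<xi>: "\<xi> \<in> Q" "s j \<le> bdist \<xi>" "bdist \<xi> < 2 * s j" by (auto simp: S_def)
          have b24: "bdist \<xi> \<le> 1 / 24" using \<xi>(3) s_le[of j] a by linarith
          have b0: "0 < bdist \<xi>" using \<xi>(2) s0(1)[of j] by linarith
          have "mass v (Z j \<inter> ball \<xi> (3 * bdist \<xi>)) \<le> inner \<xi>"
            unfolding inner_def m_def by (intro nn_set_integral_set_mono) (auto simp: Z_def)
          also have "\<dots> = 1 * inner \<xi>" by simp
          also have "\<dots> \<le> ennreal (4 * (s j)\<^sup>2 / c * (c * bdist \<xi> powr (-2))) * inner \<xi>"
          proof (intro mult_right_mono)
            have "(2 * s j) powr (-2) \<le> bdist \<xi> powr (-2)" using \<xi> b0 by (intro powr_mono2') auto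
            then have "4 * (s j)\<^sup>2 * (2 * s j) powr (-2) \<le> 4 * (s j)\<^sup>2 * bdist \<xi> powr (-2)" by (intro mult_left_mono) auto
            moreover have "4 * (s j)\<^sup>2 * (2 * s j) powr (-2) = 1"
              using s0(1)[of j] by (simp add: powr_minus power_mult_distrib)
            ultimately have "1 \<le> 4 * (s j)\<^sup>2 / c * (c * bdist \<xi> powr (-2))" using c by simp
            then show "1 \<le> ennreal (4 * (s j)\<^sup>2 / c * (c * bdist \<xi> powr (-2)))"
              using ennreal_leI by fastforce
          qed simp
          also have "\<dots> = ennreal (4 * (s j)\<^sup>2 / c) * g \<xi>"
          proof -
            have "ennreal (4 * (s j)\<^sup>2 / c * (c * bdist \<xi> powr (-2))) = ennreal (4 * (s j)\<^sup>2 / c) * ennreal (c * bdist \<xi> powr (-2))"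
              using c by (intro ennreal_mult') simp
            then show ?thesis using \<xi>(1) b24 by (simp add: g_def mult.assoc)
          qed
          finally show ?thesis using True by simp
        qed simp
      qed simp
      also have "\<dots> = ennreal (64 / (pi * (s j)\<^sup>2)) * (ennreal (4 * (s j)\<^sup>2 / c) * (\<integral>\<^sup>+\<xi>\<in>S j. g \<xi> \<partial>lborel))"
        by (subst nn_integral_cmult) measurable
      also have "\<dots> = ennreal (64 / (pi * (s j)\<^sup>2) * (4 * (s j)\<^sup>2 / c)) * (\<integral>\<^sup>+\<xi>\<in>S j. g \<xi> \<partial>lborel)"
        by (rule ennreal_mult_assoc) simp
      also have "64 / (pi * (s j)\<^sup>2) * (4 * (s j)\<^sup>2 / c) = 256 / (c * pi)"
        using s0(1)[of j] by (simp add: field_simps)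
      finally show ?thesis .
    qed
    have disj: "(\<Sum>j<N. indicator (S j) \<xi>) \<le> (indicator Q \<xi> :: ennreal)" for \<xi>
    proof (cases "\<exists>j<N. \<xi> \<in> S j")
      case True
      then obtain j where j: "j < N" "\<xi> \<in> S j" by blast
      have "\<xi> \<notin> S i" if "i \<noteq> j" for i
      proof
        assume i: "\<xi> \<in> S i"
        show False
        proof (cases "i < j")
          case True
          then have "2 * s j \<le> s i" using s_anti[of "Suc i" j] s0(2)[of i] by simp
          then show False using i j by (auto simp: S_def)
        next
          case False
          then have "2 * s i \<le> s j" using s_anti[of "Suc j" i] s0(2)[of j] that by simp
          then show False using i j by (auto simp: S_def)
        qed
      qed
      then have "(\<Sum>i<N. indicator (S i) \<xi>) = (\<Sum>i<N. if i = j then 1 else 0 :: ennreal)"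
        using j by (intro sum.cong) (auto simp: indicator_def)
      also have "\<dots> = 1" using j by simp
      finally show ?thesis using j by (simp add: S_def)
    next
      case False
      then have "(\<Sum>i<N. indicator (S i) \<xi>) = (0 :: ennreal)" by (intro sum.neutral) (auto simp: indicator_def)
      then show ?thesis by simp
    qed
    have "of_nat N * m (Z N) = (\<Sum>j<N. m (Z N))" by simp
    also have "\<dots> \<le> (\<Sum>j<N. ennreal (256 / (c * pi)) * (\<integral>\<^sup>+\<xi>\<in>S j. g \<xi> \<partial>lborel))" by (intro sum_mono shell) simp
    also have "\<dots> = ennreal (256 / (c * pi)) * (\<integral>\<^sup>+\<xi>. (\<Sum>j<N. g \<xi> * indicator (S j) \<xi>) \<partial>lborel)"
      by (subst nn_integral_sum) (simp_all add: sum_distrib_left)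
    also have "\<dots> \<le> ennreal (256 / (c * pi)) * (\<integral>\<^sup>+\<xi>\<in>Q. M \<xi> \<partial>lborel)"
    proof (intro mult_left_mono nn_integral_mono)
      fix \<xi>
      have "(\<Sum>j<N. g \<xi> * indicator (S j) \<xi>) \<le> g \<xi> * indicator Q \<xi>"
        unfolding sum_distrib_left[symmetric] by (intro mult_left_mono disj) simp
      also have "\<dots> \<le> M \<xi> * indicator Q \<xi>" using Mge[of \<xi>] by (auto simp: g_def indicator_def)
      finally show "(\<Sum>j<N. g \<xi> * indicator (S j) \<xi>) \<le> M \<xi> * indicator Q \<xi>" .
    qed simp
    also have "\<dots> \<le> ennreal (256 / (c * pi)) * (ennreal K * m Q)"
      using MK WQ(1) unfolding nn_integral_completion by (meson mult_left_mono order_trans zero_le)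
    finally have le: "of_nat N * m (Z N) \<le> ennreal (256 / (c * pi)) * (ennreal K * m Q)" .
    obtain q where q: "m Q = ennreal q" "0 \<le> q" using mfin by (cases "m Q") auto
    have "m (Z N) \<le> m Q" by (intro mono) (auto simp: Z_def)
    then obtain x where x: "m (Z N) = ennreal x" "0 \<le> x" using q by (cases "m (Z N)") (auto simp: top_unique)
    define Y where "Y = Q \<inter> {z. s N \<le> bdist z}"
    have [measurable]: "Y \<in> sets borel" unfolding Y_def by measurable
    have mY: "m Y \<le> ennreal (C2 * (192 * 2 ^ N) powr \<kappa> * 4 powr \<kappa> * v a * (pi * (3 * h)\<^sup>2))"
      unfolding m_def
    proof (rule ball_integral_le[of _ _ _ a])
      fix z assume z: "z \<in> Y"
      then have zD: "z \<in> unit_disk" "s N \<le> bdist z" using QD by (auto simp: Y_def)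
      have za: "z \<in> ball a (3 * h)" using box_subset_ball[OF I] z by (auto simp: Y_def Q_def a_def h_def)
      have zb: "bdist z \<le> 4 * h" using za bdist_ge[of z a] by (simp add: h_def dist_commute)
      have "v z \<le> C2 * (4 * h / bdist a) powr \<kappa> * (4 * h / bdist z) powr \<kappa> * v a"
        using za zb a by (intro gr[OF a(1) zD(1)]) (auto simp: h_def)
      also have "4 * h / bdist a = 4" using a by (simp add: h_def[symmetric])
      also have "C2 * 4 powr \<kappa> * (4 * h / bdist z) powr \<kappa> * v a \<le> C2 * 4 powr \<kappa> * (192 * 2 ^ N) powr \<kappa> * v a"
      proof (intro mult_right_mono mult_left_mono powr_mono2)
        have "4 * h / bdist z \<le> 4 * h / s N" using zD s0(1)[of N] a by (intro divide_left_mono) auto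
        also have "\<dots> = 192 * 2 ^ N" using a by (simp add: s_def)
        finally show "4 * h / bdist z \<le> 192 * 2 ^ N" .
      qed (use C2 \<kappa> v0 zD a in auto)
      also have "\<dots> = C2 * (192 * 2 ^ N) powr \<kappa> * 4 powr \<kappa> * v a" by simp
      finally show "z \<in> ball a (3 * h) \<and> ennreal (v z) \<le> ennreal (C2 * (192 * 2 ^ N) powr \<kappa> * 4 powr \<kappa> * v a)"
        using za ennreal_leI by auto
    qed (use a C2 v0 in auto)
    have "m Q = m (Z N) + m Y"
    proof -
      have "m Q = (\<integral>\<^sup>+z. ennreal (v z) * indicator (Z N) z + ennreal (v z) * indicator Y z \<partial>lborel)"
        unfolding m_def by (intro nn_integral_cong) (auto simp: Z_def Y_def indicator_def)
      then show ?thesis unfolding m_def by (subst (asm) nn_integral_add) measurable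
    qed
    have "real N * x \<le> 256 / (c * pi) * (K * q)"
      using le K(1) c q(2) x(2) unfolding x(1) q(1) by (simp add: ennreal_mult'[symmetric] ennreal_of_nat_eq_real_of_nat)
    also have "\<dots> = 512 * K / (c * pi) * (q / 2)" by simp
    also have "\<dots> \<le> real N * (q / 2)" using N q(2) by (intro mult_right_mono) auto
    finally have "real N * x \<le> real N * (q / 2)" .
    moreover have "0 < 512 * K / (c * pi) + 1" using K(1) c by (simp add: add_nonneg_pos)
    ultimately have xq: "x \<le> q / 2" using N by (metis less_le_trans mult_le_cancel_left_pos)
    define T where "T = C2 * (192 * 2 ^ N) powr \<kappa> * 4 powr \<kappa> * v a * (pi * (3 * h)\<^sup>2)"
    have T: "0 \<le> T" using C2 v0 by (simp add: T_def)
    have "ennreal q \<le> ennreal x + ennreal T"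
      using \<open>m Q = m (Z N) + m Y\<close> mY unfolding q(1) x(1) T_def by (simp only: add_left_mono)
    then have "q \<le> x + T" using x(2) T by (simp add: ennreal_plus[symmetric] del: ennreal_plus)
    with xq have "q \<le> 2 * T" by linarith
    moreover have "2 * T = D * h\<^sup>2 * v a" by (simp add: T_def D_def power_mult_distrib)
    ultimately have "m Q \<le> ennreal (D * h\<^sup>2 * v a)" unfolding q(1) by (simp add: ennreal_leI)
    then show "mass v (carleson_box I) \<le> ennreal (D * (bdist (box_center I))\<^sup>2 * v (box_center I))"
      unfolding m_def Q_def h_def a_def .
  qed
qed

section \<open>Areas with respect to a power of the distance to the boundary\<close>

lemma nn_integral_weighted_area:
  assumes E: "E \<in> sets borel" "E \<subseteq> unit_disk" and f: "f \<in> borel_measurable (lebesgue_on unit_disk)"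
  shows "(\<integral>\<^sup>+z\<in>E. f z \<partial>weighted_area \<eta>) = (\<integral>\<^sup>+z\<in>E. ennreal ((1 - (cmod z)\<^sup>2) powr \<eta>) * f z \<partial>lebesgue)"
proof -
  have D: "unit_disk \<in> sets lebesgue" by simp
  have E': "E \<in> sets (lebesgue_on unit_disk)"
    using E by (auto simp: sets_restrict_space_iff)
  have r: "(\<lambda>z. ennreal ((1 - (cmod z)\<^sup>2) powr \<eta>)) \<in> borel_measurable (lebesgue_on unit_disk)"
    by (intro measurable_restrict_space1 measurable_completion) simp
  have fE: "(\<lambda>z. f z * indicator E z) \<in> borel_measurable (lebesgue_on unit_disk)"
    using f E' by (intro borel_measurable_times_ennreal borel_measurable_indicator) auto
  have "(\<integral>\<^sup>+z\<in>E. f z \<partial>weighted_area \<eta>) = (\<integral>\<^sup>+z. ennreal ((1 - (cmod z)\<^sup>2) powr \<eta>) * (f z * indicator E z) \<partial>lebesgue_on unit_disk)"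
    unfolding weighted_area_def by (rule nn_integral_density[OF r fE])
  also have "\<dots> = (\<integral>\<^sup>+z. ennreal ((1 - (cmod z)\<^sup>2) powr \<eta>) * (f z * indicator E z) * indicator unit_disk z \<partial>lebesgue)"
    using D by (subst nn_integral_restrict_space) auto
  also have "\<dots> = (\<integral>\<^sup>+z\<in>E. ennreal ((1 - (cmod z)\<^sup>2) powr \<eta>) * f z \<partial>lebesgue)"
    using E(2) by (intro nn_integral_cong) (auto simp: indicator_def)
  finally show ?thesis .
qed

lemma emeasure_weighted_area:
  assumes E: "E \<in> sets borel" "E \<subseteq> unit_disk"
  shows "emeasure (weighted_area \<eta>) E = (\<integral>\<^sup>+z\<in>E. ennreal ((1 - (cmod z)\<^sup>2) powr \<eta>) \<partial>lborel)"
proof -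
  have "E \<in> sets (weighted_area \<eta>)" using E by (auto simp: weighted_area_def sets_restrict_space_iff)
  then have "emeasure (weighted_area \<eta>) E = (\<integral>\<^sup>+z\<in>E. 1 \<partial>weighted_area \<eta>)" by simp
  also have "\<dots> = (\<integral>\<^sup>+z\<in>E. ennreal ((1 - (cmod z)\<^sup>2) powr \<eta>) * 1 \<partial>lebesgue)"
    by (rule nn_integral_weighted_area[OF E]) simp
  finally show ?thesis by (simp add: nn_integral_completion)
qed

lemma one_minus_sq_powr:
  assumes "z \<in> unit_disk"
  shows "(1 - (cmod z)\<^sup>2) powr p \<le> 2 powr \<bar>p\<bar> * bdist z powr p"
proof -
  note b = one_minus_sq_bounds[OF assms]
  show ?thesis
  proof (cases "0 \<le> p")
    case True
    have "(1 - (cmod z)\<^sup>2) powr p \<le> (2 * bdist z) powr p" using b True by (intro powr_mono2) auto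
    also have "\<dots> = 2 powr p * bdist z powr p" by (rule powr_mult)
    finally show ?thesis using True by simp
  next
    case False
    have "(1 - (cmod z)\<^sup>2) powr p \<le> 1 * bdist z powr p" using b False by (auto intro!: powr_mono2')
    also have "\<dots> \<le> 2 powr \<bar>p\<bar> * bdist z powr p" by (intro mult_right_mono) (auto simp: ge_one_powr_ge_zero)
    finally show ?thesis .
  qed
qed

lemma one_minus_sq_powr_near:
  assumes a: "a \<in> unit_disk" and z: "z \<in> cball a (bdist a / 2)"
  shows "(1 - (cmod z)\<^sup>2) powr p \<le> 4 powr \<bar>p\<bar> * bdist a powr p"
    "4 powr (- \<bar>p\<bar>) * bdist a powr p \<le> (1 - (cmod z)\<^sup>2) powr p"
proof -
  note zD = half_ball(1)[OF a z]
  have *: "(1 - (cmod z)\<^sup>2) powr q \<le> 4 powr \<bar>q\<bar> * bdist a powr q" for q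
  proof -
    have "(1 - (cmod z)\<^sup>2) powr q \<le> 2 powr \<bar>q\<bar> * bdist z powr q" by (rule one_minus_sq_powr[OF zD])
    also have "\<dots> \<le> 2 powr \<bar>q\<bar> * (2 powr \<bar>q\<bar> * bdist a powr q)"
      using half_ball_powr(2)[OF a z] by (intro mult_left_mono) auto
    also have "\<dots> = 4 powr \<bar>q\<bar> * bdist a powr q" using powr_mult[of 2 2 "\<bar>q\<bar>"] by simp
    finally show ?thesis .
  qed
  show "(1 - (cmod z)\<^sup>2) powr p \<le> 4 powr \<bar>p\<bar> * bdist a powr p" by (rule *)
  have "0 < 1 - (cmod z)\<^sup>2" using one_minus_sq_bounds[OF zD] by linarith
  then have "inverse (4 powr \<bar>p\<bar> * bdist a powr (- p)) \<le> inverse ((1 - (cmod z)\<^sup>2) powr (- p))"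
    using *[of "- p"] by (intro le_imp_inverse_le) auto
  then show "4 powr (- \<bar>p\<bar>) * bdist a powr p \<le> (1 - (cmod z)\<^sup>2) powr p"
    by (simp only: powr_minus inverse_mult_distrib inverse_inverse_eq)
qed

lemma nn_integral_scale:
  fixes f :: "complex \<Rightarrow> ennreal"
  assumes [measurable]: "f \<in> borel_measurable borel" and t: "0 < t"
  shows "(\<integral>\<^sup>+z. f z \<partial>lborel) = ennreal (t\<^sup>2) * (\<integral>\<^sup>+z. f (t *\<^sub>R z) \<partial>lborel)"
proof -
  have "(lborel :: complex measure) = density (distr lborel borel (\<lambda>x. 0 + t *\<^sub>R x)) (\<lambda>_. \<bar>t\<bar> ^ DIM(complex))"
    using lborel_affine[of t "0::complex"] t by simp
  then have "(\<integral>\<^sup>+z. f z \<partial>lborel) = (\<integral>\<^sup>+z. f z \<partial>density (distr lborel borel (\<lambda>x. t *\<^sub>R x)) (\<lambda>_. ennreal (t\<^sup>2)))"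
    using t by simp
  also have "\<dots> = (\<integral>\<^sup>+z. ennreal (t\<^sup>2) * f z \<partial>distr lborel borel (\<lambda>x. t *\<^sub>R x))"
    by (rule nn_integral_density) auto
  also have "\<dots> = (\<integral>\<^sup>+z. ennreal (t\<^sup>2) * f (t *\<^sub>R z) \<partial>lborel)"
    by (rule nn_integral_distr) auto
  also have "\<dots> = ennreal (t\<^sup>2) * (\<integral>\<^sup>+z. f (t *\<^sub>R z) \<partial>lborel)"
    by (rule nn_integral_cmult) measurable
  finally show ?thesis .
qed

lemma radial_powr_integral:
  assumes \<eta>: "-1 < \<eta>" and \<rho>: "0 < \<rho>" "\<rho> \<le> 1"
  shows "(\<integral>\<^sup>+t. ennreal ((1 - t * \<rho>) powr \<eta>) * indicator {t. 1 \<le> t \<and> t * \<rho> < 1} t \<partial>lborel)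
    \<le> ennreal ((1 - \<rho>) powr (\<eta> + 1) / (\<rho> * (\<eta> + 1)))"
proof -
  define F where "F x = ennreal (x powr \<eta>) * indicator {0..1 - \<rho>} x" for x :: real
  have [measurable]: "F \<in> borel_measurable borel" unfolding F_def by measurable
  have FI: "(\<integral>\<^sup>+x. F x \<partial>lborel) = ennreal ((1 - \<rho>) powr (\<eta> + 1) / (\<eta> + 1))"
    unfolding F_def using has_integral_powr_from_0[OF \<eta>, of "1 - \<rho>"] \<rho>
    by (intro nn_integral_has_integral_lebesgue') auto
  have "(\<integral>\<^sup>+x. F x \<partial>lborel) = \<bar>- \<rho>\<bar> * (\<integral>\<^sup>+t. F (1 + (- \<rho>) * t) \<partial>lborel)"
    using \<rho> by (intro nn_integral_real_affine) auto
  then have eq: "ennreal \<rho> * (\<integral>\<^sup>+t. F (1 + (- \<rho>) * t) \<partial>lborel) = ennreal ((1 - \<rho>) powr (\<eta> + 1) / (\<eta> + 1))"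
    using FI \<rho> by simp
  have "(\<integral>\<^sup>+t. ennreal ((1 - t * \<rho>) powr \<eta>) * indicator {t. 1 \<le> t \<and> t * \<rho> < 1} t \<partial>lborel)
    \<le> (\<integral>\<^sup>+t. F (1 + (- \<rho>) * t) \<partial>lborel)"
    using \<rho> by (intro nn_integral_mono) (auto simp: F_def indicator_def mult.commute)
  also have "\<dots> = ennreal (1 / \<rho>) * (ennreal \<rho> * (\<integral>\<^sup>+t. F (1 + (- \<rho>) * t) \<partial>lborel))"
    using \<rho> by (subst ennreal_mult_assoc) auto
  also have "\<dots> = ennreal ((1 - \<rho>) powr (\<eta> + 1) / (\<rho> * (\<eta> + 1)))"
    unfolding eq using \<rho> \<eta> by (simp add: ennreal_mult'[symmetric] mult.commute)
  finally show ?thesis .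
qed

text \<open>The integral of \<open>bdist powr \<eta>\<close> over the part in the unit disk of a disk of radius comparable to its distance to
  the circle. Away from the origin the integral is averaged over the dilations by \<open>t\<close> in \<open>{1..1 + h}\<close>: after exchanging the
  integrals, the inner integral over \<open>t\<close> is the elementary one of \<open>radial_powr_integral\<close>, and only the area of a disk
  is left. This replaces an integration in polar coordinates.\<close>

lemma ball_powr_integral:
  assumes \<eta>: "-1 < \<eta>"
  obtains C where "0 \<le> C" "\<And>a. a \<in> unit_disk \<Longrightarrow>
    (\<integral>\<^sup>+z\<in>unit_disk \<inter> ball a (3 * bdist a). ennreal (bdist z powr \<eta>) \<partial>lborel) \<le> ennreal (C * bdist a powr (2 + \<eta>))"
proof -
  define C1 where "C1 = 4 * (16 * pi * (4 * 5 powr (\<eta> + 1) / (\<eta> + 1)))"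
  define C2 where "C2 = 2 powr \<bar>\<eta>\<bar> * (9 * pi) * 4 powr \<bar>\<eta>\<bar>"
  have C: "0 \<le> C1" "0 \<le> C2" using \<eta> by (auto simp: C1_def C2_def)
  show ?thesis
  proof (rule that[of "C1 + C2"])
    show "0 \<le> C1 + C2" using C by simp
    fix a :: complex assume a: "a \<in> unit_disk"
    define h where "h = bdist a"
    have h: "0 < h" "h \<le> 1" using a by (auto simp: h_def)
    define E where "E = unit_disk \<inter> ball a (3 * h)"
    have [measurable]: "E \<in> sets borel" by (simp add: E_def)
    define g where "g z = ennreal (bdist z powr \<eta>) * indicator (E \<inter> {z. 1 / 2 \<le> cmod z}) z" for z
    have [measurable]: "g \<in> borel_measurable borel" unfolding g_def by measurable
    have G: "ennreal h * (\<integral>\<^sup>+z. g z \<partial>lborel) \<le> ennreal (C1 * h powr (\<eta> + 3))"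
    proof -
      have "ennreal h * (\<integral>\<^sup>+z. g z \<partial>lborel) = (\<integral>\<^sup>+t\<in>{1..1 + h}. (\<integral>\<^sup>+z. g z \<partial>lborel) \<partial>lborel)"
        using h by (simp add: nn_integral_cmult_indicator mult.commute)
      also have "\<dots> \<le> (\<integral>\<^sup>+t. (\<integral>\<^sup>+z. ennreal 4 * (g (t *\<^sub>R z) * indicator {1..1 + h} t) \<partial>lborel) \<partial>lborel)"
      proof (intro nn_integral_mono)
        fix t :: real
        show "(\<integral>\<^sup>+z. g z \<partial>lborel) * indicator {1..1 + h} t \<le> (\<integral>\<^sup>+z. ennreal 4 * (g (t *\<^sub>R z) * indicator {1..1 + h} t) \<partial>lborel)"
        proof (cases "t \<in> {1..1 + h}")
          case True
          then have t: "1 \<le> t" "t \<le> 2" using h by auto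
          have "(\<integral>\<^sup>+z. g z \<partial>lborel) = ennreal (t\<^sup>2) * (\<integral>\<^sup>+z. g (t *\<^sub>R z) \<partial>lborel)" using t by (intro nn_integral_scale) auto
          also have "\<dots> \<le> ennreal 4 * (\<integral>\<^sup>+z. g (t *\<^sub>R z) \<partial>lborel)"
            using t power_mono[of t 2 2] by (intro mult_right_mono ennreal_leI) auto
          also have "\<dots> = (\<integral>\<^sup>+z. ennreal 4 * g (t *\<^sub>R z) \<partial>lborel)" by (intro nn_integral_cmult[symmetric]) measurable
          finally show ?thesis using True by simp
        qed simp
      qed
      also have "\<dots> = (\<integral>\<^sup>+z. (\<integral>\<^sup>+t. ennreal 4 * (g (t *\<^sub>R z) * indicator {1..1 + h} t) \<partial>lborel) \<partial>lborel)"
        by (rule lborel_pair.Fubini'[symmetric]) measurable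
      also have "\<dots> \<le> (\<integral>\<^sup>+z\<in>ball a (4 * h). ennreal (4 * (4 * (5 * h) powr (\<eta> + 1) / (\<eta> + 1))) \<partial>lborel)"
      proof (intro nn_integral_mono)
        fix z :: complex
        define \<rho> where "\<rho> = cmod z"
        show "(\<integral>\<^sup>+t. ennreal 4 * (g (t *\<^sub>R z) * indicator {1..1 + h} t) \<partial>lborel)
          \<le> ennreal (4 * (4 * (5 * h) powr (\<eta> + 1) / (\<eta> + 1))) * indicator (ball a (4 * h)) z"
        proof (cases "\<exists>t\<in>{1..1 + h}. g (t *\<^sub>R z) \<noteq> 0")
          case True
          then obtain t where t: "1 \<le> t" "t \<le> 1 + h" "g (t *\<^sub>R z) \<noteq> 0" by auto
          then have tz: "t * \<rho> < 1" "dist a (t *\<^sub>R z) < 3 * h" "1 / 2 \<le> t * \<rho>"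
            by (auto simp: g_def E_def indicator_def \<rho>_def split: if_splits)
          have \<rho>1: "\<rho> < 1"
          proof -
            have "1 * \<rho> \<le> t * \<rho>" using t(1) by (intro mult_right_mono) (auto simp: \<rho>_def)
            then show ?thesis using tz(1) by simp
          qed
          have \<rho>4: "1 / 4 \<le> \<rho>"
          proof -
            have "t * \<rho> \<le> 2 * \<rho>" using t(2) h by (intro mult_right_mono) (auto simp: \<rho>_def)
            then show ?thesis using tz(3) by simp
          qed
          have "dist (t *\<^sub>R z) z = (t - 1) * \<rho>"
          proof -
            have "t *\<^sub>R z - z = (t - 1) *\<^sub>R z" by (simp add: algebra_simps)
            then show ?thesis using t by (simp add: dist_norm \<rho>_def)
          qed
          also have "\<dots> \<le> h * 1" using t \<rho>1 by (intro mult_mono) (auto simp: \<rho>_def)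
          finally have az: "dist a z < 4 * h" using tz(2) dist_triangle[of a z "t *\<^sub>R z"] by simp
          have \<rho>5: "1 - \<rho> \<le> 5 * h" using bdist_ge[of z a] az by (simp add: \<rho>_def h_def dist_commute)
          have "(\<integral>\<^sup>+t. ennreal 4 * (g (t *\<^sub>R z) * indicator {1..1 + h} t) \<partial>lborel)
            \<le> (\<integral>\<^sup>+t. ennreal 4 * (ennreal ((1 - t * \<rho>) powr \<eta>) * indicator {t. 1 \<le> t \<and> t * \<rho> < 1} t) \<partial>lborel)"
            by (intro nn_integral_mono) (auto simp: g_def E_def indicator_def \<rho>_def)
          also have "\<dots> = ennreal 4 * (\<integral>\<^sup>+t. ennreal ((1 - t * \<rho>) powr \<eta>) * indicator {t. 1 \<le> t \<and> t * \<rho> < 1} t \<partial>lborel)"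
            by (rule nn_integral_cmult) measurable
          also have "\<dots> \<le> ennreal 4 * ennreal ((1 - \<rho>) powr (\<eta> + 1) / (\<rho> * (\<eta> + 1)))"
            using \<rho>1 \<rho>4 by (intro mult_left_mono radial_powr_integral \<eta>) auto
          also have "\<dots> \<le> ennreal 4 * ennreal ((5 * h) powr (\<eta> + 1) / (1 / 4 * (\<eta> + 1)))"
            using \<rho>1 \<rho>4 \<rho>5 \<eta> by (intro mult_left_mono ennreal_leI frac_le powr_mono2 mult_right_mono mult_pos_pos) auto
          also have "\<dots> = ennreal (4 * (4 * (5 * h) powr (\<eta> + 1) / (\<eta> + 1)))"
            by (subst ennreal_mult'[symmetric]) (auto simp: field_simps)
          finally show ?thesis using az by simp
        next
          case False
          then have "(\<integral>\<^sup>+t. ennreal 4 * (g (t *\<^sub>R z) * indicator {1..1 + h} t) \<partial>lborel) = (\<integral>\<^sup>+(t::real). 0 \<partial>lborel)"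
            by (intro nn_integral_cong) (auto simp: indicator_def)
          then show ?thesis by simp
        qed
      qed
      also have "\<dots> = ennreal (4 * (4 * (5 * h) powr (\<eta> + 1) / (\<eta> + 1)) * (pi * (4 * h)\<^sup>2))"
        using h \<eta> by (intro nn_integral_const_ball) auto
      also have "4 * (4 * (5 * h) powr (\<eta> + 1) / (\<eta> + 1)) * (pi * (4 * h)\<^sup>2) = C1 * (h powr (\<eta> + 1) * h powr 2)"
        using h by (simp add: C1_def powr_mult power_mult_distrib)
      also have "h powr (\<eta> + 1) * h powr 2 = h powr (\<eta> + 3)" unfolding powr_add[symmetric] by (simp add: add.commute)
      finally show ?thesis .
    qed
    have G': "(\<integral>\<^sup>+z. g z \<partial>lborel) \<le> ennreal (C1 * h powr (2 + \<eta>))"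
    proof -
      have "(\<integral>\<^sup>+z. g z \<partial>lborel) = ennreal (1 / h) * (ennreal h * (\<integral>\<^sup>+z. g z \<partial>lborel))"
        using h by (subst ennreal_mult_assoc) auto
      also have "\<dots> \<le> ennreal (1 / h) * ennreal (C1 * h powr (\<eta> + 3))" by (intro mult_left_mono G) simp
      also have "\<dots> = ennreal (1 / h * (C1 * h powr (\<eta> + 3)))" using h by (intro ennreal_mult'[symmetric]) simp
      also have "1 / h * (C1 * h powr (\<eta> + 3)) = C1 * h powr (2 + \<eta>)"
      proof -
        have "\<eta> + 3 = 1 + (2 + \<eta>)" by simp
        then have "h powr (\<eta> + 3) = h powr 1 * h powr (2 + \<eta>)" by (simp only: powr_add)
        moreover have "h powr 1 = h" using h by simp
        ultimately have "h powr (\<eta> + 3) = h * h powr (2 + \<eta>)" by (simp only:)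
        then show ?thesis using h by simp
      qed
      finally show ?thesis .
    qed
    have E2: "(\<integral>\<^sup>+z\<in>E \<inter> {z. cmod z < 1 / 2}. ennreal (bdist z powr \<eta>) \<partial>lborel) \<le> ennreal (C2 * h powr (2 + \<eta>))"
    proof -
      have "(\<integral>\<^sup>+z\<in>E \<inter> {z. cmod z < 1 / 2}. ennreal (bdist z powr \<eta>) \<partial>lborel) \<le> ennreal (2 powr \<bar>\<eta>\<bar> * 4 powr \<bar>\<eta>\<bar> * h powr \<eta> * (pi * (3 * h)\<^sup>2))"
      proof (rule ball_integral_le[of _ _ _ a])
        fix z assume z: "z \<in> E \<inter> {z. cmod z < 1 / 2}"
        then have b: "1 / 2 < bdist z" "bdist z \<le> 1" "dist a z < 3 * h" by (auto simp: E_def)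
        have zh: "bdist z \<le> 4 * h" using bdist_ge[of z a] b(3) by (simp add: h_def dist_commute)
        have "bdist z powr \<eta> \<le> 2 powr \<bar>\<eta>\<bar> * 4 powr \<bar>\<eta>\<bar> * h powr \<eta>"
        proof (cases "0 \<le> \<eta>")
          case True
          have "bdist z powr \<eta> \<le> (4 * h) powr \<eta>" using zh b True by (intro powr_mono2) auto
          also have "\<dots> = 4 powr \<eta> * h powr \<eta>" by (rule powr_mult)
          also have "\<dots> \<le> 2 powr \<bar>\<eta>\<bar> * (4 powr \<eta> * h powr \<eta>)"
            using mult_right_mono[of 1 "2 powr \<bar>\<eta>\<bar>" "4 powr \<eta> * h powr \<eta>"] by (simp add: ge_one_powr_ge_zero)
          finally show ?thesis using True by simp
        next
          case False
          have "bdist z powr \<eta> \<le> (1 / 2) powr \<eta>" using b False by (intro powr_mono2') auto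
          also have "\<dots> = 2 powr \<bar>\<eta>\<bar> * 1 * 1" using False by (simp add: powr_divide powr_minus inverse_eq_divide)
          also have "\<dots> \<le> 2 powr \<bar>\<eta>\<bar> * 4 powr \<bar>\<eta>\<bar> * h powr \<eta>"
          proof (intro mult_mono)
            show "1 \<le> h powr \<eta>" using h False powr_mono2'[of \<eta> h 1] by simp
          qed (auto simp: ge_one_powr_ge_zero)
          finally show ?thesis .
        qed
        then show "z \<in> ball a (3 * h) \<and> ennreal (bdist z powr \<eta>) \<le> ennreal (2 powr \<bar>\<eta>\<bar> * 4 powr \<bar>\<eta>\<bar> * h powr \<eta>)"
          using b by (simp add: ennreal_leI)
      qed (use h in auto)
      also have "2 powr \<bar>\<eta>\<bar> * 4 powr \<bar>\<eta>\<bar> * h powr \<eta> * (pi * (3 * h)\<^sup>2) = C2 * (h powr 2 * h powr \<eta>)"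
        using h by (simp add: C2_def power_mult_distrib)
      also have "h powr 2 * h powr \<eta> = h powr (2 + \<eta>)" unfolding powr_add[symmetric] ..
      finally show ?thesis .
    qed
    have "(\<integral>\<^sup>+z\<in>E. ennreal (bdist z powr \<eta>) \<partial>lborel) = (\<integral>\<^sup>+z. g z + ennreal (bdist z powr \<eta>) * indicator (E \<inter> {z. cmod z < 1 / 2}) z \<partial>lborel)"
      by (intro nn_integral_cong) (auto simp: g_def indicator_def)
    also have "\<dots> = (\<integral>\<^sup>+z. g z \<partial>lborel) + (\<integral>\<^sup>+z\<in>E \<inter> {z. cmod z < 1 / 2}. ennreal (bdist z powr \<eta>) \<partial>lborel)"
      by (rule nn_integral_add) measurable
    also have "\<dots> \<le> ennreal (C1 * h powr (2 + \<eta>)) + ennreal (C2 * h powr (2 + \<eta>))" by (intro add_mono G' E2)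
    also have "\<dots> = ennreal ((C1 + C2) * h powr (2 + \<eta>))"
      using C by (subst ennreal_plus[symmetric]) (auto simp: distrib_right)
    finally show "(\<integral>\<^sup>+z\<in>unit_disk \<inter> ball a (3 * bdist a). ennreal (bdist z powr \<eta>) \<partial>lborel) \<le> ennreal ((C1 + C2) * bdist a powr (2 + \<eta>))"
      unfolding E_def h_def .
  qed
qed

section \<open>The averaging condition on Carleson boxes\<close>

lemma le_divide_ennreal:
  assumes "0 < y" "E \<le> ennreal y" "E \<noteq> 0" "ennreal x \<le> X" "0 \<le> x"
  shows "ennreal (x / y) \<le> X / E"
proof -
  have Etop: "E \<noteq> top" using assms(2) by (auto simp: top_unique)
  have "ennreal (x / y) * E \<le> ennreal (x / y) * ennreal y" using assms(2) by (intro mult_left_mono) auto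
  also have "\<dots> = ennreal x" using assms by (simp add: ennreal_mult'[symmetric])
  also have "\<dots> \<le> X" by fact
  finally have "ennreal (x / y) * E / E \<le> X / E" by (rule divide_right_mono_ennreal)
  then show ?thesis using mult_divide_eq_ennreal[OF assms(3) Etop, of "ennreal (x / y)"] by simp
qed

lemma divide_le_divide_real: "0 < y \<Longrightarrow> 0 < z \<Longrightarrow> x * z \<le> t * y \<Longrightarrow> x / y \<le> t / (z::real)"
  by (simp add: divide_le_eq pos_le_divide_eq)

text \<open>In the first average of the condition the powers of \<open>1 - (cmod z)\<^sup>2\<close> cancel.\<close>

lemma box_weight_integral:
  assumes w: "w \<in> borel_measurable (lebesgue_on unit_disk)" and I: "I \<in> intervals"
  shows "(\<integral>\<^sup>+z\<in>carleson_box I. ennreal (w z / (1 - (cmod z)\<^sup>2) powr \<eta>) \<partial>weighted_area \<eta>)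
      = (\<integral>\<^sup>+z\<in>carleson_box I. ennreal (w z) \<partial>lebesgue)"
    "(\<integral>\<^sup>+z\<in>carleson_box I. ennreal ((w z / (1 - (cmod z)\<^sup>2) powr \<eta>) powr q) \<partial>weighted_area \<eta>)
      = (\<integral>\<^sup>+z\<in>carleson_box I. ennreal ((1 - (cmod z)\<^sup>2) powr \<eta> * (w z / (1 - (cmod z)\<^sup>2) powr \<eta>) powr q) \<partial>lborel)"
proof -
  have r: "(\<lambda>z. (1 - (cmod z)\<^sup>2) powr \<eta>) \<in> borel_measurable (lebesgue_on unit_disk)"
    by (intro measurable_restrict_space1 measurable_completion) simp
  have V: "(\<lambda>z. w z / (1 - (cmod z)\<^sup>2) powr \<eta>) \<in> borel_measurable (lebesgue_on unit_disk)"
    using w r by (rule borel_measurable_divide)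
  have V': "(\<lambda>z. ennreal (w z / (1 - (cmod z)\<^sup>2) powr \<eta>)) \<in> borel_measurable (lebesgue_on unit_disk)"
    using V by (rule measurable_compose) simp
  have Vq: "(\<lambda>z. ennreal ((w z / (1 - (cmod z)\<^sup>2) powr \<eta>) powr q)) \<in> borel_measurable (lebesgue_on unit_disk)"
    using V by (intro measurable_compose[OF _ measurable_ennreal] powr_real_measurable) auto
  have pos: "0 < (1 - (cmod z)\<^sup>2) powr \<eta>" if "z \<in> carleson_box I" for z
  proof -
    have "0 < 1 - (cmod z)\<^sup>2" using one_minus_sq_bounds[of z] that carleson_box_subset[of I] by fastforce
    then show ?thesis by simp
  qed
  have "(\<integral>\<^sup>+z\<in>carleson_box I. ennreal (w z / (1 - (cmod z)\<^sup>2) powr \<eta>) \<partial>weighted_area \<eta>)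
      = (\<integral>\<^sup>+z\<in>carleson_box I. ennreal ((1 - (cmod z)\<^sup>2) powr \<eta>) * ennreal (w z / (1 - (cmod z)\<^sup>2) powr \<eta>) \<partial>lebesgue)"
    by (rule nn_integral_weighted_area[OF carleson_box_borel carleson_box_subset V'])
  also have "\<dots> = (\<integral>\<^sup>+z\<in>carleson_box I. ennreal (w z) \<partial>lebesgue)"
  proof (intro nn_integral_cong)
    fix z
    show "ennreal ((1 - (cmod z)\<^sup>2) powr \<eta>) * ennreal (w z / (1 - (cmod z)\<^sup>2) powr \<eta>) * indicator (carleson_box I) z
      = ennreal (w z) * indicator (carleson_box I) z"
      using pos[of z] by (cases "z \<in> carleson_box I") (auto simp: ennreal_mult'[symmetric])
  qed
  finally show "(\<integral>\<^sup>+z\<in>carleson_box I. ennreal (w z / (1 - (cmod z)\<^sup>2) powr \<eta>) \<partial>weighted_area \<eta>)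
      = (\<integral>\<^sup>+z\<in>carleson_box I. ennreal (w z) \<partial>lebesgue)" .
  show "(\<integral>\<^sup>+z\<in>carleson_box I. ennreal ((w z / (1 - (cmod z)\<^sup>2) powr \<eta>) powr q) \<partial>weighted_area \<eta>)
      = (\<integral>\<^sup>+z\<in>carleson_box I. ennreal ((1 - (cmod z)\<^sup>2) powr \<eta> * (w z / (1 - (cmod z)\<^sup>2) powr \<eta>) powr q) \<partial>lborel)"
    unfolding nn_integral_weighted_area[OF carleson_box_borel carleson_box_subset Vq] nn_integral_completion
    by (simp add: ennreal_mult')
qed

lemma weighted_area_box_ge:
  assumes I: "I \<in> intervals"
  shows "ennreal (4 powr (- \<bar>\<eta>\<bar>) * pi / 16 * bdist (box_center I) powr (2 + \<eta>)) \<le> emeasure (weighted_area \<eta>) (carleson_box I)"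
proof -
  define a where "a = box_center I"
  define h where "h = bdist a"
  have a: "a \<in> unit_disk" "0 < h" using box_center(2,3)[OF I] by (auto simp: a_def h_def)
  have "ennreal (4 powr (- \<bar>\<eta>\<bar>) * h powr \<eta> * (pi * (h / 4)\<^sup>2)) \<le> (\<integral>\<^sup>+z\<in>carleson_box I. ennreal ((1 - (cmod z)\<^sup>2) powr \<eta>) \<partial>lborel)"
  proof (rule ball_integral_ge[of _ _ a])
    fix z assume z: "z \<in> ball a (h / 4)"
    then have "z \<in> cball a (bdist a / 2)" using a by (simp add: h_def)
    then have "4 powr (- \<bar>\<eta>\<bar>) * h powr \<eta> \<le> (1 - (cmod z)\<^sup>2) powr \<eta>"
      unfolding h_def by (rule one_minus_sq_powr_near(2)[OF a(1)])
    then show "z \<in> carleson_box I \<and> ennreal (4 powr (- \<bar>\<eta>\<bar>) * h powr \<eta>) \<le> ennreal ((1 - (cmod z)\<^sup>2) powr \<eta>)"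
      using ball_subset_box[OF I] z by (auto simp: a_def h_def intro: ennreal_leI)
  qed (use a in auto)
  also have "4 powr (- \<bar>\<eta>\<bar>) * h powr \<eta> * (pi * (h / 4)\<^sup>2) = 4 powr (- \<bar>\<eta>\<bar>) * pi / 16 * (h powr 2 * h powr \<eta>)"
    using a by (simp add: power_divide)
  also have "h powr 2 * h powr \<eta> = h powr (2 + \<eta>)" unfolding powr_add[symmetric] ..
  finally show ?thesis
    unfolding emeasure_weighted_area[OF carleson_box_borel carleson_box_subset] h_def a_def .
qed

lemma weighted_area_box_le:
  assumes \<eta>: "-1 < \<eta>"
  obtains C where "0 < C" "\<And>I. I \<in> intervals \<Longrightarrow>
    emeasure (weighted_area \<eta>) (carleson_box I) \<le> ennreal (C * bdist (box_center I) powr (2 + \<eta>))"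
proof -
  obtain C where C: "0 \<le> C" "\<And>a. a \<in> unit_disk \<Longrightarrow>
    (\<integral>\<^sup>+z\<in>unit_disk \<inter> ball a (3 * bdist a). ennreal (bdist z powr \<eta>) \<partial>lborel) \<le> ennreal (C * bdist a powr (2 + \<eta>))"
    by (rule ball_powr_integral[OF \<eta>]) (rule that; blast)
  show ?thesis
  proof (rule that[of "2 powr \<bar>\<eta>\<bar> * C + 1"])
    show "0 < 2 powr \<bar>\<eta>\<bar> * C + 1" using C by (simp add: add_nonneg_pos)
    fix I assume I: "I \<in> intervals"
    define a where "a = box_center I"
    have a: "a \<in> unit_disk" using box_center(2)[OF I] by (simp add: a_def)
    have "emeasure (weighted_area \<eta>) (carleson_box I) = (\<integral>\<^sup>+z\<in>carleson_box I. ennreal ((1 - (cmod z)\<^sup>2) powr \<eta>) \<partial>lborel)"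
      by (rule emeasure_weighted_area[OF carleson_box_borel carleson_box_subset])
    also have "\<dots> \<le> (\<integral>\<^sup>+z. ennreal (2 powr \<bar>\<eta>\<bar>) * (ennreal (bdist z powr \<eta>) * indicator (unit_disk \<inter> ball a (3 * bdist a)) z) \<partial>lborel)"
    proof (intro nn_integral_mono)
      fix z
      show "ennreal ((1 - (cmod z)\<^sup>2) powr \<eta>) * indicator (carleson_box I) z \<le> ennreal (2 powr \<bar>\<eta>\<bar>) * (ennreal (bdist z powr \<eta>) * indicator (unit_disk \<inter> ball a (3 * bdist a)) z)"
      proof (cases "z \<in> carleson_box I")
        case True
        then have z: "z \<in> unit_disk" "z \<in> ball a (3 * bdist a)"
          using carleson_box_subset[of I] box_subset_ball[OF I] by (auto simp: a_def)
        then show ?thesis using True one_minus_sq_powr[OF z(1), of \<eta>]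
          by (simp add: ennreal_mult'[symmetric] ennreal_leI)
      qed simp
    qed
    also have "\<dots> = ennreal (2 powr \<bar>\<eta>\<bar>) * (\<integral>\<^sup>+z\<in>unit_disk \<inter> ball a (3 * bdist a). ennreal (bdist z powr \<eta>) \<partial>lborel)"
      by (rule nn_integral_cmult) measurable
    also have "\<dots> \<le> ennreal (2 powr \<bar>\<eta>\<bar>) * ennreal (C * bdist a powr (2 + \<eta>))" by (intro mult_left_mono C(2) a) simp
    also have "\<dots> = ennreal (2 powr \<bar>\<eta>\<bar> * (C * bdist a powr (2 + \<eta>)))" by (intro ennreal_mult'[symmetric]) simp
    also have "\<dots> \<le> ennreal ((2 powr \<bar>\<eta>\<bar> * C + 1) * bdist a powr (2 + \<eta>))"
      by (intro ennreal_leI) (simp add: distrib_right mult.assoc)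
    finally show "emeasure (weighted_area \<eta>) (carleson_box I) \<le> ennreal ((2 powr \<bar>\<eta>\<bar> * C + 1) * bdist (box_center I) powr (2 + \<eta>))"
      unfolding a_def .
  qed
qed

text \<open>Let \<open>V0 = w a * bdist a powr (- \<eta>)\<close> with \<open>a\<close> the center of the box. On a small disk about \<open>a\<close> the function
  \<open>V\<close> is at most a constant times \<open>V0\<close>, so that the second average is at least a constant times \<open>V0 powr (- s)\<close>,
  where \<open>s = 1 / (p - 1)\<close>. Hence the first average, which is the mass of the box divided by its weighted area, is at most a
  constant times \<open>V0\<close>.\<close>

lemma B_p_imp_box_carleson:
  assumes v: "regular B v" and A: "1 \<le> A"
    and cmp: "\<And>z. z \<in> unit_disk \<Longrightarrow> w z \<le> v z" "\<And>z. z \<in> unit_disk \<Longrightarrow> v z \<le> A * w z"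
    and w: "weight w" and p: "1 < p" and \<eta>: "-1 < \<eta>"
    and Bp: "B_p p \<eta> (\<lambda>z. w z / (1 - (cmod z)\<^sup>2) powr \<eta>)"
  shows "box_carleson v"
proof -
  have wm: "w \<in> borel_measurable (lebesgue_on unit_disk)" and wpos: "\<And>z. z \<in> unit_disk \<Longrightarrow> 0 < w z"
    using w by (auto simp: weight_def)
  have B: "1 \<le> B" using regularD(5)[OF v] .
  define V where "V z = w z / (1 - (cmod z)\<^sup>2) powr \<eta>" for z
  define s where "s = 1 / (p - 1)"
  have s: "1 - p / (p - 1) = - s" "- s * (p - 1) = -1" "0 < s" using p by (auto simp: s_def field_simps)
  define av1 where "av1 I = area_average \<eta> (carleson_box I) V" for I
  define av2 where "av2 I = area_average \<eta> (carleson_box I) (\<lambda>z. V z powr (- s))" for I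
  have sup: "(SUP I\<in>intervals. av1 I * ennpowr (av2 I) (p - 1)) < \<infinity>"
    using Bp unfolding B_p_def s(1) av1_def av2_def V_def by blast
  obtain K where K: "0 \<le> K" "(SUP I\<in>intervals. av1 I * ennpowr (av2 I) (p - 1)) = ennreal K"
    using sup by (cases "SUP I\<in>intervals. av1 I * ennpowr (av2 I) (p - 1)") auto
  have bound: "av1 I * ennpowr (av2 I) (p - 1) \<le> ennreal K" if "I \<in> intervals" for I
    unfolding K(2)[symmetric] using that by (intro SUP_upper)
  obtain CA where CA: "0 < CA" "\<And>I. I \<in> intervals \<Longrightarrow>
    emeasure (weighted_area \<eta>) (carleson_box I) \<le> ennreal (CA * bdist (box_center I) powr (2 + \<eta>))"
    by (rule weighted_area_box_le[OF \<eta>]) (rule that; blast)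
  define c1 where "c1 = A * B * 4 powr \<bar>\<eta>\<bar>"
  have c1: "0 < c1" using A B by (simp add: c1_def)
  define c2 where "c2 = 4 powr (- \<bar>\<eta>\<bar>) * c1 powr (- s) * pi / (16 * CA)"
  have c2: "0 < c2" using c1 CA by (simp add: c2_def)
  define c3 where "c3 = c2 powr (p - 1)"
  have c3: "0 < c3" using c2 by (simp add: c3_def)
  define D where "D = A * (K * CA / c3)"
  show ?thesis
    unfolding box_carleson_def
  proof (intro exI[of _ D] conjI ballI)
    show "0 \<le> D" using A K CA c3 by (simp add: D_def)
    fix I assume I: "I \<in> intervals"
    define Q where "Q = carleson_box I"
    define a where "a = box_center I"
    define h where "h = bdist a"
    have a: "a \<in> unit_disk" "0 < h" using box_center(2,3)[OF I] by (auto simp: a_def h_def)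
    have wa: "0 < w a" using wpos[OF a(1)] .
    define W where "W = (\<integral>\<^sup>+z\<in>Q. ennreal (w z) \<partial>lebesgue)"
    define em where "em = emeasure (weighted_area \<eta>) Q"
    have em_le: "em \<le> ennreal (CA * h powr (2 + \<eta>))" using CA(2)[OF I] by (simp add: em_def Q_def h_def a_def)
    have em0: "em \<noteq> 0"
    proof -
      have "0 < ennreal (4 powr (- \<bar>\<eta>\<bar>) * pi / 16 * h powr (2 + \<eta>))" using a by simp
      also have "\<dots> \<le> em" using weighted_area_box_ge[OF I] by (simp add: em_def Q_def h_def a_def)
      finally show ?thesis by auto
    qed
    have emtop: "em \<noteq> top" using em_le by (auto simp: top_unique)
    have av1: "av1 I = W / em"
      unfolding av1_def area_average_def V_def box_weight_integral(1)[OF wm I] W_def em_def Q_def ..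
    define V0 where "V0 = w a * h powr (- \<eta>)"
    have V0: "0 < V0" using wa a by (simp add: V0_def)
    define k where "k = 4 powr (- \<bar>\<eta>\<bar>) * h powr \<eta> * (c1 * V0) powr (- s)"
    have k: "0 < k" using a c1 V0 by (simp add: k_def)
    have "ennreal (k * (pi * (h / 4)\<^sup>2)) \<le> (\<integral>\<^sup>+z\<in>Q. ennreal ((1 - (cmod z)\<^sup>2) powr \<eta> * V z powr (- s)) \<partial>lborel)"
    proof (rule ball_integral_ge[of _ _ a])
      fix z assume z: "z \<in> ball a (h / 4)"
      then have zc: "z \<in> cball a (bdist a / 2)" using a by (simp add: h_def)
      note zD = half_ball(1)[OF a(1) zc]
      have p0: "0 < 1 - (cmod z)\<^sup>2" using one_minus_sq_bounds[OF zD] by linarith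
      have e1: "(1 - (cmod z)\<^sup>2) powr (- \<eta>) \<le> 4 powr \<bar>\<eta>\<bar> * h powr (- \<eta>)"
        using one_minus_sq_powr_near(1)[OF a(1) zc, of "- \<eta>"] by (simp add: h_def)
      have e2: "4 powr (- \<bar>\<eta>\<bar>) * h powr \<eta> \<le> (1 - (cmod z)\<^sup>2) powr \<eta>"
        unfolding h_def by (rule one_minus_sq_powr_near(2)[OF a(1) zc])
      have "w z \<le> v z" by (rule cmp(1)[OF zD])
      also have "\<dots> \<le> B * v a" using zc by (intro slowD(3)[OF regularD(1)[OF v] a(1)]) simp
      also have "\<dots> \<le> B * (A * w a)" using cmp(2)[OF a(1)] B by (intro mult_left_mono) auto
      finally have wz: "w z \<le> A * B * w a" by (simp add: mult_ac)
      have "V z = w z * (1 - (cmod z)\<^sup>2) powr (- \<eta>)" by (simp add: V_def powr_minus divide_inverse)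
      also have "\<dots> \<le> (A * B * w a) * (4 powr \<bar>\<eta>\<bar> * h powr (- \<eta>))"
        using wz e1 wa A B by (intro mult_mono) auto
      also have "\<dots> = c1 * V0" by (simp add: c1_def V0_def)
      finally have VV: "V z \<le> c1 * V0" .
      have "0 < V z" using wpos[OF zD] p0 by (simp add: V_def)
      then have "(c1 * V0) powr (- s) \<le> V z powr (- s)" using VV s by (intro powr_mono2') auto
      then have "k \<le> (1 - (cmod z)\<^sup>2) powr \<eta> * V z powr (- s)"
        unfolding k_def using e2 by (intro mult_mono) auto
      then show "z \<in> Q \<and> ennreal k \<le> ennreal ((1 - (cmod z)\<^sup>2) powr \<eta> * V z powr (- s))"
        using ball_subset_box[OF I] z by (auto simp: a_def h_def Q_def intro: ennreal_leI)
    qed (use a k in auto)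
    moreover have "av2 I = (\<integral>\<^sup>+z\<in>Q. ennreal ((1 - (cmod z)\<^sup>2) powr \<eta> * V z powr (- s)) \<partial>lborel) / em"
      unfolding av2_def area_average_def V_def box_weight_integral(2)[OF wm I] em_def Q_def ..
    ultimately have "ennreal (k * (pi * (h / 4)\<^sup>2) / (CA * h powr (2 + \<eta>))) \<le> av2 I"
      using CA(1) a k em_le em0 by (simp only:) (intro le_divide_ennreal; simp)
    also have "k * (pi * (h / 4)\<^sup>2) / (CA * h powr (2 + \<eta>)) = c2 * V0 powr (- s)"
    proof -
      have "h powr (2 + \<eta>) = h\<^sup>2 * h powr \<eta>" using a by (simp add: powr_add)
      then show ?thesis using a CA(1) unfolding k_def c2_def powr_mult by (simp add: power_divide)
    qed
    finally have "ennpowr (ennreal (c2 * V0 powr (- s))) (p - 1) \<le> ennpowr (av2 I) (p - 1)"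
      using p by (intro ennpowr_mono) auto
    also have "ennpowr (ennreal (c2 * V0 powr (- s))) (p - 1) = ennreal (c3 * V0 powr (-1))"
    proof -
      have "(c2 * V0 powr (- s)) powr (p - 1) = c3 * V0 powr (-1)"
        unfolding powr_mult powr_powr s(2) c3_def ..
      moreover have "0 \<le> c2 * V0 powr (- s)" using c2 by simp
      ultimately show ?thesis using ennpowr_ennreal by (simp only:)
    qed
    finally have "av1 I * ennreal (c3 * V0 powr (-1)) \<le> av1 I * ennpowr (av2 I) (p - 1)" by (intro mult_left_mono) auto
    then have "W / em * ennreal (c3 * V0 powr (-1)) \<le> ennreal K" using bound[OF I] unfolding av1 by (rule order_trans)
    then have "ennreal (V0 / c3) * (W / em * ennreal (c3 * V0 powr (-1))) \<le> ennreal (V0 / c3) * ennreal K" by (intro mult_left_mono) auto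
    moreover have "ennreal (V0 / c3) * (W / em * ennreal (c3 * V0 powr (-1))) = W / em"
    proof -
      have "V0 / c3 * (c3 * V0 powr (-1)) = 1" using V0 c3 by (simp add: powr_minus)
      then have "ennreal (V0 / c3) * ennreal (c3 * V0 powr (-1)) = 1"
        using V0 c3 by (subst ennreal_mult'[symmetric]) auto
      then show ?thesis by (metis mult.commute mult.left_commute mult_1_right)
    qed
    ultimately have "W / em \<le> ennreal (V0 / c3) * ennreal K" by simp
    also have "\<dots> = ennreal (V0 / c3 * K)" using V0 c3 by (intro ennreal_mult'[symmetric]) simp
    finally have "W / em * em \<le> ennreal (V0 / c3 * K) * ennreal (CA * h powr (2 + \<eta>))" using em_le by (intro mult_mono) auto
    then have "W \<le> ennreal (V0 / c3 * K) * ennreal (CA * h powr (2 + \<eta>))"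
      unfolding ennreal_divide_mult_self[OF em0 emtop] .
    also have "\<dots> = ennreal (V0 / c3 * K * (CA * h powr (2 + \<eta>)))" using V0 c3 K by (intro ennreal_mult'[symmetric]) simp
    also have "V0 / c3 * K * (CA * h powr (2 + \<eta>)) = K * CA / c3 * (h\<^sup>2 * w a)"
    proof -
      have "h powr (- \<eta>) * h powr (2 + \<eta>) = h\<^sup>2" using a unfolding powr_add[symmetric] by simp
      moreover have "V0 / c3 * K * (CA * h powr (2 + \<eta>)) = K * CA / c3 * (h powr (- \<eta>) * h powr (2 + \<eta>) * w a)"
        by (simp add: V0_def)
      ultimately show ?thesis by (simp only:)
    qed
    finally have W: "W \<le> ennreal (K * CA / c3 * (h\<^sup>2 * w a))" .
    have "mass v Q \<le> ennreal A * W"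
      unfolding W_def Q_def by (rule mass_comparable[OF A cmp v]) (auto intro: carleson_box_subset[THEN subsetD])
    also have "\<dots> \<le> ennreal A * ennreal (K * CA / c3 * (h\<^sup>2 * w a))" by (intro mult_left_mono W) simp
    also have "\<dots> = ennreal (A * (K * CA / c3 * (h\<^sup>2 * w a)))" using A by (intro ennreal_mult'[symmetric]) simp
    also have "\<dots> \<le> ennreal (D * h\<^sup>2 * v a)"
    proof (intro ennreal_leI)
      have "D * h\<^sup>2 * w a \<le> D * h\<^sup>2 * v a" using cmp(1)[OF a(1)] A K CA c3 by (intro mult_left_mono) (auto simp: D_def)
      then show "A * (K * CA / c3 * (h\<^sup>2 * w a)) \<le> D * h\<^sup>2 * v a" by (simp add: D_def mult.assoc)
    qed
    finally show "mass v (carleson_box I) \<le> ennreal (D * (bdist (box_center I))\<^sup>2 * v (box_center I))"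
      unfolding Q_def h_def a_def .
  qed
qed

text \<open>For \<open>p = 2\<close> the function in the second average is \<open>(1 - (cmod z)\<^sup>2) powr \<eta> / w z\<close>. By \<open>slow_growth\<close>, \<open>1 / w z\<close> is at most a
  constant times \<open>(bdist a / bdist z) powr \<kappa> / w a\<close> on the box with center \<open>a\<close>. The choice \<open>\<eta> = \<kappa>\<close> compensates the
  power of \<open>bdist z\<close>.\<close>

lemma box_carleson_imp_B_p:
  assumes v: "regular B v" "box_carleson v" and A: "1 \<le> A"
    and cmp: "\<And>z. z \<in> unit_disk \<Longrightarrow> w z \<le> v z" "\<And>z. z \<in> unit_disk \<Longrightarrow> v z \<le> A * w z"
    and w: "weight w"
  shows "\<exists>p \<eta>. 1 < p \<and> -1 < \<eta> \<and> B_p p \<eta> (\<lambda>z. w z / (1 - (cmod z)\<^sup>2) powr \<eta>)"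
proof -
  have wm: "w \<in> borel_measurable (lebesgue_on unit_disk)" and wpos: "\<And>z. z \<in> unit_disk \<Longrightarrow> 0 < w z"
    using w by (auto simp: weight_def)
  obtain C where C: "0 \<le> C" "\<And>I. I \<in> intervals \<Longrightarrow>
     mass v (carleson_box I) \<le> ennreal (C * (bdist (box_center I))\<^sup>2 * v (box_center I))"
    using v(2) unfolding box_carleson_def by blast
  obtain \<kappa> C2 where \<kappa>: "0 \<le> \<kappa>" and C2: "1 \<le> C2" and gr: "\<And>z \<xi> R. z \<in> unit_disk \<Longrightarrow> \<xi> \<in> unit_disk \<Longrightarrow> dist z \<xi> \<le> R \<Longrightarrow> bdist z \<le> R \<Longrightarrow> bdist \<xi> \<le> R \<Longrightarrow>
      v \<xi> \<le> C2 * (R / bdist z) powr \<kappa> * (R / bdist \<xi>) powr \<kappa> * v z"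
    by (rule slow_growth[OF regularD(1)[OF v(1)]]) (rule that; blast)
  define V where "V z = w z / (1 - (cmod z)\<^sup>2) powr \<kappa>" for z
  define c4 where "c4 = 2 powr (2 * \<kappa>) * (A * C2 * (4 powr \<kappa> * 4 powr \<kappa> * 4 powr \<kappa>)) * (9 * pi)"
  have c4: "0 \<le> c4" using A C2 by (simp add: c4_def)
  define c5 where "c5 = 4 powr (- \<bar>\<kappa>\<bar>) * pi / 16"
  have c5: "0 < c5" by (simp add: c5_def)
  define K where "K = C * c4 / (c5 * c5)"
  have bound: "area_average \<kappa> (carleson_box I) V * ennpowr (area_average \<kappa> (carleson_box I) (\<lambda>z. V z powr (1 - 2 / (2 - 1)))) (2 - 1) \<le> ennreal K"
    if I: "I \<in> intervals" for I
  proof -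
    define Q where "Q = carleson_box I"
    define a where "a = box_center I"
    define h where "h = bdist a"
    have a: "a \<in> unit_disk" "0 < h" using box_center(2,3)[OF I] by (auto simp: a_def h_def)
    have va: "0 < v a" using regularD(6)[OF v(1) a(1)] .
    define y where "y = c5 * h powr (2 + \<kappa>)"
    have y: "0 < y" using c5 a by (simp add: y_def)
    have em: "ennreal y \<le> emeasure (weighted_area \<kappa>) Q"
      using weighted_area_box_ge[OF I, of \<kappa>] by (simp add: y_def c5_def Q_def h_def a_def)
    have "(\<integral>\<^sup>+z\<in>Q. ennreal (w z) \<partial>lebesgue) \<le> mass v Q"
      unfolding Q_def by (rule mass_comparable[OF A cmp v(1)]) (auto intro: carleson_box_subset[THEN subsetD])
    also have "\<dots> \<le> ennreal (C * h\<^sup>2 * v a)" using C(2)[OF I] by (simp add: Q_def h_def a_def)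
    finally have W: "(\<integral>\<^sup>+z\<in>Q. ennreal (w z) \<partial>lebesgue) \<le> ennreal (C * h\<^sup>2 * v a)" .
    have "area_average \<kappa> Q V = (\<integral>\<^sup>+z\<in>Q. ennreal (w z) \<partial>lebesgue) / emeasure (weighted_area \<kappa>) Q"
      unfolding area_average_def V_def Q_def box_weight_integral(1)[OF wm I] ..
    also have "\<dots> \<le> ennreal (1 / y) * (\<integral>\<^sup>+z\<in>Q. ennreal (w z) \<partial>lebesgue)" by (rule divide_le_ennreal[OF y em])
    also have "\<dots> \<le> ennreal (1 / y) * ennreal (C * h\<^sup>2 * v a)" by (intro mult_left_mono W) simp
    also have "\<dots> = ennreal (1 / y * (C * h\<^sup>2 * v a))" using y by (intro ennreal_mult'[symmetric]) simp
    finally have av1: "area_average \<kappa> Q V \<le> ennreal (1 / y * (C * h\<^sup>2 * v a))" .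
    define k where "k = 2 powr (2 * \<kappa>) * (A * C2 * (4 powr \<kappa> * 4 powr \<kappa> * 4 powr \<kappa>)) * (h powr \<kappa> * h powr \<kappa>) / v a"
    have "(\<integral>\<^sup>+z\<in>Q. ennreal ((1 - (cmod z)\<^sup>2) powr \<kappa> * V z powr (-1)) \<partial>lborel) \<le> ennreal (k * (pi * (3 * h)\<^sup>2))"
    proof (rule ball_integral_le[of _ _ _ a])
      fix z assume z: "z \<in> Q"
      then have zD: "z \<in> unit_disk" and za: "z \<in> ball a (3 * h)"
        using carleson_box_subset[of I] box_subset_ball[OF I] by (auto simp: Q_def h_def a_def)
      define d where "d = bdist z"
      have d: "0 < d" "d \<le> 4 * h" using zD za bdist_ge[of z a] by (auto simp: d_def h_def dist_commute)
      have p0: "0 < 1 - (cmod z)\<^sup>2" using one_minus_sq_bounds[OF zD] by linarith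
      have "V z powr (-1) = (1 - (cmod z)\<^sup>2) powr \<kappa> * (1 / w z)"
        using wpos[OF zD] p0 by (simp add: V_def powr_minus)
      then have "(1 - (cmod z)\<^sup>2) powr \<kappa> * V z powr (-1) = (1 - (cmod z)\<^sup>2) powr (2 * \<kappa>) * (1 / w z)"
        using powr_add[of "1 - (cmod z)\<^sup>2" \<kappa> \<kappa>] by simp
      also have "\<dots> \<le> (2 powr (2 * \<kappa>) * (d powr \<kappa> * d powr \<kappa>)) * (A * C2 * ((4 * h) powr \<kappa> / d powr \<kappa>) * 4 powr \<kappa> / v a)"
      proof (intro mult_mono)
        show "(1 - (cmod z)\<^sup>2) powr (2 * \<kappa>) \<le> 2 powr (2 * \<kappa>) * (d powr \<kappa> * d powr \<kappa>)"
          using one_minus_sq_powr[OF zD, of "2 * \<kappa>"] \<kappa> powr_add[of d \<kappa> \<kappa>] by (simp add: d_def)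
        have "v a \<le> C2 * (4 * h / bdist z) powr \<kappa> * (4 * h / bdist a) powr \<kappa> * v z"
          using za d a by (intro gr[OF zD a(1)]) (auto simp: dist_commute h_def d_def)
        also have "4 * h / bdist a = 4" using a by (simp add: h_def[symmetric])
        also have "(4 * h / bdist z) powr \<kappa> = (4 * h) powr \<kappa> / d powr \<kappa>" unfolding d_def by (rule powr_divide)
        finally have va_le: "v a \<le> C2 * ((4 * h) powr \<kappa> / d powr \<kappa>) * 4 powr \<kappa> * v z" .
        also have "\<dots> \<le> C2 * ((4 * h) powr \<kappa> / d powr \<kappa>) * 4 powr \<kappa> * (A * w z)"
          using cmp(2)[OF zD] C2 by (intro mult_left_mono) auto
        also have "\<dots> = A * C2 * ((4 * h) powr \<kappa> / d powr \<kappa>) * 4 powr \<kappa> * w z" by (simp only: mult_ac)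
        finally have "v a \<le> A * C2 * ((4 * h) powr \<kappa> / d powr \<kappa>) * 4 powr \<kappa> * w z" .
        then have "1 * v a \<le> (A * C2 * ((4 * h) powr \<kappa> / d powr \<kappa>) * 4 powr \<kappa>) * w z" by (simp only: mult_1)
        then show "1 / w z \<le> A * C2 * ((4 * h) powr \<kappa> / d powr \<kappa>) * 4 powr \<kappa> / v a"
          by (rule divide_le_divide_real[OF wpos[OF zD] va])
      qed (use wpos[OF zD] in auto)
      also have "\<dots> = 2 powr (2 * \<kappa>) * (A * C2 * (4 powr \<kappa> * 4 powr \<kappa>)) * h powr \<kappa> * d powr \<kappa> / v a"
        using d by (simp add: powr_mult)
      also have "\<dots> \<le> 2 powr (2 * \<kappa>) * (A * C2 * (4 powr \<kappa> * 4 powr \<kappa>)) * h powr \<kappa> * (4 * h) powr \<kappa> / v a"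
        using d \<kappa> A C2 va by (intro divide_right_mono mult_left_mono powr_mono2) auto
      also have "\<dots> = k" by (simp add: k_def powr_mult)
      finally show "z \<in> ball a (3 * h) \<and> ennreal ((1 - (cmod z)\<^sup>2) powr \<kappa> * V z powr (-1)) \<le> ennreal k"
        using za ennreal_leI by blast
    qed (use a A C2 va in \<open>auto simp: k_def\<close>)
    also have "k * (pi * (3 * h)\<^sup>2) = c4 * (h powr \<kappa> * h powr \<kappa> * h\<^sup>2) / v a"
      by (simp add: k_def c4_def power_mult_distrib)
    finally have i2: "(\<integral>\<^sup>+z\<in>Q. ennreal ((1 - (cmod z)\<^sup>2) powr \<kappa> * V z powr (-1)) \<partial>lborel) \<le> ennreal (c4 * (h powr \<kappa> * h powr \<kappa> * h\<^sup>2) / v a)" .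
    have "area_average \<kappa> Q (\<lambda>z. V z powr (-1)) \<le> ennreal (1 / y) * (\<integral>\<^sup>+z\<in>Q. ennreal ((1 - (cmod z)\<^sup>2) powr \<kappa> * V z powr (-1)) \<partial>lborel)"
      unfolding area_average_def V_def Q_def box_weight_integral(2)[OF wm I]
      by (rule divide_le_ennreal[OF y em[unfolded Q_def]])
    also have "\<dots> \<le> ennreal (1 / y) * ennreal (c4 * (h powr \<kappa> * h powr \<kappa> * h\<^sup>2) / v a)" by (intro mult_left_mono i2) simp
    also have "\<dots> = ennreal (1 / y * (c4 * (h powr \<kappa> * h powr \<kappa> * h\<^sup>2) / v a))" using y by (intro ennreal_mult'[symmetric]) simp
    finally have "ennpowr (area_average \<kappa> Q (\<lambda>z. V z powr (-1))) 1 \<le> ennpowr (ennreal (1 / y * (c4 * (h powr \<kappa> * h powr \<kappa> * h\<^sup>2) / v a))) 1"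
      by (rule ennpowr_mono) simp
    also have "\<dots> = ennreal (1 / y * (c4 * (h powr \<kappa> * h powr \<kappa> * h\<^sup>2) / v a))"
      using y c4 va by (simp add: ennpowr_ennreal)
    finally have av2: "ennpowr (area_average \<kappa> Q (\<lambda>z. V z powr (-1))) 1 \<le> ennreal (1 / y * (c4 * (h powr \<kappa> * h powr \<kappa> * h\<^sup>2) / v a))" .
    have "area_average \<kappa> Q V * ennpowr (area_average \<kappa> Q (\<lambda>z. V z powr (-1))) 1
      \<le> ennreal (1 / y * (C * h\<^sup>2 * v a)) * ennreal (1 / y * (c4 * (h powr \<kappa> * h powr \<kappa> * h\<^sup>2) / v a))"
      by (intro mult_mono av1 av2) auto
    also have "\<dots> = ennreal (1 / y * (C * h\<^sup>2 * v a) * (1 / y * (c4 * (h powr \<kappa> * h powr \<kappa> * h\<^sup>2) / v a)))"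
      using y C va by (intro ennreal_mult'[symmetric]) simp
    also have "1 / y * (C * h\<^sup>2 * v a) * (1 / y * (c4 * (h powr \<kappa> * h powr \<kappa> * h\<^sup>2) / v a)) = K"
    proof -
      have y': "y = c5 * (h\<^sup>2 * h powr \<kappa>)" using a by (simp add: y_def powr_add)
      have "0 < h\<^sup>2" "0 < h powr \<kappa>" using a by auto
      then show ?thesis using c5 va unfolding y' K_def by (simp add: field_simps)
    qed
    finally show ?thesis by (simp add: Q_def)
  qed
  have "(SUP I\<in>intervals. area_average \<kappa> (carleson_box I) V * ennpowr (area_average \<kappa> (carleson_box I) (\<lambda>z. V z powr (1 - 2 / (2 - 1)))) (2 - 1)) \<le> ennreal K"
    by (rule SUP_least[OF bound])
  then have fin: "(SUP I\<in>intervals. area_average \<kappa> (carleson_box I) V * ennpowr (area_average \<kappa> (carleson_box I) (\<lambda>z. V z powr (1 - 2 / (2 - 1)))) (2 - 1)) < \<infinity>"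
    by (rule le_less_trans) simp
  have "weight V"
    unfolding weight_def
  proof (intro conjI ballI)
    have "(\<lambda>z. (1 - (cmod z)\<^sup>2) powr \<kappa>) \<in> borel_measurable (lebesgue_on unit_disk)"
      by (intro measurable_restrict_space1 measurable_completion) simp
    then show "V \<in> borel_measurable (lebesgue_on unit_disk)" unfolding V_def[abs_def] using wm by (intro borel_measurable_divide)
    fix z :: complex assume z: "z \<in> unit_disk"
    have "0 < 1 - (cmod z)\<^sup>2" using one_minus_sq_bounds[OF z] by linarith
    then show "0 < V z" using wpos[OF z] by (simp add: V_def)
  qed
  then have "B_p 2 \<kappa> V" unfolding B_p_def using fin by blast
  then show ?thesis unfolding V_def[abs_def] using \<kappa> by (intro exI[of _ 2] exI[of _ \<kappa>]) auto
qed

section \<open>The equivalences\<close>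

theorem corollary4p4:
  fixes w :: "complex \<Rightarrow> real"
  assumes "weight w"
    and "nearly_constant_on_tops w"
  defines "a \<equiv> B_infty w"
    and "b \<equiv> (\<exists>p \<eta>. 1 < p \<and> -1 < \<eta> \<and> B_p p \<eta> (\<lambda>z. w z / (1 - (cmod z)\<^sup>2) powr \<eta>))"
    and "c \<equiv> (\<exists>\<gamma>>0. \<exists>C>0. \<forall>z\<in>unit_disk.
        (\<integral>\<^sup>+\<xi>\<in>unit_disk. ennreal (w \<xi> / cmod (1 - cnj \<xi> * z) powr (\<gamma> + 2)) \<partial>lebesgue)
          \<le> ennreal (C * (w z / (1 - (cmod z)\<^sup>2) powr \<gamma>)))"
    and "d \<equiv> (\<forall>q>0. \<forall>n\<ge>1. \<exists>C>0. \<forall>f. f analytic_on unit_disk \<longrightarrow>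
        (let X = Lq_norm q w f;
             Y = ennreal (\<Sum>j<n. cmod ((deriv ^^ j) f 0)) +
                 ennpowr (\<integral>\<^sup>+z\<in>unit_disk. ennreal (cmod ((deriv ^^ n) f z) powr q *
                   (1 - cmod z) powr (q * real n) * w z) \<partial>lebesgue) (1 / q)
         in ennreal (inverse C) * Y \<le> X \<and> X \<le> ennreal C * Y))"
  shows "(a \<longleftrightarrow> b) \<and> (a \<longleftrightarrow> c) \<and> (a \<longleftrightarrow> d)"
proof -
  have wpos: "\<And>z. z \<in> unit_disk \<Longrightarrow> 0 < w z" using assms(1) by (auto simp: weight_def)
  obtain A where sl: "slow A w" by (rule nearly_constant_imp_slow[OF assms(2) wpos]) (assumption, (rule that; assumption))
  have A: "1 \<le> A" using slowD(1)[OF sl] .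
  obtain v where v: "regular (A\<^sup>2) v" and cmp: "\<And>z. z \<in> unit_disk \<Longrightarrow> w z \<le> v z" "\<And>z. z \<in> unit_disk \<Longrightarrow> v z \<le> A * w z"
    by (rule slow_regularize[OF sl]) (rule that; simp)
  have [measurable]: "v \<in> borel_measurable borel" using regularD(2)[OF v] .
  have ball_carleson_box: "ball_carleson v \<longleftrightarrow> box_carleson v" using ball_carleson_imp_box_carleson box_carleson_imp_ball_carleson[OF v] by blast
  have a: "a \<longleftrightarrow> ball_carleson v"
    unfolding a_def using ball_carleson_imp_B_infty[OF v _ A cmp wpos] B_infty_imp_box_carleson[OF v A cmp wpos] ball_carleson_box by blast
  have b: "b \<longleftrightarrow> ball_carleson v"
    unfolding b_def ball_carleson_box using B_p_imp_box_carleson[OF v A cmp assms(1)] box_carleson_imp_B_p[OF v _ A cmp assms(1)] by blast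
  have kernel: "(\<integral>\<^sup>+\<xi>\<in>unit_disk. ennreal (w \<xi> / cmod (1 - cnj \<xi> * z) powr \<gamma>) \<partial>lebesgue) \<le> (\<integral>\<^sup>+\<xi>\<in>unit_disk. ennreal (v \<xi> / cmod (1 - cnj \<xi> * z) powr \<gamma>) \<partial>lborel)"
    "(\<integral>\<^sup>+\<xi>\<in>unit_disk. ennreal (v \<xi> / cmod (1 - cnj \<xi> * z) powr \<gamma>) \<partial>lborel) \<le> ennreal A * (\<integral>\<^sup>+\<xi>\<in>unit_disk. ennreal (w \<xi> / cmod (1 - cnj \<xi> * z) powr \<gamma>) \<partial>lebesgue)" for z \<gamma>
  proof -
    note k = weighted_integral_comparable[of A w v "\<lambda>\<xi>. inverse (cmod (1 - cnj \<xi> * z) powr \<gamma>)", OF A cmp regularD(3)[OF v]]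
    have 1: "inverse (cmod (1 - cnj \<xi> * z) powr \<gamma>) * x = x / cmod (1 - cnj \<xi> * z) powr \<gamma>" for \<xi> x
      by (simp add: divide_inverse mult.commute)
    have 2: "(\<integral>\<^sup>+\<xi>. ennreal (v \<xi> / cmod (1 - cnj \<xi> * z) powr \<gamma>) \<partial>lborel) = (\<integral>\<^sup>+\<xi>\<in>unit_disk. ennreal (v \<xi> / cmod (1 - cnj \<xi> * z) powr \<gamma>) \<partial>lborel)"
      using regularD(3)[OF v] by (intro nn_integral_cong) (auto simp: indicator_def)
    show "(\<integral>\<^sup>+\<xi>\<in>unit_disk. ennreal (w \<xi> / cmod (1 - cnj \<xi> * z) powr \<gamma>) \<partial>lebesgue) \<le> (\<integral>\<^sup>+\<xi>\<in>unit_disk. ennreal (v \<xi> / cmod (1 - cnj \<xi> * z) powr \<gamma>) \<partial>lborel)"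
      "(\<integral>\<^sup>+\<xi>\<in>unit_disk. ennreal (v \<xi> / cmod (1 - cnj \<xi> * z) powr \<gamma>) \<partial>lborel) \<le> ennreal A * (\<integral>\<^sup>+\<xi>\<in>unit_disk. ennreal (w \<xi> / cmod (1 - cnj \<xi> * z) powr \<gamma>) \<partial>lebesgue)"
      using k unfolding 1 2 by simp_all
  qed
  have c: "c \<longleftrightarrow> ball_carleson v"
  proof
    assume c
    then obtain \<gamma> C where \<gamma>: "0 < \<gamma>" "0 < C" and K: "\<And>z. z \<in> unit_disk \<Longrightarrow>
        (\<integral>\<^sup>+\<xi>\<in>unit_disk. ennreal (w \<xi> / cmod (1 - cnj \<xi> * z) powr (\<gamma> + 2)) \<partial>lebesgue) \<le> ennreal (C * (w z / (1 - (cmod z)\<^sup>2) powr \<gamma>))"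
      unfolding c_def by blast
    show "ball_carleson v"
    proof (rule kernel_imp_ball_carleson[OF v \<gamma>(1), of "A * C"])
      fix z :: complex assume z: "z \<in> unit_disk"
      have "(\<integral>\<^sup>+\<xi>\<in>unit_disk. ennreal (v \<xi> / cmod (1 - cnj \<xi> * z) powr (\<gamma> + 2)) \<partial>lborel) \<le> ennreal A * ennreal (C * (w z / (1 - (cmod z)\<^sup>2) powr \<gamma>))"
        using kernel(2)[of z "\<gamma> + 2"] K[OF z] by (meson mult_left_mono order_trans zero_le)
      also have "\<dots> = ennreal (A * (C * (w z / (1 - (cmod z)\<^sup>2) powr \<gamma>)))" using A by (intro ennreal_mult'[symmetric]) simp
      also have "\<dots> \<le> ennreal (A * C * (v z / (1 - (cmod z)\<^sup>2) powr \<gamma>))"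
        unfolding mult.assoc using cmp(1)[OF z] A \<gamma> by (intro ennreal_leI mult_left_mono divide_right_mono) auto
      finally show "(\<integral>\<^sup>+\<xi>\<in>unit_disk. ennreal (v \<xi> / cmod (1 - cnj \<xi> * z) powr (\<gamma> + 2)) \<partial>lborel) \<le> ennreal (A * C * (v z / (1 - (cmod z)\<^sup>2) powr \<gamma>))" .
    qed (use A \<gamma> in simp)
  next
    assume "ball_carleson v"
    then obtain \<gamma> C where \<gamma>: "0 < \<gamma>" "0 < C" and K: "\<And>z. z \<in> unit_disk \<Longrightarrow>
        (\<integral>\<^sup>+\<xi>\<in>unit_disk. ennreal (v \<xi> / cmod (1 - cnj \<xi> * z) powr (\<gamma> + 2)) \<partial>lborel) \<le> ennreal (C * (v z / (1 - (cmod z)\<^sup>2) powr \<gamma>))"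
      using ball_carleson_imp_kernel[OF v] by blast
    have "(\<integral>\<^sup>+\<xi>\<in>unit_disk. ennreal (w \<xi> / cmod (1 - cnj \<xi> * z) powr (\<gamma> + 2)) \<partial>lebesgue) \<le> ennreal (C * A * (w z / (1 - (cmod z)\<^sup>2) powr \<gamma>))"
      if z: "z \<in> unit_disk" for z
    proof -
      have "(\<integral>\<^sup>+\<xi>\<in>unit_disk. ennreal (w \<xi> / cmod (1 - cnj \<xi> * z) powr (\<gamma> + 2)) \<partial>lebesgue) \<le> ennreal (C * (v z / (1 - (cmod z)\<^sup>2) powr \<gamma>))"
        using kernel(1)[of z "\<gamma> + 2"] K[OF z] by (rule order_trans)
      also have "\<dots> \<le> ennreal (C * ((A * w z) / (1 - (cmod z)\<^sup>2) powr \<gamma>))"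
        using cmp(2)[OF z] \<gamma> by (intro ennreal_leI mult_left_mono divide_right_mono) auto
      finally show ?thesis by (simp add: mult_ac)
    qed
    moreover have "0 < C * A" using \<gamma> A by simp
    ultimately show c unfolding c_def using \<gamma>(1) by blast
  qed
  have d: "d \<longleftrightarrow> ball_carleson v"
  proof
    assume "ball_carleson v"
    then show d unfolding d_def using ball_carleson_imp_norm_equivalence[OF v _ A cmp] by blast
  next
    assume d
    \<comment> \<open>only the case of the exponent 1 and the first derivative is needed\<close>
    note D = \<open>d\<close>[unfolded d_def Let_def, rule_format, OF zero_less_one order_refl]
    then obtain C where C: "0 < C" and est: "\<And>f. f analytic_on unit_disk \<Longrightarrow>
      Lq_norm 1 w f \<le> ennreal C * (ennreal (\<Sum>j<1. cmod ((deriv ^^ j) f 0)) +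
                 ennpowr (\<integral>\<^sup>+z\<in>unit_disk. ennreal (cmod ((deriv ^^ 1) f z) powr 1 *
                   (1 - cmod z) powr (1 * real 1) * w z) \<partial>lebesgue) (1 / 1))"
      by blast
    have ennpowr_1: "ennpowr x 1 = x" for x by (cases x) (auto simp: ennpowr_def)
    show "ball_carleson v"
    proof (rule derivative_bound_imp_ball_carleson[OF v])
      show "0 < A * C" using A C by simp
      fix f assume f: "f holomorphic_on unit_disk"
      then have an: "f analytic_on unit_disk" by (simp add: analytic_on_open)
      have fd: "deriv f holomorphic_on unit_disk" using f by (intro holomorphic_deriv) auto
      have m1: "(\<lambda>z. ennreal (cmod (f z) * v z)) \<in> borel_measurable borel"
        using weighted_powr_measurable[OF f v, of "\<lambda>_. 1" 1] by simp
      have m2: "(\<lambda>z. ennreal (cmod (deriv f z) * bdist z powr 1 * v z)) \<in> borel_measurable borel"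
        using weighted_powr_measurable[OF fd v, of "\<lambda>z. bdist z powr 1" 1] by simp
      define X where "X = (\<integral>\<^sup>+z\<in>unit_disk. ennreal (cmod (f z) * w z) \<partial>lebesgue)"
      define Y where "Y = (\<integral>\<^sup>+z\<in>unit_disk. ennreal (cmod (deriv f z) * bdist z powr 1 * w z) \<partial>lebesgue)"
      define Y' where "Y' = (\<integral>\<^sup>+z. ennreal (cmod (deriv f z) * bdist z powr 1 * v z) \<partial>lborel)"
      have "(\<integral>\<^sup>+z. ennreal (cmod (f z) * v z) \<partial>lborel) \<le> ennreal A * X"
        unfolding X_def by (intro weighted_integral_comparable[of A w v "\<lambda>z. cmod (f z)", OF A cmp regularD(3)[OF v]] m1) simp_all
      also have "\<dots> \<le> ennreal A * (ennreal C * (ennreal (cmod (f 0)) + Y))"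
        using est[OF an] by (intro mult_left_mono) (simp_all add: Lq_norm_def ennpowr_1 X_def Y_def)
      also have "\<dots> = ennreal (A * C) * (ennreal (cmod (f 0)) + Y)" using A by (intro ennreal_mult_assoc) simp
      also have "\<dots> \<le> ennreal (A * C) * (ennreal (cmod (f 0)) + Y')"
        unfolding Y_def Y'_def
        by (intro mult_left_mono add_left_mono weighted_integral_comparable[of A w v "\<lambda>z. cmod (deriv f z) * bdist z powr 1", OF A cmp regularD(3)[OF v]] m2) simp_all
      also have "Y' = (\<integral>\<^sup>+z. ennreal (cmod (deriv f z) * bdist z * v z) \<partial>lborel)"
        unfolding Y'_def
      proof (intro nn_integral_cong)
        fix z show "ennreal (cmod (deriv f z) * bdist z powr 1 * v z) = ennreal (cmod (deriv f z) * bdist z * v z)"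
          using regularD(3)[OF v, of z] by (cases "z \<in> unit_disk") auto
      qed
      finally show "(\<integral>\<^sup>+z. ennreal (cmod (f z) * v z) \<partial>lborel) \<le> ennreal (A * C) * (ennreal (cmod (f 0)) + (\<integral>\<^sup>+z. ennreal (cmod (deriv f z) * bdist z * v z) \<partial>lborel))" .
    qed
  qed
  show ?thesis using a b c d by blast
qed

end
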